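(* Let $H$ be a Noetherian Hopf algebra over $\Bbbk$ with a central Hopf subalgebra $A$, let $H_\varepsilon=H/HA^{+}$, let $G=\mathrm{Alg}(A,\Bbbk)$ and let $\Gamma$ be a subgroup of $G$. Then the algebra $$\mathcal{H}(\Gamma)=\bigoplus_{\kappa\in\Gamma_{\mathrm{fd}}}C(\kappa)$$ is faithfully $\Gamma_{\mathrm{fd}}$-graded (that is, the sum is direct, $C(\kappa)C(\gamma)\subseteq C(\kappa\gamma)$ for all $\kappa,\gamma\in\Gamma_{\mathrm{fd}}$, and $C(\kappa)\neq 0$ for all $\kappa\in\Gamma_{\mathrm{fd}}$), and the following is an exact sequence of Hopf algebras: $$H_{\varepsilon}^{\circ}\overset{\imath}{\hookrightarrow}\mathcal{H}(\Gamma)\overset{\varpi}{\twoheadrightarrow}\Bbbk\Gamma_{\mathrm{fd}}.$$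
   Context: $\Bbbk$ is an algebraically closed field of characteristic $0$; all Hopf algebras are assumed to have bijective antipode; $X^{+}=\ker\varepsilon$ for a Hopf algebra $X$. $G=\mathrm{Alg}(A,\Bbbk)$ is the group of algebra maps $A\to\Bbbk$ under convolution, with unit $\varepsilon$. For $\kappa\in G$ put $\mathfrak{M}_\kappa=\ker\kappa$, $\mathfrak{I}_\kappa=H\mathfrak{M}_\kappa$, $H_\kappa=H/\mathfrak{I}_\kappa$ (an algebra since $A$ is central), with projection $p_\kappa:H\to H_\kappa$; $H_\varepsilon$ is a quotient Hopf algebra of $H$. For an algebra $R$, $R^{\circ}$ denotes the finite dual (functionals vanishing on a two-sided ideal of finite codimension); it is a Hopf algebra if $R$ is. $C(\kappa)\subseteq H^{\circ}$ is the subcoalgebra which is the image of the injective map $p_\kappa^{\circ}:H_\kappa^{\circ}\to H^{\circ}$ (transpose of $p_\kappa$), i.e. the set of matrix coefficients of finite-dimensional $H_\kappa$-modules viewed as $H$-modules via $p_\kappa$; in particular $C(\varepsilon)\simeq H_\varepsilon^{\circ}$ as Hopf algebras. For a subgroup $\Gamma\le G$, $\mathcal{H}(\Gamma)=\sum_{\kappa\in\Gamma}C(\kappa)$, a Hopf subalgebra of $H^{\circ}$, and $\Gamma_{\mathrm{fd}}=\{\kappa\in\Gamma: H_\kappa\text{ has a non-zero finite-dimensional module}\}=\{\kappa\in\Gamma:C(\kappa)\neq0\}$, a subgroup of $\Gamma$. The map $\imath$ is the inclusion $H_\varepsilon^{\circ}\simeq C(\varepsilon)\hookrightarrow\mathcal{H}(\Gamma)$.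 The map $\varpi$ is the restriction to $\mathcal{H}(\Gamma)$ of $\iota^{\circ}:H^{\circ}\to A^{\circ}$ (restriction of functionals to $A$, where $\iota:A\to H$ is the inclusion); the elements of $G$ are group-like elements of $A^{\circ}$, and $\Bbbk\Gamma_{\mathrm{fd}}$ is identified with the span of $\Gamma_{\mathrm{fd}}$ in $A^{\circ}$, which is the image of $\varpi$. A sequence of Hopf algebra maps $A\overset{\iota}{\to}C\overset{\pi}{\to}B$ is exact if $\iota$ is injective, $\pi$ is surjective, $\ker\pi=C\iota(A)^{+}$, and $\iota(A)=C^{\mathrm{co}\,\pi}:=\{x\in C:(\mathrm{id}\otimes\pi)\Delta(x)=x\otimes1\}$. *)

theory Defs
  imports
    "HOL-Algebra.QuotRing"
    "HOL-Algebra.Ideal_Product"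
    "HOL-Algebra.Subrings"
    "HOL-Computational_Algebra.Polynomial"
    "Jordan_Normal_Form.Matrix"
begin

text \<open>
  The ground field is a type \<open>'k\<close> of class \<open>field\<close>; algebras, coalgebras and Hopf algebras over it
  are records with an explicit carrier, extending the \<open>module\<close> record of HOL-Algebra.
\<close>

section \<open>Algebras over a field\<close>

locale k_algebra = ring R for R :: "('k::field, 'a, 'm) module_scheme" (structure) +
  assumes smult_closed: "x \<in> carrier R \<Longrightarrow> c \<odot> x \<in> carrier R"
    and smult_l_distr: "x \<in> carrier R \<Longrightarrow> (c + d) \<odot> x = c \<odot> x \<oplus> d \<odot> x"
    and smult_r_distr: "\<lbrakk>x \<in> carrier R; y \<in> carrier R\<rbrakk> \<Longrightarrow> c \<odot> (x \<oplus> y) = c \<odot> x \<oplus> c \<odot> y"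
    and smult_assoc: "x \<in> carrier R \<Longrightarrow> (c * d) \<odot> x = c \<odot> (d \<odot> x)"
    and smult_one: "x \<in> carrier R \<Longrightarrow> 1 \<odot> x = x"
    and smult_mult_left: "\<lbrakk>x \<in> carrier R; y \<in> carrier R\<rbrakk> \<Longrightarrow> (c \<odot> x) \<otimes> y = c \<odot> (x \<otimes> y)"
    and smult_mult_right: "\<lbrakk>x \<in> carrier R; y \<in> carrier R\<rbrakk> \<Longrightarrow> x \<otimes> (c \<odot> y) = c \<odot> (x \<otimes> y)"

definition k_subspace :: "('k::field, 'a, 'm) module_scheme \<Rightarrow> 'a set \<Rightarrow> bool" where
  "k_subspace V U \<longleftrightarrow> U \<subseteq> carrier V \<and> \<zero>\<^bsub>V\<^esub> \<in> U \<and>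
     (\<forall>x\<in>U. \<forall>y\<in>U. x \<oplus>\<^bsub>V\<^esub> y \<in> U) \<and> (\<forall>c. \<forall>x\<in>U. c \<odot>\<^bsub>V\<^esub> x \<in> U)"

definition k_span :: "('k::field, 'a, 'm) module_scheme \<Rightarrow> 'a set \<Rightarrow> 'a set" where
  "k_span V S = {finsum V (\<lambda>x. c x \<odot>\<^bsub>V\<^esub> x) F | c F. finite F \<and> F \<subseteq> S}"

definition subspace_sum ::
  "('k::field, 'a, 'm) module_scheme \<Rightarrow> 'i set \<Rightarrow> ('i \<Rightarrow> 'a set) \<Rightarrow> 'a set" where
  "subspace_sum V I C = {finsum V f F | f F. finite F \<and> F \<subseteq> I \<and> (\<forall>i\<in>F. f i \<in> C i)}"

definition independent_subspaces ::
  "('k::field, 'a, 'm) module_scheme \<Rightarrow> 'i set \<Rightarrow> ('i \<Rightarrow> 'a set) \<Rightarrow> bool" where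
  "independent_subspaces V I C \<longleftrightarrow>
     (\<forall>F f. finite F \<longrightarrow> F \<subseteq> I \<longrightarrow> (\<forall>i\<in>F. f i \<in> C i) \<longrightarrow> finsum V f F = \<zero>\<^bsub>V\<^esub> \<longrightarrow>
        (\<forall>i\<in>F. f i = \<zero>\<^bsub>V\<^esub>))"

definition finite_codim :: "('k::field, 'a, 'm) module_scheme \<Rightarrow> 'a set \<Rightarrow> bool" where
  "finite_codim V U \<longleftrightarrow> (\<exists>F. finite F \<and> F \<subseteq> carrier V \<and>
     (\<forall>x\<in>carrier V. \<exists>s\<in>k_span V F. \<exists>u\<in>U. x = s \<oplus>\<^bsub>V\<^esub> u))"

text \<open>The library locale \<open>noetherian_ring\<close> only speaks about two-sided ideals.\<close>

definition left_ideal :: "('a, 'm) ring_scheme \<Rightarrow> 'a set \<Rightarrow> bool" where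
  "left_ideal R I \<longleftrightarrow> additive_subgroup I R \<and> (\<forall>r\<in>carrier R. \<forall>x\<in>I. r \<otimes>\<^bsub>R\<^esub> x \<in> I)"

definition right_ideal :: "('a, 'm) ring_scheme \<Rightarrow> 'a set \<Rightarrow> bool" where
  "right_ideal R I \<longleftrightarrow> additive_subgroup I R \<and> (\<forall>r\<in>carrier R. \<forall>x\<in>I. x \<otimes>\<^bsub>R\<^esub> r \<in> I)"

definition ascending_chain_condition :: "('a set \<Rightarrow> bool) \<Rightarrow> bool" where
  "ascending_chain_condition P \<longleftrightarrow>
     (\<forall>I :: nat \<Rightarrow> 'a set. (\<forall>n. P (I n)) \<longrightarrow> (\<forall>n. I n \<subseteq> I (Suc n)) \<longrightarrow>
        (\<exists>N. \<forall>n\<ge>N. I n = I N))"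

definition noetherian :: "('a, 'm) ring_scheme \<Rightarrow> bool" where
  "noetherian R \<longleftrightarrow>
     ascending_chain_condition (left_ideal R) \<and> ascending_chain_condition (right_ideal R)"

definition quot_alg :: "('k::field, 'a, 'm) module_scheme \<Rightarrow> 'a set \<Rightarrow> ('k, 'a set) module" where
  "quot_alg R I = ring.extend (R Quot I)
     (module.fields (\<lambda>c X. \<Union>x\<in>X. I +>\<^bsub>R\<^esub> (c \<odot>\<^bsub>R\<^esub> x)))"

text \<open>An \<open>n\<close>-dimensional module is taken in the form of a matrix representation on \<open>k\<^sup>n\<close>.\<close>

definition has_nonzero_fd_module :: "('k::field, 'a, 'm) module_scheme \<Rightarrow> bool" where
  "has_nonzero_fd_module R \<longleftrightarrow>
     (\<exists>n > 0. \<exists>\<rho> \<in> Ring.ring_hom R (ring_mat TYPE('k) n ()).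
        \<forall>c. \<forall>x\<in>carrier R. \<rho> (c \<odot>\<^bsub>R\<^esub> x) = c \<cdot>\<^sub>m \<rho> x)"


section \<open>Tensor products\<close>

text \<open>
  The tensor product of \<open>V\<close> and \<open>W\<close> is realised inside the dual of the space of bilinear forms on
  \<open>V \<times> W\<close>: the elementary tensor of \<open>x\<close> and \<open>y\<close> is the evaluation \<open>b \<mapsto> b x y\<close>, and the tensor
  product is the span of the elementary tensors. Over a field this is the usual tensor product,
  since linear forms on \<open>V \<otimes> W\<close> separate points. Similarly, threefold tensors are functionals on
  trilinear forms. The functionals are set to \<open>0\<close> on arguments that are not bilinear (trilinear)
  on the carriers, so that equality of tensors is equality of functions.
\<close>

type_synonym ('k, 'a, 'b) tensor = "('a \<Rightarrow> 'b \<Rightarrow> 'k) \<Rightarrow> 'k"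
type_synonym ('k, 'a) tensor3 = "('a \<Rightarrow> 'a \<Rightarrow> 'a \<Rightarrow> 'k) \<Rightarrow> 'k"

definition linear_form :: "('k::field, 'a, 'm) module_scheme \<Rightarrow> ('a \<Rightarrow> 'k) \<Rightarrow> bool" where
  "linear_form V f \<longleftrightarrow>
     (\<forall>x\<in>carrier V. \<forall>y\<in>carrier V. f (x \<oplus>\<^bsub>V\<^esub> y) = f x + f y) \<and>
     (\<forall>c. \<forall>x\<in>carrier V. f (c \<odot>\<^bsub>V\<^esub> x) = c * f x)"

definition bilinear_form ::
  "('k::field, 'a, 'm) module_scheme \<Rightarrow> ('k, 'b, 'n) module_scheme \<Rightarrow> ('a \<Rightarrow> 'b \<Rightarrow> 'k) \<Rightarrow> bool" where
  "bilinear_form V W b \<longleftrightarrow>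
     (\<forall>y\<in>carrier W. linear_form V (\<lambda>x. b x y)) \<and> (\<forall>x\<in>carrier V. linear_form W (\<lambda>y. b x y))"

definition trilinear_form ::
  "('k::field, 'a, 'm) module_scheme \<Rightarrow> ('a \<Rightarrow> 'a \<Rightarrow> 'a \<Rightarrow> 'k) \<Rightarrow> bool" where
  "trilinear_form V t \<longleftrightarrow>
     (\<forall>y\<in>carrier V. \<forall>z\<in>carrier V. linear_form V (\<lambda>x. t x y z)) \<and>
     (\<forall>x\<in>carrier V. \<forall>z\<in>carrier V. linear_form V (\<lambda>y. t x y z)) \<and>
     (\<forall>x\<in>carrier V. \<forall>y\<in>carrier V. linear_form V (\<lambda>z. t x y z))"

definition tensor_sum ::
  "('k::field, 'a, 'm) module_scheme \<Rightarrow> ('k, 'b, 'n) module_scheme \<Rightarrow> ('a \<times> 'b) list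
     \<Rightarrow> ('k, 'a, 'b) tensor" where
  "tensor_sum V W xs =
     (\<lambda>b. if bilinear_form V W b then (\<Sum>(x, y)\<leftarrow>xs. b x y) else 0)"

definition tensor_space ::
  "('k::field, 'a, 'm) module_scheme \<Rightarrow> ('k, 'b, 'n) module_scheme \<Rightarrow> ('k, 'a, 'b) tensor set" where
  "tensor_space V W = {tensor_sum V W xs | xs. set xs \<subseteq> carrier V \<times> carrier W}"

text \<open>
  \<open>tensor_map V' W' f g\<close> is the map \<open>f \<otimes> g\<close> with values in \<open>V' \<otimes> W'\<close>; it sends
  \<open>b \<mapsto> b x y\<close> to \<open>b \<mapsto> b (f x) (g y)\<close>.
\<close>

definition tensor_map ::
  "('k::field, 'c, 'm) module_scheme \<Rightarrow> ('k, 'd, 'n) module_scheme \<Rightarrow> ('a \<Rightarrow> 'c) \<Rightarrow> ('b \<Rightarrow> 'd)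
     \<Rightarrow> ('k, 'a, 'b) tensor \<Rightarrow> ('k, 'c, 'd) tensor" where
  "tensor_map V' W' f g T =
     (\<lambda>b. if bilinear_form V' W' b then T (\<lambda>x y. b (f x) (g y)) else 0)"

text \<open>The product \<open>(x \<otimes> y) (x' \<otimes> y') = x x' \<otimes> y y'\<close> of \<open>R \<otimes> R\<close>.\<close>

definition tensor_mult ::
  "('k::field, 'a, 'm) module_scheme \<Rightarrow> ('k, 'a, 'a) tensor \<Rightarrow> ('k, 'a, 'a) tensor
     \<Rightarrow> ('k, 'a, 'a) tensor" where
  "tensor_mult R T T' =
     (\<lambda>b. if bilinear_form R R b
          then T (\<lambda>x y. T' (\<lambda>x' y'. b (x \<otimes>\<^bsub>R\<^esub> x') (y \<otimes>\<^bsub>R\<^esub> y'))) else 0)"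


section \<open>Hopf algebras\<close>

record ('k, 'a) hopf = "('k, 'a) module" +
  comult :: "'a \<Rightarrow> ('k, 'a, 'a) tensor"
  counit :: "'a \<Rightarrow> 'k"
  antipode :: "'a \<Rightarrow> 'a"

text \<open>The maps \<open>\<Delta> \<otimes> id\<close> and \<open>id \<otimes> \<Delta>\<close> from twofold to threefold tensors.\<close>

definition comult_left ::
  "('k::field, 'a, 'm) hopf_scheme \<Rightarrow> ('k, 'a, 'a) tensor \<Rightarrow> ('k, 'a) tensor3" where
  "comult_left H T =
     (\<lambda>t. if trilinear_form H t then T (\<lambda>x y. comult H x (\<lambda>u v. t u v y)) else 0)"

definition comult_right ::
  "('k::field, 'a, 'm) hopf_scheme \<Rightarrow> ('k, 'a, 'a) tensor \<Rightarrow> ('k, 'a) tensor3" where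
  "comult_right H T =
     (\<lambda>t. if trilinear_form H t then T (\<lambda>x y. comult H y (\<lambda>u v. t x u v)) else 0)"

definition list_sum :: "('a, 'm) ring_scheme \<Rightarrow> 'a list \<Rightarrow> 'a" where
  "list_sum R xs = foldr (\<lambda>x s. x \<oplus>\<^bsub>R\<^esub> s) xs \<zero>\<^bsub>R\<^esub>"

text \<open>
  The counit and antipode axioms are stated for every expression of \<open>\<Delta> x\<close> as a finite sum
  \<open>\<Sum> u \<otimes> v\<close>, that is, in Sweedler notation. Bijectivity of the antipode is a standing assumption
  on all Hopf algebras.
\<close>

locale hopf_algebra = k_algebra H for H :: "('k::field, 'a, 'm) hopf_scheme" (structure) +
  assumes comult_closed: "x \<in> carrier H \<Longrightarrow> comult H x \<in> tensor_space H H"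
    and comult_add:
      "\<lbrakk>x \<in> carrier H; y \<in> carrier H\<rbrakk> \<Longrightarrow>
         comult H (x \<oplus> y) = (\<lambda>b. comult H x b + comult H y b)"
    and comult_smult: "x \<in> carrier H \<Longrightarrow> comult H (c \<odot> x) = (\<lambda>b. c * comult H x b)"
    and coassoc:
      "x \<in> carrier H \<Longrightarrow> comult_left H (comult H x) = comult_right H (comult H x)"
    and counit_linear: "linear_form H (counit H)"
    and counit_left:
      "\<lbrakk>x \<in> carrier H; set xs \<subseteq> carrier H \<times> carrier H; comult H x = tensor_sum H H xs\<rbrakk> \<Longrightarrow>
         list_sum H (map (\<lambda>(u, v). counit H u \<odot> v) xs) = x"
    and counit_right:
      "\<lbrakk>x \<in> carrier H; set xs \<subseteq> carrier H \<times> carrier H; comult H x = tensor_sum H H xs\<rbrakk> \<Longrightarrow>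
         list_sum H (map (\<lambda>(u, v). counit H v \<odot> u) xs) = x"
    and comult_mult:
      "\<lbrakk>x \<in> carrier H; y \<in> carrier H\<rbrakk> \<Longrightarrow>
         comult H (x \<otimes> y) = tensor_mult H (comult H x) (comult H y)"
    and comult_one: "comult H \<one> = tensor_sum H H [(\<one>, \<one>)]"
    and counit_mult:
      "\<lbrakk>x \<in> carrier H; y \<in> carrier H\<rbrakk> \<Longrightarrow> counit H (x \<otimes> y) = counit H x * counit H y"
    and counit_one: "counit H \<one> = 1"
    and antipode_add:
      "\<lbrakk>x \<in> carrier H; y \<in> carrier H\<rbrakk> \<Longrightarrow> antipode H (x \<oplus> y) = antipode H x \<oplus> antipode H y"
    and antipode_smult: "x \<in> carrier H \<Longrightarrow> antipode H (c \<odot> x) = c \<odot> antipode H x"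
    and antipode_left:
      "\<lbrakk>x \<in> carrier H; set xs \<subseteq> carrier H \<times> carrier H; comult H x = tensor_sum H H xs\<rbrakk> \<Longrightarrow>
         list_sum H (map (\<lambda>(u, v). antipode H u \<otimes> v) xs) = counit H x \<odot> \<one>"
    and antipode_right:
      "\<lbrakk>x \<in> carrier H; set xs \<subseteq> carrier H \<times> carrier H; comult H x = tensor_sum H H xs\<rbrakk> \<Longrightarrow>
         list_sum H (map (\<lambda>(u, v). u \<otimes> antipode H v) xs) = counit H x \<odot> \<one>"
    and antipode_bij: "bij_betw (antipode H) (carrier H) (carrier H)"

definition hopf_hom ::
  "('k::field, 'a, 'm) hopf_scheme \<Rightarrow> ('k, 'b, 'n) hopf_scheme \<Rightarrow> ('a \<Rightarrow> 'b) \<Rightarrow> bool" where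
  "hopf_hom H K f \<longleftrightarrow> f \<in> Ring.ring_hom H K \<and>
     (\<forall>c. \<forall>x\<in>carrier H. f (c \<odot>\<^bsub>H\<^esub> x) = c \<odot>\<^bsub>K\<^esub> f x) \<and>
     (\<forall>x\<in>carrier H. comult K (f x) = tensor_map K K f f (comult H x)) \<and>
     (\<forall>x\<in>carrier H. counit K (f x) = counit H x)"

definition augmentation_ideal :: "('k::field, 'a, 'm) hopf_scheme \<Rightarrow> 'a set" where
  "augmentation_ideal H = {x \<in> carrier H. counit H x = 0}"

definition coinvariants ::
  "('k::field, 'a, 'm) hopf_scheme \<Rightarrow> ('k, 'b, 'n) hopf_scheme \<Rightarrow> ('a \<Rightarrow> 'b) \<Rightarrow> 'a set" where
  "coinvariants C B \<pi> =
     {x \<in> carrier C. tensor_map C B (\<lambda>y. y) \<pi> (comult C x) = tensor_sum C B [(x, \<one>\<^bsub>B\<^esub>)]}"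

definition exact_hopf_sequence ::
  "('k::field, 'a, 'l) hopf_scheme \<Rightarrow> ('a \<Rightarrow> 'c) \<Rightarrow> ('k, 'c, 'm) hopf_scheme \<Rightarrow> ('c \<Rightarrow> 'b)
     \<Rightarrow> ('k, 'b, 'n) hopf_scheme \<Rightarrow> bool" where
  "exact_hopf_sequence A \<iota> C \<pi> B \<longleftrightarrow>
     hopf_algebra A \<and> hopf_algebra C \<and> hopf_algebra B \<and> hopf_hom A C \<iota> \<and> hopf_hom C B \<pi> \<and>
     inj_on \<iota> (carrier A) \<and> \<pi> ` carrier C = carrier B \<and>
     {x \<in> carrier C. \<pi> x = \<zero>\<^bsub>B\<^esub>} = carrier C \<cdot>\<^bsub>C\<^esub> (\<iota> ` augmentation_ideal A) \<and>
     \<iota> ` carrier A = coinvariants C B \<pi>"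

definition hopf_subalgebra :: "('k::field, 'a, 'm) hopf_scheme \<Rightarrow> 'a set \<Rightarrow> bool" where
  "hopf_subalgebra H A \<longleftrightarrow> subring A H \<and> k_subspace H A \<and>
     (\<forall>x\<in>A. comult H x \<in> tensor_map H H (\<lambda>y. y) (\<lambda>y. y) `
        tensor_space (H\<lparr>carrier := A\<rparr>) (H\<lparr>carrier := A\<rparr>)) \<and>
     (\<forall>x\<in>A. antipode H x \<in> A)"

definition central_hopf_subalgebra :: "('k::field, 'a, 'm) hopf_scheme \<Rightarrow> 'a set \<Rightarrow> bool" where
  "central_hopf_subalgebra H A \<longleftrightarrow> hopf_subalgebra H A \<and>
     (\<forall>a\<in>A. \<forall>x\<in>carrier H. a \<otimes>\<^bsub>H\<^esub> x = x \<otimes>\<^bsub>H\<^esub> a)"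

text \<open>
  The induced Hopf structure on a Hopf subalgebra \<open>A\<close>: \<open>\<Delta> a\<close> is the unique element of
  \<open>A \<otimes> A\<close> whose image under the injective map \<open>A \<otimes> A \<rightarrow> H \<otimes> H\<close> is the given \<open>\<Delta> a\<close>.
\<close>

definition sub_hopf :: "('k::field, 'a) hopf \<Rightarrow> 'a set \<Rightarrow> ('k, 'a) hopf" where
  "sub_hopf H A = H\<lparr>carrier := A,
     comult := (\<lambda>x. THE T. T \<in> tensor_space (H\<lparr>carrier := A\<rparr>) (H\<lparr>carrier := A\<rparr>) \<and>
                       tensor_map H H (\<lambda>y. y) (\<lambda>y. y) T = comult H x)\<rparr>"

text \<open>The quotient by a Hopf ideal; the chosen coset representatives are immaterial.\<close>

definition quot_hopf :: "('k::field, 'a) hopf \<Rightarrow> 'a set \<Rightarrow> ('k, 'a set) hopf" where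
  "quot_hopf H I = module.extend (quot_alg H I)
     (hopf.fields
       (\<lambda>X. tensor_map (quot_alg H I) (quot_alg H I) (\<lambda>x. I +>\<^bsub>H\<^esub> x) (\<lambda>x. I +>\<^bsub>H\<^esub> x)
              (comult H (SOME x. x \<in> X)))
       (\<lambda>X. counit H (SOME x. x \<in> X))
       (\<lambda>X. I +>\<^bsub>H\<^esub> antipode H (SOME x. x \<in> X)))"


section \<open>The finite dual\<close>

text \<open>
  Functionals on an algebra are represented by functions that are \<open>0\<close> outside the carrier.
\<close>

definition zero_ext :: "'a set \<Rightarrow> ('a \<Rightarrow> 'k::zero) \<Rightarrow> 'a \<Rightarrow> 'k" where
  "zero_ext S f = (\<lambda>x. if x \<in> S then f x else 0)"

definition fin_dual_carrier :: "('k::field, 'a, 'm) module_scheme \<Rightarrow> ('a \<Rightarrow> 'k) set" where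
  "fin_dual_carrier R = {f. linear_form R f \<and> (\<forall>x. x \<notin> carrier R \<longrightarrow> f x = 0) \<and>
     (\<exists>I. ideal I R \<and> finite_codim R I \<and> (\<forall>x\<in>I. f x = 0))}"

text \<open>The product is the convolution \<open>(f g) x = \<Sum> f u * g v\<close> for \<open>\<Delta> x = \<Sum> u \<otimes> v\<close>.\<close>

definition fin_dual_alg :: "('k::field, 'a, 'm) hopf_scheme \<Rightarrow> ('k, 'a \<Rightarrow> 'k) module" where
  "fin_dual_alg H =
     \<lparr>carrier = fin_dual_carrier H,
      monoid.mult = (\<lambda>f g. zero_ext (carrier H) (\<lambda>x. comult H x (\<lambda>u v. f u * g v))),
      one = zero_ext (carrier H) (counit H),
      zero = (\<lambda>x. 0),
      add = (\<lambda>f g x. f x + g x),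
      module.smult = (\<lambda>c f x. c * f x)\<rparr>"

text \<open>
  \<open>\<Delta> f = \<Sum> g \<otimes> h\<close> is the unique tensor with \<open>f (x y) = \<Sum> g x * h y\<close>; the right hand side is the
  value of the tensor at the bilinear form \<open>(g, h) \<mapsto> g x * h y\<close>.
\<close>

definition fin_dual :: "('k::field, 'a, 'm) hopf_scheme \<Rightarrow> ('k, 'a \<Rightarrow> 'k) hopf" where
  "fin_dual H = module.extend (fin_dual_alg H)
     (hopf.fields
       (\<lambda>f. THE T. T \<in> tensor_space (fin_dual_alg H) (fin_dual_alg H) \<and>
              (\<forall>x\<in>carrier H. \<forall>y\<in>carrier H. T (\<lambda>g h. g x * h y) = f (x \<otimes>\<^bsub>H\<^esub> y)))
       (\<lambda>f. f \<one>\<^bsub>H\<^esub>)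
       (\<lambda>f. zero_ext (carrier H) (\<lambda>x. f (antipode H x))))"

definition algebra_maps :: "('k::field, 'a, 'm) module_scheme \<Rightarrow> ('a \<Rightarrow> 'k) set" where
  "algebra_maps R = {\<kappa>. linear_form R \<kappa> \<and> (\<forall>x. x \<notin> carrier R \<longrightarrow> \<kappa> x = 0) \<and>
     \<kappa> \<one>\<^bsub>R\<^esub> = 1 \<and> (\<forall>x\<in>carrier R. \<forall>y\<in>carrier R. \<kappa> (x \<otimes>\<^bsub>R\<^esub> y) = \<kappa> x * \<kappa> y)}"

definition Alg_group :: "('k::field, 'a, 'm) hopf_scheme \<Rightarrow> ('a \<Rightarrow> 'k) monoid" where
  "Alg_group A = \<lparr>carrier = algebra_maps A, monoid.mult = monoid.mult (fin_dual A), one = one (fin_dual A)\<rparr>"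


section \<open>Fibres over a central Hopf subalgebra\<close>

definition fibre_ideal :: "('k::field, 'a) hopf \<Rightarrow> 'a set \<Rightarrow> ('a \<Rightarrow> 'k) \<Rightarrow> 'a set" where
  "fibre_ideal H A \<kappa> = carrier H \<cdot>\<^bsub>H\<^esub> {a \<in> A. \<kappa> a = 0}"

definition fibre_alg :: "('k::field, 'a) hopf \<Rightarrow> 'a set \<Rightarrow> ('a \<Rightarrow> 'k) \<Rightarrow> ('k, 'a set) module" where
  "fibre_alg H A \<kappa> = quot_alg H (fibre_ideal H A \<kappa>)"

definition quot_transpose :: "('k::field, 'a) hopf \<Rightarrow> 'a set \<Rightarrow> ('a set \<Rightarrow> 'k) \<Rightarrow> 'a \<Rightarrow> 'k" where
  "quot_transpose H I \<phi> = zero_ext (carrier H) (\<lambda>x. \<phi> (I +>\<^bsub>H\<^esub> x))"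

definition fibre_coalg :: "('k::field, 'a) hopf \<Rightarrow> 'a set \<Rightarrow> ('a \<Rightarrow> 'k) \<Rightarrow> ('a \<Rightarrow> 'k) set" where
  "fibre_coalg H A \<kappa> =
     quot_transpose H (fibre_ideal H A \<kappa>) ` fin_dual_carrier (fibre_alg H A \<kappa>)"

definition fibre_hopf :: "('k::field, 'a) hopf \<Rightarrow> 'a set \<Rightarrow> ('a \<Rightarrow> 'k) set \<Rightarrow> ('k, 'a \<Rightarrow> 'k) hopf" where
  "fibre_hopf H A \<Gamma> = sub_hopf (fin_dual H) (subspace_sum (fin_dual H) \<Gamma> (fibre_coalg H A))"

definition fd_part :: "('k::field, 'a) hopf \<Rightarrow> 'a set \<Rightarrow> ('a \<Rightarrow> 'k) set \<Rightarrow> ('a \<Rightarrow> 'k) set" where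
  "fd_part H A \<Gamma> = {\<kappa> \<in> \<Gamma>. has_nonzero_fd_module (fibre_alg H A \<kappa>)}"

text \<open>The group algebra of a group \<open>\<Gamma>\<close> of characters of \<open>A\<close>, as the span of \<open>\<Gamma>\<close> in the finite dual.\<close>

definition character_span :: "('k::field, 'a) hopf \<Rightarrow> ('a \<Rightarrow> 'k) set \<Rightarrow> ('k, 'a \<Rightarrow> 'k) hopf" where
  "character_span A \<Gamma> = sub_hopf (fin_dual A) (k_span (fin_dual A) \<Gamma>)"

definition faithfully_graded ::
  "('g, 'n) monoid_scheme \<Rightarrow> ('k::field, 'a, 'm) module_scheme \<Rightarrow> ('g \<Rightarrow> 'a set) \<Rightarrow> bool" where
  "faithfully_graded G R C \<longleftrightarrow> group G \<and> k_algebra R \<and>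
     (\<forall>g\<in>carrier G. k_subspace R (C g)) \<and>
     carrier R = subspace_sum R (carrier G) C \<and> independent_subspaces R (carrier G) C \<and>
     (\<forall>g\<in>carrier G. \<forall>h\<in>carrier G. \<forall>x\<in>C g. \<forall>y\<in>C h. x \<otimes>\<^bsub>R\<^esub> y \<in> C (g \<otimes>\<^bsub>G\<^esub> h)) \<and>
     (\<forall>g\<in>carrier G. C g \<noteq> {\<zero>\<^bsub>R\<^esub>})"

end

theory Submission
  imports Defs
begin

text \<open>
  A functional \<open>f \<in> H\<degree>\<close> lies in \<open>C(\<kappa>)\<close> exactly if \<open>f(x a) = \<kappa>(a) f(x)\<close> for all \<open>a \<in> A\<close>, so the
  \<open>C(\<kappa>)\<close> are joint eigenspaces for the action of \<open>A\<close>; since finitely many characters of \<open>A\<close> can be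
  separated by an element of \<open>A\<close>, their sum is direct. If \<open>C(\<kappa>) \<noteq> 0\<close>, a translate of one of its
  elements takes the value \<open>1\<close> at \<open>1\<close>; evaluating products and antipodes at \<open>1\<close> shows that
  \<open>\<Gamma>\<^sub>f\<^sub>d\<close> is a group. On \<open>C(\<kappa>)\<close> the restriction to \<open>A\<close> is \<open>f \<mapsto> f(1) \<kappa>\<close>, which identifies
  the image and reduces the kernel to the elements \<open>f \<in> C(\<kappa>)\<close> with \<open>f(1) = 0\<close>. For such \<open>f\<close>, choosing
  \<open>h \<in> C(\<kappa>)\<close> with \<open>h(1) = 1\<close>, one has \<open>f = \<Sum> h\<^sub>1 (S(h\<^sub>2) f)\<close>, where \<open>S(h\<^sub>2) f\<close> belongs to the augmentation
  ideal of \<open>C(\<epsilon>)\<close>. Finally \<open>f\<close> is coinvariant iff \<open>f(x a) = \<epsilon>(a) f(x)\<close>, that is, \<open>f \<in> C(\<epsilon>)\<close>.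

  The finite dual is handled through matrix entries: \<open>f\<close> vanishes on an ideal of finite codimension iff
  it is a combination of functionals \<open>\<rho>\<^sub>i\<^sub>j\<close> with \<open>\<rho>\<^sub>i\<^sub>j(x y) = \<Sum>\<^sub>k \<rho>\<^sub>i\<^sub>k(x) \<rho>\<^sub>k\<^sub>j(y)\<close>. Identities between tensors and
  between elements of \<open>H\<close> are checked on linear forms, which separate points.
\<close>

section \<open>Linear algebra over a field\<close>

text \<open>The coproducts of finite duals and Hopf subalgebras are definite descriptions, so each
  needs a uniqueness result. A tensor over spaces of functions is determined by its values at pairs
  of points; over a subspace, a linear projection obtained from Zorn's lemma extends forms and makes
  A \<otimes> A \<rightarrow> H \<otimes> H injective. Surjectivity of the antipode does not pass to
  subalgebras by itself. On A it follows from S^2 = id, as A is commutative. On the finite dual the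
  inverse is f \<mapsto> f \<circ> S^{-1}; since S^{-1} agrees with S on A, it also sends
  C(\<kappa>) to C(\<kappa>^{-1}) and preserves the ideal H A^+. The factorisation of f needs the
  legs of h to stay in C(\<kappa>): an ideal of finite codimension killed by h can be enlarged by
  I_\<kappa>, and the matrix entries modulo the larger ideal all vanish on I_\<kappa>. The sum
  defining H(\<Gamma>) runs over all of \<Gamma>, the grading only over \<Gamma>_fd. A non-zero
  C(\<kappa>) has an element with value 1 at the unit, which yields a non-zero module, so the
  summands outside \<Gamma>_fd are zero.\<close>

definition linear_map ::
  "('k::field, 'a, 'm) module_scheme \<Rightarrow> ('k, 'b, 'n) module_scheme \<Rightarrow> ('a \<Rightarrow> 'b) \<Rightarrow> bool" where
  "linear_map V W f \<longleftrightarrow> (\<forall>x\<in>carrier V. f x \<in> carrier W) \<and>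
     (\<forall>x\<in>carrier V. \<forall>y\<in>carrier V. f (x \<oplus>\<^bsub>V\<^esub> y) = f x \<oplus>\<^bsub>W\<^esub> f y) \<and>
     (\<forall>c. \<forall>x\<in>carrier V. f (c \<odot>\<^bsub>V\<^esub> x) = c \<odot>\<^bsub>W\<^esub> f x)"

lemma linear_formI:
  assumes "\<And>x y. \<lbrakk>x \<in> carrier V; y \<in> carrier V\<rbrakk> \<Longrightarrow> f (x \<oplus>\<^bsub>V\<^esub> y) = f x + f y"
    and "\<And>c x. x \<in> carrier V \<Longrightarrow> f (c \<odot>\<^bsub>V\<^esub> x) = c * f x"
  shows "linear_form V f"
  using assms by (auto simp: linear_form_def)

lemma linear_form_add:
  "\<lbrakk>linear_form V f; x \<in> carrier V; y \<in> carrier V\<rbrakk> \<Longrightarrow> f (x \<oplus>\<^bsub>V\<^esub> y) = f x + f y"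
  by (simp add: linear_form_def)

lemma linear_form_smult:
  "\<lbrakk>linear_form V f; x \<in> carrier V\<rbrakk> \<Longrightarrow> f (c \<odot>\<^bsub>V\<^esub> x) = c * f x"
  by (simp add: linear_form_def)

lemma linear_form_plus:
  "\<lbrakk>linear_form V f; linear_form V g\<rbrakk> \<Longrightarrow> linear_form V (\<lambda>x. f x + g x)"
  by (simp add: linear_form_def algebra_simps)

lemma linear_form_minus:
  "\<lbrakk>linear_form V f; linear_form V g\<rbrakk> \<Longrightarrow> linear_form V (\<lambda>x. f x - g x)"
  by (simp add: linear_form_def algebra_simps)

lemma linear_form_times:
  "linear_form V f \<Longrightarrow> linear_form V (\<lambda>x. c * f x)"
  by (simp add: linear_form_def algebra_simps)

lemma linear_form_times_right:
  "linear_form V f \<Longrightarrow> linear_form V (\<lambda>x. f x * c)"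
  by (simp add: linear_form_def algebra_simps)

lemma linear_form_zero: "linear_form V (\<lambda>x. 0)"
  by (simp add: linear_form_def)

lemma linear_form_sum:
  assumes "\<And>i. i \<in> N \<Longrightarrow> linear_form V (f i)"
  shows "linear_form V (\<lambda>x. \<Sum>i\<in>N. f i x)"
  using assms by (auto simp: linear_form_def sum.distrib sum_distrib_left intro!: sum.cong)

lemma linear_form_sum_list:
  assumes "\<And>p. p \<in> set xs \<Longrightarrow> linear_form V (f p)"
  shows "linear_form V (\<lambda>x. \<Sum>p\<leftarrow>xs. f p x)"
  using assms by (induction xs) (auto intro: linear_form_zero linear_form_plus)

lemma linear_form_comp:
  "\<lbrakk>linear_map V W f; linear_form W g\<rbrakk> \<Longrightarrow> linear_form V (\<lambda>x. g (f x))"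
  by (simp add: linear_map_def linear_form_def)

lemma linear_mapD:
  assumes "linear_map V W f"
  shows "x \<in> carrier V \<Longrightarrow> f x \<in> carrier W"
    and "\<lbrakk>x \<in> carrier V; y \<in> carrier V\<rbrakk> \<Longrightarrow> f (x \<oplus>\<^bsub>V\<^esub> y) = f x \<oplus>\<^bsub>W\<^esub> f y"
    and "x \<in> carrier V \<Longrightarrow> f (c \<odot>\<^bsub>V\<^esub> x) = c \<odot>\<^bsub>W\<^esub> f x"
  using assms by (auto simp: linear_map_def)

lemma list_sum_simps [simp]:
  "list_sum R [] = \<zero>\<^bsub>R\<^esub>" "list_sum R (x # xs) = x \<oplus>\<^bsub>R\<^esub> list_sum R xs"
  by (simp_all add: list_sum_def)

lemma k_subspaceD:
  assumes "k_subspace V U"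
  shows "U \<subseteq> carrier V" and "\<zero>\<^bsub>V\<^esub> \<in> U"
    and "\<lbrakk>x \<in> U; y \<in> U\<rbrakk> \<Longrightarrow> x \<oplus>\<^bsub>V\<^esub> y \<in> U" and "x \<in> U \<Longrightarrow> c \<odot>\<^bsub>V\<^esub> x \<in> U"
  using assms by (auto simp: k_subspace_def)

lemma finite_codim_mono: "\<lbrakk>finite_codim V U; U \<subseteq> W\<rbrakk> \<Longrightarrow> finite_codim V W"
  unfolding finite_codim_def by (meson subsetD)

context k_algebra
begin

lemma smult_zero [simp]: "x \<in> carrier R \<Longrightarrow> 0 \<odot> x = \<zero>"
  using smult_l_distr[of x 0 0] smult_closed[of x 0] by (simp add: add.l_cancel_one)

lemma smult_zero_right [simp]: "c \<odot> \<zero> = \<zero>"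
  using smult_r_distr[of \<zero> \<zero> c] smult_closed[of \<zero> c] by (simp add: add.l_cancel_one)

lemma smult_minus_one: "x \<in> carrier R \<Longrightarrow> (- 1) \<odot> x = \<ominus> x"
  using smult_l_distr[of x 1 "- 1"] smult_closed[of x "- 1"]
  by (simp add: smult_one) (metis add.inv_comm minus_equality)

lemma smult_as_mult: "x \<in> carrier R \<Longrightarrow> c \<odot> x = (c \<odot> \<one>) \<otimes> x"
  by (simp add: smult_mult_left)

lemma list_sum_closed: "set xs \<subseteq> carrier R \<Longrightarrow> list_sum R xs \<in> carrier R"
  by (induction xs) auto

lemma linear_form_at_zero: "linear_form R f \<Longrightarrow> f \<zero> = 0"
  using linear_form_smult[of R f \<zero> 0] by simp

lemma linear_form_uminus: "\<lbrakk>linear_form R f; x \<in> carrier R\<rbrakk> \<Longrightarrow> f (\<ominus> x) = - f x"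
  using linear_form_smult[of R f x "- 1"] smult_minus_one by simp

lemma linear_form_diff:
  "\<lbrakk>linear_form R f; x \<in> carrier R; y \<in> carrier R\<rbrakk> \<Longrightarrow> f (x \<ominus> y) = f x - f y"
  by (simp add: minus_eq linear_form_add linear_form_uminus)

lemma linear_form_list_sum:
  "\<lbrakk>linear_form R f; set xs \<subseteq> carrier R\<rbrakk> \<Longrightarrow> f (list_sum R xs) = (\<Sum>x\<leftarrow>xs. f x)"
  by (induction xs) (auto simp: linear_form_at_zero linear_form_add list_sum_closed)

lemma linear_form_cong:
  assumes "\<And>x. x \<in> carrier R \<Longrightarrow> f x = g x"
  shows "linear_form R f \<longleftrightarrow> linear_form R g"
  using assms by (simp add: linear_form_def smult_closed)

lemma linear_form_mult_left: "\<lbrakk>linear_form R f; y \<in> carrier R\<rbrakk> \<Longrightarrow> linear_form R (\<lambda>x. f (y \<otimes> x))"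
  by (simp add: linear_form_def r_distr smult_mult_right smult_closed)

lemma linear_form_mult_right: "\<lbrakk>linear_form R f; y \<in> carrier R\<rbrakk> \<Longrightarrow> linear_form R (\<lambda>x. f (x \<otimes> y))"
  by (simp add: linear_form_def l_distr smult_mult_left smult_closed)

lemma subspace_uminus: "\<lbrakk>k_subspace R U; x \<in> U\<rbrakk> \<Longrightarrow> \<ominus> x \<in> U"
  using k_subspaceD(1,4)[of R U] smult_minus_one by (metis subsetD)

lemma subspace_minus: "\<lbrakk>k_subspace R U; x \<in> U; y \<in> U\<rbrakk> \<Longrightarrow> x \<ominus> y \<in> U"
  by (simp add: minus_eq k_subspaceD(3) subspace_uminus)

text \<open>\<open>c \<odot> x\<close> is the product of \<open>c \<odot> \<one>\<close> with x, so
  absorption under multiplication already gives closure under scalars.\<close>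

lemma ideal_imp_subspace:
  assumes "ideal I R" shows "k_subspace R I"
proof -
  interpret ideal I R by fact
  have "c \<odot> x \<in> I" if "x \<in> I" for c x
    using I_l_closed[OF that, of "c \<odot> \<one>"] smult_as_mult[of x c] that Icarr by (simp add: smult_closed)
  then show ?thesis
    using a_subset by (auto simp: k_subspace_def zero_closed a_closed)
qed

section \<open>Complements and separating linear forms\<close>

lemma subspace_plus_line:
  assumes U: "k_subspace R U" and z: "z \<in> carrier R"
  shows "k_subspace R {u \<oplus> c \<odot> z | u c. u \<in> U}"
proof -
  have Uc [simp]: "u \<in> U \<Longrightarrow> u \<in> carrier R" for u using k_subspaceD(1)[OF U] by auto
  note [simp] = smult_closed[OF z] k_subspaceD(2-)[OF U] z
  have "\<exists>u' c'. (u \<oplus> c \<odot> z) \<oplus> (v \<oplus> d \<odot> z) = u' \<oplus> c' \<odot> z \<and> u' \<in> U" if "u \<in> U" "v \<in> U" for u v c d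
    using that by (intro exI[of _ "u \<oplus> v"] exI[of _ "c + d"]) (simp add: smult_l_distr a_ac)
  moreover have "\<exists>u' c'. d \<odot> (u \<oplus> c \<odot> z) = u' \<oplus> c' \<odot> z \<and> u' \<in> U" if "u \<in> U" for u c d
    using that by (intro exI[of _ "d \<odot> u"] exI[of _ "d * c"]) (simp add: smult_r_distr smult_assoc)
  moreover have "\<exists>u c. \<zero> = u \<oplus> c \<odot> z \<and> u \<in> U"
    by (intro exI[of _ \<zero>] exI[of _ 0]) simp
  ultimately show ?thesis by (auto simp: k_subspace_def)
qed

text \<open>By Zorn's lemma there is a subspace W maximal among those meeting U only in zero; it is
  a complement, and P is the projection along it. This replaces the choice of bases and later
  extends forms from U to the whole space.\<close>

lemma subspace_projection:
  assumes U: "k_subspace R U"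
  obtains P where "linear_map R (R\<lparr>carrier := U\<rparr>) P" and "\<And>x. x \<in> U \<Longrightarrow> P x = x"
proof -
  let ?A = "{W. k_subspace R W \<and> W \<inter> U \<subseteq> {\<zero>}}"
  have Uc: "u \<in> U \<Longrightarrow> u \<in> carrier R" for u using k_subspaceD(1)[OF U] by auto
  have "\<exists>M\<in>?A. \<forall>X\<in>?A. M \<subseteq> X \<longrightarrow> X = M"
  proof (rule subset_Zorn_nonempty)
    have "{\<zero>} \<in> ?A" by (auto simp: k_subspace_def)
    then show "?A \<noteq> {}" by blast
  next
    fix C assume C: "C \<noteq> {}" "subset.chain ?A C"
    then have sub: "\<And>W. W \<in> C \<Longrightarrow> k_subspace R W" and int: "\<And>W. W \<in> C \<Longrightarrow> W \<inter> U \<subseteq> {\<zero>}"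
      by (auto simp: subset.chain_def)
    have dir: "\<exists>W\<in>C. x \<in> W \<and> y \<in> W" if "x \<in> \<Union>C" "y \<in> \<Union>C" for x y
    proof -
      obtain W W' where "W \<in> C" "x \<in> W" "W' \<in> C" "y \<in> W'" using \<open>x \<in> \<Union>C\<close> \<open>y \<in> \<Union>C\<close> by blast
      moreover have "W \<subseteq> W' \<or> W' \<subseteq> W"
        using calculation C(2) unfolding subset_chain_def by blast
      ultimately show ?thesis by blast
    qed
    have "k_subspace R (\<Union>C)"
      unfolding k_subspace_def
    proof (intro conjI ballI allI)
      show "\<Union>C \<subseteq> carrier R" using k_subspaceD(1)[OF sub] by blast
      show "\<zero> \<in> \<Union>C" using C(1) k_subspaceD(2)[OF sub] by blast
      show "x \<oplus> y \<in> \<Union>C" if "x \<in> \<Union>C" "y \<in> \<Union>C" for x y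
      proof -
        obtain W where "W \<in> C" "x \<in> W" "y \<in> W" using dir[OF \<open>x \<in> \<Union>C\<close> \<open>y \<in> \<Union>C\<close>] by blast
        then show ?thesis using k_subspaceD(3)[OF sub[OF \<open>W \<in> C\<close>]] by blast
      qed
      show "c \<odot> x \<in> \<Union>C" if "x \<in> \<Union>C" for x c
      proof -
        obtain W where "W \<in> C" "x \<in> W" using \<open>x \<in> \<Union>C\<close> by blast
        then show ?thesis using k_subspaceD(4)[OF sub[OF \<open>W \<in> C\<close>]] by blast
      qed
    qed
    then show "\<Union>C \<in> ?A" using int by auto
  qed
  then obtain W where W: "k_subspace R W" and int: "W \<inter> U \<subseteq> {\<zero>}"
    and max: "\<And>X. \<lbrakk>k_subspace R X; X \<inter> U \<subseteq> {\<zero>}; W \<subseteq> X\<rbrakk> \<Longrightarrow> X = W" by auto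
  have Wc: "w \<in> W \<Longrightarrow> w \<in> carrier R" for w using k_subspaceD(1)[OF W] by auto
  \<comment> \<open>If v were outside U + W, then W + kv would still meet U trivially, because a
    relation w + c v in U with non-zero c can be solved for v. This contradicts maximality.\<close>
  have ex: "\<exists>u\<in>U. v \<ominus> u \<in> W" if v: "v \<in> carrier R" for v
  proof (rule ccontr)
    assume no: "\<not> (\<exists>u\<in>U. v \<ominus> u \<in> W)"
    let ?X = "{w \<oplus> c \<odot> v | w c. w \<in> W}"
    have "?X \<inter> U \<subseteq> {\<zero>}"
    proof
      fix y assume "y \<in> ?X \<inter> U"
      then obtain w c where y: "y = w \<oplus> c \<odot> v" "w \<in> W" "y \<in> U" by auto
      show "y \<in> {\<zero>}"
      proof (cases "c = 0")
        case True
        then show ?thesis using y v int Wc by auto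
      next
        case False
        have "inverse c \<odot> y = inverse c \<odot> w \<oplus> v"
          using y(1) Wc[OF y(2)] v False
          by (simp add: smult_r_distr smult_closed smult_assoc[symmetric] smult_one)
        then have "v \<ominus> inverse c \<odot> y = \<ominus> (inverse c \<odot> w)"
          using v Wc[OF y(2)] smult_closed[OF Wc[OF y(2)], of "inverse c"]
          by (simp add: minus_eq minus_add a_ac r_neg r_neg2)
        moreover have "inverse c \<odot> y \<in> U" using k_subspaceD(4)[OF U y(3)] .
        moreover have "\<ominus> (inverse c \<odot> w) \<in> W"
          using subspace_uminus[OF W] k_subspaceD(4)[OF W y(2)] by blast
        ultimately show ?thesis using no by metis
      qed
    qed
    moreover have sX: "k_subspace R ?X" by (rule subspace_plus_line[OF W v])
    moreover have "W \<subseteq> ?X"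
    proof
      fix w assume "w \<in> W"
      then show "w \<in> ?X" using v Wc by (intro CollectI exI[of _ w] exI[of _ 0]) simp
    qed
    ultimately have "?X = W" using max by blast
    moreover have "v \<in> ?X"
      using v k_subspaceD(2)[OF W] by (intro CollectI exI[of _ \<zero>] exI[of _ 1]) (simp add: smult_one)
    ultimately have "v \<in> W" by blast
    then show False using no k_subspaceD(2)[OF U] v by (auto simp: minus_eq)
  qed
  \<comment> \<open>Two candidates for the U-component differ by an element of both U and W.\<close>
  have uniq: "u = u'" if "u \<in> U" "u' \<in> U" "v \<ominus> u \<in> W" "v \<ominus> u' \<in> W" "v \<in> carrier R" for u u' v
  proof -
    have "(v \<ominus> u') \<ominus> (v \<ominus> u) \<in> W" using subspace_minus[OF W] that by blast
    moreover have "(v \<ominus> u') \<ominus> (v \<ominus> u) = u \<ominus> u'" using Uc that by algebra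
    moreover have "u \<ominus> u' \<in> U" using subspace_minus[OF U] that by blast
    ultimately have "u \<ominus> u' = \<zero>" using int by auto
    then show ?thesis using Uc that by (simp add: r_right_minus_eq)
  qed
  define P where "P v = (THE u. u \<in> U \<and> v \<ominus> u \<in> W)" for v
  have P_eq: "P v = u" if "u \<in> U" "v \<ominus> u \<in> W" "v \<in> carrier R" for u v
    unfolding P_def using that uniq by (intro the_equality) auto
  have P: "P v \<in> U" "v \<ominus> P v \<in> W" if "v \<in> carrier R" for v
    using ex[OF that] P_eq that by blast+
  show thesis
  proof
    show "P x = x" if "x \<in> U" for x
      using that k_subspaceD(2)[OF W] Uc[OF that] by (intro P_eq) (auto simp: r_neg minus_eq)
    show "linear_map R (R\<lparr>carrier := U\<rparr>) P"
      unfolding linear_map_def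
    proof (intro conjI ballI allI)
      fix x y assume x: "x \<in> carrier R" and y: "y \<in> carrier R"
      have "(x \<oplus> y) \<ominus> (P x \<oplus> P y) = (x \<ominus> P x) \<oplus> (y \<ominus> P y)"
        using x y P(1)[THEN Uc] by algebra
      then show "P (x \<oplus> y) = P x \<oplus>\<^bsub>R\<lparr>carrier := U\<rparr>\<^esub> P y"
        using P x y k_subspaceD(3)[OF U] k_subspaceD(3)[OF W] by (auto intro!: P_eq)
    next
      fix x c assume x: "x \<in> carrier R"
      have "c \<odot> x \<ominus> c \<odot> P x = c \<odot> (x \<ominus> P x)"
        using x P(1)[OF x, THEN Uc]
        by (simp add: minus_eq smult_r_distr smult_closed smult_minus_one[symmetric] smult_assoc[symmetric])
      then show "P (c \<odot> x) = c \<odot>\<^bsub>R\<lparr>carrier := U\<rparr>\<^esub> P x"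
        using P x k_subspaceD(4)[OF U] k_subspaceD(4)[OF W] by (auto intro!: P_eq simp: smult_closed)
    qed (use P in auto)
  qed
qed

text \<open>On U + kz the coefficient of z is well defined because z lies outside U; composing it
  with a projection onto U + kz extends it to the whole space.\<close>

lemma separating_form_mod:
  assumes U: "k_subspace R U" and z: "z \<in> carrier R" "z \<notin> U"
  obtains \<psi> where "linear_form R \<psi>" and "\<psi> z = 1" and "\<And>u. u \<in> U \<Longrightarrow> \<psi> u = 0"
proof -
  let ?X = "{u \<oplus> c \<odot> z | u c. u \<in> U}"
  have Uc: "u \<in> U \<Longrightarrow> u \<in> carrier R" for u using k_subspaceD(1)[OF U] by auto
  have uniq: "c = d" if "u \<in> U" "v \<in> U" "u \<oplus> c \<odot> z = v \<oplus> d \<odot> z" for u v c d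
  proof (rule ccontr)
    assume "c \<noteq> d"
    have "u \<oplus> (c - d) \<odot> z = (u \<oplus> c \<odot> z) \<oplus> (- d) \<odot> z"
      using that(1,2) Uc z by (simp add: smult_l_distr[symmetric] smult_closed a_assoc)
    also have "\<dots> = (v \<oplus> d \<odot> z) \<oplus> (- d) \<odot> z" using that(3) by simp
    also have "\<dots> = v"
      using that(1,2) Uc z by (simp add: smult_l_distr[symmetric] smult_closed a_assoc)
    finally have "(c - d) \<odot> z = v \<ominus> u"
      using Uc that z smult_closed[OF z(1), of "c - d"] by (simp add: minus_eq) (metis a_comm a_inv_closed r_neg1)
    then have "(c - d) \<odot> z \<in> U" using subspace_minus[OF U] that by simp
    then have "inverse (c - d) \<odot> ((c - d) \<odot> z) \<in> U" by (rule k_subspaceD(4)[OF U])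
    then show False using z \<open>c \<noteq> d\<close> by (simp add: smult_assoc[symmetric] smult_one)
  qed
  have X: "k_subspace R ?X" by (rule subspace_plus_line[OF U z(1)])
  obtain P where P: "linear_map R (R\<lparr>carrier := ?X\<rparr>) P" and P_id: "\<And>x. x \<in> ?X \<Longrightarrow> P x = x"
    by (rule subspace_projection[OF X]) blast
  define t where "t x = (THE c. \<exists>u\<in>U. x = u \<oplus> c \<odot> z)" for x
  have t: "t (u \<oplus> c \<odot> z) = c" if "u \<in> U" for u c
    unfolding t_def using that uniq by (intro the_equality) blast+
  have inX: "u \<oplus> c \<odot> z \<in> ?X" if "u \<in> U" for u c using that by blast
  have "linear_form (R\<lparr>carrier := ?X\<rparr>) t"
  proof (rule linear_formI)
    fix x y assume "x \<in> carrier (R\<lparr>carrier := ?X\<rparr>)" "y \<in> carrier (R\<lparr>carrier := ?X\<rparr>)"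
    then obtain u c v d where xy: "x = u \<oplus> c \<odot> z" "y = v \<oplus> d \<odot> z" "u \<in> U" "v \<in> U" by auto
    then have "x \<oplus> y = (u \<oplus> v) \<oplus> (c + d) \<odot> z"
      using Uc z by (simp add: smult_l_distr smult_closed a_ac)
    then show "t (x \<oplus>\<^bsub>R\<lparr>carrier := ?X\<rparr>\<^esub> y) = t x + t y"
      using xy k_subspaceD(3)[OF U] by (simp add: t)
  next
    fix c x assume "x \<in> carrier (R\<lparr>carrier := ?X\<rparr>)"
    then obtain u d where x: "x = u \<oplus> d \<odot> z" "u \<in> U" by auto
    then have "c \<odot> x = c \<odot> u \<oplus> (c * d) \<odot> z"
      using Uc z by (simp add: smult_r_distr smult_closed smult_assoc)
    then show "t (c \<odot>\<^bsub>R\<lparr>carrier := ?X\<rparr>\<^esub> x) = c * t x"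
      using x k_subspaceD(4)[OF U] by (simp add: t)
  qed
  from linear_form_comp[OF P this] have "linear_form R (\<lambda>x. t (P x))" .
  moreover have "t (P z) = 1"
  proof -
    have "z = \<zero> \<oplus> 1 \<odot> z" using z by (simp add: smult_one)
    then have "t z = 1" "z \<in> ?X" using t[of \<zero> 1] k_subspaceD(2)[OF U] by auto
    then show ?thesis using P_id by simp
  qed
  moreover have "t (P u) = 0" if "u \<in> U" for u
  proof -
    have "u = u \<oplus> 0 \<odot> z" using that Uc z by simp
    then have "t u = 0" "u \<in> ?X" using t[of u 0] that by auto
    then show ?thesis using P_id by simp
  qed
  ultimately show thesis by (rule that)
qed

text \<open>This reduces equalities between elements to equalities of scalars, which fits coproducts
  that are themselves functionals.\<close>

lemma linear_forms_separate:
  assumes "x \<in> carrier R" "y \<in> carrier R" and "\<And>\<phi>. linear_form R \<phi> \<Longrightarrow> \<phi> x = \<phi> y"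
  shows "x = y"
proof (rule ccontr)
  assume "x \<noteq> y"
  then have "x \<ominus> y \<notin> {\<zero>}" using assms by (simp add: r_right_minus_eq)
  moreover have "k_subspace R {\<zero>}" by (simp add: k_subspace_def)
  ultimately obtain \<psi> where "linear_form R \<psi>" "\<psi> (x \<ominus> y) = 1"
    using separating_form_mod[of "{\<zero>}" "x \<ominus> y"] assms by auto
  moreover from this have "\<psi> x = \<psi> y" using assms(3) by blast
  ultimately show False using assms(1,2) linear_form_diff[of \<psi> x y] by simp
qed

section \<open>Spans, dual bases and finite codimension\<close>

lemma k_span_insert:
  assumes s: "s \<in> k_span R (insert z F)" and "insert z F \<subseteq> carrier R"
  obtains c s' where "s' \<in> k_span R F" and "s = s' \<oplus> c \<odot> z"
proof -
  obtain c G where G: "finite G" "G \<subseteq> insert z F" and s: "s = (\<Oplus>x\<in>G. c x \<odot> x)"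
    using s unfolding k_span_def by blast
  have cl: "(\<lambda>x. c x \<odot> x) \<in> (G - {z}) \<rightarrow> carrier R" using G assms(2) smult_closed by auto
  have z: "z \<in> carrier R" using assms by simp
  let ?s = "\<Oplus>x\<in>G - {z}. c x \<odot> x"
  have s': "?s \<in> k_span R F" using G by (auto simp: k_span_def)
  show thesis
  proof (cases "z \<in> G")
    case True
    then have "G = insert z (G - {z})" by auto
    then have "s = (\<Oplus>x\<in>insert z (G - {z}). c x \<odot> x)" using s by simp
    also have "\<dots> = ?s \<oplus> c z \<odot> z"
      using G cl z by (subst finsum_insert) (auto simp: smult_closed a_comm)
    finally show thesis using that s' by blast
  next
    case False
    then have "s = ?s \<oplus> 0 \<odot> z" using s cl z by simp
    then show thesis using that s' by blast
  qed
qed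

text \<open>An element of a span carries one coefficient per vector; \<open>z \<notin> F\<close>
  ensures that setting the coefficient at z does not overwrite one in use.\<close>

lemma k_span_insertI:
  assumes s: "s \<in> k_span R F" and F: "insert z F \<subseteq> carrier R" and "z \<notin> F"
  shows "s \<oplus> c \<odot> z \<in> k_span R (insert z F)"
proof -
  obtain d G where G: "finite G" "G \<subseteq> F" and s: "s = (\<Oplus>x\<in>G. d x \<odot> x)"
    using s by (auto simp: k_span_def)
  let ?d = "d(z := c)"
  have zG: "z \<notin> G" using assms G by auto
  have cl: "(\<lambda>x. ?d x \<odot> x) \<in> G \<rightarrow> carrier R" using G F by (auto intro!: smult_closed)
  have "(\<Oplus>x\<in>G. ?d x \<odot> x) = s"
    unfolding s using cl zG G F by (intro finsum_cong') (auto intro!: smult_closed)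
  then have "(\<Oplus>x\<in>insert z G. ?d x \<odot> x) = s \<oplus> c \<odot> z"
    using G cl zG F by (subst finsum_insert) (auto intro!: smult_closed a_comm finsum_closed)
  then show ?thesis using G unfolding k_span_def
    by (intro CollectI exI[of _ ?d] exI[of _ "insert z G"]) auto
qed

text \<open>The e_i are a basis of a complement of U, the \<phi>_i its dual basis, and n is the
  codimension. Stating the expansion for forms that vanish on U avoids the quotient space. In the
  induction on the spanning set, a vector z is moved into U; if it was not there before, it returns
  as one more basis vector.\<close>

lemma dual_basis_mod_subspace:
  assumes "finite F" "F \<subseteq> carrier R" and "k_subspace R U"
    and "\<forall>x\<in>carrier R. \<exists>s\<in>k_span R F. \<exists>u\<in>U. x = s \<oplus> u"
  shows "\<exists>n e \<phi>. (\<forall>i<n::nat. e i \<in> carrier R \<and> linear_form R (\<phi> i) \<and> (\<forall>u\<in>U. \<phi> i u = 0)) \<and>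
     (\<forall>i<n. \<forall>j<n. \<phi> i (e j) = (if i = j then 1 else 0)) \<and>
     (\<forall>f. linear_form R f \<longrightarrow> (\<forall>u\<in>U. f u = 0) \<longrightarrow>
        (\<forall>x\<in>carrier R. f x = (\<Sum>i<n. \<phi> i x * f (e i))))"
  using assms
proof (induction F arbitrary: U rule: finite_induct)
  case empty
  have "x \<in> U" if "x \<in> carrier R" for x
    using empty(3) that k_subspaceD(1)[OF empty(2)] by (auto simp: k_span_def subset_iff)
  then show ?case by (intro exI[of _ 0]) auto
next
  case (insert z F)
  have z: "z \<in> carrier R" and F: "F \<subseteq> carrier R" using insert by auto
  let ?U = "{u \<oplus> c \<odot> z | u c. u \<in> U}"
  have Uc: "u \<in> U \<Longrightarrow> u \<in> carrier R" for u using k_subspaceD(1)[OF insert(5)] by auto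
  have sub: "k_subspace R ?U" by (rule subspace_plus_line[OF insert(5) z])
  have "\<forall>x\<in>carrier R. \<exists>s\<in>k_span R F. \<exists>u\<in>?U. x = s \<oplus> u"
  proof
    fix x assume x: "x \<in> carrier R"
    obtain s u where "s \<in> k_span R (insert z F)" and u: "u \<in> U" and xs: "x = s \<oplus> u"
      using insert(6) x by auto
    then obtain s' c where s': "s' \<in> k_span R F" and s: "s = s' \<oplus> c \<odot> z"
      using insert.prems(1) by (elim k_span_insert)
    have "s' \<in> carrier R" using s' F by (auto simp: k_span_def intro!: finsum_closed smult_closed)
    then have "x = s' \<oplus> (u \<oplus> c \<odot> z)" using xs s Uc[OF u] z by (simp add: smult_closed a_ac)
    then show "\<exists>s\<in>k_span R F. \<exists>u\<in>?U. x = s \<oplus> u" using s' u by blast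
  qed
  from insert.IH[OF F sub this] obtain n :: nat and e \<phi> where
    A: "\<forall>i<n. e i \<in> carrier R \<and> linear_form R (\<phi> i) \<and> (\<forall>u\<in>?U. \<phi> i u = 0)"
    and B: "\<forall>i<n. \<forall>j<n. \<phi> i (e j) = (if i = j then 1 else 0)"
    and C: "\<forall>f. linear_form R f \<longrightarrow> (\<forall>u\<in>?U. f u = 0) \<longrightarrow>
        (\<forall>x\<in>carrier R. f x = (\<Sum>i<n. \<phi> i x * f (e i)))"
    by (elim exE conjE) rule
  have e: "e i \<in> carrier R" and lf: "linear_form R (\<phi> i)" if "i < n" for i using A that by auto
  have van: "\<phi> i u = 0" if "i < n" "u \<in> ?U" for i u using A[rule_format, OF that(1)] that(2) by blast
  have orth: "\<phi> i (e j) = (if i = j then 1 else 0)" if "i < n" "j < n" for i j using B that by auto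
  have rep: "f x = (\<Sum>i<n. \<phi> i x * f (e i))"
    if "linear_form R f" "\<forall>u\<in>?U. f u = 0" "x \<in> carrier R" for f x
    using C[rule_format, OF that(1) _ that(3)] that(2) by blast
  have UU: "u \<in> ?U" if "u \<in> U" for u
    using that Uc z by (intro CollectI exI[of _ u] exI[of _ 0]) simp
  have zU: "z \<in> ?U"
    using z k_subspaceD(2)[OF insert(5)] by (intro CollectI exI[of _ \<zero>] exI[of _ 1]) (simp add: smult_one)
  show ?case
  proof (cases "z \<in> U")
    case True
    have "u \<in> U" if "u \<in> ?U" for u
      using that True k_subspaceD(3,4)[OF insert(5)] by auto
    then have "?U = U" using UU by blast
    then show ?thesis using A B C
      by (intro exI[of _ n] exI[of _ e] exI[of _ \<phi>] conjI) simp_all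
  next
    case False
    obtain \<psi> where \<psi>: "linear_form R \<psi>" "\<psi> z = 1" "\<And>u. u \<in> U \<Longrightarrow> \<psi> u = 0"
      by (rule separating_form_mod[OF insert(5) z False]) blast
    have vanU: "\<phi> i u = 0" if "i < n" "u \<in> U" for i u using van[OF that(1) UU[OF that(2)]] .
    have vanz: "\<phi> i z = 0" if "i < n" for i using van[OF that zU] .
    \<comment> \<open>Correcting \<psi> on the earlier e_j makes it vanish there, so \<theta> is the
      form dual to the new basis vector z.\<close>
    define \<theta> where "\<theta> x = \<psi> x - (\<Sum>i<n. \<phi> i x * \<psi> (e i))" for x
    have th: "linear_form R \<theta>" unfolding \<theta>_def
      by (intro linear_form_minus \<psi> linear_form_sum linear_form_times_right) (auto intro: lf)
    have th0: "\<theta> u = 0" if "u \<in> U" for u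
      unfolding \<theta>_def using \<psi>(3)[OF that] van UU[OF that] by simp
    have thz: "\<theta> z = 1" unfolding \<theta>_def using \<psi>(2) van zU by simp
    have the: "\<theta> (e j) = 0" if "j < n" for j
      unfolding \<theta>_def using that by (simp add: orth if_distrib[of "\<lambda>c. c * _"] cong: if_cong)
    have repf: "f x = (\<Sum>i<n. \<phi> i x * f (e i)) + \<theta> x * f z"
      if f: "linear_form R f" "\<forall>u\<in>U. f u = 0" and x: "x \<in> carrier R" for f x
    proof -
      \<comment> \<open>Subtracting f(z) \<psi> makes f vanish on z as well, hence on U + kz, where
        the induction hypothesis applies.\<close>
      let ?g = "\<lambda>x. f x - f z * \<psi> x"
      have g: "linear_form R ?g" by (intro linear_form_minus linear_form_times f \<psi>)
      have "\<forall>u\<in>?U. ?g u = 0"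
        using f \<psi> Uc z by (auto simp: linear_form_add linear_form_smult smult_closed)
      from rep[OF g this x] have "f x - f z * \<psi> x = (\<Sum>i<n. \<phi> i x * f (e i)) - f z * (\<Sum>i<n. \<phi> i x * \<psi> (e i))"
        by (simp add: sum_subtractf sum_distrib_left algebra_simps)
      then show ?thesis by (simp add: \<theta>_def algebra_simps)
    qed
    show ?thesis
    proof (intro exI[of _ "Suc n"] exI[of _ "e(n := z)"] exI[of _ "\<phi>(n := \<theta>)"] conjI allI impI ballI)
      fix f x assume f: "linear_form R f" "\<forall>u\<in>U. f u = 0" "x \<in> carrier R"
      show "f x = (\<Sum>i<Suc n. (\<phi>(n := \<theta>)) i x * f ((e(n := z)) i))"
        using repf[OF f] by simp
    qed (use e z lf th th0 vanU vanz orth thz the in \<open>auto simp: less_Suc_eq\<close>)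
  qed
qed

text \<open>One more form lowers a common kernel by at most one dimension: if \<phi> is not zero on
  the previous kernel, a vector z of that kernel with \<phi>(z) = 1 spans what is lost.\<close>

lemma finite_codim_common_kernel:
  assumes "finite \<Phi>" and "\<And>\<phi>. \<phi> \<in> \<Phi> \<Longrightarrow> linear_form R \<phi>"
  shows "finite_codim R {x \<in> carrier R. \<forall>\<phi>\<in>\<Phi>. \<phi> x = 0}"
  using assms
proof (induction \<Phi> rule: finite_induct)
  case empty
  have "\<zero> \<in> k_span R {}" by (auto simp: k_span_def)
  then show ?case unfolding finite_codim_def
    by (intro exI[of _ "{}"]) (auto intro: bexI[of _ "\<zero>"])
next
  case (insert \<phi> \<Phi>)
  let ?U = "{x \<in> carrier R. \<forall>\<phi>\<in>\<Phi>. \<phi> x = 0}"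
  let ?W = "{x \<in> carrier R. \<forall>\<phi>\<in>insert \<phi> \<Phi>. \<phi> x = 0}"
  have fc: "finite_codim R ?U" using insert by auto
  show ?case
  proof (cases "\<forall>u\<in>?U. \<phi> u = 0")
    case True
    then have "?U \<subseteq> ?W" by auto
    then show ?thesis using finite_codim_mono[OF fc] by blast
  next
    case False
    then obtain u where u: "u \<in> ?U" "\<phi> u \<noteq> 0" by auto
    obtain F where F: "finite F" "F \<subseteq> carrier R"
      and sp: "\<forall>x\<in>carrier R. \<exists>s\<in>k_span R F. \<exists>u\<in>?U. x = s \<oplus> u"
      using fc unfolding finite_codim_def by (elim exE conjE) rule
    have lf: "linear_form R \<phi>" using insert by auto
    define z where "z = inverse (\<phi> u) \<odot> u"
    have z: "z \<in> ?U" "\<phi> z = 1"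
      using u insert.prems by (auto simp: z_def smult_closed linear_form_smult)
    have sp': "\<exists>s\<in>k_span R (insert z F). \<exists>w\<in>?W. x = s \<oplus> w" if x: "x \<in> carrier R" for x
    proof -
      obtain s v where s: "s \<in> k_span R F" and v: "v \<in> ?U" and xs: "x = s \<oplus> v" using sp x by blast
      have sc: "s \<in> carrier R" using s F by (auto simp: k_span_def intro!: finsum_closed smult_closed)
      show ?thesis
      proof (cases "z \<in> F")
        case False
        have "s \<oplus> \<phi> v \<odot> z \<in> k_span R (insert z F)"
          using k_span_insertI[OF s _ False] F z by auto
        moreover have "v \<ominus> \<phi> v \<odot> z \<in> ?W"
          using v z insert.prems by (auto simp: linear_form_diff linear_form_smult smult_closed)
        moreover have "x = (s \<oplus> \<phi> v \<odot> z) \<oplus> (v \<ominus> \<phi> v \<odot> z)"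
          using xs sc v z smult_closed[of z "\<phi> v"] by (simp add: minus_eq) algebra
        ultimately show ?thesis by blast
      next
        case True
        \<comment> \<open>Here z already belongs to the spanning set, so its old coefficient d has
          to be merged with \<open>\<phi> v\<close>.\<close>
        have "s \<in> k_span R (insert z (F - {z}))" "insert z (F - {z}) \<subseteq> carrier R"
          using s True F by (auto simp: insert_absorb)
        then obtain s2 d where s2: "s2 \<in> k_span R (F - {z})" "s = s2 \<oplus> d \<odot> z"
          by (rule k_span_insert)
        have s2c: "s2 \<in> carrier R" using s2 F by (auto simp: k_span_def intro!: finsum_closed smult_closed)
        have "s2 \<oplus> (d + \<phi> v) \<odot> z \<in> k_span R (insert z (F - {z}))"
          using k_span_insertI[OF s2(1), of z] F z by auto
        then have "s2 \<oplus> (d + \<phi> v) \<odot> z \<in> k_span R (insert z F)" by simp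
        moreover have "v \<ominus> \<phi> v \<odot> z \<in> ?W"
          using v z insert.prems by (auto simp: linear_form_diff linear_form_smult smult_closed)
        moreover have "x = (s2 \<oplus> (d + \<phi> v) \<odot> z) \<oplus> (v \<ominus> \<phi> v \<odot> z)"
          using xs s2(2) s2c v z smult_closed[of z "\<phi> v"] smult_closed[of z d]
          by (simp add: minus_eq smult_l_distr) algebra
        ultimately show ?thesis by blast
      qed
    qed
    show ?thesis unfolding finite_codim_def
      by (intro exI[of _ "insert z F"]) (use F z sp' in auto)
  qed
qed

end

section \<open>Tensors\<close>

lemma bilinear_formI:
  assumes "\<And>y. y \<in> carrier W \<Longrightarrow> linear_form V (\<lambda>x. b x y)"
    and "\<And>x. x \<in> carrier V \<Longrightarrow> linear_form W (\<lambda>y. b x y)"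
  shows "bilinear_form V W b"
  using assms by (simp add: bilinear_form_def)

lemma bilinear_formD:
  assumes "bilinear_form V W b"
  shows "y \<in> carrier W \<Longrightarrow> linear_form V (\<lambda>x. b x y)"
    and "x \<in> carrier V \<Longrightarrow> linear_form W (\<lambda>y. b x y)"
  using assms by (simp_all add: bilinear_form_def)

lemma bilinear_form_product:
  "\<lbrakk>linear_form V f; linear_form W g\<rbrakk> \<Longrightarrow> bilinear_form V W (\<lambda>x y. f x * g y)"
  by (intro bilinear_formI linear_form_times linear_form_times_right)

lemma bilinear_form_plus:
  "\<lbrakk>bilinear_form V W b; bilinear_form V W b'\<rbrakk> \<Longrightarrow> bilinear_form V W (\<lambda>x y. b x y + b' x y)"
  by (auto intro!: bilinear_formI linear_form_plus dest: bilinear_formD)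

lemma bilinear_form_times:
  "bilinear_form V W b \<Longrightarrow> bilinear_form V W (\<lambda>x y. c * b x y)"
  by (auto intro!: bilinear_formI linear_form_times dest: bilinear_formD)

lemma bilinear_form_comp:
  assumes "linear_map V V' f" "linear_map W W' g" "bilinear_form V' W' b"
  shows "bilinear_form V W (\<lambda>x y. b (f x) (g y))"
proof (rule bilinear_formI)
  show "linear_form V (\<lambda>x. b (f x) (g y))" if "y \<in> carrier W" for y
    by (rule linear_form_comp[OF assms(1) bilinear_formD(1)[OF assms(3)]]) (rule linear_mapD(1)[OF assms(2) that])
  show "linear_form W (\<lambda>y. b (f x) (g y))" if "x \<in> carrier V" for x
    by (rule linear_form_comp[OF assms(2) bilinear_formD(2)[OF assms(3)]]) (rule linear_mapD(1)[OF assms(1) that])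
qed

lemma bilinear_form_cong:
  assumes "k_algebra V" "k_algebra W"
    and "\<And>x y. \<lbrakk>x \<in> carrier V; y \<in> carrier W\<rbrakk> \<Longrightarrow> b x y = b' x y"
  shows "bilinear_form V W b \<longleftrightarrow> bilinear_form V W b'"
proof -
  have "linear_form V (\<lambda>x. b x y) \<longleftrightarrow> linear_form V (\<lambda>x. b' x y)" if "y \<in> carrier W" for y
    by (rule k_algebra.linear_form_cong[OF assms(1)]) (rule assms(3)[OF _ that])
  moreover have "linear_form W (\<lambda>y. b x y) \<longleftrightarrow> linear_form W (\<lambda>y. b' x y)" if "x \<in> carrier V" for x
    by (rule k_algebra.linear_form_cong[OF assms(2)]) (rule assms(3)[OF that])
  ultimately show ?thesis by (simp add: bilinear_form_def)
qed

lemma tensor_spaceE: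
  assumes "T \<in> tensor_space V W"
  obtains xs where "set xs \<subseteq> carrier V \<times> carrier W" and "T = tensor_sum V W xs"
  using assms unfolding tensor_space_def by auto

lemma tensor_sum_apply:
  "bilinear_form V W b \<Longrightarrow> tensor_sum V W xs b = (\<Sum>(x, y)\<leftarrow>xs. b x y)"
  by (simp add: tensor_sum_def)

lemma tensor_sum_in_space: "set xs \<subseteq> carrier V \<times> carrier W \<Longrightarrow> tensor_sum V W xs \<in> tensor_space V W"
  by (auto simp: tensor_space_def)

lemma sum_list_pair_cong:
  assumes "\<And>x y. (x, y) \<in> set xs \<Longrightarrow> b x y = b' x y"
  shows "(\<Sum>(x, y)\<leftarrow>xs. b x y) = (\<Sum>(x, y)\<leftarrow>xs. b' x y)"
  using assms by (intro arg_cong[of _ _ sum_list] map_cong) auto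

lemma sum_list_pair_add:
  "(\<Sum>(x, y)\<leftarrow>xs. b x y + b' x y) = (\<Sum>(x, y)\<leftarrow>xs. b x y) + (\<Sum>(x, y)\<leftarrow>xs. b' x y :: 'k::field)"
  by (induction xs) (auto simp: algebra_simps)

lemma sum_list_pair_times:
  "(\<Sum>(x, y)\<leftarrow>xs. c * b x y) = c * (\<Sum>(x, y)\<leftarrow>xs. b x y :: 'k::field)"
  by (induction xs) (auto simp: algebra_simps)

lemma sum_list_pair_swap:
  "(\<Sum>(x, y)\<leftarrow>xs. \<Sum>(u, v)\<leftarrow>ys. t x y u v) = (\<Sum>(u, v)\<leftarrow>ys. \<Sum>(x, y)\<leftarrow>xs. t x y u v :: 'k::field)"
proof (induction xs)
  case Nil
  then show ?case by (induction ys) auto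
next
  case (Cons p xs)
  then show ?case by (cases p) (simp add: sum_list_pair_add)
qed

text \<open>Serves the multiplicativity of the coproduct on the finite dual, where sums over the
  legs of two functionals are exchanged with sums over the legs of two elements.\<close>

lemma sum_list_pair_swap4:
  "(\<Sum>(p, q)\<leftarrow>as. \<Sum>(p', q')\<leftarrow>bs. \<Sum>(u, v)\<leftarrow>cs. \<Sum>(u', v')\<leftarrow>ds. t p q p' q' u v u' v') =
   (\<Sum>(u, v)\<leftarrow>cs. \<Sum>(u', v')\<leftarrow>ds. \<Sum>(p, q)\<leftarrow>as. \<Sum>(p', q')\<leftarrow>bs. t p q p' q' u v u' v' :: 'k::field)"
  (is "?L = ?R")
proof -
  have "?L = (\<Sum>(p, q)\<leftarrow>as. \<Sum>(u, v)\<leftarrow>cs. \<Sum>(p', q')\<leftarrow>bs. \<Sum>(u', v')\<leftarrow>ds. t p q p' q' u v u' v')"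
    by (rule sum_list_pair_cong) (rule sum_list_pair_swap)
  also have "\<dots> = (\<Sum>(u, v)\<leftarrow>cs. \<Sum>(p, q)\<leftarrow>as. \<Sum>(p', q')\<leftarrow>bs. \<Sum>(u', v')\<leftarrow>ds. t p q p' q' u v u' v')"
    by (rule sum_list_pair_swap)
  also have "\<dots> = (\<Sum>(u, v)\<leftarrow>cs. \<Sum>(p, q)\<leftarrow>as. \<Sum>(u', v')\<leftarrow>ds. \<Sum>(p', q')\<leftarrow>bs. t p q p' q' u v u' v')"
    by (rule sum_list_pair_cong, rule sum_list_pair_cong) (rule sum_list_pair_swap)
  also have "\<dots> = ?R"
    by (rule sum_list_pair_cong) (rule sum_list_pair_swap)
  finally show ?thesis .
qed

lemma sum_list_sum_swap:
  "(\<Sum>(x, y)\<leftarrow>xs. \<Sum>i\<in>N. f i x y) = (\<Sum>i\<in>N. \<Sum>(x, y)\<leftarrow>xs. f i x y :: 'k::field)"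
  by (induction xs) (auto simp: sum.distrib)

lemma sum_list_pair_product:
  "(\<Sum>(x, y)\<leftarrow>xs. f x y) * (\<Sum>(u, v)\<leftarrow>ys. g u v) = (\<Sum>(x, y)\<leftarrow>xs. \<Sum>(u, v)\<leftarrow>ys. f x y * g u v :: 'k::field)"
  by (induction xs) (auto simp: distrib_right sum_list_pair_times)

lemma sum_list_pair_comprehension:
  "(\<Sum>(u, v)\<leftarrow>[(f x x', g y y'). (x, y) \<leftarrow> xs, (x', y') \<leftarrow> ys]. b u v) =
     (\<Sum>(x, y)\<leftarrow>xs. \<Sum>(x', y')\<leftarrow>ys. b (f x x') (g y y') :: 'k::field)"
proof (induction xs)
  case (Cons p xs)
  have "(\<Sum>(u, v)\<leftarrow>map (\<lambda>(x', y'). (f x x', g y y')) ys. b u v) = (\<Sum>(x', y')\<leftarrow>ys. b (f x x') (g y y'))" for x y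
    by (induction ys) auto
  then show ?case using Cons by (cases p) (simp add: o_def)
qed simp

lemma tensor_space_plus:
  assumes "T \<in> tensor_space V W" "T' \<in> tensor_space V W"
  shows "(\<lambda>b. T b + T' b) \<in> tensor_space V W"
proof -
  obtain xs ys where "set xs \<subseteq> carrier V \<times> carrier W" "T = tensor_sum V W xs"
    "set ys \<subseteq> carrier V \<times> carrier W" "T' = tensor_sum V W ys"
    using assms by (elim tensor_spaceE)
  then show ?thesis unfolding tensor_space_def
    by (intro CollectI exI[of _ "xs @ ys"]) (auto simp: tensor_sum_def)
qed

lemma tensor_space_zero: "(\<lambda>b. 0) \<in> tensor_space V W"
  unfolding tensor_space_def by (intro CollectI exI[of _ "[]"]) (auto simp: tensor_sum_def)

lemma tensor_space_elementary:
  "\<lbrakk>x \<in> carrier V; y \<in> carrier W\<rbrakk> \<Longrightarrow> tensor_sum V W [(x, y)] \<in> tensor_space V W"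
  by (rule tensor_sum_in_space) simp

lemma tensor_space_sum:
  assumes "finite N" "\<And>i. i \<in> N \<Longrightarrow> T i \<in> tensor_space V W"
  shows "(\<lambda>b. \<Sum>i\<in>N. T i b) \<in> tensor_space V W"
  using assms
  by (induction N rule: finite_induct) (auto intro: tensor_space_zero tensor_space_plus)

lemma tensor_space_times:
  assumes V: "k_algebra V" and T: "T \<in> tensor_space V W"
  shows "(\<lambda>b. c * T b) \<in> tensor_space V W"
proof -
  obtain xs where xs: "set xs \<subseteq> carrier V \<times> carrier W" "T = tensor_sum V W xs"
    using T by (elim tensor_spaceE)
  let ?ys = "map (\<lambda>(x, y). (c \<odot>\<^bsub>V\<^esub> x, y)) xs"
  have "(\<lambda>b. c * T b) = tensor_sum V W ?ys"
  proof
    fix b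
    show "c * T b = tensor_sum V W ?ys b"
    proof (cases "bilinear_form V W b")
      case True
      have "c * (\<Sum>(x, y)\<leftarrow>xs. b x y) = (\<Sum>(x, y)\<leftarrow>xs. b (c \<odot>\<^bsub>V\<^esub> x) y)"
        unfolding sum_list_pair_times[symmetric] using xs(1) linear_form_smult[OF bilinear_formD(1)[OF True]] by (intro sum_list_pair_cong) auto
      then show ?thesis using True xs(2)
        by (simp add: tensor_sum_apply o_def case_prod_unfold)
    qed (simp add: xs(2) tensor_sum_def)
  qed
  moreover have "set ?ys \<subseteq> carrier V \<times> carrier W"
    using xs(1) k_algebra.smult_closed[OF V] by auto
  ultimately show ?thesis by (simp add: tensor_sum_in_space)
qed

context
  fixes V :: "('k::field, 'a, 'm) module_scheme" and W :: "('k, 'b, 'n) module_scheme"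
    and T :: "('k, 'a, 'b) tensor"
  assumes T: "T \<in> tensor_space V W"
begin

lemma tensor_plus:
  "\<lbrakk>bilinear_form V W b; bilinear_form V W b'\<rbrakk> \<Longrightarrow> T (\<lambda>x y. b x y + b' x y) = T b + T b'"
  by (rule tensor_spaceE[OF T]) (simp add: tensor_sum_apply bilinear_form_plus sum_list_pair_add)

lemma tensor_times:
  "bilinear_form V W b \<Longrightarrow> T (\<lambda>x y. c * b x y) = c * T b"
  by (rule tensor_spaceE[OF T]) (simp add: tensor_sum_apply bilinear_form_times sum_list_pair_times)

text \<open>A tensor evaluates a form at finitely many pairs of carrier elements only, and whether
  the form counts as bilinear also depends on the carriers alone; the second point covers the
  default value 0.\<close>

lemma tensor_cong:
  assumes "k_algebra V" "k_algebra W"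
    and "\<And>x y. \<lbrakk>x \<in> carrier V; y \<in> carrier W\<rbrakk> \<Longrightarrow> b x y = b' x y"
  shows "T b = T b'"
proof -
  obtain xs where xs: "set xs \<subseteq> carrier V \<times> carrier W" "T = tensor_sum V W xs"
    by (rule tensor_spaceE[OF T])
  have "(\<Sum>(x, y)\<leftarrow>xs. b x y) = (\<Sum>(x, y)\<leftarrow>xs. b' x y)"
    using xs(1) assms(3) by (intro sum_list_pair_cong) auto
  then show ?thesis using bilinear_form_cong[OF assms] by (simp add: xs(2) tensor_sum_def)
qed

text \<open>Shows that an iterated evaluation of coproducts is still linear in the remaining
  variable.\<close>

lemma linear_form_tensor:
  assumes "\<And>z. z \<in> carrier U \<Longrightarrow> bilinear_form V W (b z)"
    and "\<And>x y. \<lbrakk>x \<in> carrier V; y \<in> carrier W\<rbrakk> \<Longrightarrow> linear_form U (\<lambda>z. b z x y)"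
    and "k_algebra U"
  shows "linear_form U (\<lambda>z. T (b z))"
proof -
  obtain xs where xs: "set xs \<subseteq> carrier V \<times> carrier W" "T = tensor_sum V W xs"
    by (rule tensor_spaceE[OF T])
  have "linear_form U (\<lambda>z. \<Sum>(x, y)\<leftarrow>xs. b z x y)"
    unfolding case_prod_unfold using xs(1) assms(2) by (intro linear_form_sum_list) auto
  moreover have "T (b z) = (\<Sum>(x, y)\<leftarrow>xs. b z x y)" if "z \<in> carrier U" for z
    using assms(1)[OF that] by (simp add: xs(2) tensor_sum_apply)
  ultimately show ?thesis
    using k_algebra.linear_form_cong[OF assms(3), of "\<lambda>z. T (b z)"] by simp
qed

end

lemma tensor_map_tensor_sum:
  assumes "linear_map V V' f" "linear_map W W' g"
  shows "tensor_map V' W' f g (tensor_sum V W xs) = tensor_sum V' W' (map (\<lambda>(x, y). (f x, g y)) xs)"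
proof
  fix b
  show "tensor_map V' W' f g (tensor_sum V W xs) b = tensor_sum V' W' (map (\<lambda>(x, y). (f x, g y)) xs) b"
    using bilinear_form_comp[OF assms, of b]
    by (auto simp: tensor_map_def tensor_sum_def o_def case_prod_unfold)
qed

lemma tensor_map_in_space:
  assumes f: "linear_map V V' f" and g: "linear_map W W' g" and T: "T \<in> tensor_space V W"
  shows "tensor_map V' W' f g T \<in> tensor_space V' W'"
proof -
  obtain xs where xs: "set xs \<subseteq> carrier V \<times> carrier W" "T = tensor_sum V W xs"
    by (rule tensor_spaceE[OF T])
  show ?thesis unfolding xs(2) tensor_map_tensor_sum[OF f g]
    using xs(1) linear_mapD(1)[OF f] linear_mapD(1)[OF g] by (intro tensor_sum_in_space) auto
qed

lemma tensor_map_apply: "bilinear_form V' W' b \<Longrightarrow> tensor_map V' W' f g T b = T (\<lambda>x y. b (f x) (g y))"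
  by (simp add: tensor_map_def)

section \<open>Tensors over spaces of functions\<close>

definition function_space :: "('k::field, 'a \<Rightarrow> 'k, 'm) module_scheme \<Rightarrow> bool" where
  "function_space V \<longleftrightarrow> add V = (\<lambda>f g x. f x + g x) \<and> zero V = (\<lambda>x. 0) \<and>
     module.smult V = (\<lambda>c f x. c * f x)"

lemma function_spaceD:
  assumes "function_space V"
  shows "f \<oplus>\<^bsub>V\<^esub> g = (\<lambda>x. f x + g x)" "\<zero>\<^bsub>V\<^esub> = (\<lambda>x. 0)" "c \<odot>\<^bsub>V\<^esub> f = (\<lambda>x. c * f x)"
  using assms by (auto simp: function_space_def)

lemma linear_form_eval: "function_space V \<Longrightarrow> linear_form V (\<lambda>f. f x)"
  by (simp add: linear_form_def function_spaceD)

lemma list_sum_pointwise: "function_space V \<Longrightarrow> list_sum V fs x = (\<Sum>f\<leftarrow>fs. f x)"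
  by (induction fs) (auto simp: function_spaceD)

lemma finsum_pointwise:
  assumes "k_algebra V" "function_space V" "\<And>i. i \<in> F \<Longrightarrow> f i \<in> carrier V" "finite F"
  shows "finsum V f F = (\<lambda>x. \<Sum>i\<in>F. f i x)"
proof -
  interpret k_algebra V by fact
  from assms(4,3) show ?thesis
  proof (induction F rule: finite_induct)
    case empty
    then show ?case by (simp add: function_spaceD[OF assms(2)])
  next
    case (insert i F)
    then have "finsum V f (insert i F) = f i \<oplus>\<^bsub>V\<^esub> finsum V f F"
      by (intro finsum_insert) auto
    then show ?case using insert by (simp add: function_spaceD[OF assms(2)])
  qed
qed

text \<open>Induction on the number of summands: if h(y0) is non-zero, evaluating the vanishing sum
  at y0 expresses g through the other first factors, and substituting this absorbs the pair (g, h).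
  In other words V \<otimes> W embeds into functions of two variables, the fact behind the
  uniqueness of coproducts on finite duals.\<close>

lemma pointwise_zero_tensor:
  assumes V: "k_algebra V" "function_space V" and W: "k_algebra W" "function_space W"
    and b: "bilinear_form V W b"
    and "set zs \<subseteq> carrier V \<times> carrier W" and "\<And>x y. (\<Sum>(g, h)\<leftarrow>zs. g x * h y) = 0"
  shows "(\<Sum>(g, h)\<leftarrow>zs. b g h) = 0"
  using assms(6,7)
proof (induction "length zs" arbitrary: zs)
  case 0
  then show ?case by simp
next
  case (Suc n)
  interpret V: k_algebra V by fact
  interpret W: k_algebra W by fact
  obtain g h rest where zs: "zs = (g, h) # rest" using Suc(2) by (cases zs) auto
  have g: "g \<in> carrier V" and h: "h \<in> carrier W" and rest: "set rest \<subseteq> carrier V \<times> carrier W"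
    using Suc(3) zs by auto
  show ?case
  proof (cases "\<forall>y. h y = 0")
    case True
    then have h0: "h = \<zero>\<^bsub>W\<^esub>" using function_spaceD(2)[OF W(2)] by auto
    have "(\<Sum>(g, h)\<leftarrow>rest. b g h) = 0"
      using Suc(2,4) zs True rest by (intro Suc(1)) auto
    moreover have "b g \<zero>\<^bsub>W\<^esub> = 0" using W.linear_form_at_zero[OF bilinear_formD(2)[OF b g]] .
    ultimately show ?thesis using zs h0 by simp
  next
    case False
    then obtain y0 where y0: "h y0 \<noteq> 0" by auto
    \<comment> \<open>Solving the relation at y0 for g gives g = - \<Sum> c(h') g'.\<close>
    define c where "c h' = h' y0 / h y0" for h'
    have g_eq: "g = list_sum V (map (\<lambda>(g', h'). (- c h') \<odot>\<^bsub>V\<^esub> g') rest)"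
    proof
      fix x
      have "g x * h y0 = - (\<Sum>(g', h')\<leftarrow>rest. g' x * h' y0)"
        using Suc(4)[of x y0] zs by (simp add: eq_neg_iff_add_eq_0)
      then have "g x = (- 1 / h y0) * (\<Sum>(g', h')\<leftarrow>rest. g' x * h' y0)"
        using y0 by (simp add: field_simps)
      also have "\<dots> = (\<Sum>(g', h')\<leftarrow>rest. (- c h') * g' x)"
        unfolding sum_list_pair_times[symmetric] by (intro sum_list_pair_cong) (simp add: c_def field_simps)
      finally show "g x = list_sum V (map (\<lambda>(g', h'). (- c h') \<odot>\<^bsub>V\<^esub> g') rest) x"
        by (simp add: list_sum_pointwise[OF V(2)] o_def case_prod_unfold function_spaceD[OF V(2)])
    qed
    have "b g h = (\<Sum>(g', h')\<leftarrow>rest. b ((- c h') \<odot>\<^bsub>V\<^esub> g') h)"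
    proof -
      have "set (map (\<lambda>(g', h'). (- c h') \<odot>\<^bsub>V\<^esub> g') rest) \<subseteq> carrier V"
        using rest V.smult_closed by auto
      from V.linear_form_list_sum[OF bilinear_formD(1)[OF b h] this] show ?thesis
        unfolding g_eq[symmetric] by (simp add: o_def case_prod_unfold)
    qed
    also have "\<dots> = (\<Sum>(g', h')\<leftarrow>rest. - c h' * b g' h)"
      using rest linear_form_smult[OF bilinear_formD(1)[OF b h]] by (intro sum_list_pair_cong) auto
    finally have bg: "b g h = (\<Sum>(g', h')\<leftarrow>rest. - c h' * b g' h)" .
    \<comment> \<open>Bilinearity moves the coefficients of g into the second factors and leaves one
      pair fewer.\<close>
    let ?rest = "map (\<lambda>(g', h'). (g', h' \<oplus>\<^bsub>W\<^esub> (- c h') \<odot>\<^bsub>W\<^esub> h)) rest"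
    have "(\<Sum>(g, h)\<leftarrow>?rest. b g h) = 0"
    proof (rule Suc(1))
      show "n = length ?rest" using Suc(2) zs by simp
      show "set ?rest \<subseteq> carrier V \<times> carrier W" using rest h W.smult_closed by auto
      fix x y
      have "(\<Sum>(g, h)\<leftarrow>?rest. g x * h y) = (\<Sum>(g', h')\<leftarrow>rest. g' x * h' y + h y * (- c h' * g' x))"
        by (simp add: o_def case_prod_unfold function_spaceD[OF W(2)] algebra_simps)
      also have "\<dots> = (\<Sum>(g', h')\<leftarrow>rest. g' x * h' y) + h y * (\<Sum>(g', h')\<leftarrow>rest. - c h' * g' x)"
        by (simp only: sum_list_pair_add sum_list_pair_times)
      also have "(\<Sum>(g', h')\<leftarrow>rest. - c h' * g' x) = g x"
        by (subst g_eq) (simp add: list_sum_pointwise[OF V(2)] o_def case_prod_unfold function_spaceD[OF V(2)])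
      also have "(\<Sum>(g', h')\<leftarrow>rest. g' x * h' y) + h y * g x = 0"
        using Suc(4)[of x y] zs by (simp add: algebra_simps)
      finally show "(\<Sum>(g, h)\<leftarrow>?rest. g x * h y) = 0" .
    qed
    moreover have "(\<Sum>(g, h)\<leftarrow>?rest. b g h) = (\<Sum>(g', h')\<leftarrow>rest. b g' h' + - c h' * b g' h)"
    proof -
      have "b g' (h' \<oplus>\<^bsub>W\<^esub> (- c h') \<odot>\<^bsub>W\<^esub> h) = b g' h' + - c h' * b g' h" if "(g', h') \<in> set rest" for g' h'
      proof -
        have "g' \<in> carrier V" "h' \<in> carrier W" using rest that by auto
        then show ?thesis using h
          by (simp add: linear_form_add[OF bilinear_formD(2)[OF b]] linear_form_smult[OF bilinear_formD(2)[OF b]] W.smult_closed)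
      qed
      then have "(\<Sum>(g', h')\<leftarrow>rest. b g' (h' \<oplus>\<^bsub>W\<^esub> (- c h') \<odot>\<^bsub>W\<^esub> h)) = (\<Sum>(g', h')\<leftarrow>rest. b g' h' + - c h' * b g' h)"
        by (rule sum_list_pair_cong)
      then show ?thesis by (simp add: o_def case_prod_unfold)
    qed
    ultimately have "(\<Sum>(g', h')\<leftarrow>rest. b g' h' + - c h' * b g' h) = 0" by (rule trans[OF sym, rotated])
    then have "(\<Sum>(g', h')\<leftarrow>rest. b g' h') + b g h = 0" by (simp only: sum_list_pair_add bg)
    then show ?thesis by (simp add: zs add.commute)
  qed
qed

text \<open>X and Y confine the test to points of the underlying algebras; elsewhere all functions
  involved vanish and both sides agree.\<close>

lemma tensor_eqI_pointwise:
  assumes V: "k_algebra V" "function_space V" and W: "k_algebra W" "function_space W"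
    and T: "T \<in> tensor_space V W" "T' \<in> tensor_space V W"
    and X: "\<And>f x. \<lbrakk>f \<in> carrier V; x \<notin> X\<rbrakk> \<Longrightarrow> f x = 0" and Y: "\<And>f y. \<lbrakk>f \<in> carrier W; y \<notin> Y\<rbrakk> \<Longrightarrow> f y = 0"
    and eq: "\<And>x y. \<lbrakk>x \<in> X; y \<in> Y\<rbrakk> \<Longrightarrow> T (\<lambda>g h. g x * h y) = T' (\<lambda>g h. g x * h y)"
  shows "T = T'"
proof
  fix b
  interpret V: k_algebra V by fact
  obtain xs where xs: "set xs \<subseteq> carrier V \<times> carrier W" "T = tensor_sum V W xs"
    by (rule tensor_spaceE[OF T(1)])
  \<comment> \<open>With the sign included, the difference of T and T' is represented by the single
    list \<open>xs @ ys\<close>.\<close>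
  have "(\<lambda>b. - 1 * T' b) \<in> tensor_space V W" by (rule tensor_space_times[OF V(1) T(2)])
  then obtain ys where ys: "set ys \<subseteq> carrier V \<times> carrier W" "(\<lambda>b. - 1 * T' b) = tensor_sum V W ys"
    by (rule tensor_spaceE)
  have T': "T' b = - tensor_sum V W ys b" for b using fun_cong[OF ys(2)[symmetric], of b] by simp
  have ev: "bilinear_form V W (\<lambda>g h. g x * h y)" for x y
    by (intro bilinear_form_product linear_form_eval V W)
  show "T b = T' b"
  proof (cases "bilinear_form V W b")
    case True
    have "(\<Sum>(g, h)\<leftarrow>xs @ ys. b g h) = 0"
    proof (rule pointwise_zero_tensor[OF V W True])
      show "set (xs @ ys) \<subseteq> carrier V \<times> carrier W" using xs ys by simp
      fix x y
      show "(\<Sum>(g, h)\<leftarrow>xs @ ys. g x * h y) = 0"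
      proof (cases "x \<in> X \<and> y \<in> Y")
        case True
        then show ?thesis using eq[of x y] ev[of x y]
          by (simp add: T' xs(2) tensor_sum_apply)
      next
        case False
        have "(\<Sum>(g, h)\<leftarrow>xs @ ys. g x * h y) = (\<Sum>(g, h)\<leftarrow>xs @ ys. 0)"
          using xs(1) ys(1) False X Y by (intro sum_list_pair_cong) auto
        also have "\<dots> = 0" by (simp add: case_prod_unfold)
        finally show ?thesis .
      qed
    qed
    then show ?thesis using True by (simp add: T' xs(2) tensor_sum_apply eq_neg_iff_add_eq_0)
  next
    case False
    then show ?thesis by (simp add: T' xs(2) tensor_sum_def)
  qed
qed

section \<open>Hopf algebras in terms of linear forms\<close>

lemma trilinear_formD:
  assumes "trilinear_form V t"
  shows "\<lbrakk>y \<in> carrier V; z \<in> carrier V\<rbrakk> \<Longrightarrow> linear_form V (\<lambda>x. t x y z)"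
    and "\<lbrakk>x \<in> carrier V; z \<in> carrier V\<rbrakk> \<Longrightarrow> linear_form V (\<lambda>y. t x y z)"
    and "\<lbrakk>x \<in> carrier V; y \<in> carrier V\<rbrakk> \<Longrightarrow> linear_form V (\<lambda>z. t x y z)"
  using assms by (simp_all add: trilinear_form_def)

lemma trilinear_formI:
  assumes "\<And>y z. \<lbrakk>y \<in> carrier V; z \<in> carrier V\<rbrakk> \<Longrightarrow> linear_form V (\<lambda>x. t x y z)"
    and "\<And>x z. \<lbrakk>x \<in> carrier V; z \<in> carrier V\<rbrakk> \<Longrightarrow> linear_form V (\<lambda>y. t x y z)"
    and "\<And>x y. \<lbrakk>x \<in> carrier V; y \<in> carrier V\<rbrakk> \<Longrightarrow> linear_form V (\<lambda>z. t x y z)"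
  shows "trilinear_form V t"
  using assms by (simp add: trilinear_form_def)

lemma trilinear_form_comp:
  assumes f: "linear_map V W f" and t: "trilinear_form W t"
  shows "trilinear_form V (\<lambda>x y z. t (f x) (f y) (f z))"
  by (intro trilinear_formI linear_form_comp[OF f] trilinear_formD[OF t] linear_mapD(1)[OF f])

lemma trilinear_form_bilinear:
  assumes "trilinear_form V t"
  shows "z \<in> carrier V \<Longrightarrow> bilinear_form V V (\<lambda>x y. t x y z)"
    and "x \<in> carrier V \<Longrightarrow> bilinear_form V V (\<lambda>y z. t x y z)"
  using assms by (simp_all add: trilinear_form_def bilinear_form_def)

lemma (in k_algebra) bilinear_form_mult:
  assumes "linear_form R \<phi>"
  shows "bilinear_form R R (\<lambda>x y. \<phi> (x \<otimes> y))"
  by (intro bilinear_formI linear_form_mult_left linear_form_mult_right assms)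

lemma (in k_algebra) tensor_mult_tensor_sum:
  assumes xs: "set xs \<subseteq> carrier R \<times> carrier R"
    and ys: "set ys \<subseteq> carrier R \<times> carrier R"
  shows "tensor_mult R (tensor_sum R R xs) (tensor_sum R R ys) =
    tensor_sum R R [(x \<otimes> x', y \<otimes> y'). (x, y) \<leftarrow> xs, (x', y') \<leftarrow> ys]"
proof
  fix b
  show "tensor_mult R (tensor_sum R R xs) (tensor_sum R R ys) b =
    tensor_sum R R [(x \<otimes> x', y \<otimes> y'). (x, y) \<leftarrow> xs, (x', y') \<leftarrow> ys] b"
  proof (cases "bilinear_form R R b")
    case True
    have inner: "bilinear_form R R (\<lambda>x' y'. b (x \<otimes> x') (y \<otimes> y'))"
      if "x \<in> carrier R" "y \<in> carrier R" for x y
    proof (rule bilinear_formI)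
      show "linear_form R (\<lambda>x'. b (x \<otimes> x') (y \<otimes> y'))" if "y' \<in> carrier R" for y'
        using that \<open>x \<in> carrier R\<close> \<open>y \<in> carrier R\<close> by (intro linear_form_mult_left[of "\<lambda>u. b u (y \<otimes> y')"] bilinear_formD(1)[OF True]) auto
      show "linear_form R (\<lambda>y'. b (x \<otimes> x') (y \<otimes> y'))" if "x' \<in> carrier R" for x'
        using that \<open>x \<in> carrier R\<close> \<open>y \<in> carrier R\<close> by (intro linear_form_mult_left[of "\<lambda>v. b (x \<otimes> x') v"] bilinear_formD(2)[OF True]) auto
    qed
    have inner2: "bilinear_form R R (\<lambda>x y. b (x \<otimes> x') (y \<otimes> y'))"
      if "x' \<in> carrier R" "y' \<in> carrier R" for x' y'
    proof (rule bilinear_formI)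
      show "linear_form R (\<lambda>x. b (x \<otimes> x') (y \<otimes> y'))" if "y \<in> carrier R" for y
        using that \<open>x' \<in> carrier R\<close> \<open>y' \<in> carrier R\<close> by (intro linear_form_mult_right[of "\<lambda>u. b u (y \<otimes> y')"] bilinear_formD(1)[OF True]) auto
      show "linear_form R (\<lambda>y. b (x \<otimes> x') (y \<otimes> y'))" if "x \<in> carrier R" for x
        using that \<open>x' \<in> carrier R\<close> \<open>y' \<in> carrier R\<close> by (intro linear_form_mult_right[of "\<lambda>v. b (x \<otimes> x') v"] bilinear_formD(2)[OF True]) auto
    qed
    have T: "tensor_sum R R ys \<in> tensor_space R R" by (rule tensor_sum_in_space[OF ys])
    \<comment> \<open>\<open>tensor_sum\<close> yields 0 on a form that is not bilinear, so the
      partially evaluated form has to be bilinear in the outer pair before it can be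
      expanded.\<close>
    have outer: "bilinear_form R R (\<lambda>x y. tensor_sum R R ys (\<lambda>x' y'. b (x \<otimes> x') (y \<otimes> y')))"
      by (intro bilinear_formI linear_form_tensor[OF T] inner bilinear_formD[OF inner2] k_algebra_axioms)
    have "tensor_mult R (tensor_sum R R xs) (tensor_sum R R ys) b =
      (\<Sum>(x, y)\<leftarrow>xs. tensor_sum R R ys (\<lambda>x' y'. b (x \<otimes> x') (y \<otimes> y')))"
      by (simp add: tensor_mult_def True tensor_sum_apply[OF outer])
    also have "\<dots> = (\<Sum>(x, y)\<leftarrow>xs. \<Sum>(x', y')\<leftarrow>ys. b (x \<otimes> x') (y \<otimes> y'))"
      using xs by (intro sum_list_pair_cong tensor_sum_apply inner) auto
    also have "\<dots> = tensor_sum R R [(x \<otimes> x', y \<otimes> y'). (x, y) \<leftarrow> xs, (x', y') \<leftarrow> ys] b"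
      unfolding tensor_sum_apply[OF True] by (rule sum_list_pair_comprehension[symmetric])
    finally show ?thesis .
  qed (simp add: tensor_mult_def tensor_sum_def)
qed

lemma (in k_algebra) tensor_mult_in_space:
  assumes T: "T \<in> tensor_space R R" and T': "T' \<in> tensor_space R R"
  shows "tensor_mult R T T' \<in> tensor_space R R"
proof -
  obtain xs where xs: "set xs \<subseteq> carrier R \<times> carrier R" "T = tensor_sum R R xs"
    by (rule tensor_spaceE[OF T])
  obtain ys where ys: "set ys \<subseteq> carrier R \<times> carrier R" "T' = tensor_sum R R ys"
    by (rule tensor_spaceE[OF T'])
  have "set [(x \<otimes> x', y \<otimes> y'). (x, y) \<leftarrow> xs, (x', y') \<leftarrow> ys] \<subseteq> carrier R \<times> carrier R"
    using xs(1) ys(1) by fastforce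
  then show ?thesis
    unfolding xs(2) ys(2) tensor_mult_tensor_sum[OF xs(1) ys(1)] by (rule tensor_sum_in_space)
qed

section \<open>Sweedler calculus through forms\<close>

context hopf_algebra
begin

lemma comultE:
  assumes "x \<in> carrier H"
  obtains xs where "set xs \<subseteq> carrier H \<times> carrier H" and "comult H x = tensor_sum H H xs"
  using tensor_spaceE[OF comult_closed[OF assms]] .

lemma comult_cong:
  assumes "x \<in> carrier H" and "\<And>u v. \<lbrakk>u \<in> carrier H; v \<in> carrier H\<rbrakk> \<Longrightarrow> b u v = b' u v"
  shows "comult H x b = comult H x b'"
  by (rule tensor_cong[OF comult_closed[OF assms(1)] k_algebra_axioms k_algebra_axioms assms(2)])

lemma linear_form_comult: "linear_form H (\<lambda>x. comult H x b)"
  by (rule linear_formI) (simp_all add: comult_add comult_smult)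

lemma bilinear_form_comult_left:
  assumes "trilinear_form H t"
  shows "bilinear_form H H (\<lambda>x y. comult H x (\<lambda>u v. t u v y))"
  by (intro bilinear_formI linear_form_comult linear_form_tensor[OF comult_closed] k_algebra_axioms
      trilinear_form_bilinear[OF assms] trilinear_formD[OF assms])

lemma bilinear_form_comult_right:
  assumes "trilinear_form H t"
  shows "bilinear_form H H (\<lambda>x y. comult H y (\<lambda>u v. t x u v))"
  by (intro bilinear_formI linear_form_comult linear_form_tensor[OF comult_closed] k_algebra_axioms
      trilinear_form_bilinear[OF assms] trilinear_formD[OF assms])

text \<open>Reading \<open>comult H x b\<close> as the sum of all b(x_1, x_2) gives a Sweedler
  calculus with scalar values: nested evaluations stand for iterated coproducts, and this rule
  regroups x_1, x_2, x_3.\<close>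

lemma coassoc_form:
  assumes "x \<in> carrier H" "trilinear_form H t"
  shows "comult H x (\<lambda>u v. comult H u (\<lambda>p q. t p q v)) = comult H x (\<lambda>u v. comult H v (\<lambda>p q. t u p q))"
  using fun_cong[OF coassoc[OF assms(1)], of t] assms(2) by (simp add: comult_left_def comult_right_def)

text \<open>The axiom speaks of a list representing the coproduct; applying a form to it removes the
  list.\<close>

lemma counit_left_form:
  assumes x: "x \<in> carrier H" and \<phi>: "linear_form H \<phi>"
  shows "comult H x (\<lambda>u v. counit H u * \<phi> v) = \<phi> x"
proof -
  obtain xs where xs: "set xs \<subseteq> carrier H \<times> carrier H" "comult H x = tensor_sum H H xs"
    by (rule comultE[OF x])
  have "comult H x (\<lambda>u v. counit H u * \<phi> v) = (\<Sum>(u, v)\<leftarrow>xs. counit H u * \<phi> v)"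
    by (simp add: xs(2) tensor_sum_apply bilinear_form_product counit_linear \<phi>)
  also have "\<dots> = (\<Sum>(u, v)\<leftarrow>xs. \<phi> (counit H u \<odot> v))"
    using xs(1) by (intro sum_list_pair_cong) (auto simp: linear_form_smult[OF \<phi>])
  also have "\<dots> = \<phi> (list_sum H (map (\<lambda>(u, v). counit H u \<odot> v) xs))"
    using xs(1) by (subst linear_form_list_sum[OF \<phi>]) (auto simp: o_def case_prod_unfold smult_closed)
  finally show ?thesis using counit_left[OF x xs] by simp
qed

lemma counit_right_form:
  assumes x: "x \<in> carrier H" and \<phi>: "linear_form H \<phi>"
  shows "comult H x (\<lambda>u v. counit H v * \<phi> u) = \<phi> x"
proof -
  obtain xs where xs: "set xs \<subseteq> carrier H \<times> carrier H" "comult H x = tensor_sum H H xs"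
    by (rule comultE[OF x])
  have "comult H x (\<lambda>u v. \<phi> u * counit H v) = (\<Sum>(u, v)\<leftarrow>xs. \<phi> u * counit H v)"
    by (simp add: xs(2) tensor_sum_apply bilinear_form_product counit_linear \<phi>)
  also have "\<dots> = (\<Sum>(u, v)\<leftarrow>xs. \<phi> (counit H v \<odot> u))"
    using xs(1) by (intro sum_list_pair_cong) (auto simp: linear_form_smult[OF \<phi>])
  also have "\<dots> = \<phi> (list_sum H (map (\<lambda>(u, v). counit H v \<odot> u) xs))"
    using xs(1) by (subst linear_form_list_sum[OF \<phi>]) (auto simp: o_def case_prod_unfold smult_closed)
  finally show ?thesis using counit_right[OF x xs] by (simp add: mult.commute)
qed

lemma antipode_closed: "x \<in> carrier H \<Longrightarrow> antipode H x \<in> carrier H"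
  using antipode_bij by (auto simp: bij_betw_def)

lemma antipode_linear_map: "linear_map H H (antipode H)"
  by (simp add: linear_map_def antipode_closed antipode_add antipode_smult)

lemma linear_form_antipode: "linear_form H \<phi> \<Longrightarrow> linear_form H (\<lambda>x. \<phi> (antipode H x))"
  by (rule linear_form_comp[OF antipode_linear_map])

lemma linear_map_id: "linear_map H H (\<lambda>x. x)"
  by (simp add: linear_map_def)

lemma antipode_left_form:
  assumes x: "x \<in> carrier H" and \<phi>: "linear_form H \<phi>"
  shows "comult H x (\<lambda>u v. \<phi> (antipode H u \<otimes> v)) = counit H x * \<phi> \<one>"
proof -
  obtain xs where xs: "set xs \<subseteq> carrier H \<times> carrier H" "comult H x = tensor_sum H H xs"
    by (rule comultE[OF x])
  have "bilinear_form H H (\<lambda>u v. \<phi> (antipode H u \<otimes> v))"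
    by (rule bilinear_form_comp[OF antipode_linear_map linear_map_id bilinear_form_mult[OF \<phi>]])
  then have "comult H x (\<lambda>u v. \<phi> (antipode H u \<otimes> v)) = (\<Sum>(u, v)\<leftarrow>xs. \<phi> (antipode H u \<otimes> v))"
    by (simp add: xs(2) tensor_sum_apply)
  also have "\<dots> = \<phi> (list_sum H (map (\<lambda>(u, v). antipode H u \<otimes> v) xs))"
    using xs(1) by (subst linear_form_list_sum[OF \<phi>]) (auto simp: o_def case_prod_unfold antipode_closed)
  finally show ?thesis using antipode_left[OF x xs] by (simp add: linear_form_smult[OF \<phi>])
qed

lemma antipode_right_form:
  assumes x: "x \<in> carrier H" and \<phi>: "linear_form H \<phi>"
  shows "comult H x (\<lambda>u v. \<phi> (u \<otimes> antipode H v)) = counit H x * \<phi> \<one>"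
proof -
  obtain xs where xs: "set xs \<subseteq> carrier H \<times> carrier H" "comult H x = tensor_sum H H xs"
    by (rule comultE[OF x])
  have "bilinear_form H H (\<lambda>u v. \<phi> (u \<otimes> antipode H v))"
    by (rule bilinear_form_comp[OF linear_map_id antipode_linear_map bilinear_form_mult[OF \<phi>]])
  then have "comult H x (\<lambda>u v. \<phi> (u \<otimes> antipode H v)) = (\<Sum>(u, v)\<leftarrow>xs. \<phi> (u \<otimes> antipode H v))"
    by (simp add: xs(2) tensor_sum_apply)
  also have "\<dots> = \<phi> (list_sum H (map (\<lambda>(u, v). u \<otimes> antipode H v) xs))"
    using xs(1) by (subst linear_form_list_sum[OF \<phi>]) (auto simp: o_def case_prod_unfold antipode_closed)
  finally show ?thesis using antipode_right[OF x xs] by (simp add: linear_form_smult[OF \<phi>])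
qed

lemma comult_mult_form:
  assumes "x \<in> carrier H" "y \<in> carrier H" "bilinear_form H H b"
  shows "comult H (x \<otimes> y) b = comult H x (\<lambda>u v. comult H y (\<lambda>u' v'. b (u \<otimes> u') (v \<otimes> v')))"
  using assms by (simp add: comult_mult tensor_mult_def)

lemma comult_one_form: "bilinear_form H H b \<Longrightarrow> comult H \<one> b = b \<one> \<one>"
  by (simp add: comult_one tensor_sum_apply)

lemma comult_sum_list:
  assumes x: "x \<in> carrier H" and b: "\<And>p q. (p, q) \<in> set ys \<Longrightarrow> bilinear_form H H (b p q)"
  shows "comult H x (\<lambda>u v. \<Sum>(p, q)\<leftarrow>ys. b p q u v) = (\<Sum>(p, q)\<leftarrow>ys. comult H x (b p q))"
proof -
  have bs: "bilinear_form H H (\<lambda>u v. \<Sum>(p, q)\<leftarrow>zs. b p q u v)" if "set zs \<subseteq> set ys" for zs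
    unfolding case_prod_unfold using that
    by (intro bilinear_formI linear_form_sum_list) (auto intro!: bilinear_formD[OF b])
  obtain xs where xs: "set xs \<subseteq> carrier H \<times> carrier H" "comult H x = tensor_sum H H xs"
    by (rule comultE[OF x])
  have "comult H x (\<lambda>u v. \<Sum>(p, q)\<leftarrow>ys. b p q u v) = (\<Sum>(u, v)\<leftarrow>xs. \<Sum>(p, q)\<leftarrow>ys. b p q u v)"
    unfolding xs(2) by (rule tensor_sum_apply[OF bs]) simp
  also have "\<dots> = (\<Sum>(p, q)\<leftarrow>ys. \<Sum>(u, v)\<leftarrow>xs. b p q u v)"
    by (rule sum_list_pair_swap)
  also have "\<dots> = (\<Sum>(p, q)\<leftarrow>ys. comult H x (b p q))"
    unfolding xs(2) using b by (intro sum_list_pair_cong) (simp add: tensor_sum_apply)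
  finally show ?thesis .
qed

lemma antipode_one: "antipode H \<one> = \<one>"
  using antipode_left[of \<one> "[(\<one>, \<one>)]"] antipode_closed[of \<one>]
  by (simp add: comult_one counit_one smult_one)

text \<open>
  Both sides are convolution inverses of the product map: \<open>S(x\<^sub>1 y\<^sub>1) x\<^sub>2 y\<^sub>2 S(y\<^sub>3) S(x\<^sub>3)\<close> is evaluated
  in two ways.
\<close>

lemma antipode_mult:
  assumes x: "x \<in> carrier H" and y: "y \<in> carrier H"
  shows "antipode H (x \<otimes> y) = antipode H y \<otimes> antipode H x"
proof (rule linear_forms_separate)
  let ?S = "antipode H"
  fix \<phi> assume \<phi>: "linear_form H \<phi>"
  note cl [simp] = antipode_closed
  \<comment> \<open>In \<phi>(S(x_1 y) x_2 S(x_3)) the element y stays unexpanded, so that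
    contracting x_2 S(x_3) yields S(x y) at once.\<close>
  define \<tau> where "\<tau> p q r = \<phi> (?S (p \<otimes> y) \<otimes> (q \<otimes> ?S r))" for p q r
  have lf1: "linear_form H (\<lambda>p. \<phi> (?S (p \<otimes> u) \<otimes> z))" if "u \<in> carrier H" "z \<in> carrier H" for u z
    by (rule linear_form_mult_right[OF linear_form_antipode[OF linear_form_mult_right[OF \<phi>]]]) (use that in auto)
  have tri: "trilinear_form H \<tau>"
  proof (rule trilinear_formI)
    show "linear_form H (\<lambda>p. \<tau> p q r)" if "q \<in> carrier H" "r \<in> carrier H" for q r
      unfolding \<tau>_def by (rule lf1) (use that y in auto)
    show "linear_form H (\<lambda>q. \<tau> p q r)" if "p \<in> carrier H" "r \<in> carrier H" for p r
      unfolding \<tau>_def by (rule linear_form_mult_right[OF linear_form_mult_left[OF \<phi>]]) (use that y in auto)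
    show "linear_form H (\<lambda>r. \<tau> p q r)" if "p \<in> carrier H" "q \<in> carrier H" for p q
      unfolding \<tau>_def
      by (rule linear_form_antipode[OF linear_form_mult_left[OF linear_form_mult_left[OF \<phi>]]]) (use that y in auto)
  qed
  have lfy: "linear_form H (\<lambda>z. \<phi> (?S (z \<otimes> y)))"
    by (rule linear_form_mult_right[OF linear_form_antipode[OF \<phi>] y])
  have "comult H x (\<lambda>u v. comult H v (\<lambda>q r. \<tau> u q r)) = comult H x (\<lambda>u v. counit H v * \<phi> (?S (u \<otimes> y)))"
  proof (rule comult_cong[OF x])
    fix u v assume u: "u \<in> carrier H" and v: "v \<in> carrier H"
    have "linear_form H (\<lambda>z. \<phi> (?S (u \<otimes> y) \<otimes> z))" by (rule linear_form_mult_left[OF \<phi>]) (use u y in auto)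
    from antipode_right_form[OF v this]
    show "comult H v (\<lambda>q r. \<tau> u q r) = counit H v * \<phi> (?S (u \<otimes> y))"
      using u y by (simp add: \<tau>_def)
  qed
  also have "\<dots> = \<phi> (?S (x \<otimes> y))" by (rule counit_right_form[OF x lfy])
  finally have right: "comult H x (\<lambda>u v. comult H v (\<lambda>q r. \<tau> u q r)) = \<phi> (?S (x \<otimes> y))" .
  \<comment> \<open>A fixed list for the coproduct of y lets the sum over its legs be exchanged with
    the coproduct of x.\<close>
  obtain ys where ys: "set ys \<subseteq> carrier H \<times> carrier H" "comult H y = tensor_sum H H ys"
    by (rule comultE[OF y])
  define \<sigma> where "\<sigma> s w r p q = comult H s (\<lambda>s1 s2. \<phi> (?S (p \<otimes> s1) \<otimes> (q \<otimes> s2) \<otimes> (?S w \<otimes> ?S r)))" for s w p q r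
  have bil2: "bilinear_form H H (\<lambda>s1 s2. \<phi> (?S (p \<otimes> s1) \<otimes> (q \<otimes> s2) \<otimes> z))"
    if "p \<in> carrier H" "q \<in> carrier H" "z \<in> carrier H" for p q z
  proof (rule bilinear_formI)
    show "linear_form H (\<lambda>s1. \<phi> (?S (p \<otimes> s1) \<otimes> (q \<otimes> s2) \<otimes> z))" if "s2 \<in> carrier H" for s2
      by (rule linear_form_mult_left[OF linear_form_antipode[OF linear_form_mult_right[OF linear_form_mult_right[OF \<phi>]]]])
        (use that \<open>p \<in> _\<close> \<open>q \<in> _\<close> \<open>z \<in> _\<close> in auto)
    show "linear_form H (\<lambda>s2. \<phi> (?S (p \<otimes> s1) \<otimes> (q \<otimes> s2) \<otimes> z))" if "s1 \<in> carrier H" for s1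
      by (rule linear_form_mult_left[OF linear_form_mult_left[OF linear_form_mult_right[OF \<phi>]]])
        (use that \<open>p \<in> _\<close> \<open>q \<in> _\<close> \<open>z \<in> _\<close> in auto)
  qed
  have bil1: "bilinear_form H H (\<lambda>p q. \<phi> (?S (p \<otimes> s1) \<otimes> (q \<otimes> s2) \<otimes> z))"
    if "s1 \<in> carrier H" "s2 \<in> carrier H" "z \<in> carrier H" for s1 s2 z
  proof (rule bilinear_formI)
    show "linear_form H (\<lambda>p. \<phi> (?S (p \<otimes> s1) \<otimes> (q \<otimes> s2) \<otimes> z))" if "q \<in> carrier H" for q
      by (rule linear_form_mult_right[OF linear_form_antipode[OF linear_form_mult_right[OF linear_form_mult_right[OF \<phi>]]]])
        (use that \<open>s1 \<in> _\<close> \<open>s2 \<in> _\<close> \<open>z \<in> _\<close> in auto)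
    show "linear_form H (\<lambda>q. \<phi> (?S (p \<otimes> s1) \<otimes> (q \<otimes> s2) \<otimes> z))" if "p \<in> carrier H" for p
      by (rule linear_form_mult_right[OF linear_form_mult_left[OF linear_form_mult_right[OF \<phi>]]])
        (use that \<open>s1 \<in> _\<close> \<open>s2 \<in> _\<close> \<open>z \<in> _\<close> in auto)
  qed
  have \<sigma>_bil: "bilinear_form H H (\<sigma> s w r)" if "s \<in> carrier H" "w \<in> carrier H" "r \<in> carrier H" for s w r
    unfolding \<sigma>_def using that
    by (intro bilinear_formI linear_form_tensor[OF comult_closed] bil2 bilinear_formD[OF bil1] k_algebra_axioms) auto
  \<comment> \<open>Inserting y_2 S(y_3), which contracts to the counit, between x_2 and S(x_3) puts
    the product x_2 y_2 next to S(x_1 y_1).\<close>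
  have \<tau>_\<sigma>: "\<tau> p q r = (\<Sum>(s, w)\<leftarrow>ys. \<sigma> s w r p q)"
    if p: "p \<in> carrier H" and q: "q \<in> carrier H" and r: "r \<in> carrier H" for p q r
  proof -
    let ?t = "\<lambda>s1 s2 w. \<phi> (?S (p \<otimes> s1) \<otimes> (q \<otimes> s2) \<otimes> (?S w \<otimes> ?S r))"
    have t: "trilinear_form H ?t"
    proof (rule trilinear_formI)
      show "linear_form H (\<lambda>w. ?t s1 s2 w)" if "s1 \<in> carrier H" "s2 \<in> carrier H" for s1 s2
        by (rule linear_form_antipode[OF linear_form_mult_right[OF linear_form_mult_left[OF \<phi>]]])
          (use that p q r in auto)
    qed (use p q r in \<open>auto intro!: bilinear_formD[OF bil2]\<close>)
    have "(\<Sum>(s, w)\<leftarrow>ys. \<sigma> s w r p q) = comult H y (\<lambda>s w. comult H s (\<lambda>s1 s2. ?t s1 s2 w))"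
      using tensor_sum_apply[OF bilinear_form_comult_left[OF t], of ys] by (simp add: ys(2) \<sigma>_def)
    also have "\<dots> = comult H y (\<lambda>s w. comult H w (\<lambda>s2 s3. ?t s s2 s3))"
      by (rule coassoc_form[OF y t])
    also have "\<dots> = comult H y (\<lambda>s w. counit H w * \<phi> (?S (p \<otimes> s) \<otimes> (q \<otimes> ?S r)))"
    proof (rule comult_cong[OF y])
      fix s w assume s: "s \<in> carrier H" and w: "w \<in> carrier H"
      have lf: "linear_form H (\<lambda>z. \<phi> (?S (p \<otimes> s) \<otimes> (q \<otimes> (z \<otimes> ?S r))))"
        by (rule linear_form_mult_right[OF linear_form_mult_left[OF linear_form_mult_left[OF \<phi>]]])
          (use p q r s in auto)
      have "comult H w (\<lambda>s2 s3. ?t s s2 s3) =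
          comult H w (\<lambda>s2 s3. \<phi> (?S (p \<otimes> s) \<otimes> (q \<otimes> ((s2 \<otimes> ?S s3) \<otimes> ?S r))))"
        by (rule comult_cong[OF w]) (use p q r s in \<open>simp add: m_assoc\<close>)
      also have "\<dots> = counit H w * \<phi> (?S (p \<otimes> s) \<otimes> (q \<otimes> ?S r))"
        using antipode_right_form[OF w lf] r by simp
      finally show "comult H w (\<lambda>s2 s3. ?t s s2 s3) = counit H w * \<phi> (?S (p \<otimes> s) \<otimes> (q \<otimes> ?S r))" .
    qed
    also have "\<dots> = \<phi> (?S (p \<otimes> y) \<otimes> (q \<otimes> ?S r))"
      by (rule counit_right_form[OF y])
        (rule linear_form_mult_left[OF linear_form_antipode[OF linear_form_mult_right[OF \<phi>]]], use p q r in auto)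
    finally show ?thesis by (simp add: \<tau>_def)
  qed
  define \<psi> where "\<psi> r = (\<Sum>(s, w)\<leftarrow>ys. counit H s * \<phi> (?S w \<otimes> ?S r))" for r
  have \<psi>: "linear_form H \<psi>"
    unfolding \<psi>_def case_prod_unfold using ys(1)
    by (intro linear_form_sum_list linear_form_times linear_form_antipode[OF linear_form_mult_left[OF \<phi>]]) auto
  \<comment> \<open>Second evaluation of the same expression: now S(x_1 y_1) x_2 y_2 contracts to a
    counit.\<close>
  have "comult H x (\<lambda>u v. comult H u (\<lambda>p q. \<tau> p q v)) = comult H x (\<lambda>u v. counit H u * \<psi> v)"
  proof (rule comult_cong[OF x])
    fix u v assume u: "u \<in> carrier H" and v: "v \<in> carrier H"
    have "comult H u (\<lambda>p q. \<tau> p q v) = comult H u (\<lambda>p q. \<Sum>(s, w)\<leftarrow>ys. \<sigma> s w v p q)"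
      by (rule comult_cong[OF u]) (rule \<tau>_\<sigma>[OF _ _ v])
    also have "\<dots> = (\<Sum>(s, w)\<leftarrow>ys. comult H u (\<sigma> s w v))"
      using ys(1) v by (intro comult_sum_list[OF u] \<sigma>_bil) auto
    also have "\<dots> = (\<Sum>(s, w)\<leftarrow>ys. counit H u * (counit H s * \<phi> (?S w \<otimes> ?S v)))"
    proof (rule sum_list_pair_cong)
      fix s w assume "(s, w) \<in> set ys"
      then have s: "s \<in> carrier H" and w: "w \<in> carrier H" using ys(1) by auto
      have lf: "linear_form H (\<lambda>z. \<phi> (z \<otimes> (?S w \<otimes> ?S v)))"
        by (rule linear_form_mult_right[OF \<phi>]) (use w v in auto)
      have bil: "bilinear_form H H (\<lambda>a b. \<phi> (?S a \<otimes> b \<otimes> (?S w \<otimes> ?S v)))"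
        by (rule bilinear_form_comp[OF antipode_linear_map linear_map_id bilinear_form_mult[OF lf]])
      have "comult H u (\<sigma> s w v) = comult H (u \<otimes> s) (\<lambda>a b. \<phi> (?S a \<otimes> b \<otimes> (?S w \<otimes> ?S v)))"
        unfolding \<sigma>_def by (rule comult_mult_form[OF u s bil, symmetric])
      also have "\<dots> = counit H (u \<otimes> s) * \<phi> (?S w \<otimes> ?S v)"
        using antipode_left_form[OF _ lf, of "u \<otimes> s"] u s w v by simp
      finally show "comult H u (\<sigma> s w v) = counit H u * (counit H s * \<phi> (?S w \<otimes> ?S v))"
        using u s by (simp add: counit_mult mult.assoc)
    qed
    finally show "comult H u (\<lambda>p q. \<tau> p q v) = counit H u * \<psi> v"
      by (simp only: \<psi>_def sum_list_pair_times)
  qed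
  also have "\<dots> = \<psi> x" by (rule counit_left_form[OF x \<psi>])
  also have "\<psi> x = comult H y (\<lambda>s w. counit H s * \<phi> (?S w \<otimes> ?S x))"
    unfolding \<psi>_def ys(2)
    by (rule tensor_sum_apply[OF bilinear_form_product[OF counit_linear], symmetric])
      (rule linear_form_antipode[OF linear_form_mult_right[OF \<phi>]], use x in auto)
  also have "\<dots> = \<phi> (?S y \<otimes> ?S x)"
    by (rule counit_left_form[OF y]) (rule linear_form_antipode[OF linear_form_mult_right[OF \<phi>]], use x in auto)
  finally show "\<phi> (?S (x \<otimes> y)) = \<phi> (?S y \<otimes> ?S x)"
    using right coassoc_form[OF x tri] by simp
qed (use x y antipode_closed in auto)

definition antipode_inv :: "'a \<Rightarrow> 'a" where
  "antipode_inv = the_inv_into (carrier H) (antipode H)"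

lemma antipode_inv:
  assumes "x \<in> carrier H"
  shows "antipode_inv x \<in> carrier H" "antipode H (antipode_inv x) = x" "antipode_inv (antipode H x) = x"
proof -
  have i: "inj_on (antipode H) (carrier H)" and s: "antipode H ` carrier H = carrier H"
    using antipode_bij by (auto simp: bij_betw_def)
  show "antipode_inv x \<in> carrier H" "antipode H (antipode_inv x) = x" "antipode_inv (antipode H x) = x"
    unfolding antipode_inv_def using the_inv_into_into[OF i, of x] f_the_inv_into_f[OF i, of x] the_inv_into_f_f[OF i assms] s assms
    by auto
qed

lemma antipode_inv_eq: "\<lbrakk>y \<in> carrier H; antipode H y = x\<rbrakk> \<Longrightarrow> antipode_inv x = y"
  using antipode_inv(3) by auto

lemma antipode_inv_linear_map: "linear_map H H antipode_inv"
  unfolding linear_map_def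
  by (auto intro!: antipode_inv_eq simp: antipode_inv antipode_add antipode_smult smult_closed)

lemma antipode_inv_mult:
  "\<lbrakk>x \<in> carrier H; y \<in> carrier H\<rbrakk> \<Longrightarrow> antipode_inv (x \<otimes> y) = antipode_inv y \<otimes> antipode_inv x"
  by (rule antipode_inv_eq) (auto simp: antipode_inv antipode_mult)

end

section \<open>The finite dual\<close>

context k_algebra
begin

text \<open>Together with \<open>finite_codimI_forms\<close> this describes finite codimension as
  containing the common kernel of finitely many forms. In that shape it passes to intersections,
  preimages and images by collecting, pulling back and pushing down forms.\<close>

lemma finite_codim_forms:
  assumes U: "k_subspace R U" and fc: "finite_codim R U"
  obtains \<Phi> where "finite \<Phi>" and "\<And>\<phi>. \<phi> \<in> \<Phi> \<Longrightarrow> linear_form R \<phi>"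
    and "\<And>\<phi> u. \<lbrakk>\<phi> \<in> \<Phi>; u \<in> U\<rbrakk> \<Longrightarrow> \<phi> u = 0"
    and "\<And>x. \<lbrakk>x \<in> carrier R; \<And>\<phi>. \<phi> \<in> \<Phi> \<Longrightarrow> \<phi> x = 0\<rbrakk> \<Longrightarrow> x \<in> U"
proof -
  obtain F where F: "finite F" "F \<subseteq> carrier R" "\<forall>x\<in>carrier R. \<exists>s\<in>k_span R F. \<exists>u\<in>U. x = s \<oplus> u"
    using fc unfolding finite_codim_def by (elim exE conjE) rule
  from dual_basis_mod_subspace[OF F(1,2) U F(3)] obtain n :: nat and e \<phi> where
    A: "\<forall>i<n. e i \<in> carrier R \<and> linear_form R (\<phi> i) \<and> (\<forall>u\<in>U. \<phi> i u = 0)"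
    and C: "\<forall>f. linear_form R f \<longrightarrow> (\<forall>u\<in>U. f u = 0) \<longrightarrow>
        (\<forall>x\<in>carrier R. f x = (\<Sum>i<n. \<phi> i x * f (e i)))"
    by (elim exE conjE) rule
  show thesis
  proof (rule that[of "\<phi> ` {..<n}"])
    show "finite (\<phi> ` {..<n})" by simp
    show "linear_form R \<psi>" if "\<psi> \<in> \<phi> ` {..<n}" for \<psi> using A that by auto
    show "\<psi> u = 0" if "\<psi> \<in> \<phi> ` {..<n}" "u \<in> U" for \<psi> u using A that by auto
    fix x assume x: "x \<in> carrier R" and "\<And>\<psi>. \<psi> \<in> \<phi> ` {..<n} \<Longrightarrow> \<psi> x = 0"
    then have x0: "\<phi> i x = 0" if "i < n" for i using that by simp
    show "x \<in> U"
    proof (rule ccontr)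
      assume "x \<notin> U"
      then obtain \<psi> where \<psi>: "linear_form R \<psi>" "\<psi> x = 1" "\<And>u. u \<in> U \<Longrightarrow> \<psi> u = 0"
        by (rule separating_form_mod[OF U x]) blast
      have "\<psi> x = (\<Sum>i<n. \<phi> i x * \<psi> (e i))"
        using C[rule_format, OF \<psi>(1) _ x] \<psi>(3) by blast
      then show False using x0 \<psi>(2) by simp
    qed
  qed
qed

lemma finite_codimI_forms:
  assumes "finite \<Phi>" "\<And>\<phi>. \<phi> \<in> \<Phi> \<Longrightarrow> linear_form R \<phi>"
    and "\<And>x. \<lbrakk>x \<in> carrier R; \<And>\<phi>. \<phi> \<in> \<Phi> \<Longrightarrow> \<phi> x = 0\<rbrakk> \<Longrightarrow> x \<in> U"
  shows "finite_codim R U"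
  by (rule finite_codim_mono[OF finite_codim_common_kernel[OF assms(1,2)]]) (auto intro: assms(3))

lemma finite_codim_inter:
  assumes U: "k_subspace R U" "finite_codim R U" and W: "k_subspace R W" "finite_codim R W"
  shows "finite_codim R (U \<inter> W)"
proof -
  obtain \<Phi> where \<Phi>: "finite \<Phi>" "\<And>\<phi>. \<phi> \<in> \<Phi> \<Longrightarrow> linear_form R \<phi>"
    "\<And>x. \<lbrakk>x \<in> carrier R; \<And>\<phi>. \<phi> \<in> \<Phi> \<Longrightarrow> \<phi> x = 0\<rbrakk> \<Longrightarrow> x \<in> U"
    by (rule finite_codim_forms[OF U]) blast
  obtain \<Psi> where \<Psi>: "finite \<Psi>" "\<And>\<phi>. \<phi> \<in> \<Psi> \<Longrightarrow> linear_form R \<phi>"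
    "\<And>x. \<lbrakk>x \<in> carrier R; \<And>\<phi>. \<phi> \<in> \<Psi> \<Longrightarrow> \<phi> x = 0\<rbrakk> \<Longrightarrow> x \<in> W"
    by (rule finite_codim_forms[OF W]) blast
  show ?thesis
    by (rule finite_codimI_forms[of "\<Phi> \<union> \<Psi>"]) (use \<Phi> \<Psi> in auto)
qed

lemma finite_codim_vimage:
  assumes f: "linear_map R W f" and W: "k_algebra W" and U: "k_subspace W U" "finite_codim W U"
  shows "finite_codim R {x \<in> carrier R. f x \<in> U}"
proof -
  obtain \<Phi> where \<Phi>: "finite \<Phi>" "\<And>\<phi>. \<phi> \<in> \<Phi> \<Longrightarrow> linear_form W \<phi>"
    "\<And>x. \<lbrakk>x \<in> carrier W; \<And>\<phi>. \<phi> \<in> \<Phi> \<Longrightarrow> \<phi> x = 0\<rbrakk> \<Longrightarrow> x \<in> U"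
    by (rule k_algebra.finite_codim_forms[OF W U]) blast
  show ?thesis
  proof (rule finite_codimI_forms[of "(\<lambda>\<phi> x. \<phi> (f x)) ` \<Phi>"])
    show "finite ((\<lambda>\<phi> x. \<phi> (f x)) ` \<Phi>)" using \<Phi>(1) by simp
    show "linear_form R \<psi>" if "\<psi> \<in> (\<lambda>\<phi> x. \<phi> (f x)) ` \<Phi>" for \<psi>
      using that linear_form_comp[OF f \<Phi>(2)] by auto
    fix x assume x: "x \<in> carrier R" and 0: "\<And>\<psi>. \<psi> \<in> (\<lambda>\<phi> x. \<phi> (f x)) ` \<Phi> \<Longrightarrow> \<psi> x = 0"
    have "f x \<in> U"
      by (rule \<Phi>(3)) (use linear_mapD(1)[OF f x] 0 in auto)
    then show "x \<in> {x \<in> carrier R. f x \<in> U}" using x by simp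
  qed
qed

lemma zero_ext_carrier [simp]: "x \<in> carrier R \<Longrightarrow> zero_ext (carrier R) f x = f x"
  by (simp add: zero_ext_def)

lemma linear_form_zero_ext: "linear_form R f \<Longrightarrow> linear_form R (zero_ext (carrier R) f)"
  by (subst linear_form_cong[of _ f]) auto

end

lemma zero_ext_outside [simp]: "x \<notin> S \<Longrightarrow> zero_ext S f x = 0"
  by (simp add: zero_ext_def)

lemma fin_dualI:
  assumes "linear_form R f" "\<And>x. x \<notin> carrier R \<Longrightarrow> f x = 0"
    and "ideal I R" "finite_codim R I" "\<And>x. x \<in> I \<Longrightarrow> f x = 0"
  shows "f \<in> fin_dual_carrier R"
  unfolding fin_dual_carrier_def using assms by (intro CollectI conjI exI[of _ I]) auto

lemma fin_dualD:
  assumes "f \<in> fin_dual_carrier R"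
  shows "linear_form R f" "x \<notin> carrier R \<Longrightarrow> f x = 0"
  using assms by (auto simp: fin_dual_carrier_def)

lemma fin_dualE:
  assumes "f \<in> fin_dual_carrier R"
  obtains I where "ideal I R" "finite_codim R I" "\<And>x. x \<in> I \<Longrightarrow> f x = 0"
  using assms unfolding fin_dual_carrier_def by (elim CollectE conjE exE) (rule that, assumption+, simp)

text \<open>The matrix entries of a representation, which need not be unital.\<close>

definition coeff_system ::
  "('k::field, 'a, 'm) module_scheme \<Rightarrow> 'i set \<Rightarrow> ('i \<Rightarrow> 'i \<Rightarrow> 'a \<Rightarrow> 'k) \<Rightarrow> bool" where
  "coeff_system R N \<rho> \<longleftrightarrow> finite N \<and> (\<forall>i\<in>N. \<forall>j\<in>N. linear_form R (\<rho> i j) \<and>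
     (\<forall>x. x \<notin> carrier R \<longrightarrow> \<rho> i j x = 0) \<and>
     (\<forall>x\<in>carrier R. \<forall>y\<in>carrier R. \<rho> i j (x \<otimes>\<^bsub>R\<^esub> y) = (\<Sum>k\<in>N. \<rho> i k x * \<rho> k j y)))"

lemma coeff_systemD:
  assumes "coeff_system R N \<rho>"
  shows "finite N" and "\<lbrakk>i \<in> N; j \<in> N\<rbrakk> \<Longrightarrow> linear_form R (\<rho> i j)"
    and "\<lbrakk>i \<in> N; j \<in> N; x \<notin> carrier R\<rbrakk> \<Longrightarrow> \<rho> i j x = 0"
    and "\<lbrakk>i \<in> N; j \<in> N; x \<in> carrier R; y \<in> carrier R\<rbrakk> \<Longrightarrow> \<rho> i j (x \<otimes>\<^bsub>R\<^esub> y) = (\<Sum>k\<in>N. \<rho> i k x * \<rho> k j y)"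
  using assms by (auto simp: coeff_system_def)

context k_algebra
begin

text \<open>By the product formula the elements killed by all entries form a two-sided ideal, and
  finitely many forms cut out a subspace of finite codimension.\<close>

lemma coeff_system_in_fin_dual:
  assumes \<rho>: "coeff_system R N \<rho>" and ij: "i \<in> N" "j \<in> N"
  shows "\<rho> i j \<in> fin_dual_carrier R"
proof -
  note D = coeff_systemD[OF \<rho>]
  let ?I = "{x \<in> carrier R. \<forall>i\<in>N. \<forall>j\<in>N. \<rho> i j x = 0}"
  have "ideal ?I R"
  proof (rule idealI[OF ring_axioms])
    show "subgroup ?I (add_monoid R)"
    proof (rule add.subgroupI)
      show "?I \<noteq> {}" using D(2) linear_form_at_zero by (auto intro!: exI[of _ \<zero>])
      show "\<ominus> x \<in> ?I" if "x \<in> ?I" for x using that D(2) by (auto simp: linear_form_uminus)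
      show "x \<oplus> y \<in> ?I" if "x \<in> ?I" "y \<in> ?I" for x y using that D(2) by (auto simp: linear_form_add)
    qed auto
    show "x \<otimes> a \<in> ?I" "a \<otimes> x \<in> ?I" if "a \<in> ?I" "x \<in> carrier R" for a x
      using that by (auto simp: D(4))
  qed
  moreover have "finite_codim R ?I"
    by (rule finite_codimI_forms[of "(\<lambda>(i, j). \<rho> i j) ` (N \<times> N)"]) (use D(1,2) in auto)
  ultimately show ?thesis
    using D(2,3) ij by (intro fin_dualI) auto
qed

text \<open>The regular representation on R/I: in a dual basis e, \<phi> modulo I its entries are
  \<phi>_i(x e_j). That they vanish on I is recorded so that a functional killing a larger ideal
  gets entries with the same property.\<close>

lemma fin_dual_coeffs:
  assumes f: "linear_form R f" "\<And>x. x \<notin> carrier R \<Longrightarrow> f x = 0"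
    and I: "ideal I R" "finite_codim R I" "\<And>x. x \<in> I \<Longrightarrow> f x = 0"
  obtains n :: nat and \<rho> c where "coeff_system R {..<n} \<rho>"
    and "\<And>i j x. \<lbrakk>i < n; j < n; x \<in> I\<rbrakk> \<Longrightarrow> \<rho> i j x = 0"
    and "\<And>x. f x = (\<Sum>(i, j)\<in>{..<n} \<times> {..<n}. c i j * \<rho> i j x)"
proof -
  interpret I: ideal I R by fact
  have U: "k_subspace R I" by (rule ideal_imp_subspace[OF I(1)])
  obtain F where F: "finite F" "F \<subseteq> carrier R" "\<forall>x\<in>carrier R. \<exists>s\<in>k_span R F. \<exists>u\<in>I. x = s \<oplus> u"
    using I(2) unfolding finite_codim_def by (elim exE conjE) rule
  from dual_basis_mod_subspace[OF F(1,2) U F(3)] obtain n :: nat and e \<phi> where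
    A: "\<forall>i<n. e i \<in> carrier R \<and> linear_form R (\<phi> i) \<and> (\<forall>u\<in>I. \<phi> i u = 0)"
    and C: "\<forall>f. linear_form R f \<longrightarrow> (\<forall>u\<in>I. f u = 0) \<longrightarrow>
        (\<forall>x\<in>carrier R. f x = (\<Sum>i<n. \<phi> i x * f (e i)))"
    by (elim exE conjE) rule
  have e: "e i \<in> carrier R" and \<phi>: "linear_form R (\<phi> i)" and van: "\<And>u. u \<in> I \<Longrightarrow> \<phi> i u = 0" if "i < n" for i
    using A that by auto
  have rep: "g x = (\<Sum>i<n. \<phi> i x * g (e i))"
    if "linear_form R g" "\<And>u. u \<in> I \<Longrightarrow> g u = 0" "x \<in> carrier R" for g x
    using C[rule_format, OF that(1) _ that(3)] that(2) by blast
  define \<rho> where "\<rho> i j = zero_ext (carrier R) (\<lambda>x. \<phi> i (x \<otimes> e j))" for i j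
  show thesis
  \<comment> \<open>From f(x) = \<Sum> f(e_i) \<phi>_i(x \<one>), where the class of \<one> has the
    coordinates \<phi>_j(\<one>).\<close>
  proof (rule that[of n \<rho> "\<lambda>i j. f (e i) * \<phi> j \<one>"])
    show "coeff_system R {..<n} \<rho>"
      unfolding coeff_system_def
    proof (intro conjI ballI allI impI)
      fix i j assume "i \<in> {..<n}" "j \<in> {..<n}"
      then have i: "i < n" and j: "j < n" by auto
      show "linear_form R (\<rho> i j)" unfolding \<rho>_def
        by (rule linear_form_zero_ext[OF linear_form_mult_right[OF \<phi>[OF i] e[OF j]]])
      show "\<rho> i j x = 0" if "x \<notin> carrier R" for x using that by (simp add: \<rho>_def)
      fix x y assume x: "x \<in> carrier R" and y: "y \<in> carrier R"
      have "\<phi> i (x \<otimes> (y \<otimes> e j)) = (\<Sum>k<n. \<phi> k (y \<otimes> e j) * \<phi> i (x \<otimes> e k))"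
        by (rule rep[OF linear_form_mult_left[OF \<phi>[OF i] x]]) (use van[OF i] I.I_l_closed x y e[OF j] in auto)
      then show "\<rho> i j (x \<otimes> y) = (\<Sum>k\<in>{..<n}. \<rho> i k x * \<rho> k j y)"
        using x y e[OF j] by (simp add: \<rho>_def m_assoc mult.commute)
    qed simp
    show "\<rho> i j x = 0" if "i < n" "j < n" "x \<in> I" for i j x
      using that I.Icarr[OF that(3)] van[OF that(1)] I.I_r_closed[OF that(3) e[OF that(2)]] by (simp add: \<rho>_def)
    fix x
    show "f x = (\<Sum>(i, j)\<in>{..<n} \<times> {..<n}. f (e i) * \<phi> j \<one> * \<rho> i j x)"
    proof (cases "x \<in> carrier R")
      case True
      have "\<phi> i x = (\<Sum>j<n. \<phi> j \<one> * \<rho> i j x)" if "i < n" for i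
      proof -
        have "\<phi> i (x \<otimes> \<one>) = (\<Sum>j<n. \<phi> j \<one> * \<phi> i (x \<otimes> e j))"
          by (rule rep[OF linear_form_mult_left[OF \<phi>[OF that] True]]) (use van[OF that] I.I_l_closed True in auto)
        then show ?thesis using True by (simp add: \<rho>_def)
      qed
      then have "f x = (\<Sum>i<n. (\<Sum>j<n. \<phi> j \<one> * \<rho> i j x) * f (e i))"
        using rep[OF f(1) I(3) True] by simp
      then show ?thesis
        by (simp add: sum.cartesian_product[symmetric] sum_distrib_left sum_distrib_right mult_ac)
    next
      case False
      then show ?thesis by (simp add: f(2) \<rho>_def)
    qed
  qed
qed

lemma fin_dual_plus:
  assumes f: "f \<in> fin_dual_carrier R" and g: "g \<in> fin_dual_carrier R"
  shows "(\<lambda>x. f x + g x) \<in> fin_dual_carrier R"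
proof -
  obtain I where I: "ideal I R" "finite_codim R I" "\<And>x. x \<in> I \<Longrightarrow> f x = 0" by (rule fin_dualE[OF f]) blast
  obtain J where J: "ideal J R" "finite_codim R J" "\<And>x. x \<in> J \<Longrightarrow> g x = 0" by (rule fin_dualE[OF g]) blast
  show ?thesis
  proof (rule fin_dualI)
    show "ideal (I \<inter> J) R" by (rule i_intersect[OF I(1) J(1)])
    show "finite_codim R (I \<inter> J)"
      by (rule finite_codim_inter) (use I J ideal_imp_subspace in auto)
  qed (use I J fin_dualD[OF f] fin_dualD[OF g] in \<open>auto intro: linear_form_plus\<close>)
qed

lemma fin_dual_times:
  assumes f: "f \<in> fin_dual_carrier R"
  shows "(\<lambda>x. c * f x) \<in> fin_dual_carrier R"
proof -
  obtain I where I: "ideal I R" "finite_codim R I" "\<And>x. x \<in> I \<Longrightarrow> f x = 0" by (rule fin_dualE[OF f]) blast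
  show ?thesis
    by (rule fin_dualI[OF _ _ I(1,2)]) (use I fin_dualD[OF f] in \<open>auto intro: linear_form_times\<close>)
qed

lemma fin_dual_zero: "(\<lambda>x. 0) \<in> fin_dual_carrier R"
proof (rule fin_dualI[OF linear_form_zero _ oneideal])
  show "finite_codim R (carrier R)"
    by (rule finite_codimI_forms[of "{}"]) auto
qed auto

lemma fin_dual_sum:
  assumes "finite N" "\<And>i. i \<in> N \<Longrightarrow> f i \<in> fin_dual_carrier R"
  shows "(\<lambda>x. \<Sum>i\<in>N. f i x) \<in> fin_dual_carrier R"
  using assms by (induction N rule: finite_induct) (auto intro: fin_dual_zero fin_dual_plus)

text \<open>An algebra map is a representation of dimension one, with index set
  \<open>{()}\<close>.\<close>

lemma algebra_maps_fin_dual: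
  assumes "\<kappa> \<in> algebra_maps R" shows "\<kappa> \<in> fin_dual_carrier R"
proof -
  have "coeff_system R {()} (\<lambda>_ _. \<kappa>)"
    using assms by (auto simp: coeff_system_def algebra_maps_def)
  then show ?thesis using coeff_system_in_fin_dual by fastforce
qed

end

section \<open>Convolution of functionals\<close>

definition conv :: "('k::field, 'a, 'm) hopf_scheme \<Rightarrow> ('a \<Rightarrow> 'k) \<Rightarrow> ('a \<Rightarrow> 'k) \<Rightarrow> 'a \<Rightarrow> 'k" where
  "conv H f g = zero_ext (carrier H) (\<lambda>x. comult H x (\<lambda>u v. f u * g v))"

context hopf_algebra
begin

lemma conv_apply: "x \<in> carrier H \<Longrightarrow> conv H f g x = comult H x (\<lambda>u v. f u * g v)"
  by (simp add: conv_def)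

lemma linear_form_conv: "linear_form H (conv H f g)"
  unfolding conv_def by (rule linear_form_zero_ext[OF linear_form_comult])

lemma conv_assoc:
  assumes "linear_form H f" "linear_form H g" "linear_form H h"
  shows "conv H (conv H f g) h = conv H f (conv H g h)"
proof
  fix x
  show "conv H (conv H f g) h x = conv H f (conv H g h) x"
  proof (cases "x \<in> carrier H")
    case True
    have tri: "trilinear_form H (\<lambda>p q r. f p * g q * h r)"
      by (intro trilinear_formI linear_form_times linear_form_times_right assms)
    have "conv H (conv H f g) h x = comult H x (\<lambda>u v. comult H u (\<lambda>p q. f p * g q * h v))"
      unfolding conv_apply[OF True]
    proof (rule comult_cong[OF True])
      fix u v assume u: "u \<in> carrier H" and v: "v \<in> carrier H"
      show "conv H f g u * h v = comult H u (\<lambda>p q. f p * g q * h v)"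
        using tensor_times[OF comult_closed[OF u] bilinear_form_product[OF assms(1,2)], of "h v"]
        by (simp add: conv_apply u mult_ac)
    qed
    also have "\<dots> = comult H x (\<lambda>u v. comult H v (\<lambda>p q. f u * g p * h q))"
      by (rule coassoc_form[OF True tri])
    also have "\<dots> = conv H f (conv H g h) x"
      unfolding conv_apply[OF True]
    proof (rule comult_cong[OF True])
      fix u v assume u: "u \<in> carrier H" and v: "v \<in> carrier H"
      show "comult H v (\<lambda>p q. f u * g p * h q) = f u * conv H g h v"
        using tensor_times[OF comult_closed[OF v] bilinear_form_product[OF assms(2,3)], of "f u"]
        by (simp add: conv_apply v mult_ac)
    qed
    finally show ?thesis .
  qed (simp add: conv_def)
qed

lemma conv_counit:
  assumes "linear_form H f" "\<And>x. x \<notin> carrier H \<Longrightarrow> f x = 0"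
  shows "conv H (zero_ext (carrier H) (counit H)) f = f" "conv H f (zero_ext (carrier H) (counit H)) = f"
proof -
  have "conv H (zero_ext (carrier H) (counit H)) f x = f x" for x
  proof (cases "x \<in> carrier H")
    case True
    have "conv H (zero_ext (carrier H) (counit H)) f x = comult H x (\<lambda>u v. counit H u * f v)"
      unfolding conv_apply[OF True] by (rule comult_cong[OF True]) simp
    then show ?thesis using counit_left_form[OF True assms(1)] by simp
  qed (simp add: conv_def assms)
  moreover have "conv H f (zero_ext (carrier H) (counit H)) x = f x" for x
  proof (cases "x \<in> carrier H")
    case True
    have "conv H f (zero_ext (carrier H) (counit H)) x = comult H x (\<lambda>u v. counit H v * f u)"
      unfolding conv_apply[OF True] by (rule comult_cong[OF True]) simp
    then show ?thesis using counit_right_form[OF True assms(1)] by simp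
  qed (simp add: conv_def assms)
  ultimately show "conv H (zero_ext (carrier H) (counit H)) f = f" "conv H f (zero_ext (carrier H) (counit H)) = f"
    by auto
qed

lemma conv_plus:
  assumes "linear_form H f" "linear_form H g" "linear_form H h"
  shows "conv H (\<lambda>x. f x + g x) h = (\<lambda>x. conv H f h x + conv H g h x)"
    "conv H h (\<lambda>x. f x + g x) = (\<lambda>x. conv H h f x + conv H h g x)"
  unfolding conv_def zero_ext_def
  using tensor_plus[OF comult_closed bilinear_form_product[OF assms(1,3)] bilinear_form_product[OF assms(2,3)]]
    tensor_plus[OF comult_closed bilinear_form_product[OF assms(3,1)] bilinear_form_product[OF assms(3,2)]]
  by (auto simp: algebra_simps)

lemma conv_times:
  assumes "linear_form H f" "linear_form H g"
  shows "conv H (\<lambda>x. c * f x) g = (\<lambda>x. c * conv H f g x)"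
    "conv H f (\<lambda>x. c * g x) = (\<lambda>x. c * conv H f g x)"
  unfolding conv_def zero_ext_def
  using tensor_times[OF comult_closed bilinear_form_product[OF assms], of _ c]
  by (auto simp: algebra_simps)

lemma conv_sum:
  assumes "finite N" "\<And>i. i \<in> N \<Longrightarrow> linear_form H (f i)" "linear_form H g"
  shows "conv H (\<lambda>x. \<Sum>i\<in>N. f i x) g = (\<lambda>x. \<Sum>i\<in>N. conv H (f i) g x)"
    "conv H g (\<lambda>x. \<Sum>i\<in>N. f i x) = (\<lambda>x. \<Sum>i\<in>N. conv H g (f i) x)"
proof -
  have "conv H (\<lambda>x. 0) g = (\<lambda>x. 0)" "conv H g (\<lambda>x. 0) = (\<lambda>x. 0)"
    using conv_times[OF linear_form_zero assms(3), of 0] conv_times[OF assms(3) linear_form_zero, of 0] by auto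
  note zero = this
  have "conv H (\<lambda>x. \<Sum>i\<in>N. f i x) g = (\<lambda>x. \<Sum>i\<in>N. conv H (f i) g x) \<and>
    conv H g (\<lambda>x. \<Sum>i\<in>N. f i x) = (\<lambda>x. \<Sum>i\<in>N. conv H g (f i) x)"
    using assms(1,2)
    by (induction N rule: finite_induct) (auto simp: zero conv_plus linear_form_sum assms(3))
  then show "conv H (\<lambda>x. \<Sum>i\<in>N. f i x) g = (\<lambda>x. \<Sum>i\<in>N. conv H (f i) g x)"
    "conv H g (\<lambda>x. \<Sum>i\<in>N. f i x) = (\<lambda>x. \<Sum>i\<in>N. conv H g (f i) x)" by auto
qed

text \<open>The entries of a tensor product of two representations are the convolutions of their
  entries. So f and g, written through entries, multiply to a combination of entries of a system
  indexed by pairs.\<close>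

lemma conv_fin_dual:
  assumes f: "f \<in> fin_dual_carrier H" and g: "g \<in> fin_dual_carrier H"
  shows "conv H f g \<in> fin_dual_carrier H"
proof -
  obtain I where I: "ideal I H" "finite_codim H I" "\<And>x. x \<in> I \<Longrightarrow> f x = 0" by (rule fin_dualE[OF f]) blast
  obtain J where J: "ideal J H" "finite_codim H J" "\<And>x. x \<in> J \<Longrightarrow> g x = 0" by (rule fin_dualE[OF g]) blast
  obtain n :: nat and \<rho> c where \<rho>: "coeff_system H {..<n} \<rho>"
    and fe: "\<And>x. f x = (\<Sum>(i, j)\<in>{..<n} \<times> {..<n}. c i j * \<rho> i j x)"
    by (rule fin_dual_coeffs[OF fin_dualD[OF f] I]) blast+
  obtain m :: nat and \<sigma> d where \<sigma>: "coeff_system H {..<m} \<sigma>"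
    and ge: "\<And>x. g x = (\<Sum>(i, j)\<in>{..<m} \<times> {..<m}. d i j * \<sigma> i j x)"
    by (rule fin_dual_coeffs[OF fin_dualD[OF g] J]) blast+
  define \<tau> where "\<tau> p q = conv H (\<rho> (fst p) (fst q)) (\<sigma> (snd p) (snd q))" for p q
  let ?N = "{..<n} \<times> {..<m}"
  note R = coeff_systemD[OF \<rho>] and S = coeff_systemD[OF \<sigma>]
  have "coeff_system H ?N \<tau>"
    unfolding coeff_system_def
  proof (intro conjI ballI allI impI)
    show "finite ?N" by simp
    fix p q assume pq: "p \<in> ?N" "q \<in> ?N"
    obtain i k where p: "p = (i, k)" "i < n" "k < m" using pq by auto
    obtain j l where q: "q = (j, l)" "j < n" "l < m" using pq by auto
    show "linear_form H (\<tau> p q)" unfolding \<tau>_def by (rule linear_form_conv)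
    show "\<tau> p q x = 0" if "x \<notin> carrier H" for x using that by (simp add: \<tau>_def conv_def)
    fix x y assume x: "x \<in> carrier H" and y: "y \<in> carrier H"
    obtain xs where xs: "set xs \<subseteq> carrier H \<times> carrier H" "comult H x = tensor_sum H H xs"
      by (rule comultE[OF x])
    obtain ys where ys: "set ys \<subseteq> carrier H \<times> carrier H" "comult H y = tensor_sum H H ys"
      by (rule comultE[OF y])
    have cx: "conv H (\<rho> i a) (\<sigma> k b) x = (\<Sum>(u, v)\<leftarrow>xs. \<rho> i a u * \<sigma> k b v)" if "a < n" "b < m" for a b
      unfolding conv_apply[OF x] xs(2)
      by (rule tensor_sum_apply[OF bilinear_form_product]) (use R S p that in auto)
    have cy: "conv H (\<rho> a j) (\<sigma> b l) y = (\<Sum>(u, v)\<leftarrow>ys. \<rho> a j u * \<sigma> b l v)" if "a < n" "b < m" for a b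
      unfolding conv_apply[OF y] ys(2)
      by (rule tensor_sum_apply[OF bilinear_form_product]) (use R S q that in auto)
    have bil: "bilinear_form H H (\<lambda>u v. \<rho> i j u * \<sigma> k l v)"
      by (rule bilinear_form_product) (use R S p q in auto)
    have xy: "x \<otimes> y \<in> carrier H" using x y by simp
    have sub: "set [(u \<otimes> u', v \<otimes> v'). (u, v) \<leftarrow> xs, (u', v') \<leftarrow> ys] \<subseteq> carrier H \<times> carrier H"
      using xs(1) ys(1) by fastforce
    have "\<tau> p q (x \<otimes> y) = (\<Sum>(u, v)\<leftarrow>[(u \<otimes> u', v \<otimes> v'). (u, v) \<leftarrow> xs, (u', v') \<leftarrow> ys]. \<rho> i j u * \<sigma> k l v)"
      using bil by (simp add: \<tau>_def p q conv_apply[OF xy] comult_mult[OF x y] xs(2) ys(2)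
        tensor_mult_tensor_sum[OF xs(1) ys(1)] tensor_sum_apply)
    also have "\<dots> = (\<Sum>(u, v)\<leftarrow>xs. \<Sum>(u', v')\<leftarrow>ys. \<rho> i j (u \<otimes> u') * \<sigma> k l (v \<otimes> v'))"
      by (rule sum_list_pair_comprehension)
    also have "\<dots> = (\<Sum>(u, v)\<leftarrow>xs. \<Sum>(u', v')\<leftarrow>ys. \<Sum>r\<in>?N. (\<rho> i (fst r) u * \<sigma> k (snd r) v) * (\<rho> (fst r) j u' * \<sigma> (snd r) l v'))"
    proof (intro sum_list_pair_cong)
      fix u v u' v' assume "(u, v) \<in> set xs" "(u', v') \<in> set ys"
      then have "u \<in> carrier H" "v \<in> carrier H" "u' \<in> carrier H" "v' \<in> carrier H" using xs ys by auto
      then show "\<rho> i j (u \<otimes> u') * \<sigma> k l (v \<otimes> v') = (\<Sum>r\<in>?N. (\<rho> i (fst r) u * \<sigma> k (snd r) v) * (\<rho> (fst r) j u' * \<sigma> (snd r) l v'))"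
        using p q by (simp add: R(4) S(4) sum_product sum.cartesian_product case_prod_unfold mult_ac)
    qed
    also have "\<dots> = (\<Sum>r\<in>?N. \<Sum>(u, v)\<leftarrow>xs. \<Sum>(u', v')\<leftarrow>ys. (\<rho> i (fst r) u * \<sigma> k (snd r) v) * (\<rho> (fst r) j u' * \<sigma> (snd r) l v'))"
      by (simp only: sum_list_sum_swap)
    also have "\<dots> = (\<Sum>r\<in>?N. conv H (\<rho> i (fst r)) (\<sigma> k (snd r)) x * conv H (\<rho> (fst r) j) (\<sigma> (snd r) l) y)"
      by (rule sum.cong) (auto simp: cx cy sum_list_pair_product)
    finally show "\<tau> p q (x \<otimes> y) = (\<Sum>r\<in>?N. \<tau> p r x * \<tau> r q y)"
      by (simp add: \<tau>_def p q case_prod_unfold)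
  qed
  from coeff_system_in_fin_dual[OF this]
  have \<tau>: "conv H (\<rho> i j) (\<sigma> k l) \<in> fin_dual_carrier H" if "i < n" "j < n" "k < m" "l < m" for i j k l
    using that by (force simp: \<tau>_def)
  have "conv H f g = (\<lambda>x. \<Sum>p\<in>{..<n} \<times> {..<n}. c (fst p) (snd p) * (\<Sum>q\<in>{..<m} \<times> {..<m}. d (fst q) (snd q) * conv H (\<rho> (fst p) (snd p)) (\<sigma> (fst q) (snd q)) x))"
  proof -
    have fe': "f = (\<lambda>x. \<Sum>p\<in>{..<n} \<times> {..<n}. c (fst p) (snd p) * \<rho> (fst p) (snd p) x)"
      using fe by (auto simp: case_prod_unfold)
    have ge': "g = (\<lambda>x. \<Sum>p\<in>{..<m} \<times> {..<m}. d (fst p) (snd p) * \<sigma> (fst p) (snd p) x)"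
      using ge by (auto simp: case_prod_unfold)
    have 1: "conv H (\<rho> i j) g = (\<lambda>x. \<Sum>q\<in>{..<m} \<times> {..<m}. d (fst q) (snd q) * conv H (\<rho> i j) (\<sigma> (fst q) (snd q)) x)"
      if "i < n" "j < n" for i j
      unfolding ge' using that R(2) S(2)
      by (subst conv_sum) (auto intro!: linear_form_times sum.cong ext simp: conv_times)
    have "conv H f g = (\<lambda>x. \<Sum>p\<in>{..<n} \<times> {..<n}. c (fst p) (snd p) * conv H (\<rho> (fst p) (snd p)) g x)"
      unfolding fe' using R(2) fin_dualD(1)[OF g]
      by (subst conv_sum) (auto intro!: linear_form_times sum.cong ext simp: conv_times)
    then show ?thesis using 1 by (auto intro!: sum.cong ext)
  qed
  then show ?thesis
    using \<tau> by (auto intro!: fin_dual_sum fin_dual_times)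
qed

lemma counit_fin_dual: "zero_ext (carrier H) (counit H) \<in> fin_dual_carrier H"
proof (rule algebra_maps_fin_dual)
  show "zero_ext (carrier H) (counit H) \<in> algebra_maps H"
    using counit_linear by (simp add: algebra_maps_def linear_form_zero_ext counit_one counit_mult)
qed

text \<open>The preimage of a two-sided ideal under an antimultiplicative linear map is again one. A
  general S covers both the antipode and its inverse.\<close>

lemma antimultiplicative_fin_dual:
  assumes S: "linear_map H H S" "\<And>x y. \<lbrakk>x \<in> carrier H; y \<in> carrier H\<rbrakk> \<Longrightarrow> S (x \<otimes> y) = S y \<otimes> S x"
    and f: "f \<in> fin_dual_carrier H"
  shows "zero_ext (carrier H) (\<lambda>x. f (S x)) \<in> fin_dual_carrier H"
proof -
  obtain I where I: "ideal I H" "finite_codim H I" "\<And>x. x \<in> I \<Longrightarrow> f x = 0" by (rule fin_dualE[OF f]) blast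
  interpret I: ideal I H by fact
  have U: "k_subspace H I" by (rule ideal_imp_subspace[OF I(1)])
  let ?J = "{x \<in> carrier H. S x \<in> I}"
  note Sc = linear_mapD[OF S(1)]
  have S0: "S \<zero> = \<zero>" using Sc(3)[of \<zero> 0] Sc(1)[of \<zero>] by simp
  have "ideal ?J H"
  proof (rule idealI[OF ring_axioms])
    show "subgroup ?J (add_monoid H)"
    proof (rule add.subgroupI)
      show "?J \<noteq> {}" using S0 I.zero_closed by (auto intro!: exI[of _ \<zero>])
      show "\<ominus> x \<in> ?J" if "x \<in> ?J" for x
        using that Sc(3)[of x "- 1"] k_subspaceD(4)[OF U, of "S x" "- 1"] by (simp add: smult_minus_one Sc(1))
      show "x \<oplus> y \<in> ?J" if "x \<in> ?J" "y \<in> ?J" for x y using that by (simp add: Sc(2) I.a_closed)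
    qed auto
    show "x \<otimes> a \<in> ?J" "a \<otimes> x \<in> ?J" if "a \<in> ?J" "x \<in> carrier H" for a x
      using that Sc(1) by (auto simp: S(2) I.I_l_closed I.I_r_closed)
  qed
  moreover have "finite_codim H ?J"
    by (rule finite_codim_vimage[OF S(1) k_algebra_axioms U I(2)])
  ultimately show ?thesis
    using I(3) by (intro fin_dualI[OF linear_form_zero_ext[OF linear_form_comp[OF S(1) fin_dualD(1)[OF f]]]]) auto
qed

end

section \<open>The Hopf structure of the finite dual\<close>

lemma fin_dual_simps [simp]:
  "carrier (fin_dual H) = fin_dual_carrier H"
  "f \<otimes>\<^bsub>fin_dual H\<^esub> g = conv H f g"
  "\<one>\<^bsub>fin_dual H\<^esub> = zero_ext (carrier H) (counit H)"
  "\<zero>\<^bsub>fin_dual H\<^esub> = (\<lambda>x. 0)"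
  "f \<oplus>\<^bsub>fin_dual H\<^esub> g = (\<lambda>x. f x + g x)"
  "c \<odot>\<^bsub>fin_dual H\<^esub> f = (\<lambda>x. c * f x)"
  "counit (fin_dual H) f = f \<one>\<^bsub>H\<^esub>"
  "antipode (fin_dual H) f = zero_ext (carrier H) (\<lambda>x. f (antipode H x))"
  by (simp_all add: fin_dual_def fin_dual_alg_def conv_def module.defs hopf.defs)

lemma function_space_fin_dual: "function_space (fin_dual H)"
  by (simp add: function_space_def fin_dual_def fin_dual_alg_def module.defs hopf.defs)

text \<open>The definition takes tensors over \<open>fin_dual_alg H\<close>; bilinearity sees only
  carrier, addition and scalars, so \<open>fin_dual H\<close> gives the same tensors.\<close>

lemma comult_fin_dual_def:
  "comult (fin_dual H) f = (THE T. T \<in> tensor_space (fin_dual H) (fin_dual H) \<and>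
     (\<forall>x\<in>carrier H. \<forall>y\<in>carrier H. T (\<lambda>g h. g x * h y) = f (x \<otimes>\<^bsub>H\<^esub> y)))"
proof -
  have "tensor_space (fin_dual H) (fin_dual H) = tensor_space (fin_dual_alg H) (fin_dual_alg H)"
    by (simp add: tensor_space_def tensor_sum_def bilinear_form_def linear_form_def
        fin_dual_alg_def)
  then show ?thesis
    by (simp add: fin_dual_def module.defs hopf.defs)
qed

context hopf_algebra
begin

lemma k_algebra_fin_dual: "k_algebra (fin_dual H)"
proof -
  let ?D = "fin_dual H"
  note D = fin_dualD(1)[of _ H]
  have "ring ?D"
  proof (rule ringI)
    show "abelian_group ?D"
    proof (rule abelian_groupI)
      fix f assume "f \<in> carrier ?D"
      then have "(\<lambda>x. - 1 * f x) \<in> fin_dual_carrier H" using fin_dual_times[of f "- 1"] by simp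
      then show "\<exists>g\<in>carrier ?D. g \<oplus>\<^bsub>?D\<^esub> f = \<zero>\<^bsub>?D\<^esub>" by (intro bexI[of _ "\<lambda>x. - 1 * f x"]) auto
    qed (auto simp: fin_dual_plus fin_dual_zero algebra_simps)
    show "Group.monoid ?D"
    proof (rule monoidI)
      fix f g h assume "f \<in> carrier ?D" "g \<in> carrier ?D" "h \<in> carrier ?D"
      then show "f \<otimes>\<^bsub>?D\<^esub> g \<otimes>\<^bsub>?D\<^esub> h = f \<otimes>\<^bsub>?D\<^esub> (g \<otimes>\<^bsub>?D\<^esub> h)" by (simp add: conv_assoc D)
    qed (auto simp: conv_fin_dual counit_fin_dual conv_counit fin_dualD)
  qed (auto simp: conv_plus D)
  then show ?thesis
    by (intro k_algebra.intro k_algebra_axioms.intro) (auto simp: fin_dual_times algebra_simps conv_times D)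
qed

text \<open>Elements of the finite dual vanish off the carrier, so pairs of elements of H suffice as
  test points. This is the uniqueness needed for the definite description of the coproduct.\<close>

lemma fin_dual_tensor_eqI:
  assumes "T \<in> tensor_space (fin_dual H) (fin_dual H)" "T' \<in> tensor_space (fin_dual H) (fin_dual H)"
    and "\<And>x y. \<lbrakk>x \<in> carrier H; y \<in> carrier H\<rbrakk> \<Longrightarrow> T (\<lambda>g h. g x * h y) = T' (\<lambda>g h. g x * h y)"
  shows "T = T'"
  by (rule tensor_eqI_pointwise[OF k_algebra_fin_dual function_space_fin_dual k_algebra_fin_dual
        function_space_fin_dual assms(1,2) _ _ assms(3)]) (auto simp: fin_dualD)

lemma bilinear_form_eval: "bilinear_form (fin_dual H) (fin_dual H) (\<lambda>g h. g x * h y)"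
  by (intro bilinear_form_product linear_form_eval function_space_fin_dual)

lemma comult_fin_dual_eqI:
  assumes "T \<in> tensor_space (fin_dual H) (fin_dual H)"
    and "\<And>x y. \<lbrakk>x \<in> carrier H; y \<in> carrier H\<rbrakk> \<Longrightarrow> T (\<lambda>g h. g x * h y) = f (x \<otimes> y)"
  shows "comult (fin_dual H) f = T"
  unfolding comult_fin_dual_def
proof (rule the_equality)
  fix T' assume T': "T' \<in> tensor_space (fin_dual H) (fin_dual H) \<and>
    (\<forall>x\<in>carrier H. \<forall>y\<in>carrier H. T' (\<lambda>g h. g x * h y) = f (x \<otimes> y))"
  show "T' = T" by (rule fin_dual_tensor_eqI) (use T' assms in auto)
qed (use assms in auto)

text \<open>The product formula for entries dualises to \<Delta> \<rho>_ij = \<Sum> \<rho>_ik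
  \<otimes> \<rho>_kj. The index set M allows for a single entry as well as for a general element of
  the finite dual.\<close>

lemma comult_fin_dual_coeffs:
  assumes \<rho>: "coeff_system H N \<rho>" and M: "finite M" "M \<subseteq> N \<times> N"
    and f: "\<And>x. x \<in> carrier H \<Longrightarrow> f x = (\<Sum>(i, j)\<in>M. c i j * \<rho> i j x)"
  shows "comult (fin_dual H) f =
      (\<lambda>b. \<Sum>(i, j)\<in>M. c i j * (\<Sum>k\<in>N. tensor_sum (fin_dual H) (fin_dual H) [(\<rho> i k, \<rho> k j)] b))"
proof -
  let ?T = "\<lambda>b. \<Sum>(i, j)\<in>M. c i j * (\<Sum>k\<in>N. tensor_sum (fin_dual H) (fin_dual H) [(\<rho> i k, \<rho> k j)] b)"
  note R = coeff_systemD[OF \<rho>]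
  show "comult (fin_dual H) f = ?T"
  proof (rule comult_fin_dual_eqI)
    show "?T \<in> tensor_space (fin_dual H) (fin_dual H)"
      unfolding case_prod_unfold using M R(1)
      by (intro tensor_space_sum tensor_space_times k_algebra_fin_dual tensor_space_elementary)
        (auto intro!: coeff_system_in_fin_dual[OF \<rho>])
    fix x y assume x: "x \<in> carrier H" and y: "y \<in> carrier H"
    have "?T (\<lambda>g h. g x * h y) = (\<Sum>(i, j)\<in>M. c i j * (\<Sum>k\<in>N. \<rho> i k x * \<rho> k j y))"
      by (simp add: tensor_sum_apply bilinear_form_eval)
    also have "\<dots> = (\<Sum>(i, j)\<in>M. c i j * \<rho> i j (x \<otimes> y))"
      using M x y by (intro sum.cong) (auto simp: R(4))
    finally show "?T (\<lambda>g h. g x * h y) = f (x \<otimes> y)" using f x y by simp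
  qed
qed

lemma comult_fin_dual_coeff:
  assumes \<rho>: "coeff_system H N \<rho>" and ij: "i \<in> N" "j \<in> N"
    and b: "bilinear_form (fin_dual H) (fin_dual H) b"
  shows "comult (fin_dual H) (\<rho> i j) b = (\<Sum>k\<in>N. b (\<rho> i k) (\<rho> k j))"
  using comult_fin_dual_coeffs[OF \<rho>, of "{(i, j)}" "\<rho> i j" "\<lambda>_ _. 1"] ij b
  by (simp add: tensor_sum_apply)

lemma fin_dual_coeffsE:
  assumes "f \<in> fin_dual_carrier H"
  obtains n :: nat and \<rho> c where "coeff_system H {..<n} \<rho>"
    and "\<And>x. f x = (\<Sum>(i, j)\<in>{..<n} \<times> {..<n}. c i j * \<rho> i j x)"
proof -
  obtain I where I: "ideal I H" "finite_codim H I" "\<And>x. x \<in> I \<Longrightarrow> f x = 0"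
    by (rule fin_dualE[OF assms]) blast
  show thesis
    by (rule fin_dual_coeffs[OF fin_dualD[OF assms] I]) (blast intro: that)+
qed

text \<open>Existence for the definite description: the formula for matrix entries exhibits a tensor
  with the required values.\<close>

lemma comult_fin_dual:
  assumes "f \<in> fin_dual_carrier H"
  shows "comult (fin_dual H) f \<in> tensor_space (fin_dual H) (fin_dual H)"
    and "\<lbrakk>x \<in> carrier H; y \<in> carrier H\<rbrakk> \<Longrightarrow> comult (fin_dual H) f (\<lambda>g h. g x * h y) = f (x \<otimes> y)"
proof -
  obtain n :: nat and \<rho> c where \<rho>: "coeff_system H {..<n} \<rho>"
    and fe: "\<And>x. f x = (\<Sum>(i, j)\<in>{..<n} \<times> {..<n}. c i j * \<rho> i j x)"
    by (rule fin_dual_coeffsE[OF assms]) blast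
  note R = coeff_systemD[OF \<rho>]
  have eq: "comult (fin_dual H) f = (\<lambda>b. \<Sum>(i, j)\<in>{..<n} \<times> {..<n}. c i j * (\<Sum>k\<in>{..<n}. tensor_sum (fin_dual H) (fin_dual H) [(\<rho> i k, \<rho> k j)] b))"
    by (rule comult_fin_dual_coeffs[OF \<rho>]) (auto simp: fe)
  show "comult (fin_dual H) f \<in> tensor_space (fin_dual H) (fin_dual H)"
    unfolding eq case_prod_unfold
    by (intro tensor_space_sum tensor_space_times k_algebra_fin_dual tensor_space_elementary)
      (auto intro!: coeff_system_in_fin_dual[OF \<rho>])
  assume x: "x \<in> carrier H" and y: "y \<in> carrier H"
  have "comult (fin_dual H) f (\<lambda>g h. g x * h y) = (\<Sum>(i, j)\<in>{..<n} \<times> {..<n}. c i j * (\<Sum>k\<in>{..<n}. \<rho> i k x * \<rho> k j y))"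
    by (simp add: eq tensor_sum_apply bilinear_form_eval)
  also have "\<dots> = f (x \<otimes> y)"
    using x y unfolding fe by (intro sum.cong) (auto simp: R(4))
  finally show "comult (fin_dual H) f (\<lambda>g h. g x * h y) = f (x \<otimes> y)" .
qed

lemma comult_fin_dual_list:
  assumes "f \<in> fin_dual_carrier H" "comult (fin_dual H) f = tensor_sum (fin_dual H) (fin_dual H) fs"
    and "x \<in> carrier H" "y \<in> carrier H"
  shows "(\<Sum>(g, h)\<leftarrow>fs. g x * h y) = f (x \<otimes> y)"
  using comult_fin_dual(2)[OF assms(1,3,4)] by (simp add: assms(2) tensor_sum_apply bilinear_form_eval)

lemma comult_fin_dual_plus:
  assumes f: "f \<in> fin_dual_carrier H" and g: "g \<in> fin_dual_carrier H"
  shows "comult (fin_dual H) (\<lambda>x. f x + g x) = (\<lambda>b. comult (fin_dual H) f b + comult (fin_dual H) g b)"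
  by (rule comult_fin_dual_eqI) (simp_all add: tensor_space_plus comult_fin_dual f g)

lemma comult_fin_dual_times:
  assumes f: "f \<in> fin_dual_carrier H"
  shows "comult (fin_dual H) (\<lambda>x. c * f x) = (\<lambda>b. c * comult (fin_dual H) f b)"
  by (rule comult_fin_dual_eqI) (simp_all add: tensor_space_times[OF k_algebra_fin_dual] comult_fin_dual f)

text \<open>Tested at a pair (x, y), both sides expand to one fourfold sum, taken over the legs of
  f, g, x and y; that the coproduct of x y is the product of the coproducts of x and y is the
  property of H behind it.\<close>

lemma comult_fin_dual_conv:
  assumes f: "f \<in> fin_dual_carrier H" and g: "g \<in> fin_dual_carrier H"
  shows "comult (fin_dual H) (conv H f g) =
    tensor_mult (fin_dual H) (comult (fin_dual H) f) (comult (fin_dual H) g)"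
proof (rule comult_fin_dual_eqI)
  interpret D: k_algebra "fin_dual H" by (rule k_algebra_fin_dual)
  show "tensor_mult (fin_dual H) (comult (fin_dual H) f) (comult (fin_dual H) g) \<in> tensor_space (fin_dual H) (fin_dual H)"
    by (rule D.tensor_mult_in_space[OF comult_fin_dual(1)[OF f] comult_fin_dual(1)[OF g]])
  fix x y assume x: "x \<in> carrier H" and y: "y \<in> carrier H"
  obtain fs where fs: "set fs \<subseteq> carrier (fin_dual H) \<times> carrier (fin_dual H)" "comult (fin_dual H) f = tensor_sum (fin_dual H) (fin_dual H) fs"
    by (rule tensor_spaceE[OF comult_fin_dual(1)[OF f]])
  obtain gs where gs: "set gs \<subseteq> carrier (fin_dual H) \<times> carrier (fin_dual H)" "comult (fin_dual H) g = tensor_sum (fin_dual H) (fin_dual H) gs"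
    by (rule tensor_spaceE[OF comult_fin_dual(1)[OF g]])
  obtain xs where xs: "set xs \<subseteq> carrier H \<times> carrier H" "comult H x = tensor_sum H H xs"
    by (rule comultE[OF x])
  obtain ys where ys: "set ys \<subseteq> carrier H \<times> carrier H" "comult H y = tensor_sum H H ys"
    by (rule comultE[OF y])
  have ev: "conv H h h' x = (\<Sum>(u, v)\<leftarrow>xs. h u * h' v)" "conv H h h' y = (\<Sum>(u, v)\<leftarrow>ys. h u * h' v)"
    if "linear_form H h" "linear_form H h'" for h h'
    using that by (simp_all add: conv_apply x y xs ys tensor_sum_apply bilinear_form_product)
  have bil: "bilinear_form H H (\<lambda>u v. f u * g v)"
    by (rule bilinear_form_product) (use fin_dualD f g in auto)
  have "tensor_mult (fin_dual H) (comult (fin_dual H) f) (comult (fin_dual H) g) (\<lambda>g h. g x * h y) =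
    (\<Sum>(p, q)\<leftarrow>fs. \<Sum>(p', q')\<leftarrow>gs. conv H p p' x * conv H q q' y)"
    unfolding fs(2) gs(2) D.tensor_mult_tensor_sum[OF fs(1) gs(1)] tensor_sum_apply[OF bilinear_form_eval] fin_dual_simps
    by (rule sum_list_pair_comprehension)
  also have "\<dots> = (\<Sum>(p, q)\<leftarrow>fs. \<Sum>(p', q')\<leftarrow>gs. \<Sum>(u, v)\<leftarrow>xs. \<Sum>(u', v')\<leftarrow>ys. (p u * q u') * (p' v * q' v'))"
  proof (intro sum_list_pair_cong)
    fix p q p' q' assume "(p, q) \<in> set fs" "(p', q') \<in> set gs"
    then have "linear_form H p" "linear_form H q" "linear_form H p'" "linear_form H q'"
      using fs(1) gs(1) fin_dualD(1) by auto
    then show "conv H p p' x * conv H q q' y = (\<Sum>(u, v)\<leftarrow>xs. \<Sum>(u', v')\<leftarrow>ys. (p u * q u') * (p' v * q' v'))"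
      by (simp add: ev sum_list_pair_product mult_ac)
  qed
  also have "\<dots> = (\<Sum>(u, v)\<leftarrow>xs. \<Sum>(u', v')\<leftarrow>ys. \<Sum>(p, q)\<leftarrow>fs. \<Sum>(p', q')\<leftarrow>gs. (p u * q u') * (p' v * q' v'))"
    by (rule sum_list_pair_swap4)
  also have "\<dots> = (\<Sum>(u, v)\<leftarrow>xs. \<Sum>(u', v')\<leftarrow>ys. f (u \<otimes> u') * g (v \<otimes> v'))"
  proof (intro sum_list_pair_cong)
    fix u v u' v' assume "(u, v) \<in> set xs" "(u', v') \<in> set ys"
    then have "u \<in> carrier H" "v \<in> carrier H" "u' \<in> carrier H" "v' \<in> carrier H" using xs ys by auto
    then show "(\<Sum>(p, q)\<leftarrow>fs. \<Sum>(p', q')\<leftarrow>gs. (p u * q u') * (p' v * q' v')) = f (u \<otimes> u') * g (v \<otimes> v')"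
      using comult_fin_dual_list[OF f fs(2)] comult_fin_dual_list[OF g gs(2)]
      by (simp add: sum_list_pair_product[symmetric])
  qed
  also have "\<dots> = (\<Sum>(u, v)\<leftarrow>[(u \<otimes> u', v \<otimes> v'). (u, v) \<leftarrow> xs, (u', v') \<leftarrow> ys]. f u * g v)"
    by (rule sum_list_pair_comprehension[symmetric])
  also have "\<dots> = conv H f g (x \<otimes> y)"
    using bil x y by (simp add: conv_apply comult_mult[OF x y] xs(2) ys(2)
        tensor_mult_tensor_sum[OF xs(1) ys(1)] tensor_sum_apply)
  finally show "tensor_mult (fin_dual H) (comult (fin_dual H) f) (comult (fin_dual H) g) (\<lambda>g h. g x * h y) =
    conv H f g (x \<otimes> y)" .
qed

text \<open>In matrix entries both iterated coproducts of \<rho>_ij are \<Sum> \<rho>_il \<otimes>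
  \<rho>_lk \<otimes> \<rho>_kj.\<close>

lemma fin_dual_coassoc:
  assumes f: "f \<in> fin_dual_carrier H"
  shows "comult_left (fin_dual H) (comult (fin_dual H) f) = comult_right (fin_dual H) (comult (fin_dual H) f)"
proof
  fix t
  show "comult_left (fin_dual H) (comult (fin_dual H) f) t = comult_right (fin_dual H) (comult (fin_dual H) f) t"
  proof (cases "trilinear_form (fin_dual H) t")
    case True
    obtain n :: nat and \<rho> c where \<rho>: "coeff_system H {..<n} \<rho>"
      and fe: "\<And>x. f x = (\<Sum>(i, j)\<in>{..<n} \<times> {..<n}. c i j * \<rho> i j x)"
      by (rule fin_dual_coeffsE[OF f]) blast
    note R = coeff_systemD[OF \<rho>]
    have \<rho>d: "\<rho> i j \<in> fin_dual_carrier H" if "i < n" "j < n" for i j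
      using coeff_system_in_fin_dual[OF \<rho>] that by auto
    have eq: "comult (fin_dual H) f b = (\<Sum>(i, j)\<in>{..<n} \<times> {..<n}. c i j * (\<Sum>k\<in>{..<n}. b (\<rho> i k) (\<rho> k j)))"
      if "bilinear_form (fin_dual H) (fin_dual H) b" for b
      by (subst comult_fin_dual_coeffs[OF \<rho>, of "{..<n} \<times> {..<n}" f c]) (auto simp: fe tensor_sum_apply that)
    have lin: "linear_form (fin_dual H) (\<lambda>g. comult (fin_dual H) g b)" for b
      by (rule linear_formI) (simp_all add: comult_fin_dual_plus comult_fin_dual_times)
    have bl: "bilinear_form (fin_dual H) (fin_dual H) (\<lambda>x y. comult (fin_dual H) x (\<lambda>u v. t u v y))"
      by (intro bilinear_formI lin linear_form_tensor[OF comult_fin_dual(1)] k_algebra_fin_dual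
          trilinear_form_bilinear[OF True] trilinear_formD[OF True]) auto
    have br: "bilinear_form (fin_dual H) (fin_dual H) (\<lambda>x y. comult (fin_dual H) y (\<lambda>u v. t x u v))"
      by (intro bilinear_formI lin linear_form_tensor[OF comult_fin_dual(1)] k_algebra_fin_dual
          trilinear_form_bilinear[OF True] trilinear_formD[OF True]) auto
    have "comult_left (fin_dual H) (comult (fin_dual H) f) t =
       (\<Sum>(i, j)\<in>{..<n} \<times> {..<n}. c i j * (\<Sum>k\<in>{..<n}. comult (fin_dual H) (\<rho> i k) (\<lambda>u v. t u v (\<rho> k j))))"
      using True by (simp add: comult_left_def eq[OF bl])
    also have "\<dots> = (\<Sum>(i, j)\<in>{..<n} \<times> {..<n}. c i j * (\<Sum>k\<in>{..<n}. \<Sum>l\<in>{..<n}. t (\<rho> i l) (\<rho> l k) (\<rho> k j)))"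
      by (intro sum.cong refl) (auto intro!: arg_cong[of _ _ "\<lambda>z. _ * z"] sum.cong comult_fin_dual_coeff[OF \<rho>]
          trilinear_form_bilinear[OF True] \<rho>d)
    also have "\<dots> = (\<Sum>(i, j)\<in>{..<n} \<times> {..<n}. c i j * (\<Sum>l\<in>{..<n}. \<Sum>k\<in>{..<n}. t (\<rho> i l) (\<rho> l k) (\<rho> k j)))"
      by (subst sum.swap) (rule refl)
    also have "\<dots> = (\<Sum>(i, j)\<in>{..<n} \<times> {..<n}. c i j * (\<Sum>l\<in>{..<n}. comult (fin_dual H) (\<rho> l j) (\<lambda>u v. t (\<rho> i l) u v)))"
      by (intro sum.cong refl) (auto intro!: arg_cong[of _ _ "\<lambda>z. _ * z"] sum.cong comult_fin_dual_coeff[OF \<rho>, symmetric]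
          trilinear_form_bilinear[OF True] \<rho>d)
    also have "\<dots> = comult_right (fin_dual H) (comult (fin_dual H) f) t"
      using True by (simp add: comult_right_def eq[OF br])
    finally show ?thesis .
  qed (simp add: comult_left_def comult_right_def)
qed

lemma antipode_fin_dual_closed:
  "f \<in> fin_dual_carrier H \<Longrightarrow> zero_ext (carrier H) (\<lambda>x. f (antipode H x)) \<in> fin_dual_carrier H"
  by (rule antimultiplicative_fin_dual[OF antipode_linear_map antipode_mult])

lemma antipode_inv_fin_dual_closed:
  "f \<in> fin_dual_carrier H \<Longrightarrow> zero_ext (carrier H) (\<lambda>x. f (antipode_inv x)) \<in> fin_dual_carrier H"
  by (rule antimultiplicative_fin_dual[OF antipode_inv_linear_map antipode_inv_mult])

lemma antipode_fin_dual_inv: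
  "f \<in> fin_dual_carrier H \<Longrightarrow> antipode (fin_dual H) (zero_ext (carrier H) (\<lambda>x. f (antipode_inv x))) = f"
  by (rule ext) (auto simp: zero_ext_def antipode_closed antipode_inv fin_dualD)

text \<open>The structure is dual to that of H, so evaluation at elements turns each axiom into one
  of H: product and coproduct, unit and counit exchange roles, and the antipode axiom for f is that
  of H tested on the form f.\<close>

theorem fin_dual_hopf_algebra: "hopf_algebra (fin_dual H)"
proof (intro hopf_algebra.intro hopf_algebra_axioms.intro k_algebra_fin_dual)
  let ?D = "fin_dual H"
  interpret D: k_algebra ?D by (rule k_algebra_fin_dual)
  note pw = list_sum_pointwise[OF function_space_fin_dual]
  fix f g c fs
  show "linear_form ?D (counit ?D)" by (rule linear_formI) simp_all
  show "comult ?D \<one>\<^bsub>?D\<^esub> = tensor_sum ?D ?D [(\<one>\<^bsub>?D\<^esub>, \<one>\<^bsub>?D\<^esub>)]"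
    by (rule comult_fin_dual_eqI)
      (auto simp: tensor_space_elementary counit_fin_dual tensor_sum_apply bilinear_form_eval counit_mult)
  show "counit ?D \<one>\<^bsub>?D\<^esub> = 1" by (simp add: counit_one)
  \<comment> \<open>Here the bijectivity of the antipode of H enters: precomposition with its
    inverse inverts the antipode of the dual.\<close>
  show "bij_betw (antipode ?D) (carrier ?D) (carrier ?D)"
  proof (rule bij_betw_byWitness[where f' = "\<lambda>f. zero_ext (carrier H) (\<lambda>x. f (antipode_inv x))"])
    show "\<forall>a\<in>carrier ?D. zero_ext (carrier H) (\<lambda>x. antipode ?D a (antipode_inv x)) = a"
      by (auto simp: zero_ext_def antipode_inv fin_dualD)
    show "\<forall>a\<in>carrier ?D. antipode ?D (zero_ext (carrier H) (\<lambda>x. a (antipode_inv x))) = a"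
      using antipode_fin_dual_inv by simp
  qed (use antipode_fin_dual_closed antipode_inv_fin_dual_closed in auto)
  assume f: "f \<in> carrier ?D"
  then have f': "f \<in> fin_dual_carrier H" by simp
  show "comult ?D f \<in> tensor_space ?D ?D" by (rule comult_fin_dual(1)[OF f'])
  show "comult ?D (c \<odot>\<^bsub>?D\<^esub> f) = (\<lambda>b. c * comult ?D f b)" by (simp add: comult_fin_dual_times f')
  show "comult_left ?D (comult ?D f) = comult_right ?D (comult ?D f)" by (rule fin_dual_coassoc[OF f'])
  show "antipode ?D (c \<odot>\<^bsub>?D\<^esub> f) = c \<odot>\<^bsub>?D\<^esub> antipode ?D f" by (auto simp: zero_ext_def)
  {
    assume g: "g \<in> carrier ?D"
    then show "comult ?D (f \<oplus>\<^bsub>?D\<^esub> g) = (\<lambda>b. comult ?D f b + comult ?D g b)"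
      using f' by (simp add: comult_fin_dual_plus)
    show "comult ?D (f \<otimes>\<^bsub>?D\<^esub> g) = tensor_mult ?D (comult ?D f) (comult ?D g)"
      using f' g by (simp add: comult_fin_dual_conv)
    show "counit ?D (f \<otimes>\<^bsub>?D\<^esub> g) = counit ?D f * counit ?D g"
      using f' g by (simp add: conv_apply comult_one_form bilinear_form_product fin_dualD)
    show "antipode ?D (f \<oplus>\<^bsub>?D\<^esub> g) = antipode ?D f \<oplus>\<^bsub>?D\<^esub> antipode ?D g" by (auto simp: zero_ext_def)
  }
  assume fs: "set fs \<subseteq> carrier ?D \<times> carrier ?D" "comult ?D f = tensor_sum ?D ?D fs"
  note ls = comult_fin_dual_list[OF f' fs(2)]
  \<comment> \<open>The identities of functions must also hold off the carrier, where every summand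
    vanishes.\<close>
  have out: "(\<Sum>(u, v)\<leftarrow>fs. b u v) = 0" if "\<And>u v. (u, v) \<in> set fs \<Longrightarrow> b u v = 0" for b :: "_ \<Rightarrow> _ \<Rightarrow> 'k"
  proof -
    have "(\<Sum>(u, v)\<leftarrow>fs. b u v) = (\<Sum>(u, v)\<leftarrow>fs. 0)" by (rule sum_list_pair_cong[OF that])
    then show ?thesis by (simp add: case_prod_unfold)
  qed
  have u0: "u x = 0" and v0: "v x = 0" if "(u, v) \<in> set fs" "x \<notin> carrier H" for u v x
    using that fs(1) fin_dualD(2)[of _ H] by auto
  have lin: "linear_form H u" "linear_form H v" if "(u, v) \<in> set fs" for u v
    using that fs(1) fin_dualD(1) by auto
  have "list_sum ?D (map (\<lambda>(u, v). counit ?D u \<odot>\<^bsub>?D\<^esub> v) fs) x = f x" for x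
  proof -
    have "list_sum ?D (map (\<lambda>(u, v). counit ?D u \<odot>\<^bsub>?D\<^esub> v) fs) x = (\<Sum>(u, v)\<leftarrow>fs. u \<one> * v x)"
      by (simp add: pw o_def case_prod_unfold)
    also have "\<dots> = f x"
    proof (cases "x \<in> carrier H")
      case False
      then show ?thesis using fin_dualD(2)[OF f'] by (subst out) (auto simp: u0 v0)
    qed (simp add: ls)
    finally show ?thesis .
  qed
  then show "list_sum ?D (map (\<lambda>(u, v). counit ?D u \<odot>\<^bsub>?D\<^esub> v) fs) = f" by auto
  have "list_sum ?D (map (\<lambda>(u, v). counit ?D v \<odot>\<^bsub>?D\<^esub> u) fs) x = f x" for x
  proof -
    have "list_sum ?D (map (\<lambda>(u, v). counit ?D v \<odot>\<^bsub>?D\<^esub> u) fs) x = (\<Sum>(u, v)\<leftarrow>fs. u x * v \<one>)"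
      by (simp add: pw o_def case_prod_unfold mult.commute)
    also have "\<dots> = f x"
    proof (cases "x \<in> carrier H")
      case False
      then show ?thesis using fin_dualD(2)[OF f'] by (subst out) (auto simp: u0 v0)
    qed (simp add: ls)
    finally show ?thesis .
  qed
  then show "list_sum ?D (map (\<lambda>(u, v). counit ?D v \<odot>\<^bsub>?D\<^esub> u) fs) = f" by auto
  have "list_sum ?D (map (\<lambda>(u, v). antipode ?D u \<otimes>\<^bsub>?D\<^esub> v) fs) x = (counit ?D f \<odot>\<^bsub>?D\<^esub> \<one>\<^bsub>?D\<^esub>) x" for x
  proof (cases "x \<in> carrier H")
    case True
    have "list_sum ?D (map (\<lambda>(u, v). antipode ?D u \<otimes>\<^bsub>?D\<^esub> v) fs) x = (\<Sum>(u, v)\<leftarrow>fs. conv H (antipode ?D u) v x)"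
      by (simp add: pw o_def case_prod_unfold)
    also have "\<dots> = (\<Sum>(u, v)\<leftarrow>fs. comult H x (\<lambda>p q. u (antipode H p) * v q))"
      unfolding conv_apply[OF True] by (intro sum_list_pair_cong comult_cong[OF True]) simp
    also have "\<dots> = comult H x (\<lambda>p q. \<Sum>(u, v)\<leftarrow>fs. u (antipode H p) * v q)"
      by (rule comult_sum_list[OF True, symmetric]) (intro bilinear_form_product linear_form_antipode lin)
    also have "\<dots> = comult H x (\<lambda>p q. f (antipode H p \<otimes> q))"
      by (rule comult_cong[OF True]) (simp add: ls antipode_closed)
    also have "\<dots> = counit H x * f \<one>"
      by (rule antipode_left_form[OF True fin_dualD(1)[OF f']])
    finally show ?thesis using True by simp
  next
    case False
    then show ?thesis by (simp add: pw o_def case_prod_unfold conv_def)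
  qed
  then show "list_sum ?D (map (\<lambda>(u, v). antipode ?D u \<otimes>\<^bsub>?D\<^esub> v) fs) = counit ?D f \<odot>\<^bsub>?D\<^esub> \<one>\<^bsub>?D\<^esub>" by auto
  have "list_sum ?D (map (\<lambda>(u, v). u \<otimes>\<^bsub>?D\<^esub> antipode ?D v) fs) x = (counit ?D f \<odot>\<^bsub>?D\<^esub> \<one>\<^bsub>?D\<^esub>) x" for x
  proof (cases "x \<in> carrier H")
    case True
    have "list_sum ?D (map (\<lambda>(u, v). u \<otimes>\<^bsub>?D\<^esub> antipode ?D v) fs) x = (\<Sum>(u, v)\<leftarrow>fs. conv H u (antipode ?D v) x)"
      by (simp add: pw o_def case_prod_unfold)
    also have "\<dots> = (\<Sum>(u, v)\<leftarrow>fs. comult H x (\<lambda>p q. u p * v (antipode H q)))"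
      unfolding conv_apply[OF True] by (intro sum_list_pair_cong comult_cong[OF True]) simp
    also have "\<dots> = comult H x (\<lambda>p q. \<Sum>(u, v)\<leftarrow>fs. u p * v (antipode H q))"
      by (rule comult_sum_list[OF True, symmetric]) (intro bilinear_form_product linear_form_antipode lin)
    also have "\<dots> = comult H x (\<lambda>p q. f (p \<otimes> antipode H q))"
      by (rule comult_cong[OF True]) (simp add: ls antipode_closed)
    also have "\<dots> = counit H x * f \<one>"
      by (rule antipode_right_form[OF True fin_dualD(1)[OF f']])
    finally show ?thesis using True by simp
  next
    case False
    then show ?thesis by (simp add: pw o_def case_prod_unfold conv_def)
  qed
  then show "list_sum ?D (map (\<lambda>(u, v). u \<otimes>\<^bsub>?D\<^esub> antipode ?D v) fs) = counit ?D f \<odot>\<^bsub>?D\<^esub> \<one>\<^bsub>?D\<^esub>" by auto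
qed

end

section \<open>Hopf subalgebras\<close>

lemma sub_hopf_simps [simp]:
  "carrier (sub_hopf H A) = A"
  "x \<otimes>\<^bsub>sub_hopf H A\<^esub> y = x \<otimes>\<^bsub>H\<^esub> y"
  "\<one>\<^bsub>sub_hopf H A\<^esub> = \<one>\<^bsub>H\<^esub>"
  "\<zero>\<^bsub>sub_hopf H A\<^esub> = \<zero>\<^bsub>H\<^esub>"
  "x \<oplus>\<^bsub>sub_hopf H A\<^esub> y = x \<oplus>\<^bsub>H\<^esub> y"
  "c \<odot>\<^bsub>sub_hopf H A\<^esub> x = c \<odot>\<^bsub>H\<^esub> x"
  "counit (sub_hopf H A) x = counit H x"
  "antipode (sub_hopf H A) x = antipode H x"
  "list_sum (sub_hopf H A) = list_sum H"
  by (auto simp: sub_hopf_def list_sum_def)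

text \<open>\<open>hopf_subalgebra\<close> and \<open>sub_hopf\<close> are defined with
  \<open>H\<lparr>carrier := A\<rparr>\<close>, whose coproduct still is that of H. Tensors see only
  the linear structure, so \<open>sub_hopf H A\<close> may take its place.\<close>

lemma tensor_space_sub_hopf:
  "tensor_space (H\<lparr>carrier := A\<rparr>) (H\<lparr>carrier := A\<rparr>) = tensor_space (sub_hopf H A) (sub_hopf H A)"
  by (simp add: tensor_space_def tensor_sum_def bilinear_form_def linear_form_def)

lemma function_space_sub_hopf: "function_space D \<Longrightarrow> function_space (sub_hopf D A)"
  by (auto simp: function_space_def sub_hopf_def)

locale hopf_sub = hopf_algebra H for H :: "('k::field, 'a) hopf" (structure) +
  fixes A :: "'a set"
  assumes sub: "hopf_subalgebra H A"
begin

abbreviation HA where "HA \<equiv> sub_hopf H A"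

lemma sub_subspace: "k_subspace H A"
  using sub by (simp add: hopf_subalgebra_def)

lemma sub_carrier: "a \<in> A \<Longrightarrow> a \<in> carrier H"
  using k_subspaceD(1)[OF sub_subspace] by auto

lemma sub_mult: "\<lbrakk>a \<in> A; b \<in> A\<rbrakk> \<Longrightarrow> a \<otimes> b \<in> A"
  using sub subringE(6) by (auto simp: hopf_subalgebra_def)

lemma sub_one: "\<one> \<in> A"
  using sub subringE(3) by (auto simp: hopf_subalgebra_def)

lemma sub_antipode: "a \<in> A \<Longrightarrow> antipode H a \<in> A"
  using sub by (simp add: hopf_subalgebra_def)

lemma k_algebra_sub: "k_algebra HA"
proof -
  note [simp] = k_subspaceD(2-)[OF sub_subspace] sub_carrier sub_mult sub_one subspace_uminus[OF sub_subspace]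
  have "ring HA"
  proof (rule ringI)
    show "abelian_group HA"
    proof (rule abelian_groupI)
      fix x assume "x \<in> carrier HA"
      then show "\<exists>y\<in>carrier HA. y \<oplus>\<^bsub>HA\<^esub> x = \<zero>\<^bsub>HA\<^esub>"
        by (intro bexI[of _ "\<ominus> x"]) (simp_all add: l_neg)
    qed (simp_all add: a_ac)
    show "Group.monoid HA" by (rule monoidI) (simp_all add: m_assoc)
  qed (simp_all add: l_distr r_distr)
  then show ?thesis
    by (intro k_algebra.intro k_algebra_axioms.intro)
      (simp_all add: smult_l_distr smult_r_distr smult_assoc smult_one smult_mult_left smult_mult_right)
qed

lemma linear_map_incl: "linear_map HA H (\<lambda>x. x)"
  by (simp add: linear_map_def sub_carrier)

lemma bilinear_form_restrict: "bilinear_form H H b \<Longrightarrow> bilinear_form HA HA b"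
  by (rule bilinear_form_comp[OF linear_map_incl linear_map_incl])

lemma sub_projection:
  obtains P where "linear_map H HA P" and "\<And>x. x \<in> A \<Longrightarrow> P x = x"
proof -
  obtain P where P: "linear_map H (H\<lparr>carrier := A\<rparr>) P" "\<And>x. x \<in> A \<Longrightarrow> P x = x"
    by (rule subspace_projection[OF sub_subspace]) blast
  show thesis by (rule that[of P]) (use P in \<open>simp_all add: linear_map_def\<close>)
qed

text \<open>A form on A extends to H by precomposition with a projection, and a tensor over A cannot
  see the difference. Hence such a tensor is determined by its image in H \<otimes> H.\<close>

lemma tensor_project:
  assumes T: "T \<in> tensor_space HA HA" and P: "linear_map H HA P" "\<And>x. x \<in> A \<Longrightarrow> P x = x"
    and b: "bilinear_form HA HA b"
  shows "T b = tensor_map H H (\<lambda>y. y) (\<lambda>y. y) T (\<lambda>x y. b (P x) (P y))"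
proof -
  have "T b = T (\<lambda>x y. b (P x) (P y))"
    by (rule tensor_cong[OF T k_algebra_sub k_algebra_sub]) (simp add: P(2))
  then show ?thesis by (simp add: tensor_map_apply[OF bilinear_form_comp[OF P(1) P(1) b]])
qed

lemma tensor_incl_inj:
  assumes T: "T \<in> tensor_space HA HA" and T': "T' \<in> tensor_space HA HA"
    and eq: "tensor_map H H (\<lambda>y. y) (\<lambda>y. y) T = tensor_map H H (\<lambda>y. y) (\<lambda>y. y) T'"
  shows "T = T'"
proof
  fix b
  obtain P where P: "linear_map H HA P" "\<And>x. x \<in> A \<Longrightarrow> P x = x"
    by (rule sub_projection) blast
  show "T b = T' b"
  proof (cases "bilinear_form HA HA b")
    case True
    then show ?thesis using tensor_project[OF T P True] tensor_project[OF T' P True] eq by simp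
  next
    case False
    then show ?thesis using tensor_spaceE[OF T] tensor_spaceE[OF T'] by (metis tensor_sum_def)
  qed
qed

lemma comult_sub_eqI:
  assumes "T \<in> tensor_space HA HA" "tensor_map H H (\<lambda>y. y) (\<lambda>y. y) T = comult H x"
  shows "comult HA x = T"
proof -
  have "comult HA x = (THE T. T \<in> tensor_space HA HA \<and> tensor_map H H (\<lambda>y. y) (\<lambda>y. y) T = comult H x)"
    unfolding tensor_space_sub_hopf[symmetric] by (simp add: sub_hopf_def)
  also have "\<dots> = T"
    using assms by (intro the_equality) (auto intro: tensor_incl_inj)
  finally show ?thesis .
qed

lemma comult_sub:
  assumes "x \<in> A"
  shows "comult HA x \<in> tensor_space HA HA"
    and "tensor_map H H (\<lambda>y. y) (\<lambda>y. y) (comult HA x) = comult H x"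
proof -
  have "comult H x \<in> tensor_map H H (\<lambda>y. y) (\<lambda>y. y) ` tensor_space HA HA"
    using sub assms by (simp add: hopf_subalgebra_def tensor_space_sub_hopf)
  then obtain T where T: "T \<in> tensor_space HA HA" "tensor_map H H (\<lambda>y. y) (\<lambda>y. y) T = comult H x" by auto
  with comult_sub_eqI[OF T] show "comult HA x \<in> tensor_space HA HA"
    and "tensor_map H H (\<lambda>y. y) (\<lambda>y. y) (comult HA x) = comult H x" by auto
qed

lemma tensor_map_incl_sum:
  "tensor_map H H (\<lambda>y. y) (\<lambda>y. y) (tensor_sum HA HA xs) = tensor_sum H H xs"
  by (simp add: tensor_map_tensor_sum[OF linear_map_incl linear_map_incl])

lemma comult_subE:
  assumes "x \<in> A"
  obtains xs where "set xs \<subseteq> A \<times> A" and "comult HA x = tensor_sum HA HA xs"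
    and "comult H x = tensor_sum H H xs"
proof -
  obtain xs where xs: "set xs \<subseteq> carrier HA \<times> carrier HA" "comult HA x = tensor_sum HA HA xs"
    by (rule tensor_spaceE[OF comult_sub(1)[OF assms]])
  show thesis
    by (rule that[of xs]) (use xs comult_sub(2)[OF assms] tensor_map_incl_sum[of xs] in auto)
qed

lemma comult_sub_apply:
  "\<lbrakk>x \<in> A; bilinear_form H H b\<rbrakk> \<Longrightarrow> comult HA x b = comult H x b"
  using fun_cong[OF comult_sub(2), of x b] by (simp add: tensor_map_def)

lemma comult_sub_project:
  assumes "x \<in> A" and P: "linear_map H HA P" "\<And>x. x \<in> A \<Longrightarrow> P x = x" and "bilinear_form HA HA b"
  shows "comult HA x b = comult H x (\<lambda>u v. b (P u) (P v))"
  using tensor_project[OF comult_sub(1)[OF assms(1)] P assms(4)] comult_sub(2)[OF assms(1)] by simp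

text \<open>The identities descend because the coproducts in A and in H are given by common lists.
  Injectivity of the antipode is inherited too; surjectivity onto A is not automatic, whence
  \<open>surj\<close>.\<close>

theorem sub_hopf_algebra:
  assumes surj: "A \<subseteq> antipode H ` A"
  shows "hopf_algebra HA"
proof (intro hopf_algebra.intro hopf_algebra_axioms.intro k_algebra_sub)
  interpret HA: k_algebra HA by (rule k_algebra_sub)
  note [simp] = sub_carrier
  fix x y c xs
  have add: "comult HA (x \<oplus>\<^bsub>HA\<^esub> y) = (\<lambda>b. comult HA x b + comult HA y b)"
    if "x \<in> carrier HA" "y \<in> carrier HA" for x y
  proof -
    have xy: "x \<in> A" "y \<in> A" using that by auto
    have "comult HA (x \<oplus> y) = (\<lambda>b. comult HA x b + comult HA y b)"
    proof (rule comult_sub_eqI)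
      show "(\<lambda>b. comult HA x b + comult HA y b) \<in> tensor_space HA HA"
        by (rule tensor_space_plus[OF comult_sub(1)[OF xy(1)] comult_sub(1)[OF xy(2)]])
      have "tensor_map H H (\<lambda>y. y) (\<lambda>y. y) (\<lambda>b. comult HA x b + comult HA y b) =
        (\<lambda>b. tensor_map H H (\<lambda>y. y) (\<lambda>y. y) (comult HA x) b + tensor_map H H (\<lambda>y. y) (\<lambda>y. y) (comult HA y) b)"
        by (auto simp: tensor_map_def)
      then show "tensor_map H H (\<lambda>y. y) (\<lambda>y. y) (\<lambda>b. comult HA x b + comult HA y b) = comult H (x \<oplus> y)"
        using xy by (simp add: comult_sub comult_add)
    qed
    then show ?thesis by simp
  qed
  have sm: "comult HA (c \<odot>\<^bsub>HA\<^esub> x) = (\<lambda>b. c * comult HA x b)" if "x \<in> carrier HA" for x c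
  proof -
    have x: "x \<in> A" using that by auto
    have "comult HA (c \<odot> x) = (\<lambda>b. c * comult HA x b)"
    proof (rule comult_sub_eqI)
      show "(\<lambda>b. c * comult HA x b) \<in> tensor_space HA HA"
        by (rule tensor_space_times[OF k_algebra_sub comult_sub(1)[OF x]])
      have "tensor_map H H (\<lambda>y. y) (\<lambda>y. y) (\<lambda>b. c * comult HA x b) =
        (\<lambda>b. c * tensor_map H H (\<lambda>y. y) (\<lambda>y. y) (comult HA x) b)"
        by (auto simp: tensor_map_def)
      then show "tensor_map H H (\<lambda>y. y) (\<lambda>y. y) (\<lambda>b. c * comult HA x b) = comult H (c \<odot> x)"
        using x by (simp add: comult_sub comult_smult)
    qed
    then show ?thesis by simp
  qed
  have lin: "linear_form HA (\<lambda>x. comult HA x b)" for b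
    by (rule linear_formI) (simp_all only: add sm)
  show "linear_form HA (counit HA)"
    using linear_form_comp[OF linear_map_incl counit_linear] by (simp add: linear_form_def)
  show "comult HA \<one>\<^bsub>HA\<^esub> = tensor_sum HA HA [(\<one>\<^bsub>HA\<^esub>, \<one>\<^bsub>HA\<^esub>)]"
    using comult_sub_eqI[of "tensor_sum HA HA [(\<one>, \<one>)]" \<one>] sub_one comult_one
    by (simp add: tensor_map_incl_sum tensor_space_elementary)
  show "counit HA \<one>\<^bsub>HA\<^esub> = 1" by (simp add: counit_one)
  show "bij_betw (antipode HA) (carrier HA) (carrier HA)"
  proof -
    have "inj_on (antipode H) A"
      using antipode_bij k_subspaceD(1)[OF sub_subspace] inj_on_subset by (auto simp: bij_betw_def)
    moreover have "antipode H ` A = A" using surj sub_antipode by auto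
    ultimately show ?thesis by (simp add: bij_betw_def inj_on_def)
  qed
  assume "x \<in> carrier HA"
  then have x: "x \<in> A" by simp
  show "comult HA x \<in> tensor_space HA HA" by (rule comult_sub(1)[OF x])
  show "comult HA (c \<odot>\<^bsub>HA\<^esub> x) = (\<lambda>b. c * comult HA x b)" by (rule sm) (simp add: x)
  show "antipode HA (c \<odot>\<^bsub>HA\<^esub> x) = c \<odot>\<^bsub>HA\<^esub> antipode HA x" using x by (simp add: antipode_smult)
  show "comult_left HA (comult HA x) = comult_right HA (comult HA x)"
  proof
    fix t
    show "comult_left HA (comult HA x) t = comult_right HA (comult HA x) t"
    proof (cases "trilinear_form HA t")
      case True
      \<comment> \<open>Coassociativity in H speaks of forms on H, so the given form on A is
        extended along a projection.\<close>
      obtain P where P: "linear_map H HA P" "\<And>x. x \<in> A \<Longrightarrow> P x = x"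
        by (rule sub_projection) blast
      let ?t = "\<lambda>u v w. t (P u) (P v) (P w)"
      have t: "trilinear_form H ?t" by (rule trilinear_form_comp[OF P(1) True])
      obtain xs where xs: "set xs \<subseteq> A \<times> A" "comult HA x = tensor_sum HA HA xs" "comult H x = tensor_sum H H xs"
        by (rule comult_subE[OF x])
      have bl: "bilinear_form HA HA (\<lambda>x y. comult HA x (\<lambda>u v. t u v y))"
        by (intro bilinear_formI lin linear_form_tensor[OF comult_sub(1)] k_algebra_sub
            trilinear_form_bilinear[OF True] trilinear_formD[OF True]) auto
      have br: "bilinear_form HA HA (\<lambda>x y. comult HA y (\<lambda>u v. t x u v))"
        by (intro bilinear_formI lin linear_form_tensor[OF comult_sub(1)] k_algebra_sub
            trilinear_form_bilinear[OF True] trilinear_formD[OF True]) auto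
      have "comult_left HA (comult HA x) t = (\<Sum>(p, q)\<leftarrow>xs. comult HA p (\<lambda>u v. t u v q))"
        using True by (simp add: comult_left_def xs(2) tensor_sum_apply[OF bl])
      also have "\<dots> = (\<Sum>(p, q)\<leftarrow>xs. comult H p (\<lambda>u v. ?t u v q))"
      proof (rule sum_list_pair_cong)
        fix p q assume "(p, q) \<in> set xs"
        then have "p \<in> A" "q \<in> A" using xs(1) by auto
        then show "comult HA p (\<lambda>u v. t u v q) = comult H p (\<lambda>u v. ?t u v q)"
          using comult_sub_project[OF _ P trilinear_form_bilinear(1)[OF True], of p q] P(2) by simp
      qed
      also have "\<dots> = comult H x (\<lambda>p q. comult H p (\<lambda>u v. ?t u v q))"
        unfolding xs(3) by (rule tensor_sum_apply[OF bilinear_form_comult_left[OF t], symmetric])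
      also have "\<dots> = comult H x (\<lambda>p q. comult H q (\<lambda>u v. ?t p u v))"
        by (rule coassoc_form[OF _ t]) (simp add: x)
      also have "\<dots> = (\<Sum>(p, q)\<leftarrow>xs. comult H q (\<lambda>u v. ?t p u v))"
        unfolding xs(3) by (rule tensor_sum_apply[OF bilinear_form_comult_right[OF t]])
      also have "\<dots> = (\<Sum>(p, q)\<leftarrow>xs. comult HA q (\<lambda>u v. t p u v))"
      proof (rule sum_list_pair_cong)
        fix p q assume "(p, q) \<in> set xs"
        then have "p \<in> A" "q \<in> A" using xs(1) by auto
        then show "comult H q (\<lambda>u v. ?t p u v) = comult HA q (\<lambda>u v. t p u v)"
          using comult_sub_project[OF _ P trilinear_form_bilinear(2)[OF True], of q p] P(2) by simp
      qed
      also have "\<dots> = comult_right HA (comult HA x) t"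
        using True by (simp add: comult_right_def xs(2) tensor_sum_apply[OF br])
      finally show ?thesis .
    qed (simp add: comult_left_def comult_right_def)
  qed
  {
    assume "y \<in> carrier HA"
    then have y: "y \<in> A" by simp
    show "comult HA (x \<oplus>\<^bsub>HA\<^esub> y) = (\<lambda>b. comult HA x b + comult HA y b)" by (rule add) (simp_all add: x y)
    show "counit HA (x \<otimes>\<^bsub>HA\<^esub> y) = counit HA x * counit HA y" using x y by (simp add: counit_mult)
    show "antipode HA (x \<oplus>\<^bsub>HA\<^esub> y) = antipode HA x \<oplus>\<^bsub>HA\<^esub> antipode HA y" using x y by (simp add: antipode_add)
    obtain xs where xs: "set xs \<subseteq> A \<times> A" "comult HA x = tensor_sum HA HA xs" "comult H x = tensor_sum H H xs"
      by (rule comult_subE[OF x])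
    obtain ys where ys: "set ys \<subseteq> A \<times> A" "comult HA y = tensor_sum HA HA ys" "comult H y = tensor_sum H H ys"
      by (rule comult_subE[OF y])
    have c: "set xs \<subseteq> carrier H \<times> carrier H" "set ys \<subseteq> carrier H \<times> carrier H" using xs(1) ys(1) by auto
    have "comult HA (x \<otimes> y) = tensor_mult HA (comult HA x) (comult HA y)"
    proof (rule comult_sub_eqI)
      show "tensor_mult HA (comult HA x) (comult HA y) \<in> tensor_space HA HA"
        by (rule HA.tensor_mult_in_space[OF comult_sub(1)[OF x] comult_sub(1)[OF y]])
      have "tensor_mult HA (comult HA x) (comult HA y) = tensor_sum HA HA [(u \<otimes> u', v \<otimes> v'). (u, v) \<leftarrow> xs, (u', v') \<leftarrow> ys]"
        using HA.tensor_mult_tensor_sum[of xs ys] xs ys by simp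
      then have "tensor_map H H (\<lambda>y. y) (\<lambda>y. y) (tensor_mult HA (comult HA x) (comult HA y)) = tensor_sum H H [(u \<otimes> u', v \<otimes> v'). (u, v) \<leftarrow> xs, (u', v') \<leftarrow> ys]"
        by (simp only: tensor_map_incl_sum)
      also have "\<dots> = comult H (x \<otimes> y)"
        using x y comult_mult[of x y] by (simp only: xs(3) ys(3) tensor_mult_tensor_sum[OF c] sub_carrier)
      finally show "tensor_map H H (\<lambda>y. y) (\<lambda>y. y) (tensor_mult HA (comult HA x) (comult HA y)) = comult H (x \<otimes> y)" .
    qed
    then show "comult HA (x \<otimes>\<^bsub>HA\<^esub> y) = tensor_mult HA (comult HA x) (comult HA y)" by simp
  }
  assume xs: "set xs \<subseteq> carrier HA \<times> carrier HA" "comult HA x = tensor_sum HA HA xs"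
  have xs': "set xs \<subseteq> carrier H \<times> carrier H" using xs(1) by auto
  have eq: "comult H x = tensor_sum H H xs"
    using comult_sub(2)[OF x] by (simp only: xs(2) tensor_map_incl_sum)
  have xc: "x \<in> carrier H" using x by simp
  show "list_sum HA (map (\<lambda>(u, v). counit HA u \<odot>\<^bsub>HA\<^esub> v) xs) = x"
    using counit_left[OF xc xs' eq] by simp
  show "list_sum HA (map (\<lambda>(u, v). counit HA v \<odot>\<^bsub>HA\<^esub> u) xs) = x"
    using counit_right[OF xc xs' eq] by simp
  show "list_sum HA (map (\<lambda>(u, v). antipode HA u \<otimes>\<^bsub>HA\<^esub> v) xs) = counit HA x \<odot>\<^bsub>HA\<^esub> \<one>\<^bsub>HA\<^esub>"
    using antipode_left[OF xc xs' eq] by simp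
  show "list_sum HA (map (\<lambda>(u, v). u \<otimes>\<^bsub>HA\<^esub> antipode HA v) xs) = counit HA x \<odot>\<^bsub>HA\<^esub> \<one>\<^bsub>HA\<^esub>"
    using antipode_right[OF xc xs' eq] by simp
qed

text \<open>
  On a commutative Hopf subalgebra both \<open>id\<close> and \<open>S\<^sup>2\<close> are convolution inverse to \<open>S\<close>; evaluate
  \<open>x\<^sub>1 S(x\<^sub>2) S\<^sup>2(x\<^sub>3)\<close> in two ways.
\<close>

lemma antipode_involutive:
  assumes comm: "\<And>a x. \<lbrakk>a \<in> A; x \<in> A\<rbrakk> \<Longrightarrow> a \<otimes> x = x \<otimes> a" and x: "x \<in> A"
  shows "antipode H (antipode H x) = x"
proof (rule linear_forms_separate)
  let ?S = "antipode H"
  note [simp] = antipode_closed sub_carrier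
  show "?S (?S x) \<in> carrier H" "x \<in> carrier H" using x by auto
  fix \<phi> assume \<phi>: "linear_form H \<phi>"
  let ?t = "\<lambda>p q r. \<phi> (p \<otimes> (?S q \<otimes> ?S (?S r)))"
  have t: "trilinear_form H ?t"
  proof (rule trilinear_formI)
    show "linear_form H (\<lambda>p. ?t p q r)" if "q \<in> carrier H" "r \<in> carrier H" for q r
      by (rule linear_form_mult_right[OF \<phi>]) (use that in auto)
    show "linear_form H (\<lambda>q. ?t p q r)" if "p \<in> carrier H" "r \<in> carrier H" for p r
      by (rule linear_form_antipode[OF linear_form_mult_right[OF linear_form_mult_left[OF \<phi>]]]) (use that in auto)
    show "linear_form H (\<lambda>r. ?t p q r)" if "p \<in> carrier H" "q \<in> carrier H" for p q
      by (rule linear_form_antipode[OF linear_form_antipode[OF linear_form_mult_left[OF linear_form_mult_left[OF \<phi>]]]]) (use that in auto)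
  qed
  have xc: "x \<in> carrier H" using x by simp
  have "comult H x (\<lambda>u v. comult H u (\<lambda>p q. ?t p q v)) = comult H x (\<lambda>u v. counit H u * \<phi> (?S (?S v)))"
  proof (rule comult_cong[OF xc])
    fix u v assume u: "u \<in> carrier H" and v: "v \<in> carrier H"
    have "comult H u (\<lambda>p q. ?t p q v) = comult H u (\<lambda>p q. \<phi> ((p \<otimes> ?S q) \<otimes> ?S (?S v)))"
      by (rule comult_cong[OF u]) (use v in \<open>simp add: m_assoc\<close>)
    also have "\<dots> = counit H u * \<phi> (\<one> \<otimes> ?S (?S v))"
      by (rule antipode_right_form[OF u linear_form_mult_right[OF \<phi>]]) (use v in auto)
    finally show "comult H u (\<lambda>p q. ?t p q v) = counit H u * \<phi> (?S (?S v))" using v by simp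
  qed
  also have "\<dots> = \<phi> (?S (?S x))"
    by (rule counit_left_form[OF xc linear_form_antipode[OF linear_form_antipode[OF \<phi>]]])
  finally have left: "comult H x (\<lambda>u v. comult H u (\<lambda>p q. ?t p q v)) = \<phi> (?S (?S x))" .
  obtain xs where xs: "set xs \<subseteq> A \<times> A" "comult H x = tensor_sum H H xs"
    by (rule comult_subE[OF x])
  have "comult H x (\<lambda>u v. comult H v (\<lambda>q r. ?t u q r)) = (\<Sum>(u, v)\<leftarrow>xs. comult H v (\<lambda>q r. ?t u q r))"
    unfolding xs(2) by (rule tensor_sum_apply[OF bilinear_form_comult_right[OF t]])
  also have "\<dots> = (\<Sum>(u, v)\<leftarrow>xs. counit H v * \<phi> u)"
  proof (rule sum_list_pair_cong)
    fix u v assume "(u, v) \<in> set xs"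
    then have u: "u \<in> A" and v: "v \<in> A" using xs(1) by auto
    obtain vs where vs: "set vs \<subseteq> A \<times> A" "comult H v = tensor_sum H H vs"
      by (rule comult_subE[OF v])
    let ?\<psi> = "\<lambda>z. \<phi> (u \<otimes> ?S z)"
    have \<psi>: "linear_form H ?\<psi>" by (rule linear_form_antipode[OF linear_form_mult_left[OF \<phi>]]) (use u in auto)
    have b1: "bilinear_form H H (\<lambda>q r. ?t u q r)" by (rule trilinear_form_bilinear(2)[OF t]) (use u in auto)
    have b2: "bilinear_form H H (\<lambda>q r. ?\<psi> (q \<otimes> ?S r))"
      by (rule bilinear_form_comp[OF linear_map_id antipode_linear_map bilinear_form_mult[OF \<psi>]])
    have "comult H v (\<lambda>q r. ?t u q r) = (\<Sum>(q, r)\<leftarrow>vs. ?t u q r)"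
      by (simp add: vs(2) tensor_sum_apply[OF b1])
    also have "\<dots> = (\<Sum>(q, r)\<leftarrow>vs. ?\<psi> (q \<otimes> ?S r))"
    proof (rule sum_list_pair_cong)
      fix q r assume "(q, r) \<in> set vs"
      then have q: "q \<in> A" and r: "r \<in> A" using vs(1) by auto
      \<comment> \<open>Antimultiplicativity and commutativity turn S(x_2) S^2(x_3) into S(x_2
        S(x_3)), where the antipode axiom applies.\<close>
      have "?S q \<otimes> ?S (?S r) = ?S (?S r \<otimes> q)" using q r by (simp add: antipode_mult)
      also have "?S r \<otimes> q = q \<otimes> ?S r" using comm[OF sub_antipode[OF r] q] .
      finally show "?t u q r = ?\<psi> (q \<otimes> ?S r)" by simp
    qed
    also have "\<dots> = comult H v (\<lambda>q r. ?\<psi> (q \<otimes> ?S r))"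
      by (simp add: vs(2) tensor_sum_apply[OF b2])
    also have "\<dots> = counit H v * ?\<psi> \<one>"
      by (rule antipode_right_form[OF _ \<psi>]) (use v in auto)
    finally show "comult H v (\<lambda>q r. ?t u q r) = counit H v * \<phi> u" using u by (simp add: antipode_one)
  qed
  also have "\<dots> = comult H x (\<lambda>u v. counit H v * \<phi> u)"
    using tensor_sum_apply[OF bilinear_form_product[OF \<phi> counit_linear], of xs] by (simp add: xs(2) mult.commute)
  also have "\<dots> = \<phi> x" by (rule counit_right_form[OF xc \<phi>])
  finally show "\<phi> (?S (?S x)) = \<phi> x" using left coassoc_form[OF xc t] by simp
qed

end

section \<open>Quotients\<close>

text \<open>The ideal is the sum of K and an ideal of finite codimension killed by f. As it contains
  K, it survives the passage to R/K and shows that the functional induced there lies in the finite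
  dual.\<close>

lemma (in k_algebra) fin_dual_enlarge_ideal:
  assumes f: "f \<in> fin_dual_carrier R" and K: "ideal K R" and fK: "\<And>x. x \<in> K \<Longrightarrow> f x = 0"
  obtains J where "ideal J R" "finite_codim R J" "K \<subseteq> J" "\<And>x. x \<in> J \<Longrightarrow> f x = 0"
proof -
  interpret K: ideal K R by fact
  obtain J where J: "ideal J R" "finite_codim R J" "\<And>x. x \<in> J \<Longrightarrow> f x = 0"
    by (rule fin_dualE[OF f]) blast
  interpret J: ideal J R by fact
  let ?J = "J <+>\<^bsub>R\<^esub> K"
  have sJ: "ideal ?J R" by (rule add_ideals[OF J(1) K])
  have JJ: "J \<subseteq> ?J" and KJ: "K \<subseteq> ?J"
  proof -
    have "x \<in> ?J" if "x \<in> J" for x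
    proof -
      have "\<zero> \<in> K" by (rule additive_subgroup.zero_closed[OF K.additive_subgroup_axioms])
      moreover have "x = x \<oplus> \<zero>" using J.Icarr[OF that] by simp
      ultimately show ?thesis using that unfolding set_add_def' by blast
    qed
    then show "J \<subseteq> ?J" by auto
    have "x \<in> ?J" if "x \<in> K" for x
    proof -
      have "\<zero> \<in> J" by (rule additive_subgroup.zero_closed[OF J.additive_subgroup_axioms])
      moreover have "x = \<zero> \<oplus> x" using K.Icarr[OF that] by simp
      ultimately show ?thesis using that unfolding set_add_def' by blast
    qed
    then show "K \<subseteq> ?J" by auto
  qed
  have fJ: "f x = 0" if "x \<in> ?J" for x
    using that J(3) fK J.Icarr K.Icarr fin_dualD(1)[OF f] by (auto simp: set_add_def' linear_form_add)
  show thesis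
    by (rule that[OF sJ finite_codim_mono[OF J(2) JJ] KJ fJ])
qed

text \<open>Q is only a record onto which p maps compatibly; its algebra axioms are derived. This
  form fits quotients with explicit coset operations and serves the quotient algebra as well as the
  quotient Hopf algebra.\<close>

locale k_epi = k_algebra R for R :: "('k::field, 'a, 'm) module_scheme" (structure) +
  fixes Q :: "('k, 'b, 'n) module_scheme" and p :: "'a \<Rightarrow> 'b"
  assumes p_surj: "carrier Q = p ` carrier R"
    and p_add: "\<lbrakk>x \<in> carrier R; y \<in> carrier R\<rbrakk> \<Longrightarrow> p (x \<oplus> y) = p x \<oplus>\<^bsub>Q\<^esub> p y"
    and p_mult: "\<lbrakk>x \<in> carrier R; y \<in> carrier R\<rbrakk> \<Longrightarrow> p (x \<otimes> y) = p x \<otimes>\<^bsub>Q\<^esub> p y"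
    and p_smult: "x \<in> carrier R \<Longrightarrow> p (c \<odot> x) = c \<odot>\<^bsub>Q\<^esub> p x"
    and p_one: "p \<one> = \<one>\<^bsub>Q\<^esub>" and p_zero: "p \<zero> = \<zero>\<^bsub>Q\<^esub>"
begin

lemma p_closed: "x \<in> carrier R \<Longrightarrow> p x \<in> carrier Q"
  using p_surj by auto

lemma p_rep:
  assumes "y \<in> carrier Q" obtains x where "x \<in> carrier R" "y = p x"
  using assms p_surj by auto

lemma k_algebra_image: "k_algebra Q"
proof -
  note P = p_add[symmetric] p_mult[symmetric] p_smult[symmetric] p_one[symmetric] p_zero[symmetric]
  have "ring Q"
  proof (rule ringI)
    show "abelian_group Q"
    proof (rule abelian_groupI)
      fix x assume "x \<in> carrier Q"
      then obtain x' where "x' \<in> carrier R" "x = p x'" by (rule p_rep)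
      then show "\<exists>y\<in>carrier Q. y \<oplus>\<^bsub>Q\<^esub> x = \<zero>\<^bsub>Q\<^esub>"
        by (intro bexI[of _ "p (\<ominus> x')"]) (simp_all add: P l_neg p_closed)
    qed (auto simp: p_surj P a_ac)
    show "Group.monoid Q" by (rule monoidI) (auto simp: p_surj P m_assoc)
  qed (auto simp: p_surj P l_distr r_distr)
  then show ?thesis
    by (intro k_algebra.intro k_algebra_axioms.intro)
      (auto simp: p_surj P smult_closed smult_l_distr smult_r_distr smult_assoc smult_one smult_mult_left smult_mult_right)
qed

sublocale Q: k_algebra Q by (rule k_algebra_image)

lemma p_linear: "linear_map R Q p"
  by (simp add: linear_map_def p_closed p_add p_smult)

lemma p_uminus: "x \<in> carrier R \<Longrightarrow> p (\<ominus> x) = \<ominus>\<^bsub>Q\<^esub> p x"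
  using p_smult[of x "- 1"] by (simp add: smult_minus_one Q.smult_minus_one p_closed)

lemma p_eq_iff:
  assumes "x \<in> carrier R" "y \<in> carrier R"
  shows "p x = p y \<longleftrightarrow> p (x \<ominus> y) = \<zero>\<^bsub>Q\<^esub>"
  using assms by (simp add: minus_eq p_add p_uminus Q.minus_eq[symmetric] Q.r_right_minus_eq p_closed)

lemma ideal_vimage:
  assumes "ideal J Q" shows "ideal {x \<in> carrier R. p x \<in> J} R"
proof -
  interpret J: ideal J Q by fact
  show ?thesis
  proof (rule idealI[OF ring_axioms])
    show "subgroup {x \<in> carrier R. p x \<in> J} (add_monoid R)"
    proof (rule add.subgroupI)
      show "{x \<in> carrier R. p x \<in> J} \<noteq> {}" using p_zero J.zero_closed by auto
    qed (auto simp: p_uminus p_add J.a_closed J.a_inv_closed)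
  qed (auto simp: p_mult J.I_l_closed J.I_r_closed p_closed)
qed

lemma ideal_image:
  assumes "ideal J R" shows "ideal (p ` J) Q"
proof -
  interpret J: ideal J R by fact
  show ?thesis
  proof (rule idealI[OF Q.ring_axioms])
    show "subgroup (p ` J) (add_monoid Q)"
    proof (rule Q.add.subgroupI)
      show "p ` J \<subseteq> carrier Q" using J.Icarr p_closed by auto
      show "p ` J \<noteq> {}" using additive_subgroup.zero_closed[OF J.additive_subgroup_axioms] by blast
      show "\<ominus>\<^bsub>Q\<^esub> x \<in> p ` J" if "x \<in> p ` J" for x
        using that by (rule imageE) (simp add: p_uminus[symmetric] J.Icarr J.a_inv_closed)
      show "x \<oplus>\<^bsub>Q\<^esub> y \<in> p ` J" if "x \<in> p ` J" "y \<in> p ` J" for x y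
        using that by (elim imageE) (simp add: p_add[symmetric] J.Icarr J.a_closed)
    qed
    show "x \<otimes>\<^bsub>Q\<^esub> a \<in> p ` J" if "a \<in> p ` J" "x \<in> carrier Q" for a x
      using that by (elim imageE p_rep) (simp add: p_mult[symmetric] J.Icarr J.I_l_closed)
    show "a \<otimes>\<^bsub>Q\<^esub> x \<in> p ` J" if "a \<in> p ` J" "x \<in> carrier Q" for a x
      using that by (elim imageE p_rep) (simp add: p_mult[symmetric] J.Icarr J.I_r_closed)
  qed
qed

text \<open>Evaluation at a chosen preimage, independent of the choice once f vanishes on the kernel
  of p.\<close>

definition descend :: "('a \<Rightarrow> 'k) \<Rightarrow> 'b \<Rightarrow> 'k" where
  "descend f = zero_ext (carrier Q) (\<lambda>y. f (SOME x. x \<in> carrier R \<and> p x = y))"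

lemma descend_apply:
  assumes f: "linear_form R f" "\<And>x. \<lbrakk>x \<in> carrier R; p x = \<zero>\<^bsub>Q\<^esub>\<rbrakk> \<Longrightarrow> f x = 0" and x: "x \<in> carrier R"
  shows "descend f (p x) = f x"
proof -
  let ?x = "SOME x'. x' \<in> carrier R \<and> p x' = p x"
  have s: "?x \<in> carrier R \<and> p ?x = p x" by (rule someI[of _ x]) (simp add: x)
  then have "f (?x \<ominus> x) = 0" using x p_eq_iff[of ?x x] by (intro f(2)) auto
  then have "f ?x = f x" using s x by (simp add: linear_form_diff[OF f(1)])
  then show ?thesis using x by (simp add: descend_def p_closed)
qed

lemma linear_form_descend:
  assumes f: "linear_form R f" "\<And>x. \<lbrakk>x \<in> carrier R; p x = \<zero>\<^bsub>Q\<^esub>\<rbrakk> \<Longrightarrow> f x = 0"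
  shows "linear_form Q (descend f)"
proof (rule linear_formI)
  note d = descend_apply[OF f]
  fix x y assume "x \<in> carrier Q" "y \<in> carrier Q"
  then obtain x' y' where "x' \<in> carrier R" "x = p x'" "y' \<in> carrier R" "y = p y'" by (elim p_rep)
  then show "descend f (x \<oplus>\<^bsub>Q\<^esub> y) = descend f x + descend f y"
    by (simp add: p_add[symmetric] d linear_form_add[OF f(1)])
next
  note d = descend_apply[OF f]
  fix c x assume "x \<in> carrier Q"
  then obtain x' where "x' \<in> carrier R" "x = p x'" by (rule p_rep)
  then show "descend f (c \<odot>\<^bsub>Q\<^esub> x) = c * descend f x"
    by (simp add: p_smult[symmetric] d linear_form_smult[OF f(1)] smult_closed)
qed

text \<open>Since J contains the kernel, the forms cutting out J vanish on the kernel and descend to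
  forms cutting out the image.\<close>

lemma finite_codim_image:
  assumes J: "ideal J R" "finite_codim R J" and ker: "\<And>x. \<lbrakk>x \<in> carrier R; p x = \<zero>\<^bsub>Q\<^esub>\<rbrakk> \<Longrightarrow> x \<in> J"
  shows "finite_codim Q (p ` J)"
proof -
  obtain \<Phi> where \<Phi>: "finite \<Phi>" "\<And>\<phi>. \<phi> \<in> \<Phi> \<Longrightarrow> linear_form R \<phi>"
    "\<And>\<phi> u. \<lbrakk>\<phi> \<in> \<Phi>; u \<in> J\<rbrakk> \<Longrightarrow> \<phi> u = 0"
    "\<And>x. \<lbrakk>x \<in> carrier R; \<And>\<phi>. \<phi> \<in> \<Phi> \<Longrightarrow> \<phi> x = 0\<rbrakk> \<Longrightarrow> x \<in> J"
    by (rule finite_codim_forms[OF ideal_imp_subspace[OF J(1)] J(2)]) blast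
  have van: "\<phi> x = 0" if "\<phi> \<in> \<Phi>" "x \<in> carrier R" "p x = \<zero>\<^bsub>Q\<^esub>" for \<phi> x
    using \<Phi>(3)[OF that(1) ker[OF that(2,3)]] .
  show ?thesis
  proof (rule Q.finite_codimI_forms[of "descend ` \<Phi>"])
    show "finite (descend ` \<Phi>)" using \<Phi>(1) by simp
    show "linear_form Q \<psi>" if "\<psi> \<in> descend ` \<Phi>" for \<psi>
    proof -
      obtain \<phi> where \<phi>: "\<phi> \<in> \<Phi>" "\<psi> = descend \<phi>" using \<open>\<psi> \<in> descend ` \<Phi>\<close> by auto
      show ?thesis unfolding \<phi>(2) by (rule linear_form_descend[OF \<Phi>(2)[OF \<phi>(1)] van[OF \<phi>(1)]])
    qed
    fix y assume "y \<in> carrier Q" and 0: "\<And>\<psi>. \<psi> \<in> descend ` \<Phi> \<Longrightarrow> \<psi> y = 0"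
    then obtain x where x: "x \<in> carrier R" "y = p x" by (elim p_rep)
    have "x \<in> J"
    proof (rule \<Phi>(4)[OF x(1)])
      fix \<phi> assume "\<phi> \<in> \<Phi>"
      have "descend \<phi> y = \<phi> x" unfolding x(2) by (rule descend_apply[OF \<Phi>(2)[OF \<open>\<phi> \<in> \<Phi>\<close>] van[OF \<open>\<phi> \<in> \<Phi>\<close>] x(1)])
      then show "\<phi> x = 0" using 0[of "descend \<phi>"] \<open>\<phi> \<in> \<Phi>\<close> by simp
    qed
    then show "y \<in> p ` J" using x by simp
  qed
qed

definition transpose :: "('b \<Rightarrow> 'k) \<Rightarrow> 'a \<Rightarrow> 'k" where
  "transpose \<phi> = zero_ext (carrier R) (\<lambda>x. \<phi> (p x))"

lemma transpose_fin_dual: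
  assumes "\<phi> \<in> fin_dual_carrier Q"
  shows "transpose \<phi> \<in> fin_dual_carrier R"
    and "\<lbrakk>x \<in> carrier R; p x = \<zero>\<^bsub>Q\<^esub>\<rbrakk> \<Longrightarrow> transpose \<phi> x = 0"
proof -
  obtain J where J: "ideal J Q" "finite_codim Q J" "\<And>x. x \<in> J \<Longrightarrow> \<phi> x = 0"
    by (rule fin_dualE[OF assms]) blast
  show "transpose \<phi> \<in> fin_dual_carrier R"
  proof (rule fin_dualI)
    show "linear_form R (transpose \<phi>)" unfolding transpose_def
      by (rule linear_form_zero_ext[OF linear_form_comp[OF p_linear fin_dualD(1)[OF assms]]])
    show "ideal {x \<in> carrier R. p x \<in> J} R" by (rule ideal_vimage[OF J(1)])
    show "finite_codim R {x \<in> carrier R. p x \<in> J}"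
      by (rule finite_codim_vimage[OF p_linear k_algebra_image Q.ideal_imp_subspace[OF J(1)] J(2)])
  qed (auto simp: transpose_def J(3))
  show "transpose \<phi> x = 0" if "x \<in> carrier R" "p x = \<zero>\<^bsub>Q\<^esub>"
    using that Q.linear_form_at_zero[OF fin_dualD(1)[OF assms]] by (simp add: transpose_def)
qed

text \<open>A functional killing the kernel K descends to Q, and the result lies in the finite dual
  because the ideal witnessing finiteness can be chosen to contain K.\<close>

lemma transpose_image:
  assumes K: "ideal K R" "\<And>x. x \<in> carrier R \<Longrightarrow> p x = \<zero>\<^bsub>Q\<^esub> \<longleftrightarrow> x \<in> K"
  shows "transpose ` fin_dual_carrier Q = {f \<in> fin_dual_carrier R. \<forall>x\<in>K. f x = 0}"
proof (intro equalityI subsetI)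
  fix f assume "f \<in> transpose ` fin_dual_carrier Q"
  then show "f \<in> {f \<in> fin_dual_carrier R. \<forall>x\<in>K. f x = 0}"
    using transpose_fin_dual K ideal.Icarr[OF K(1)] by auto
next
  fix f assume "f \<in> {f \<in> fin_dual_carrier R. \<forall>x\<in>K. f x = 0}"
  then have f: "f \<in> fin_dual_carrier R" and fK: "\<And>x. x \<in> K \<Longrightarrow> f x = 0" by auto
  obtain J where J: "ideal J R" "finite_codim R J" "K \<subseteq> J" "\<And>x. x \<in> J \<Longrightarrow> f x = 0"
    by (rule fin_dual_enlarge_ideal[OF f K(1) fK]) blast+
  have fk: "f x = 0" if "x \<in> carrier R" "p x = \<zero>\<^bsub>Q\<^esub>" for x using that K fK by auto
  note d = descend_apply[OF fin_dualD(1)[OF f] fk]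
  have "descend f \<in> fin_dual_carrier Q"
  proof (rule fin_dualI)
    show "linear_form Q (descend f)" by (rule linear_form_descend[OF fin_dualD(1)[OF f] fk])
    show "ideal (p ` J) Q" by (rule ideal_image[OF J(1)])
    show "finite_codim Q (p ` J)"
      by (rule finite_codim_image[OF J(1,2)]) (use K J(3) in auto)
    show "descend f y = 0" if "y \<in> p ` J" for y
      using that d J(4) ideal.Icarr[OF J(1)] by auto
  qed (simp add: descend_def)
  moreover have "transpose (descend f) = f"
    by (rule ext) (auto simp: transpose_def zero_ext_def d fin_dualD(2)[OF f])
  ultimately show "f \<in> transpose ` fin_dual_carrier Q" by force
qed

lemma transpose_inj: "inj_on transpose (fin_dual_carrier Q)"
proof (rule inj_onI, rule ext)
  fix \<phi> \<psi> y assume \<phi>: "\<phi> \<in> fin_dual_carrier Q" and \<psi>: "\<psi> \<in> fin_dual_carrier Q" and eq: "transpose \<phi> = transpose \<psi>"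
  show "\<phi> y = \<psi> y"
  proof (cases "y \<in> carrier Q")
    case True
    then obtain x where "x \<in> carrier R" "y = p x" by (rule p_rep)
    then show ?thesis using fun_cong[OF eq, of x] by (simp add: transpose_def)
  qed (use fin_dualD(2)[OF \<phi>] fin_dualD(2)[OF \<psi>] in auto)
qed

end

text \<open>\<open>antipode_kernel\<close> says that the inverse antipode preserves the kernel of p;
  it makes the induced antipode injective.\<close>

locale hopf_epi = hopf_algebra H + k_epi H Q p
  for H :: "('k::field, 'a, 'm) hopf_scheme" (structure) and Q :: "('k, 'b, 'n) hopf_scheme" and p +
  assumes p_comult: "x \<in> carrier H \<Longrightarrow> comult Q (p x) = tensor_map Q Q p p (comult H x)"
    and p_counit: "x \<in> carrier H \<Longrightarrow> counit Q (p x) = counit H x"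
    and p_antipode: "x \<in> carrier H \<Longrightarrow> antipode Q (p x) = p (antipode H x)"
    and antipode_kernel: "\<lbrakk>x \<in> carrier H; p (antipode H x) = \<zero>\<^bsub>Q\<^esub>\<rbrakk> \<Longrightarrow> p x = \<zero>\<^bsub>Q\<^esub>"
begin

lemma p_comult_form:
  "\<lbrakk>x \<in> carrier H; bilinear_form Q Q b\<rbrakk> \<Longrightarrow> comult Q (p x) b = comult H x (\<lambda>u v. b (p u) (p v))"
  by (simp add: p_comult tensor_map_apply)

lemma pull_linear: "linear_form Q f \<Longrightarrow> linear_form H (\<lambda>x. f (p x))"
  by (rule linear_form_comp[OF p_linear])

text \<open>The counit and antipode axioms range over all lists representing the coproduct of X, and
  such a list need not come from H. Applying a linear form on Q makes the sum depend on the tensor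
  alone, which is the image of the coproduct of a preimage x.\<close>

theorem hopf_algebra_image: "hopf_algebra Q"
proof (intro hopf_algebra.intro hopf_algebra_axioms.intro k_algebra_image)
  fix X Y c xs
  have T: "comult Q X \<in> tensor_space Q Q" if X: "X \<in> carrier Q" for X
    using X by (rule p_rep) (use tensor_map_in_space[OF p_linear p_linear comult_closed] p_comult in auto)
  have add: "comult Q (X \<oplus>\<^bsub>Q\<^esub> Y) = (\<lambda>b. comult Q X b + comult Q Y b)"
    if X: "X \<in> carrier Q" and Y: "Y \<in> carrier Q" for X Y
  proof -
    obtain x y where xy: "x \<in> carrier H" "X = p x" "y \<in> carrier H" "Y = p y" using X Y by (elim p_rep)
    then show ?thesis by (auto simp: p_add[symmetric] p_comult comult_add tensor_map_def)
  qed
  have sm: "comult Q (c \<odot>\<^bsub>Q\<^esub> X) = (\<lambda>b. c * comult Q X b)" if X: "X \<in> carrier Q" for X c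
  proof -
    obtain x where x: "x \<in> carrier H" "X = p x" using X by (elim p_rep)
    then show ?thesis by (auto simp: p_smult[symmetric] p_comult comult_smult tensor_map_def smult_closed)
  qed
  have lin: "linear_form Q (\<lambda>x. comult Q x b)" for b
    by (rule linear_formI) (simp_all only: add sm)
  show lc: "linear_form Q (counit Q)"
  proof (rule linear_formI)
    fix X Y assume "X \<in> carrier Q" "Y \<in> carrier Q"
    then obtain x y where xy: "x \<in> carrier H" "X = p x" "y \<in> carrier H" "Y = p y" by (elim p_rep)
    then show "counit Q (X \<oplus>\<^bsub>Q\<^esub> Y) = counit Q X + counit Q Y"
      by (simp add: p_add[symmetric] p_counit linear_form_add[OF counit_linear])
  next
    fix c X assume "X \<in> carrier Q"
    then obtain x where x: "x \<in> carrier H" "X = p x" by (elim p_rep)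
    then show "counit Q (c \<odot>\<^bsub>Q\<^esub> X) = c * counit Q X"
      by (simp add: p_smult[symmetric] p_counit linear_form_smult[OF counit_linear] smult_closed)
  qed
  have Sadd: "antipode Q (X \<oplus>\<^bsub>Q\<^esub> Y) = antipode Q X \<oplus>\<^bsub>Q\<^esub> antipode Q Y"
    if X: "X \<in> carrier Q" and Y: "Y \<in> carrier Q" for X Y
  proof -
    obtain x y where xy: "x \<in> carrier H" "X = p x" "y \<in> carrier H" "Y = p y" using X Y by (elim p_rep)
    then show ?thesis by (simp add: p_add[symmetric] p_antipode antipode_add antipode_closed)
  qed
  have Ssm: "antipode Q (c \<odot>\<^bsub>Q\<^esub> X) = c \<odot>\<^bsub>Q\<^esub> antipode Q X" if X: "X \<in> carrier Q" for X c
  proof -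
    obtain x where x: "x \<in> carrier H" "X = p x" using X by (elim p_rep)
    then show ?thesis by (simp add: p_smult[symmetric] p_antipode antipode_smult antipode_closed smult_closed)
  qed
  have Sc: "antipode Q X \<in> carrier Q" if X: "X \<in> carrier Q" for X
    using X by (rule p_rep) (simp add: p_antipode p_closed antipode_closed)
  have SQ: "linear_map Q Q (antipode Q)" by (simp add: linear_map_def Sadd Ssm Sc)
  have idQ: "linear_map Q Q (\<lambda>x. x)" by (simp add: linear_map_def)
  show "comult Q \<one>\<^bsub>Q\<^esub> = tensor_sum Q Q [(\<one>\<^bsub>Q\<^esub>, \<one>\<^bsub>Q\<^esub>)]"
    using p_comult[of \<one>] by (simp add: p_one comult_one tensor_map_tensor_sum[OF p_linear p_linear])
  show "counit Q \<one>\<^bsub>Q\<^esub> = 1" using p_counit[of \<one>] by (simp add: p_one counit_one)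
  show "bij_betw (antipode Q) (carrier Q) (carrier Q)"
    unfolding bij_betw_def
  proof
    show "inj_on (antipode Q) (carrier Q)"
    proof (rule inj_onI)
      fix X Y assume "X \<in> carrier Q" "Y \<in> carrier Q" and eq: "antipode Q X = antipode Q Y"
      then obtain x y where xy: "x \<in> carrier H" "X = p x" "y \<in> carrier H" "Y = p y" by (elim p_rep)
      have "antipode H (x \<ominus> y) = antipode H x \<ominus> antipode H y"
        using xy antipode_smult[of y "- 1"] by (simp add: minus_eq antipode_add smult_minus_one antipode_closed)
      then have "p (antipode H (x \<ominus> y)) = \<zero>\<^bsub>Q\<^esub>"
        using eq xy p_eq_iff[of "antipode H x" "antipode H y"] by (simp add: p_antipode antipode_closed)
      then have "p (x \<ominus> y) = \<zero>\<^bsub>Q\<^esub>" by (rule antipode_kernel[rotated]) (simp add: xy)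
      then show "X = Y" using xy p_eq_iff by simp
    qed
    show "antipode Q ` carrier Q = carrier Q"
    proof (intro equalityI subsetI)
      fix Y assume "Y \<in> carrier Q"
      then obtain y where "y \<in> carrier H" "Y = p y" by (elim p_rep)
      then have "Y = antipode Q (p (antipode_inv y))" by (simp add: p_antipode antipode_inv)
      then show "Y \<in> antipode Q ` carrier Q" using \<open>y \<in> carrier H\<close> by (simp add: antipode_inv p_closed)
    qed (use Sc in auto)
  qed
  assume X: "X \<in> carrier Q"
  then obtain x where x: "x \<in> carrier H" "X = p x" by (elim p_rep)
  show "comult Q X \<in> tensor_space Q Q" by (rule T[OF X])
  show "comult Q (c \<odot>\<^bsub>Q\<^esub> X) = (\<lambda>b. c * comult Q X b)" by (rule sm[OF X])
  show "antipode Q (c \<odot>\<^bsub>Q\<^esub> X) = c \<odot>\<^bsub>Q\<^esub> antipode Q X" by (rule Ssm[OF X])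
  show "comult_left Q (comult Q X) = comult_right Q (comult Q X)"
  proof
    fix t
    show "comult_left Q (comult Q X) t = comult_right Q (comult Q X) t"
    proof (cases "trilinear_form Q t")
      case True
      let ?t = "\<lambda>u v w. t (p u) (p v) (p w)"
      have t: "trilinear_form H ?t" by (rule trilinear_form_comp[OF p_linear True])
      have bl: "bilinear_form Q Q (\<lambda>x y. comult Q x (\<lambda>u v. t u v y))"
        by (intro bilinear_formI lin linear_form_tensor[OF T] k_algebra_image
            trilinear_form_bilinear[OF True] trilinear_formD[OF True])
      have br: "bilinear_form Q Q (\<lambda>x y. comult Q y (\<lambda>u v. t x u v))"
        by (intro bilinear_formI lin linear_form_tensor[OF T] k_algebra_image
            trilinear_form_bilinear[OF True] trilinear_formD[OF True])
      have "comult_left Q (comult Q X) t = comult H x (\<lambda>u v. comult Q (p u) (\<lambda>a b. t a b (p v)))"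
        using True by (simp add: comult_left_def x p_comult_form[OF x(1) bl])
      also have "\<dots> = comult H x (\<lambda>u v. comult H u (\<lambda>a b. ?t a b v))"
        by (rule comult_cong[OF x(1)]) (rule p_comult_form[OF _ trilinear_form_bilinear(1)[OF True p_closed]])
      also have "\<dots> = comult H x (\<lambda>u v. comult H v (\<lambda>a b. ?t u a b))" by (rule coassoc_form[OF x(1) t])
      also have "\<dots> = comult H x (\<lambda>u v. comult Q (p v) (\<lambda>a b. t (p u) a b))"
        by (rule comult_cong[OF x(1)]) (rule p_comult_form[OF _ trilinear_form_bilinear(2)[OF True p_closed], symmetric])
      also have "\<dots> = comult_right Q (comult Q X) t"
        using True by (simp add: comult_right_def x p_comult_form[OF x(1) br])
      finally show ?thesis .
    qed (simp add: comult_left_def comult_right_def)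
  qed
  {
    assume Y: "Y \<in> carrier Q"
    then obtain y where y: "y \<in> carrier H" "Y = p y" by (elim p_rep)
    show "comult Q (X \<oplus>\<^bsub>Q\<^esub> Y) = (\<lambda>b. comult Q X b + comult Q Y b)" by (rule add[OF X Y])
    show "antipode Q (X \<oplus>\<^bsub>Q\<^esub> Y) = antipode Q X \<oplus>\<^bsub>Q\<^esub> antipode Q Y" by (rule Sadd[OF X Y])
    show "counit Q (X \<otimes>\<^bsub>Q\<^esub> Y) = counit Q X * counit Q Y"
      using x y by (simp add: p_mult[symmetric] p_counit counit_mult)
    obtain xs where xs: "set xs \<subseteq> carrier H \<times> carrier H" "comult H x = tensor_sum H H xs"
      by (rule comultE[OF x(1)])
    obtain ys where ys: "set ys \<subseteq> carrier H \<times> carrier H" "comult H y = tensor_sum H H ys"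
      by (rule comultE[OF y(1)])
    let ?p = "map (\<lambda>(u, v). (p u, p v))"
    have pc: "set (?p xs) \<subseteq> carrier Q \<times> carrier Q" "set (?p ys) \<subseteq> carrier Q \<times> carrier Q"
      using xs(1) ys(1) p_closed by auto
    have eq: "[(u \<otimes>\<^bsub>Q\<^esub> u', v \<otimes>\<^bsub>Q\<^esub> v'). (u, v) \<leftarrow> ?p xs, (u', v') \<leftarrow> ?p ys] =
        ?p [(u \<otimes> u', v \<otimes> v'). (u, v) \<leftarrow> xs, (u', v') \<leftarrow> ys]"
      using xs(1) ys(1)
      by (induction xs) (auto simp: p_mult o_def case_prod_unfold)
    have "comult Q (X \<otimes>\<^bsub>Q\<^esub> Y) = tensor_sum Q Q (?p [(u \<otimes> u', v \<otimes> v'). (u, v) \<leftarrow> xs, (u', v') \<leftarrow> ys])"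
      using x y by (simp only: p_mult[symmetric] p_comult m_closed comult_mult xs(2) ys(2)
          tensor_mult_tensor_sum[OF xs(1) ys(1)] tensor_map_tensor_sum[OF p_linear p_linear])
    also have "\<dots> = tensor_mult Q (tensor_sum Q Q (?p xs)) (tensor_sum Q Q (?p ys))"
      by (simp only: Q.tensor_mult_tensor_sum[OF pc] eq)
    also have "\<dots> = tensor_mult Q (comult Q X) (comult Q Y)"
      using x y by (simp only: p_comult xs(2) ys(2) tensor_map_tensor_sum[OF p_linear p_linear])
    finally show "comult Q (X \<otimes>\<^bsub>Q\<^esub> Y) = tensor_mult Q (comult Q X) (comult Q Y)" .
  }
  assume xs: "set xs \<subseteq> carrier Q \<times> carrier Q" "comult Q X = tensor_sum Q Q xs"
  have ev: "(\<Sum>(u, v)\<leftarrow>xs. b u v) = comult H x (\<lambda>u v. b (p u) (p v))" if b: "bilinear_form Q Q b" for b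
    using p_comult_form[OF x(1) b] by (simp add: x(2)[symmetric] xs(2) tensor_sum_apply[OF b])
  have sum: "\<phi> (list_sum Q (map (\<lambda>(u, v). F u v) xs)) = (\<Sum>(u, v)\<leftarrow>xs. \<phi> (F u v))"
    if "linear_form Q \<phi>" "\<And>u v. \<lbrakk>u \<in> carrier Q; v \<in> carrier Q\<rbrakk> \<Longrightarrow> F u v \<in> carrier Q" for \<phi> F
    using xs(1) that(2) by (subst Q.linear_form_list_sum[OF that(1)]) (auto simp: o_def case_prod_unfold)
  have ls: "list_sum Q (map (\<lambda>(u, v). F u v) xs) \<in> carrier Q"
    if "\<And>u v. \<lbrakk>u \<in> carrier Q; v \<in> carrier Q\<rbrakk> \<Longrightarrow> F u v \<in> carrier Q" for F
    using xs(1) that by (intro Q.list_sum_closed) auto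
  show "list_sum Q (map (\<lambda>(u, v). counit Q u \<odot>\<^bsub>Q\<^esub> v) xs) = X"
  proof (rule Q.linear_forms_separate)
    fix \<phi> assume \<phi>: "linear_form Q \<phi>"
    have "\<phi> (list_sum Q (map (\<lambda>(u, v). counit Q u \<odot>\<^bsub>Q\<^esub> v) xs)) = (\<Sum>(u, v)\<leftarrow>xs. \<phi> (counit Q u \<odot>\<^bsub>Q\<^esub> v))"
      by (rule sum[OF \<phi>]) (rule Q.smult_closed)
    also have "\<dots> = (\<Sum>(u, v)\<leftarrow>xs. counit Q u * \<phi> v)"
      using xs(1) by (intro sum_list_pair_cong) (auto simp: linear_form_smult[OF \<phi>])
    also have "\<dots> = comult H x (\<lambda>u v. counit Q (p u) * \<phi> (p v))"
      by (rule ev[OF bilinear_form_product[OF lc \<phi>]])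
    also have "\<dots> = comult H x (\<lambda>u v. counit H u * \<phi> (p v))"
      by (rule comult_cong[OF x(1)]) (simp add: p_counit)
    also have "\<dots> = \<phi> X" using counit_left_form[OF x(1) pull_linear[OF \<phi>]] x(2) by simp
    finally show "\<phi> (list_sum Q (map (\<lambda>(u, v). counit Q u \<odot>\<^bsub>Q\<^esub> v) xs)) = \<phi> X" .
  qed (auto intro!: ls X Q.smult_closed)
  show "list_sum Q (map (\<lambda>(u, v). counit Q v \<odot>\<^bsub>Q\<^esub> u) xs) = X"
  proof (rule Q.linear_forms_separate)
    fix \<phi> assume \<phi>: "linear_form Q \<phi>"
    have "\<phi> (list_sum Q (map (\<lambda>(u, v). counit Q v \<odot>\<^bsub>Q\<^esub> u) xs)) = (\<Sum>(u, v)\<leftarrow>xs. \<phi> (counit Q v \<odot>\<^bsub>Q\<^esub> u))"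
      by (rule sum[OF \<phi>]) (rule Q.smult_closed)
    also have "\<dots> = (\<Sum>(u, v)\<leftarrow>xs. \<phi> u * counit Q v)"
      using xs(1) by (intro sum_list_pair_cong) (auto simp: linear_form_smult[OF \<phi>])
    also have "\<dots> = comult H x (\<lambda>u v. \<phi> (p u) * counit Q (p v))"
      by (rule ev[OF bilinear_form_product[OF \<phi> lc]])
    also have "\<dots> = comult H x (\<lambda>u v. counit H v * \<phi> (p u))"
      by (rule comult_cong[OF x(1)]) (simp add: p_counit)
    also have "\<dots> = \<phi> X" using counit_right_form[OF x(1) pull_linear[OF \<phi>]] x(2) by simp
    finally show "\<phi> (list_sum Q (map (\<lambda>(u, v). counit Q v \<odot>\<^bsub>Q\<^esub> u) xs)) = \<phi> X" .
  qed (auto intro!: ls X Q.smult_closed)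
  have cX: "counit Q X \<odot>\<^bsub>Q\<^esub> \<one>\<^bsub>Q\<^esub> \<in> carrier Q" by (rule Q.smult_closed) simp
  have p1: "\<phi> (counit Q X \<odot>\<^bsub>Q\<^esub> \<one>\<^bsub>Q\<^esub>) = counit H x * \<phi> (p \<one>)" if "linear_form Q \<phi>" for \<phi>
    using that x by (simp add: linear_form_smult p_counit p_one)
  show "list_sum Q (map (\<lambda>(u, v). antipode Q u \<otimes>\<^bsub>Q\<^esub> v) xs) = counit Q X \<odot>\<^bsub>Q\<^esub> \<one>\<^bsub>Q\<^esub>"
  proof (rule Q.linear_forms_separate)
    fix \<phi> assume \<phi>: "linear_form Q \<phi>"
    have "\<phi> (list_sum Q (map (\<lambda>(u, v). antipode Q u \<otimes>\<^bsub>Q\<^esub> v) xs)) = (\<Sum>(u, v)\<leftarrow>xs. \<phi> (antipode Q u \<otimes>\<^bsub>Q\<^esub> v))"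
      by (rule sum[OF \<phi>]) (simp add: Sc)
    also have "\<dots> = comult H x (\<lambda>u v. \<phi> (antipode Q (p u) \<otimes>\<^bsub>Q\<^esub> p v))"
      by (rule ev[OF bilinear_form_comp[OF SQ idQ Q.bilinear_form_mult[OF \<phi>]]])
    also have "\<dots> = comult H x (\<lambda>u v. \<phi> (p (antipode H u \<otimes> v)))"
      by (rule comult_cong[OF x(1)]) (simp add: p_antipode p_mult antipode_closed)
    also have "\<dots> = counit H x * \<phi> (p \<one>)" by (rule antipode_left_form[OF x(1) pull_linear[OF \<phi>]])
    finally show "\<phi> (list_sum Q (map (\<lambda>(u, v). antipode Q u \<otimes>\<^bsub>Q\<^esub> v) xs)) = \<phi> (counit Q X \<odot>\<^bsub>Q\<^esub> \<one>\<^bsub>Q\<^esub>)"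
      using p1[OF \<phi>] by simp
  qed (auto intro!: ls cX Sc)
  show "list_sum Q (map (\<lambda>(u, v). u \<otimes>\<^bsub>Q\<^esub> antipode Q v) xs) = counit Q X \<odot>\<^bsub>Q\<^esub> \<one>\<^bsub>Q\<^esub>"
  proof (rule Q.linear_forms_separate)
    fix \<phi> assume \<phi>: "linear_form Q \<phi>"
    have "\<phi> (list_sum Q (map (\<lambda>(u, v). u \<otimes>\<^bsub>Q\<^esub> antipode Q v) xs)) = (\<Sum>(u, v)\<leftarrow>xs. \<phi> (u \<otimes>\<^bsub>Q\<^esub> antipode Q v))"
      by (rule sum[OF \<phi>]) (simp add: Sc)
    also have "\<dots> = comult H x (\<lambda>u v. \<phi> (p u \<otimes>\<^bsub>Q\<^esub> antipode Q (p v)))"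
      by (rule ev[OF bilinear_form_comp[OF idQ SQ Q.bilinear_form_mult[OF \<phi>]]])
    also have "\<dots> = comult H x (\<lambda>u v. \<phi> (p (u \<otimes> antipode H v)))"
      by (rule comult_cong[OF x(1)]) (simp add: p_antipode p_mult antipode_closed)
    also have "\<dots> = counit H x * \<phi> (p \<one>)" by (rule antipode_right_form[OF x(1) pull_linear[OF \<phi>]])
    finally show "\<phi> (list_sum Q (map (\<lambda>(u, v). u \<otimes>\<^bsub>Q\<^esub> antipode Q v) xs)) = \<phi> (counit Q X \<odot>\<^bsub>Q\<^esub> \<one>\<^bsub>Q\<^esub>)"
      using p1[OF \<phi>] by simp
  qed (auto intro!: ls cX Sc)
qed

lemma transpose_conv:
  assumes "\<phi> \<in> fin_dual_carrier Q" "\<psi> \<in> fin_dual_carrier Q"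
  shows "transpose (conv Q \<phi> \<psi>) = conv H (transpose \<phi>) (transpose \<psi>)"
proof
  fix x
  show "transpose (conv Q \<phi> \<psi>) x = conv H (transpose \<phi>) (transpose \<psi>) x"
  proof (cases "x \<in> carrier H")
    case True
    have "transpose (conv Q \<phi> \<psi>) x = comult Q (p x) (\<lambda>u v. \<phi> u * \<psi> v)"
      using True p_closed[OF True] by (simp add: transpose_def conv_def)
    also have "\<dots> = comult H x (\<lambda>u v. \<phi> (p u) * \<psi> (p v))"
      by (rule p_comult_form[OF True bilinear_form_product]) (use assms fin_dualD(1) in auto)
    also have "\<dots> = conv H (transpose \<phi>) (transpose \<psi>) x"
      unfolding conv_apply[OF True] by (rule comult_cong[OF True]) (simp add: transpose_def)
    finally show ?thesis .
  qed (simp add: transpose_def conv_def)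
qed

end

section \<open>Concrete quotients and their finite-dimensional modules\<close>

lemma (in ideal) coset_eq_iff: "x \<in> carrier R \<Longrightarrow> I +> x = I \<longleftrightarrow> x \<in> I"
  using a_rcos_self[of x] a_rcos_const[of x] by auto

lemma (in ideal) coset_memE:
  assumes "x' \<in> I +> x" obtains i where "i \<in> I" "x' = i \<oplus> x"
  using assms by (auto simp: a_r_coset_def')

lemma quot_alg_simps:
  "carrier (quot_alg R I) = a_rcosets\<^bsub>R\<^esub> I"
  "X \<otimes>\<^bsub>quot_alg R I\<^esub> Y = rcoset_mult R I X Y"
  "\<one>\<^bsub>quot_alg R I\<^esub> = I +>\<^bsub>R\<^esub> \<one>\<^bsub>R\<^esub>"
  "\<zero>\<^bsub>quot_alg R I\<^esub> = I"
  "X \<oplus>\<^bsub>quot_alg R I\<^esub> Y = X <+>\<^bsub>R\<^esub> Y"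
  "c \<odot>\<^bsub>quot_alg R I\<^esub> X = (\<Union>x\<in>X. I +>\<^bsub>R\<^esub> (c \<odot>\<^bsub>R\<^esub> x))"
  by (simp_all add: quot_alg_def FactRing_def ring.defs module.defs)

lemma quot_hopf_simps:
  "carrier (quot_hopf H I) = carrier (quot_alg H I)"
  "X \<otimes>\<^bsub>quot_hopf H I\<^esub> Y = X \<otimes>\<^bsub>quot_alg H I\<^esub> Y"
  "\<one>\<^bsub>quot_hopf H I\<^esub> = \<one>\<^bsub>quot_alg H I\<^esub>"
  "\<zero>\<^bsub>quot_hopf H I\<^esub> = \<zero>\<^bsub>quot_alg H I\<^esub>"
  "X \<oplus>\<^bsub>quot_hopf H I\<^esub> Y = X \<oplus>\<^bsub>quot_alg H I\<^esub> Y"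
  "c \<odot>\<^bsub>quot_hopf H I\<^esub> X = c \<odot>\<^bsub>quot_alg H I\<^esub> X"
  "comult (quot_hopf H I) X = tensor_map (quot_alg H I) (quot_alg H I) (\<lambda>x. I +>\<^bsub>H\<^esub> x) (\<lambda>x. I +>\<^bsub>H\<^esub> x) (comult H (SOME x. x \<in> X))"
  "counit (quot_hopf H I) X = counit H (SOME x. x \<in> X)"
  "antipode (quot_hopf H I) X = I +>\<^bsub>H\<^esub> antipode H (SOME x. x \<in> X)"
  by (simp_all add: quot_hopf_def module.defs hopf.defs)

lemma (in k_algebra) k_epi_quot_alg:
  assumes "ideal I R" shows "k_epi R (quot_alg R I) (\<lambda>x. I +> x)"
proof
  interpret I: ideal I R by fact
  show "carrier (quot_alg R I) = (\<lambda>x. I +> x) ` carrier R"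
    by (auto simp: quot_alg_simps A_RCOSETS_def')
  fix x y c assume x: "x \<in> carrier R"
  show "I +> c \<odot> x = c \<odot>\<^bsub>quot_alg R I\<^esub> (I +> x)"
  proof -
    \<comment> \<open>A scalar multiple of a coset is defined as a union over its members; all of
      them contribute the same coset.\<close>
    have "I +> c \<odot> x' = I +> c \<odot> x" if x': "x' \<in> I +> x" for x'
    proof -
      obtain i where i: "i \<in> I" "x' = i \<oplus> x" using x' by (rule I.coset_memE)
      have "c \<odot> i \<in> I" using k_subspaceD(4)[OF ideal_imp_subspace[OF assms] i(1)] .
      moreover have "c \<odot> x' = c \<odot> i \<oplus> c \<odot> x" using i x I.Icarr by (simp add: smult_r_distr)
      ultimately have "c \<odot> x' \<in> I +> c \<odot> x" by (auto simp: a_r_coset_def')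
      then show ?thesis using a_repr_independence[OF _ _ I.a_subgroup, of "c \<odot> x'" "c \<odot> x"] x by (simp add: smult_closed)
    qed
    moreover have "I +> x \<noteq> {}" using I.a_rcos_self[OF x] by blast
    ultimately have "(\<Union>x'\<in>I +> x. I +> c \<odot> x') = I +> c \<odot> x" by (intro SUP_eq_const)
    then show ?thesis by (simp only: quot_alg_simps)
  qed
  assume y: "y \<in> carrier R"
  show "I +> x \<oplus> y = (I +> x) \<oplus>\<^bsub>quot_alg R I\<^esub> (I +> y)"
    using I.a_rcos_sum[OF x y] by (simp add: quot_alg_simps)
  show "I +> x \<otimes> y = (I +> x) \<otimes>\<^bsub>quot_alg R I\<^esub> (I +> y)"
    using I.rcoset_mult_add[OF x y] by (simp add: quot_alg_simps)
next
  interpret I: ideal I R by fact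
  have "\<zero> \<in> I" by (rule additive_subgroup.zero_closed[OF I.additive_subgroup_axioms])
  then show "I +> \<zero> = \<zero>\<^bsub>quot_alg R I\<^esub>" by (simp add: quot_alg_simps I.coset_eq_iff)
  show "I +> \<one> = \<one>\<^bsub>quot_alg R I\<^esub>" by (simp add: quot_alg_simps)
qed

text \<open>A diagonal matrix entry takes the value 1 at \<one>. Conversely f factors through some
  R/I of finite dimension, and the regular representation on R/I is non-zero because f(\<one>)
  is.\<close>

lemma (in k_algebra) has_nonzero_fd_module_iff:
  "has_nonzero_fd_module R \<longleftrightarrow> (\<exists>f\<in>fin_dual_carrier R. f \<one> \<noteq> 0)"
proof
  assume "has_nonzero_fd_module R"
  then obtain n \<rho> where n: "n > 0" and \<rho>: "\<rho> \<in> Ring.ring_hom R (ring_mat TYPE('k) n ())"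
    and sm: "\<forall>c. \<forall>x\<in>carrier R. \<rho> (c \<odot> x) = c \<cdot>\<^sub>m \<rho> x"
    unfolding has_nonzero_fd_module_def by (elim exE conjE bexE) rule
  have c: "\<rho> x \<in> carrier_mat n n" if "x \<in> carrier R" for x
    using ring_hom_closed[OF \<rho> that] by (simp add: ring_mat_simps)
  let ?r = "\<lambda>i j. zero_ext (carrier R) (\<lambda>x. \<rho> x $$ (i, j))"
  have "coeff_system R {..<n} ?r"
    unfolding coeff_system_def
  proof (intro conjI ballI allI impI)
    fix i j assume "i \<in> {..<n}" "j \<in> {..<n}"
    then have ij: "i < n" "j < n" by auto
    show "linear_form R (?r i j)"
    proof (rule linear_form_zero_ext, rule linear_formI)
      fix x y assume xy: "x \<in> carrier R" "y \<in> carrier R"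
      show "\<rho> (x \<oplus> y) $$ (i, j) = \<rho> x $$ (i, j) + \<rho> y $$ (i, j)"
        using ring_hom_add[OF \<rho> xy] c[OF xy(1)] c[OF xy(2)] ij by (simp add: ring_mat_simps)
    next
      fix a x assume x: "x \<in> carrier R"
      show "\<rho> (a \<odot> x) $$ (i, j) = a * \<rho> x $$ (i, j)"
        using sm x c[OF x] ij by simp
    qed
    fix x y assume xy: "x \<in> carrier R" "y \<in> carrier R"
    have "\<rho> (x \<otimes> y) $$ (i, j) = (\<Sum>k\<in>{..<n}. \<rho> x $$ (i, k) * \<rho> y $$ (k, j))"
      using ring_hom_mult[OF \<rho> xy] c[OF xy(1)] c[OF xy(2)] ij
      by (simp add: ring_mat_simps scalar_prod_def lessThan_atLeast0)
    then show "?r i j (x \<otimes> y) = (\<Sum>k\<in>{..<n}. ?r i k x * ?r k j y)" using xy by simp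
  qed simp_all
  from coeff_system_in_fin_dual[OF this, of 0 0] have "?r 0 0 \<in> fin_dual_carrier R" using n by simp
  moreover have "?r 0 0 \<one> = 1" using ring_hom_one[OF \<rho>] n by (simp add: ring_mat_simps)
  ultimately show "\<exists>f\<in>fin_dual_carrier R. f \<one> \<noteq> 0" by (intro bexI[of _ "?r 0 0"]) simp_all
next
  assume "\<exists>f\<in>fin_dual_carrier R. f \<one> \<noteq> 0"
  then obtain f where f: "f \<in> fin_dual_carrier R" and f1: "f \<one> \<noteq> 0" by auto
  obtain I where I: "ideal I R" "finite_codim R I" "\<And>x. x \<in> I \<Longrightarrow> f x = 0" by (rule fin_dualE[OF f]) blast
  interpret I: ideal I R by fact
  obtain F where F: "finite F" "F \<subseteq> carrier R" "\<forall>x\<in>carrier R. \<exists>s\<in>k_span R F. \<exists>u\<in>I. x = s \<oplus> u"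
    using I(2) unfolding finite_codim_def by (elim exE conjE) rule
  from dual_basis_mod_subspace[OF F(1,2) ideal_imp_subspace[OF I(1)] F(3)] obtain n :: nat and e \<phi> where
    A: "\<forall>i<n. e i \<in> carrier R \<and> linear_form R (\<phi> i) \<and> (\<forall>u\<in>I. \<phi> i u = 0)"
    and B: "\<forall>i<n. \<forall>j<n. \<phi> i (e j) = (if i = j then 1 else 0)"
    and C: "\<forall>f. linear_form R f \<longrightarrow> (\<forall>u\<in>I. f u = 0) \<longrightarrow>
        (\<forall>x\<in>carrier R. f x = (\<Sum>i<n. \<phi> i x * f (e i)))"
    by (elim exE conjE) rule
  have e: "e i \<in> carrier R" and \<phi>: "linear_form R (\<phi> i)" and van: "\<And>u. u \<in> I \<Longrightarrow> \<phi> i u = 0" if "i < n" for i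
    using A that by auto
  have rep: "g x = (\<Sum>i<n. \<phi> i x * g (e i))"
    if "linear_form R g" "\<And>u. u \<in> I \<Longrightarrow> g u = 0" "x \<in> carrier R" for g x
    using C[rule_format, OF that(1) _ that(3)] that(2) by blast
  \<comment> \<open>In dimension zero the expansion of f(\<one>) would be an empty sum.\<close>
  have n: "n > 0" using rep[OF fin_dualD(1)[OF f] I(3), of \<one>] f1 by (cases n) auto
  let ?\<rho> = "\<lambda>x. mat n n (\<lambda>(i, j). \<phi> i (x \<otimes> e j))"
  have "?\<rho> \<in> Ring.ring_hom R (ring_mat TYPE('k) n ())"
  proof (rule ring_hom_memI)
    fix x y assume x: "x \<in> carrier R" and y: "y \<in> carrier R"
    have "\<phi> i (x \<otimes> y \<otimes> e j) = (\<Sum>k<n. \<phi> i (x \<otimes> e k) * \<phi> k (y \<otimes> e j))" if ij: "i < n" "j < n" for i j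
    proof -
      have "\<phi> i (x \<otimes> (y \<otimes> e j)) = (\<Sum>k<n. \<phi> k (y \<otimes> e j) * \<phi> i (x \<otimes> e k))"
        by (rule rep[OF linear_form_mult_left[OF \<phi>[OF ij(1)] x]]) (use van[OF ij(1)] I.I_l_closed x y e[OF ij(2)] in auto)
      then show ?thesis using x y e[OF ij(2)] by (simp add: m_assoc mult.commute)
    qed
    then show "?\<rho> (x \<otimes> y) = ?\<rho> x \<otimes>\<^bsub>ring_mat TYPE('k) n ()\<^esub> ?\<rho> y"
      by (intro eq_matI) (auto simp: ring_mat_simps scalar_prod_def lessThan_atLeast0)
    show "?\<rho> (x \<oplus> y) = ?\<rho> x \<oplus>\<^bsub>ring_mat TYPE('k) n ()\<^esub> ?\<rho> y"
      using x y e linear_form_add[OF \<phi>] by (intro eq_matI) (auto simp: ring_mat_simps l_distr)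
  next
    show "?\<rho> \<one> = \<one>\<^bsub>ring_mat TYPE('k) n ()\<^esub>"
      using B e by (intro eq_matI) (auto simp: ring_mat_simps)
  qed (simp add: ring_mat_simps)
  moreover have "?\<rho> (c \<odot> x) = c \<cdot>\<^sub>m ?\<rho> x" if "x \<in> carrier R" for c x
    using that e linear_form_smult[OF \<phi>] by (intro eq_matI) (auto simp: smult_mult_left)
  ultimately show "has_nonzero_fd_module R" unfolding has_nonzero_fd_module_def
    using n by (intro exI[of _ n] conjI bexI[of _ ?\<rho>] allI ballI)
qed

section \<open>The group of characters\<close>

lemma Alg_group_simps [simp]:
  "carrier (Alg_group H) = algebra_maps H"
  "f \<otimes>\<^bsub>Alg_group H\<^esub> g = conv H f g"
  "\<one>\<^bsub>Alg_group H\<^esub> = zero_ext (carrier H) (counit H)"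
  by (simp_all add: Alg_group_def)

lemma algebra_mapsD:
  assumes "\<kappa> \<in> algebra_maps R"
  shows "linear_form R \<kappa>" "x \<notin> carrier R \<Longrightarrow> \<kappa> x = 0" "\<kappa> \<one>\<^bsub>R\<^esub> = 1"
    "\<lbrakk>x \<in> carrier R; y \<in> carrier R\<rbrakk> \<Longrightarrow> \<kappa> (x \<otimes>\<^bsub>R\<^esub> y) = \<kappa> x * \<kappa> y"
  using assms by (auto simp: algebra_maps_def)

context hopf_algebra
begin

text \<open>Evaluates \<epsilon>(S(x_1)) \<epsilon>(x_2) = \<epsilon>(S(x_1) x_2) by the counit
  axiom and by the antipode axiom.\<close>

lemma counit_antipode: "x \<in> carrier H \<Longrightarrow> counit H (antipode H x) = counit H x"
proof -
  assume x: "x \<in> carrier H"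
  have "comult H x (\<lambda>u v. counit H v * counit H (antipode H u)) = comult H x (\<lambda>u v. counit H (antipode H u \<otimes> v))"
    by (rule comult_cong[OF x]) (simp add: counit_mult antipode_closed)
  then show ?thesis
    using antipode_left_form[OF x counit_linear] counit_right_form[OF x linear_form_antipode[OF counit_linear]]
    by (simp add: counit_one)
qed

lemma conv_algebra_maps:
  assumes \<kappa>: "\<kappa> \<in> algebra_maps H" and \<gamma>: "\<gamma> \<in> algebra_maps H"
  shows "conv H \<kappa> \<gamma> \<in> algebra_maps H"
proof -
  note K = algebra_mapsD[OF \<kappa>] and G = algebra_mapsD[OF \<gamma>]
  have bil: "bilinear_form H H (\<lambda>u v. \<kappa> u * \<gamma> v)" by (rule bilinear_form_product[OF K(1) G(1)])
  have "conv H \<kappa> \<gamma> (x \<otimes> y) = conv H \<kappa> \<gamma> x * conv H \<kappa> \<gamma> y" if x: "x \<in> carrier H" and y: "y \<in> carrier H" for x y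
  proof -
    have "conv H \<kappa> \<gamma> (x \<otimes> y) = comult H x (\<lambda>u v. comult H y (\<lambda>u' v'. \<kappa> (u \<otimes> u') * \<gamma> (v \<otimes> v')))"
      using x y by (simp add: conv_apply comult_mult_form[OF x y bil])
    also have "\<dots> = comult H x (\<lambda>u v. conv H \<kappa> \<gamma> y * (\<kappa> u * \<gamma> v))"
    proof (rule comult_cong[OF x])
      fix u v assume u: "u \<in> carrier H" and v: "v \<in> carrier H"
      have "comult H y (\<lambda>u' v'. \<kappa> (u \<otimes> u') * \<gamma> (v \<otimes> v')) = comult H y (\<lambda>u' v'. \<kappa> u * \<gamma> v * (\<kappa> u' * \<gamma> v'))"
        by (rule comult_cong[OF y]) (simp add: K(4) G(4) u v mult_ac)
      also have "\<dots> = \<kappa> u * \<gamma> v * conv H \<kappa> \<gamma> y"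
        by (simp add: tensor_times[OF comult_closed[OF y] bil] conv_apply y)
      finally show "comult H y (\<lambda>u' v'. \<kappa> (u \<otimes> u') * \<gamma> (v \<otimes> v')) = conv H \<kappa> \<gamma> y * (\<kappa> u * \<gamma> v)"
        by (simp add: mult_ac)
    qed
    also have "\<dots> = conv H \<kappa> \<gamma> y * conv H \<kappa> \<gamma> x"
      by (simp add: tensor_times[OF comult_closed[OF x] bil] conv_apply x)
    finally show ?thesis by (simp add: mult.commute)
  qed
  moreover have "conv H \<kappa> \<gamma> \<one> = 1" by (simp add: conv_apply comult_one_form[OF bil] K(3) G(3))
  ultimately show ?thesis
    by (simp add: algebra_maps_def linear_form_conv) (simp add: conv_def)
qed

definition char_inv :: "('a \<Rightarrow> 'k) \<Rightarrow> 'a \<Rightarrow> 'k" where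
  "char_inv \<kappa> = zero_ext (carrier H) (\<lambda>x. \<kappa> (antipode H x))"

lemma char_inv:
  assumes \<kappa>: "\<kappa> \<in> algebra_maps H"
  shows "char_inv \<kappa> \<in> algebra_maps H" "conv H (char_inv \<kappa>) \<kappa> = zero_ext (carrier H) (counit H)"
proof -
  note K = algebra_mapsD[OF \<kappa>]
  show "char_inv \<kappa> \<in> algebra_maps H"
    unfolding char_inv_def algebra_maps_def
    using linear_form_zero_ext[OF linear_form_antipode[OF K(1)]]
    by (simp add: antipode_one K(3) antipode_mult antipode_closed K(4) mult.commute)
  show "conv H (char_inv \<kappa>) \<kappa> = zero_ext (carrier H) (counit H)"
  proof
    fix x
    show "conv H (char_inv \<kappa>) \<kappa> x = zero_ext (carrier H) (counit H) x"
    proof (cases "x \<in> carrier H")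
      case True
      have "conv H (char_inv \<kappa>) \<kappa> x = comult H x (\<lambda>u v. \<kappa> (antipode H u \<otimes> v))"
        unfolding conv_apply[OF True] by (rule comult_cong[OF True]) (simp add: char_inv_def K(4) antipode_closed)
      then show ?thesis using True antipode_left_form[OF True K(1)] by (simp add: K(3))
    qed (simp add: conv_def)
  qed
qed

lemma counit_algebra_map: "zero_ext (carrier H) (counit H) \<in> algebra_maps H"
  using counit_linear by (simp add: algebra_maps_def linear_form_zero_ext counit_one counit_mult)

lemma group_Alg_group: "group (Alg_group H)"
proof (rule groupI)
  fix \<kappa> assume "\<kappa> \<in> carrier (Alg_group H)"
  then show "\<exists>\<gamma>\<in>carrier (Alg_group H). \<gamma> \<otimes>\<^bsub>Alg_group H\<^esub> \<kappa> = \<one>\<^bsub>Alg_group H\<^esub>"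
    using char_inv by (intro bexI[of _ "char_inv \<kappa>"]) auto
qed (simp_all add: conv_algebra_maps counit_algebra_map conv_assoc conv_counit algebra_mapsD)

lemma inv_Alg_group: "\<kappa> \<in> algebra_maps H \<Longrightarrow> inv\<^bsub>Alg_group H\<^esub> \<kappa> = char_inv \<kappa>"
  using group.inv_equality[OF group_Alg_group, of "char_inv \<kappa>" \<kappa>] char_inv by simp

end

section \<open>Fibres over a central Hopf subalgebra\<close>

locale central_hopf_sub = hopf_sub +
  assumes central: "\<lbrakk>a \<in> A; x \<in> carrier H\<rbrakk> \<Longrightarrow> a \<otimes> x = x \<otimes> a"
begin

lemma antipode_antipode: "a \<in> A \<Longrightarrow> antipode H (antipode H a) = a"
  by (rule antipode_involutive) (auto simp: central sub_carrier)

text \<open>The square of the antipode is the identity on the commutative A, so a is the antipode of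
  \<open>antipode H a\<close>, which lies in A. This is the surjectivity required of a Hopf
  subalgebra.\<close>

lemma HA_hopf_algebra: "hopf_algebra HA"
proof (rule sub_hopf_algebra, rule subsetI)
  fix a assume a: "a \<in> A"
  show "a \<in> antipode H ` A"
    using antipode_antipode[OF a] sub_antipode[OF a] by (rule image_eqI[OF sym])
qed

lemma antipode_inv_sub: "a \<in> A \<Longrightarrow> antipode_inv a = antipode H a"
  by (rule antipode_inv_eq) (simp_all add: antipode_antipode sub_carrier antipode_closed)

abbreviation \<epsilon>A where "\<epsilon>A \<equiv> zero_ext A (counit H)"

lemma sub_form_add: "\<lbrakk>linear_form HA \<kappa>; a \<in> A; b \<in> A\<rbrakk> \<Longrightarrow> \<kappa> (a \<oplus> b) = \<kappa> a + \<kappa> b"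
  using linear_form_add[of HA \<kappa> a b] by simp

lemma sub_form_smult: "\<lbrakk>linear_form HA \<kappa>; a \<in> A\<rbrakk> \<Longrightarrow> \<kappa> (c \<odot> a) = c * \<kappa> a"
  using linear_form_smult[of HA \<kappa> a c] by simp

lemma algebra_map_sub:
  assumes "\<kappa> \<in> algebra_maps HA"
  shows "linear_form HA \<kappa>" "a \<notin> A \<Longrightarrow> \<kappa> a = 0" "\<kappa> \<one> = 1" "\<lbrakk>a \<in> A; b \<in> A\<rbrakk> \<Longrightarrow> \<kappa> (a \<otimes> b) = \<kappa> a * \<kappa> b"
  using algebra_mapsD[OF assms] by simp_all

lemma counit_algebra_map_sub: "\<epsilon>A \<in> algebra_maps HA"
proof -
  have "zero_ext (carrier HA) (counit HA) = \<epsilon>A" by (rule ext) (simp add: zero_ext_def)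
  then show ?thesis using hopf_algebra.counit_algebra_map[OF HA_hopf_algebra] by simp
qed

text \<open>Sums of products h m are stable under left multiplication by construction; centrality of
  A rewrites (h m) x as (h x) m and gives the other side.\<close>

lemma fibre_ideal_ideal:
  assumes \<kappa>: "linear_form HA \<kappa>"
  shows "ideal (fibre_ideal H A \<kappa>) H"
proof -
  let ?M = "{a \<in> A. \<kappa> a = 0}"
  let ?I = "carrier H \<cdot>\<^bsub>H\<^esub> ?M"
  have cl: "s \<in> carrier H" if "s \<in> ?I" for s
    using that by (induction rule: ideal_prod.induct) (auto simp: sub_carrier)
  have k0: "\<kappa> \<zero> = 0" using k_algebra.linear_form_at_zero[OF k_algebra_sub \<kappa>] by simp
  have "ideal ?I H"
  proof (rule idealI[OF ring_axioms])
    show "subgroup ?I (add_monoid H)"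
    proof (rule add.subgroupI)
      show "?I \<subseteq> carrier H" using cl by auto
      have "\<zero> \<otimes> \<zero> \<in> ?I" by (rule ideal_prod.prod) (use k_subspaceD(2)[OF sub_subspace] k0 in auto)
      then show "?I \<noteq> {}" by blast
      show "\<ominus> s \<in> ?I" if "s \<in> ?I" for s
        using that
      proof (induction rule: ideal_prod.induct)
        case (prod i j)
        have "\<ominus> i \<otimes> j \<in> ?I" by (rule ideal_prod.prod) (use prod in auto)
        then show ?case using prod by (simp add: l_minus sub_carrier)
      next
        case (sum s1 s2)
        then show ?case using ideal_prod.sum[of "\<ominus> s1" H "carrier H" ?M "\<ominus> s2"] cl by (simp add: minus_add)
      qed
      show "s \<oplus> t \<in> ?I" if "s \<in> ?I" "t \<in> ?I" for s t using that by (rule ideal_prod.sum)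
    qed
    show "x \<otimes> s \<in> ?I" if "s \<in> ?I" and x: "x \<in> carrier H" for s x
      using that(1)
    proof (induction rule: ideal_prod.induct)
      case (prod i j)
      have "(x \<otimes> i) \<otimes> j \<in> ?I" by (rule ideal_prod.prod) (use prod x in auto)
      then show ?case using prod x by (simp add: m_assoc sub_carrier)
    next
      case (sum s1 s2)
      then show ?case using ideal_prod.sum[of "x \<otimes> s1" H "carrier H" ?M "x \<otimes> s2"] cl x by (simp add: r_distr)
    qed
    show "s \<otimes> x \<in> ?I" if "s \<in> ?I" and x: "x \<in> carrier H" for s x
      using that(1)
    proof (induction rule: ideal_prod.induct)
      case (prod i j)
      have "(i \<otimes> x) \<otimes> j \<in> ?I" by (rule ideal_prod.prod) (use prod x in auto)
      then show ?case using prod x central[of j x] by (simp add: m_assoc sub_carrier)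
    next
      case (sum s1 s2)
      then show ?case using ideal_prod.sum[of "s1 \<otimes> x" H "carrier H" ?M "s2 \<otimes> x"] cl x by (simp add: l_distr)
    qed
  qed
  then show ?thesis by (simp add: fibre_ideal_def)
qed

text \<open>The element a - \<kappa>(a) \<one> lies in the kernel of \<kappa>. Modulo I_\<kappa>, A
  thus acts through \<kappa>.\<close>

lemma shift_in_fibre_ideal:
  assumes \<kappa>: "linear_form HA \<kappa>" "\<kappa> \<one> = 1" and x: "x \<in> carrier H" and a: "a \<in> A"
  shows "x \<otimes> a \<ominus> \<kappa> a \<odot> x \<in> fibre_ideal H A \<kappa>"
proof -
  let ?b = "a \<oplus> (- \<kappa> a) \<odot> \<one>"
  have b: "?b \<in> A" "\<kappa> ?b = 0"
    using a sub_one k_subspaceD(3,4)[OF sub_subspace] by (auto simp: sub_form_add[OF \<kappa>(1)] sub_form_smult[OF \<kappa>(1)] \<kappa>(2))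
  have "x \<otimes> ?b \<in> fibre_ideal H A \<kappa>"
    unfolding fibre_ideal_def by (rule ideal_prod.prod) (use x b in auto)
  moreover have "x \<otimes> ?b = x \<otimes> a \<ominus> \<kappa> a \<odot> x"
  proof -
    have "(- \<kappa> a) \<odot> x = \<ominus> (\<kappa> a \<odot> x)"
      using smult_assoc[of x "- 1" "\<kappa> a"] smult_minus_one[of "\<kappa> a \<odot> x"] x by (simp add: smult_closed)
    then show ?thesis using x a by (simp add: r_distr sub_carrier smult_closed smult_mult_right minus_eq)
  qed
  ultimately show ?thesis by simp
qed

text \<open>Testing on x (a - \<kappa>(a) \<one>) gives one direction; the other holds on the
  generators x a with \<kappa>(a) = 0 and extends additively.\<close>

lemma vanish_fibre_ideal_iff:
  assumes f: "linear_form H f" and \<kappa>: "linear_form HA \<kappa>" "\<kappa> \<one> = 1"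
  shows "(\<forall>x\<in>fibre_ideal H A \<kappa>. f x = 0) \<longleftrightarrow> (\<forall>x\<in>carrier H. \<forall>a\<in>A. f (x \<otimes> a) = \<kappa> a * f x)"
proof (intro iffI ballI)
  fix x a assume 0: "\<forall>x\<in>fibre_ideal H A \<kappa>. f x = 0" and x: "x \<in> carrier H" and a: "a \<in> A"
  have "f (x \<otimes> a \<ominus> \<kappa> a \<odot> x) = 0" using 0 shift_in_fibre_ideal[OF \<kappa> x a] by blast
  then show "f (x \<otimes> a) = \<kappa> a * f x"
    using x a by (simp add: linear_form_diff[OF f] linear_form_smult[OF f] smult_closed sub_carrier)
next
  fix x assume eq: "\<forall>x\<in>carrier H. \<forall>a\<in>A. f (x \<otimes> a) = \<kappa> a * f x" and x: "x \<in> fibre_ideal H A \<kappa>"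
  have "x \<in> carrier H \<and> f x = 0"
    using x unfolding fibre_ideal_def
    by (induction rule: ideal_prod.induct) (auto simp: eq sub_carrier linear_form_add[OF f])
  then show "f x = 0" by blast
qed

section \<open>The spaces C(\<kappa>) as eigenspaces\<close>

lemma fibre_coalg_eq:
  assumes \<kappa>: "\<kappa> \<in> algebra_maps HA"
  shows "fibre_coalg H A \<kappa> = {f \<in> fin_dual_carrier H. \<forall>x\<in>carrier H. \<forall>a\<in>A. f (x \<otimes> a) = \<kappa> a * f x}"
proof -
  let ?I = "fibre_ideal H A \<kappa>"
  note K = algebra_map_sub[OF \<kappa>]
  have I: "ideal ?I H" by (rule fibre_ideal_ideal[OF K(1)])
  interpret I: ideal ?I H by fact
  interpret E: k_epi H "quot_alg H ?I" "\<lambda>x. ?I +> x" by (rule k_epi_quot_alg[OF I])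
  have tr: "quot_transpose H ?I = E.transpose" by (rule ext) (simp add: quot_transpose_def E.transpose_def)
  have "fibre_coalg H A \<kappa> = {f \<in> fin_dual_carrier H. \<forall>x\<in>?I. f x = 0}"
    unfolding fibre_coalg_def fibre_alg_def tr
    by (rule E.transpose_image[OF I]) (simp add: quot_alg_simps I.coset_eq_iff)
  also have "\<dots> = {f \<in> fin_dual_carrier H. \<forall>x\<in>carrier H. \<forall>a\<in>A. f (x \<otimes> a) = \<kappa> a * f x}"
    using vanish_fibre_ideal_iff[OF fin_dualD(1) K(1,3)] by (intro Collect_cong conj_cong refl) blast
  finally show ?thesis .
qed

text \<open>A non-zero module is detected by a functional that is non-zero at the unit, and the
  transpose of the projection preserves the value at the unit.\<close>

lemma fd_module_iff:
  assumes \<kappa>: "\<kappa> \<in> algebra_maps HA"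
  shows "has_nonzero_fd_module (fibre_alg H A \<kappa>) \<longleftrightarrow> (\<exists>f\<in>fibre_coalg H A \<kappa>. f \<one> \<noteq> 0)"
proof -
  let ?I = "fibre_ideal H A \<kappa>"
  have I: "ideal ?I H" by (rule fibre_ideal_ideal[OF algebra_map_sub(1)[OF \<kappa>]])
  interpret E: k_epi H "quot_alg H ?I" "\<lambda>x. ?I +> x" by (rule k_epi_quot_alg[OF I])
  have "has_nonzero_fd_module (fibre_alg H A \<kappa>) \<longleftrightarrow> (\<exists>\<phi>\<in>fin_dual_carrier (quot_alg H ?I). \<phi> \<one>\<^bsub>quot_alg H ?I\<^esub> \<noteq> 0)"
    unfolding fibre_alg_def by (rule E.Q.has_nonzero_fd_module_iff)
  also have "\<dots> \<longleftrightarrow> (\<exists>f\<in>fibre_coalg H A \<kappa>. f \<one> \<noteq> 0)"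
    by (simp add: fibre_coalg_def fibre_alg_def quot_transpose_def quot_alg_simps)
  finally show ?thesis .
qed

lemma fibre_coalgI:
  assumes "\<kappa> \<in> algebra_maps HA" "f \<in> fin_dual_carrier H"
    and "\<And>x a. \<lbrakk>x \<in> carrier H; a \<in> A\<rbrakk> \<Longrightarrow> f (x \<otimes> a) = \<kappa> a * f x"
  shows "f \<in> fibre_coalg H A \<kappa>"
  using assms by (simp add: fibre_coalg_eq)

lemma fibre_coalgD:
  assumes "f \<in> fibre_coalg H A \<kappa>" "\<kappa> \<in> algebra_maps HA"
  shows "f \<in> fin_dual_carrier H" "\<lbrakk>x \<in> carrier H; a \<in> A\<rbrakk> \<Longrightarrow> f (x \<otimes> a) = \<kappa> a * f x" "linear_form H f"
    "x \<notin> carrier H \<Longrightarrow> f x = 0"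
  using assms fin_dualD[of f H] by (auto simp: fibre_coalg_eq)

lemma fibre_coalg_restrict:
  assumes "f \<in> fibre_coalg H A \<kappa>" "\<kappa> \<in> algebra_maps HA" "a \<in> A"
  shows "f a = f \<one> * \<kappa> a"
  using fibre_coalgD(2)[OF assms(1,2) one_closed assms(3)] assms(3) by (simp add: sub_carrier mult.commute)

lemma fibre_coalg_plus:
  assumes \<kappa>: "\<kappa> \<in> algebra_maps HA" and "f \<in> fibre_coalg H A \<kappa>" "g \<in> fibre_coalg H A \<kappa>"
  shows "(\<lambda>x. f x + g x) \<in> fibre_coalg H A \<kappa>"
  using assms fin_dual_plus by (auto simp: fibre_coalg_eq algebra_simps)

lemma fibre_coalg_times:
  assumes \<kappa>: "\<kappa> \<in> algebra_maps HA" and "f \<in> fibre_coalg H A \<kappa>"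
  shows "(\<lambda>x. c * f x) \<in> fibre_coalg H A \<kappa>"
  using assms fin_dual_times by (auto simp: fibre_coalg_eq algebra_simps)

lemma fibre_coalg_zero: "\<kappa> \<in> algebra_maps HA \<Longrightarrow> (\<lambda>x. 0) \<in> fibre_coalg H A \<kappa>"
  using fin_dual_zero by (simp add: fibre_coalg_eq)

text \<open>Because the coproduct of a lies in A \<otimes> A, the value at x a is \<Sum> f(x_1 a_1)
  g(x_2 a_2); the two eigenvalues come out as \<Sum> \<kappa>(a_1) \<gamma>(a_2), the convolution of
  the characters.\<close>

lemma fibre_coalg_conv:
  assumes \<kappa>: "\<kappa> \<in> algebra_maps HA" and \<gamma>: "\<gamma> \<in> algebra_maps HA"
    and f: "f \<in> fibre_coalg H A \<kappa>" and g: "g \<in> fibre_coalg H A \<gamma>"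
  shows "conv H f g \<in> fibre_coalg H A (conv HA \<kappa> \<gamma>)"
proof (rule fibre_coalgI)
  note F = fibre_coalgD[OF f \<kappa>] and G = fibre_coalgD[OF g \<gamma>]
  show "conv HA \<kappa> \<gamma> \<in> algebra_maps HA"
    by (rule hopf_algebra.conv_algebra_maps[OF HA_hopf_algebra \<kappa> \<gamma>])
  show "conv H f g \<in> fin_dual_carrier H" by (rule conv_fin_dual[OF F(1) G(1)])
  fix x a assume x: "x \<in> carrier H" and a: "a \<in> A"
  have ac: "a \<in> carrier H" using a by (rule sub_carrier)
  have bil: "bilinear_form H H (\<lambda>u v. f u * g v)" by (rule bilinear_form_product[OF F(3) G(3)])
  have bkg: "bilinear_form HA HA (\<lambda>u v. \<kappa> u * \<gamma> v)"
    by (rule bilinear_form_product[OF algebra_map_sub(1)[OF \<kappa>] algebra_map_sub(1)[OF \<gamma>]])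
  obtain as where as: "set as \<subseteq> A \<times> A" "comult HA a = tensor_sum HA HA as" "comult H a = tensor_sum H H as"
    by (rule comult_subE[OF a])
  have kg: "conv HA \<kappa> \<gamma> a = (\<Sum>(u, v)\<leftarrow>as. \<kappa> u * \<gamma> v)"
    using a by (simp add: conv_def zero_ext_def as(2) tensor_sum_apply[OF bkg])
  have "conv H f g (x \<otimes> a) = comult H x (\<lambda>u v. comult H a (\<lambda>u' v'. f (u \<otimes> u') * g (v \<otimes> v')))"
    using x ac by (simp add: conv_apply comult_mult_form[OF x ac bil])
  also have "\<dots> = comult H x (\<lambda>u v. conv HA \<kappa> \<gamma> a * (f u * g v))"
  proof (rule comult_cong[OF x])
    fix u v assume u: "u \<in> carrier H" and v: "v \<in> carrier H"
    have "comult H a (\<lambda>u' v'. f (u \<otimes> u') * g (v \<otimes> v')) = (\<Sum>(u', v')\<leftarrow>as. f (u \<otimes> u') * g (v \<otimes> v'))"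
      unfolding as(3)
      by (rule tensor_sum_apply[OF bilinear_form_product[OF linear_form_mult_left[OF F(3) u] linear_form_mult_left[OF G(3) v]]])
    also have "\<dots> = (\<Sum>(u', v')\<leftarrow>as. f u * g v * (\<kappa> u' * \<gamma> v'))"
      using as(1) u v F(2) G(2) by (intro sum_list_pair_cong) (auto simp: mult_ac)
    also have "\<dots> = f u * g v * conv HA \<kappa> \<gamma> a" by (simp only: kg sum_list_pair_times)
    finally show "comult H a (\<lambda>u' v'. f (u \<otimes> u') * g (v \<otimes> v')) = conv HA \<kappa> \<gamma> a * (f u * g v)"
      by (simp only: mult.commute)
  qed
  also have "\<dots> = conv HA \<kappa> \<gamma> a * conv H f g x"
    by (simp add: tensor_times[OF comult_closed[OF x] bil] conv_apply x)
  finally show "conv H f g (x \<otimes> a) = conv HA \<kappa> \<gamma> a * conv H f g x" .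
qed

lemma fibre_coalg_counit: "zero_ext (carrier H) (counit H) \<in> fibre_coalg H A \<epsilon>A"
  by (rule fibre_coalgI[OF counit_algebra_map_sub counit_fin_dual])
    (simp add: sub_carrier counit_mult zero_ext_def mult.commute)

lemma char_inv_sub:
  assumes "\<kappa> \<in> algebra_maps HA"
  shows "inv\<^bsub>Alg_group HA\<^esub> \<kappa> = zero_ext A (\<lambda>a. \<kappa> (antipode H a))"
    and "zero_ext A (\<lambda>a. \<kappa> (antipode H a)) \<in> algebra_maps HA"
  using hopf_algebra.inv_Alg_group[OF HA_hopf_algebra assms] hopf_algebra.char_inv(1)[OF HA_hopf_algebra assms]
  by (simp_all add: hopf_algebra.char_inv_def[OF HA_hopf_algebra])

text \<open>By centrality S(x a) = S(x) S(a), so the eigenvalue becomes \<kappa>(S(a)). The inverse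
  antipode agrees with S on A and shifts the degree in the same way, which later gives bijectivity
  on the sum of the fibres.\<close>

lemma fibre_coalg_antipode:
  assumes \<kappa>: "\<kappa> \<in> algebra_maps HA" and f: "f \<in> fibre_coalg H A \<kappa>"
  shows "zero_ext (carrier H) (\<lambda>x. f (antipode H x)) \<in> fibre_coalg H A (inv\<^bsub>Alg_group HA\<^esub> \<kappa>)"
    and "zero_ext (carrier H) (\<lambda>x. f (antipode_inv x)) \<in> fibre_coalg H A (inv\<^bsub>Alg_group HA\<^esub> \<kappa>)"
proof -
  note F = fibre_coalgD[OF f \<kappa>]
  have "f (antipode H (x \<otimes> a)) = \<kappa> (antipode H a) * f (antipode H x)" if x: "x \<in> carrier H" and a: "a \<in> A" for x a
    using x a by (simp add: antipode_mult sub_carrier central[OF sub_antipode[OF a]] antipode_closed F(2) sub_antipode)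
  then show "zero_ext (carrier H) (\<lambda>x. f (antipode H x)) \<in> fibre_coalg H A (inv\<^bsub>Alg_group HA\<^esub> \<kappa>)"
    unfolding char_inv_sub(1)[OF \<kappa>]
    by (intro fibre_coalgI char_inv_sub(2)[OF \<kappa>] antipode_fin_dual_closed[OF F(1)]) (simp add: sub_carrier zero_ext_def)
  have "f (antipode_inv (x \<otimes> a)) = \<kappa> (antipode H a) * f (antipode_inv x)" if x: "x \<in> carrier H" and a: "a \<in> A" for x a
    using x a by (simp add: antipode_inv_mult sub_carrier antipode_inv_sub central[OF sub_antipode[OF a]] antipode_inv F(2) sub_antipode)
  then show "zero_ext (carrier H) (\<lambda>x. f (antipode_inv x)) \<in> fibre_coalg H A (inv\<^bsub>Alg_group HA\<^esub> \<kappa>)"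
    unfolding char_inv_sub(1)[OF \<kappa>]
    by (intro fibre_coalgI char_inv_sub(2)[OF \<kappa>] antipode_inv_fin_dual_closed[OF F(1)]) (simp add: sub_carrier zero_ext_def)
qed

lemma fibre_coalg_unital:
  assumes \<kappa>: "\<kappa> \<in> algebra_maps HA" and f: "f \<in> fibre_coalg H A \<kappa>" and "f \<noteq> (\<lambda>x. 0)"
  obtains g where "g \<in> fibre_coalg H A \<kappa>" "g \<one> = 1"
proof -
  note F = fibre_coalgD[OF f \<kappa>]
  obtain x where fx: "f x \<noteq> 0" using assms(3) by auto
  then have x: "x \<in> carrier H" using F(4) by blast
  obtain I where I: "ideal I H" "finite_codim H I" "\<And>x. x \<in> I \<Longrightarrow> f x = 0" by (rule fin_dualE[OF F(1)]) blast
  interpret I: ideal I H by fact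
  \<comment> \<open>Translation on the left leaves the eigenvalue equation on the right untouched,
    and the translate still vanishes on I; the factor normalises the value at \<one>.\<close>
  let ?g = "zero_ext (carrier H) (\<lambda>y. inverse (f x) * f (x \<otimes> y))"
  have "?g \<in> fin_dual_carrier H"
    by (rule fin_dualI[OF linear_form_zero_ext[OF linear_form_times[OF linear_form_mult_left[OF F(3) x]]] _ I(1,2)])
      (use I(3) I.I_l_closed x I.Icarr in auto)
  then have "?g \<in> fibre_coalg H A \<kappa>"
    by (rule fibre_coalgI[OF \<kappa>]) (simp add: sub_carrier x F(2) m_assoc[symmetric])
  moreover have "?g \<one> = 1" using x fx by simp
  ultimately show thesis by (rule that)
qed

text \<open>After enlarging the ideal killed by f by I_\<kappa>, the entries of the representation
  on the quotient vanish on I_\<kappa>. They therefore lie in C(\<kappa>), and so do both legs of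
  the coproduct. S will be C(\<kappa>) itself or the sum of all fibres.\<close>

lemma fibre_coalg_comult:
  assumes \<kappa>: "\<kappa> \<in> algebra_maps HA" and f: "f \<in> fibre_coalg H A \<kappa>" and S: "fibre_coalg H A \<kappa> \<subseteq> S"
    and Sc: "S \<subseteq> fin_dual_carrier H"
  shows "comult (fin_dual H) f \<in> tensor_map (fin_dual H) (fin_dual H) (\<lambda>y. y) (\<lambda>y. y) `
    tensor_space (sub_hopf (fin_dual H) S) (sub_hopf (fin_dual H) S)"
proof -
  let ?D = "fin_dual H" and ?K = "sub_hopf (fin_dual H) S"
  note F = fibre_coalgD[OF f \<kappa>] and K = algebra_map_sub[OF \<kappa>]
  have f0: "f x = 0" if "x \<in> fibre_ideal H A \<kappa>" for x
    using vanish_fibre_ideal_iff[OF F(3) K(1,3)] F(2) that by blast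
  obtain J where J: "ideal J H" "finite_codim H J" "fibre_ideal H A \<kappa> \<subseteq> J" "\<And>x. x \<in> J \<Longrightarrow> f x = 0"
    by (rule fin_dual_enlarge_ideal[OF F(1) fibre_ideal_ideal[OF K(1)] f0]) blast+
  obtain n :: nat and \<rho> c where \<rho>: "coeff_system H {..<n} \<rho>"
    and van: "\<And>i j x. \<lbrakk>i < n; j < n; x \<in> J\<rbrakk> \<Longrightarrow> \<rho> i j x = 0"
    and fe: "\<And>x. f x = (\<Sum>(i, j)\<in>{..<n} \<times> {..<n}. c i j * \<rho> i j x)"
    by (rule fin_dual_coeffs[OF F(3,4) J(1,2,4)]) blast+
  have \<rho>C: "\<rho> i j \<in> fibre_coalg H A \<kappa>" if ij: "i < n" "j < n" for i j
  proof -
    have d: "\<rho> i j \<in> fin_dual_carrier H" using coeff_system_in_fin_dual[OF \<rho>] ij by simp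
    have "\<forall>x\<in>fibre_ideal H A \<kappa>. \<rho> i j x = 0" using van[OF ij] J(3) by blast
    then show ?thesis
      using vanish_fibre_ideal_iff[OF fin_dualD(1)[OF d] K(1,3)] by (intro fibre_coalgI[OF \<kappa> d]) blast
  qed
  have incl: "linear_map ?K ?D (\<lambda>y. y)" using Sc by (auto simp: linear_map_def)
  \<comment> \<open>The coefficient is absorbed into the first leg, so that every summand is an
    elementary tensor of elements of S.\<close>
  let ?T = "\<lambda>b. \<Sum>(i, j)\<in>{..<n} \<times> {..<n}. \<Sum>k\<in>{..<n}. tensor_sum ?K ?K [(\<lambda>x. c i j * \<rho> i k x, \<rho> k j)] b"
  have "?T \<in> tensor_space ?K ?K"
    unfolding case_prod_unfold using \<rho>C S fibre_coalg_times[OF \<kappa>]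
    by (intro tensor_space_sum tensor_space_elementary) auto
  moreover have "tensor_map ?D ?D (\<lambda>y. y) (\<lambda>y. y) ?T = comult ?D f"
  proof
    fix b
    have eq: "comult ?D f b = (\<Sum>(i, j)\<in>{..<n} \<times> {..<n}. c i j * (\<Sum>k\<in>{..<n}. tensor_sum ?D ?D [(\<rho> i k, \<rho> k j)] b))"
      by (subst comult_fin_dual_coeffs[OF \<rho>, of "{..<n} \<times> {..<n}" f c]) (auto simp: fe)
    show "tensor_map ?D ?D (\<lambda>y. y) (\<lambda>y. y) ?T b = comult ?D f b"
    proof (cases "bilinear_form ?D ?D b")
      case True
      then have "bilinear_form ?K ?K b" using bilinear_form_comp[OF incl incl True] by simp
      moreover have "b (\<lambda>x. c i j * \<rho> i k x) (\<rho> k j) = c i j * b (\<rho> i k) (\<rho> k j)" if "i < n" "j < n" "k < n" for i j k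
        using linear_form_smult[OF bilinear_formD(1)[OF True, of "\<rho> k j"], of "\<rho> i k" "c i j"] that fibre_coalgD(1)[OF \<rho>C \<kappa>]
        by simp
      ultimately show ?thesis using True
        by (auto simp: eq tensor_map_apply tensor_sum_apply sum_distrib_left intro!: sum.cong)
    next
      case False
      then show ?thesis by (simp add: eq tensor_map_def tensor_sum_def)
    qed
  qed
  ultimately show ?thesis by (metis (no_types, lifting) image_eqI)
qed

text \<open>Characters are separated one at a time, and the separating elements are multiplied;
  multiplicativity of the characters preserves the values 0 and 1.\<close>

lemma separating_element:
  assumes "finite F" "F \<subseteq> algebra_maps HA" "\<kappa>0 \<in> algebra_maps HA" "\<kappa>0 \<notin> F"
  shows "\<exists>a\<in>A. \<kappa>0 a = 1 \<and> (\<forall>\<kappa>\<in>F. \<kappa> a = 0)"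
  using assms
proof (induction F rule: finite_induct)
  case empty
  then show ?case using sub_one algebra_map_sub(3) by (intro bexI[of _ \<one>]) auto
next
  case (insert \<kappa> F)
  then obtain a where a: "a \<in> A" "\<kappa>0 a = 1" "\<forall>\<kappa>\<in>F. \<kappa> a = 0" by auto
  have \<kappa>: "\<kappa> \<in> algebra_maps HA" and F: "F \<subseteq> algebra_maps HA" using insert by auto
  have "\<exists>c. \<kappa> c \<noteq> \<kappa>0 c" using insert.prems(3) by auto
  then obtain c where c: "\<kappa> c \<noteq> \<kappa>0 c" by blast
  \<comment> \<open>Characters vanish off A by convention, so a point where two of them differ lies
    in A.\<close>
  then have cA: "c \<in> A" using algebra_map_sub(2)[OF \<kappa>] algebra_map_sub(2)[OF insert.prems(2)] by metis
  \<comment> \<open>Normalised to value 1 under \<kappa>0 and 0 under \<kappa>; the factor a takes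
    care of the rest of F.\<close>
  define b where "b = inverse (\<kappa>0 c - \<kappa> c) \<odot> (c \<oplus> (- \<kappa> c) \<odot> \<one>)"
  have mem: "(- \<kappa> c) \<odot> \<one> \<in> A" "c \<oplus> (- \<kappa> c) \<odot> \<one> \<in> A" "b \<in> A"
    using cA sub_one k_subspaceD(3,4)[OF sub_subspace] by (auto simp: b_def)
  have ev: "\<gamma> b = inverse (\<kappa>0 c - \<kappa> c) * (\<gamma> c - \<kappa> c)" if "\<gamma> \<in> algebra_maps HA" for \<gamma>
    unfolding b_def using that mem cA sub_one algebra_map_sub(3)[OF that]
    by (simp add: sub_form_smult[OF algebra_map_sub(1)[OF that]] sub_form_add[OF algebra_map_sub(1)[OF that]])
  have "a \<otimes> b \<in> A" using a(1) mem(3) by (rule sub_mult)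
  moreover have "\<kappa>0 (a \<otimes> b) = 1"
    using c a mem(3) algebra_map_sub(4)[OF insert.prems(2)] by (simp add: ev[OF insert.prems(2)])
  moreover have "\<gamma> (a \<otimes> b) = 0" if "\<gamma> \<in> insert \<kappa> F" for \<gamma>
  proof -
    have g: "\<gamma> \<in> algebra_maps HA" using that \<kappa> F by auto
    show ?thesis using that a mem(3) algebra_map_sub(4)[OF g a(1) mem(3)] ev[OF \<kappa>] by auto
  qed
  ultimately show ?case by blast
qed

text \<open>Evaluating the relation at x a, with a separating \<kappa> from the other members of F,
  leaves \<open>f \<kappa> x\<close> alone.\<close>

lemma fibre_coalg_independent:
  assumes F: "finite F" "F \<subseteq> algebra_maps HA" and f: "\<And>\<kappa>. \<kappa> \<in> F \<Longrightarrow> f \<kappa> \<in> fibre_coalg H A \<kappa>"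
    and 0: "\<And>x. (\<Sum>\<kappa>\<in>F. f \<kappa> x) = 0" and \<kappa>: "\<kappa> \<in> F"
  shows "f \<kappa> = (\<lambda>x. 0)"
proof
  fix x
  have \<kappa>': "\<kappa> \<in> algebra_maps HA" using \<kappa> F by auto
  show "f \<kappa> x = 0"
  proof (cases "x \<in> carrier H")
    case True
    obtain a where a: "a \<in> A" "\<kappa> a = 1" "\<forall>\<gamma>\<in>F - {\<kappa>}. \<gamma> a = 0"
      using separating_element[of "F - {\<kappa>}" \<kappa>] F \<kappa>' by auto
    have "0 = (\<Sum>\<gamma>\<in>F. f \<gamma> (x \<otimes> a))" using 0 by simp
    also have "\<dots> = (\<Sum>\<gamma>\<in>F. \<gamma> a * f \<gamma> x)"
      using F f fibre_coalgD(2) True a(1) by (intro sum.cong refl) blast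
    also have "\<dots> = \<kappa> a * f \<kappa> x + (\<Sum>\<gamma>\<in>F - {\<kappa>}. \<gamma> a * f \<gamma> x)" by (rule sum.remove[OF F(1) \<kappa>])
    also have "(\<Sum>\<gamma>\<in>F - {\<kappa>}. \<gamma> a * f \<gamma> x) = 0" by (rule sum.neutral) (use a(3) in simp)
    finally show ?thesis using a(2) by simp
  next
    case False
    then show ?thesis using fibre_coalgD(4)[OF f[OF \<kappa>] \<kappa>'] by blast
  qed
qed

end

section \<open>Sums of subspaces of a function space\<close>

text \<open>Has three instances: the fibres inside the finite dual, the same fibres inside
  H(\<Gamma>) indexed by \<Gamma>_fd, and the lines spanned by characters.\<close>

locale function_family = k_algebra V for V :: "('k::field, 'a \<Rightarrow> 'k, 'm) module_scheme" (structure) +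
  fixes J :: "'i set" and C :: "'i \<Rightarrow> ('a \<Rightarrow> 'k) set"
  assumes fs: "function_space V" and C_subspace: "i \<in> J \<Longrightarrow> k_subspace V (C i)"
begin

abbreviation total where "total \<equiv> subspace_sum V J C"

lemma total_iff:
  "f \<in> total \<longleftrightarrow> (\<exists>g F. finite F \<and> F \<subseteq> J \<and> (\<forall>i\<in>F. g i \<in> C i) \<and> f = (\<lambda>x. \<Sum>i\<in>F. g i x))"
proof -
  have "finsum V g F = (\<lambda>x. \<Sum>i\<in>F. g i x)" if "finite F" "F \<subseteq> J" "\<forall>i\<in>F. g i \<in> C i" for g F
    using that k_subspaceD(1)[OF C_subspace] by (intro finsum_pointwise[OF k_algebra_axioms fs]) auto
  then show ?thesis unfolding subspace_sum_def by (intro iffI; clarify) metis+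
qed

lemma total_incl: "\<lbrakk>i \<in> J; f \<in> C i\<rbrakk> \<Longrightarrow> f \<in> total"
  unfolding total_iff by (intro exI[of _ "\<lambda>_. f"] exI[of _ "{i}"]) auto

lemma total_zero: "(\<lambda>x. 0) \<in> total"
  unfolding total_iff by (intro exI[of _ "\<lambda>_. undefined"] exI[of _ "{}"]) auto

lemma total_plus:
  assumes "f \<in> total" "f' \<in> total"
  shows "(\<lambda>x. f x + f' x) \<in> total"
proof -
  obtain g F where F: "finite F" "F \<subseteq> J" "\<forall>i\<in>F. g i \<in> C i" "f = (\<lambda>x. \<Sum>i\<in>F. g i x)"
    using assms(1) unfolding total_iff by blast
  obtain g' F' where F': "finite F'" "F' \<subseteq> J" "\<forall>i\<in>F'. g' i \<in> C i" "f' = (\<lambda>x. \<Sum>i\<in>F'. g' i x)"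
    using assms(2) unfolding total_iff by blast
  \<comment> \<open>Both families are padded with zeros to a common index set before they are
    added.\<close>
  define h where "h i = (if i \<in> F then g i else (\<lambda>x. 0))" for i
  define h' where "h' i = (if i \<in> F' then g' i else (\<lambda>x. 0))" for i
  have z: "(\<lambda>x. 0) \<in> C i" if "i \<in> J" for i
    using k_subspaceD(2)[OF C_subspace[OF that]] by (simp add: function_spaceD[OF fs])
  have pl: "(\<lambda>x. u x + v x) \<in> C i" if "i \<in> J" "u \<in> C i" "v \<in> C i" for i u v
    using k_subspaceD(3)[OF C_subspace[OF that(1)] that(2,3)] by (simp add: function_spaceD[OF fs])
  have "f x = (\<Sum>i\<in>F \<union> F'. h i x)" for x
    unfolding F(4) using F(1) F'(1) by (intro sum.mono_neutral_cong_left) (auto simp: h_def)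
  moreover have "f' x = (\<Sum>i\<in>F \<union> F'. h' i x)" for x
    unfolding F'(4) using F(1) F'(1) by (intro sum.mono_neutral_cong_left) (auto simp: h'_def)
  ultimately have "(\<lambda>x. f x + f' x) = (\<lambda>x. \<Sum>i\<in>F \<union> F'. h i x + h' i x)"
    by (simp add: sum.distrib)
  moreover have "\<forall>i\<in>F \<union> F'. (\<lambda>x. h i x + h' i x) \<in> C i"
    using F F' z pl by (auto simp: h_def h'_def)
  ultimately show ?thesis unfolding total_iff using F F'
    by (intro exI[of _ "\<lambda>i x. h i x + h' i x"] exI[of _ "F \<union> F'"]) auto
qed

text \<open>Reduces a linear statement about the whole sum to a single summand; the closure
  properties of H(\<Gamma>) are obtained in this way.\<close>

lemma total_induct [consumes 1, case_names zero plus incl]: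
  assumes "f \<in> total" "P (\<lambda>x. 0)"
    and "\<And>f g. \<lbrakk>f \<in> total; g \<in> total; P f; P g\<rbrakk> \<Longrightarrow> P (\<lambda>x. f x + g x)"
    and "\<And>i f. \<lbrakk>i \<in> J; f \<in> C i\<rbrakk> \<Longrightarrow> P f"
  shows "P f"
proof -
  obtain g F where F: "finite F" "F \<subseteq> J" "\<forall>i\<in>F. g i \<in> C i" "f = (\<lambda>x. \<Sum>i\<in>F. g i x)"
    using assms(1) unfolding total_iff by blast
  have "(\<lambda>x. \<Sum>i\<in>F. g i x) \<in> total \<and> P (\<lambda>x. \<Sum>i\<in>F. g i x)"
    using F(1-3)
  proof (induction F rule: finite_induct)
    case empty
    then show ?case using assms(2) total_zero by simp
  next
    case (insert i F)
    then have "g i \<in> total" "P (g i)" using assms(4) total_incl by auto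
    then show ?case using insert total_plus assms(3) by simp
  qed
  then show ?thesis using F(4) by simp
qed

lemma total_times: "f \<in> total \<Longrightarrow> (\<lambda>x. c * f x) \<in> total"
proof (induction rule: total_induct)
  case (plus f g)
  then show ?case using total_plus[of "\<lambda>x. c * f x" "\<lambda>x. c * g x"] by (simp add: distrib_left)
next
  case (incl i f)
  then show ?case using total_incl[of i] k_subspaceD(4)[OF C_subspace[OF incl(1)] incl(2)]
    by (simp add: function_spaceD[OF fs])
qed (simp add: total_zero)

lemma total_carrier: "f \<in> total \<Longrightarrow> f \<in> carrier V"
proof (induction rule: total_induct)
  case zero
  then show ?case using zero_closed by (simp add: function_spaceD[OF fs])
next
  case (plus f g)
  then show ?case using a_closed[of f g] by (simp add: function_spaceD[OF fs])
next
  case (incl i f)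
  then show ?case using k_subspaceD(1)[OF C_subspace] by blast
qed

lemma total_subspace: "k_subspace V total"
  using total_carrier total_zero total_plus total_times by (auto simp: k_subspace_def function_spaceD[OF fs])

end

lemma (in ring) list_sum_mult_right:
  "\<lbrakk>set xs \<subseteq> carrier R; y \<in> carrier R\<rbrakk> \<Longrightarrow> list_sum R xs \<otimes> y = list_sum R (map (\<lambda>x. x \<otimes> y) xs)"
proof (induction xs)
  case (Cons x xs)
  have "list_sum R xs \<in> carrier R" using Cons.prems by (induction xs) auto
  then show ?case using Cons by (simp add: l_distr)
qed simp

section \<open>The Hopf algebra of the zero fibre\<close>

context central_hopf_sub
begin

abbreviation IE where "IE \<equiv> fibre_ideal H A \<epsilon>A"
abbreviation QE where "QE \<equiv> quot_hopf H IE"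

text \<open>The restriction of the counit to A is the trivial character, and its kernel is A^+. This
  links the quotient Hopf algebra of the sequence to the fibre over \<epsilon>.\<close>

lemma augmentation_fibre_ideal: "carrier H \<cdot>\<^bsub>H\<^esub> augmentation_ideal HA = IE"
proof -
  have "augmentation_ideal HA = {a \<in> A. \<epsilon>A a = 0}" by (auto simp: augmentation_ideal_def zero_ext_def)
  then show ?thesis by (simp add: fibre_ideal_def)
qed

lemma counit_form: "linear_form HA \<epsilon>A" "\<epsilon>A \<one> = 1"
  using algebra_map_sub[OF counit_algebra_map_sub] by auto

lemma ideal_IE: "ideal IE H"
  by (rule fibre_ideal_ideal[OF counit_form(1)])

lemma IE_induct [consumes 1, case_names prod sum]:
  assumes "x \<in> IE" and "\<And>h a. \<lbrakk>h \<in> carrier H; a \<in> A; counit H a = 0\<rbrakk> \<Longrightarrow> P (h \<otimes> a)"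
    and "\<And>x y. \<lbrakk>x \<in> IE; y \<in> IE; P x; P y\<rbrakk> \<Longrightarrow> P (x \<oplus> y)"
  shows "P x"
  using assms(1) unfolding fibre_ideal_def
  by (induction rule: ideal_prod.induct) (auto intro: assms(2,3) simp: zero_ext_def fibre_ideal_def)

lemma IE_prod: "\<lbrakk>h \<in> carrier H; a \<in> A; counit H a = 0\<rbrakk> \<Longrightarrow> h \<otimes> a \<in> IE"
  unfolding fibre_ideal_def by (rule ideal_prod.prod) (auto simp: zero_ext_def)

text \<open>Bilinearity does not see the Hopf structure; this matters because the coproduct of
  \<open>quot_hopf\<close> is defined with tensors over \<open>quot_alg\<close>.\<close>

lemma bilinear_form_quot_hopf:
  "bilinear_form (quot_hopf H I) (quot_hopf H I) = bilinear_form (quot_alg H I) (quot_alg H I)"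
  by (intro ext) (simp add: bilinear_form_def linear_form_def quot_hopf_simps(1,5,6))

lemma k_epi_QE: "k_epi H QE (\<lambda>x. IE +> x)"
proof -
  interpret E: k_epi H "quot_alg H IE" "\<lambda>x. IE +> x" by (rule k_epi_quot_alg[OF ideal_IE])
  show ?thesis
    by unfold_locales (simp_all only: quot_hopf_simps(1-6) E.p_surj E.p_add E.p_mult E.p_smult E.p_one E.p_zero)
qed

text \<open>I_\<epsilon> is a Hopf ideal: modulo it A acts through the counit, so the coproduct of h
  a becomes \<epsilon>(a) times that of h; and S(h a) = S(h) S(a) with \<epsilon>(S(a)) =
  \<epsilon>(a).\<close>

theorem hopf_epi_QE: "hopf_epi H QE (\<lambda>x. IE +> x)"
proof -
  let ?q = "\<lambda>x. IE +> x"
  interpret E: k_epi H QE ?q by (rule k_epi_QE)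
  interpret I: ideal IE H by (rule ideal_IE)
  have ker: "?q x = \<zero>\<^bsub>QE\<^esub> \<longleftrightarrow> x \<in> IE" if "x \<in> carrier H" for x
    using that by (simp add: quot_hopf_simps quot_alg_simps I.coset_eq_iff)
  have shift: "?q (x \<otimes> a) = counit H a \<odot>\<^bsub>QE\<^esub> ?q x" if x: "x \<in> carrier H" and a: "a \<in> A" for x a
  proof -
    have "x \<otimes> a \<ominus> counit H a \<odot> x \<in> IE"
      using shift_in_fibre_ideal[OF counit_form x a] a by (simp add: zero_ext_def)
    then have "?q (x \<otimes> a) = ?q (counit H a \<odot> x)"
      using x a by (subst E.p_eq_iff) (simp_all add: ker sub_carrier smult_closed)
    then show ?thesis using E.p_smult[OF x] by simp
  qed
  \<comment> \<open>The structure maps of \<open>quot_hopf\<close> use an arbitrary member of a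
    coset. It differs from x by an element of \<open>IE\<close>, so coproduct and counit have to
    kill \<open>IE\<close>, and the antipode has to preserve it.\<close>
  have rep: "\<exists>i\<in>IE. (SOME x'. x' \<in> ?q x) = i \<oplus> x" if x: "x \<in> carrier H" for x
  proof -
    have "(SOME x'. x' \<in> ?q x) \<in> ?q x" using I.a_rcos_self[OF x] by (rule someI)
    then show ?thesis by (rule I.coset_memE) blast
  qed
  have comult0: "comult H i (\<lambda>u v. b (?q u) (?q v)) = 0" if b: "bilinear_form QE QE b" and i: "i \<in> IE" for b i
    using i
  proof (induction rule: IE_induct)
    case (prod h a)
    have bq: "bilinear_form H H (\<lambda>u v. b (?q u) (?q v))"
      by (rule bilinear_form_comp[OF E.p_linear E.p_linear b])
    have ac: "a \<in> carrier H" using prod by (simp add: sub_carrier)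
    obtain as where as: "set as \<subseteq> A \<times> A" "comult H a = tensor_sum H H as" by (rule comult_subE[OF prod(2)])
    have "comult H (h \<otimes> a) (\<lambda>u v. b (?q u) (?q v)) =
        comult H h (\<lambda>u v. comult H a (\<lambda>u' v'. b (?q (u \<otimes> u')) (?q (v \<otimes> v'))))"
      by (rule comult_mult_form[OF prod(1) ac bq])
    \<comment> \<open>Zero is kept as a multiple of a bilinear form so that homogeneity of the
      tensor applies.\<close>
    also have "\<dots> = comult H h (\<lambda>u v. 0 * (b (?q u) (?q v)))"
    proof (rule comult_cong[OF prod(1)])
      fix u v assume u: "u \<in> carrier H" and v: "v \<in> carrier H"
      have lm: "linear_map H H (\<lambda>x. y \<otimes> x)" if "y \<in> carrier H" for y
        using that by (simp add: linear_map_def r_distr smult_mult_right)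
      have "comult H a (\<lambda>u' v'. b (?q (u \<otimes> u')) (?q (v \<otimes> v'))) = (\<Sum>(u', v')\<leftarrow>as. b (?q (u \<otimes> u')) (?q (v \<otimes> v')))"
        unfolding as(2) by (rule tensor_sum_apply[OF bilinear_form_comp[OF lm[OF u] lm[OF v] bq]])
      also have "\<dots> = (\<Sum>(u', v')\<leftarrow>as. b (?q u) (?q v) * (counit H u' * counit H v'))"
      proof (rule sum_list_pair_cong)
        fix u' v' assume "(u', v') \<in> set as"
        then have u': "u' \<in> A" and v': "v' \<in> A" using as(1) by auto
        show "b (?q (u \<otimes> u')) (?q (v \<otimes> v')) = b (?q u) (?q v) * (counit H u' * counit H v')"
          using E.p_closed[OF u] E.p_closed[OF v]
          by (simp add: shift[OF u u'] shift[OF v v'] linear_form_smult[OF bilinear_formD(1)[OF b]]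
              linear_form_smult[OF bilinear_formD(2)[OF b]] E.Q.smult_closed)
      qed
      also have "\<dots> = b (?q u) (?q v) * (\<Sum>(u', v')\<leftarrow>as. counit H u' * counit H v')"
        by (rule sum_list_pair_times)
      also have "(\<Sum>(u', v')\<leftarrow>as. counit H u' * counit H v') = comult H a (\<lambda>u v. counit H u * counit H v)"
        unfolding as(2) by (rule tensor_sum_apply[OF bilinear_form_product[OF counit_linear counit_linear], symmetric])
      also have "\<dots> = counit H a" by (rule counit_left_form[OF ac counit_linear])
      finally show "comult H a (\<lambda>u' v'. b (?q (u \<otimes> u')) (?q (v \<otimes> v'))) = 0 * (b (?q u) (?q v))"
        using prod(3) by simp
    qed
    also have "\<dots> = 0" using tensor_times[OF comult_closed[OF prod(1)] bq, of 0] by simp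
    finally show ?case .
  next
    case (sum x y)
    then show ?case using I.Icarr by (simp add: comult_add)
  qed
  have counit0: "counit H i = 0" if "i \<in> IE" for i
    using that by (induction rule: IE_induct)
      (simp_all add: counit_mult sub_carrier linear_form_add[OF counit_linear] I.Icarr)
  have S0: "antipode H i \<in> IE" if "i \<in> IE" for i
    using that
  proof (induction rule: IE_induct)
    case (prod h a)
    have "antipode H h \<otimes> antipode H a \<in> IE"
      by (rule IE_prod) (use prod in \<open>simp_all add: antipode_closed sub_antipode counit_antipode sub_carrier\<close>)
    then show ?case
      using prod central[OF sub_antipode[OF prod(2)] antipode_closed[OF prod(1)]]
      by (simp add: antipode_mult sub_carrier)
  qed (simp add: antipode_add I.Icarr I.a_closed)
  \<comment> \<open>Stability under the inverse makes the antipode of the quotient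
    injective.\<close>
  have S0': "antipode_inv i \<in> IE" if "i \<in> IE" for i
    using that
  proof (induction rule: IE_induct)
    case (prod h a)
    have "antipode_inv h \<otimes> antipode H a \<in> IE"
      by (rule IE_prod) (use prod in \<open>simp_all add: antipode_inv sub_antipode counit_antipode sub_carrier\<close>)
    then show ?case
      using prod central[OF sub_antipode[OF prod(2)] antipode_inv(1)[OF prod(1)]]
      by (simp add: antipode_inv_mult sub_carrier antipode_inv_sub)
  qed (simp add: linear_mapD(2)[OF antipode_inv_linear_map] I.Icarr I.a_closed)
  show ?thesis
  proof (intro hopf_epi.intro hopf_epi_axioms.intro hopf_algebra_axioms k_epi_QE)
    fix x assume x: "x \<in> carrier H"
    obtain i where i: "i \<in> IE" "(SOME x'. x' \<in> ?q x) = i \<oplus> x" using rep[OF x] by blast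
    have ic: "i \<in> carrier H" using i(1) by (rule I.Icarr)
    show "counit QE (?q x) = counit H x"
      by (simp add: quot_hopf_simps i(2) linear_form_add[OF counit_linear ic x] counit0[OF i(1)])
    have "?q (antipode H i \<oplus> antipode H x) = ?q (antipode H x)"
      using E.p_add[of "antipode H i" "antipode H x"] ker[of "antipode H i"] S0[OF i(1)] x ic
      by (simp add: antipode_closed E.p_closed)
    then show "antipode QE (?q x) = ?q (antipode H x)"
      by (simp add: quot_hopf_simps i(2) antipode_add ic x)
    show "comult QE (?q x) = tensor_map QE QE ?q ?q (comult H x)"
    proof
      fix b
      show "comult QE (?q x) b = tensor_map QE QE ?q ?q (comult H x) b"
        using comult0[OF _ i(1), of b]
        by (simp add: quot_hopf_simps(7) tensor_map_def bilinear_form_quot_hopf i(2) comult_add[OF ic x])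
    qed
    assume "?q (antipode H x) = \<zero>\<^bsub>QE\<^esub>"
    then have "antipode H x \<in> IE" using ker[of "antipode H x"] x by (simp add: antipode_closed)
    then have "x \<in> IE" using S0'[of "antipode H x"] x by (simp add: antipode_inv(3))
    then show "?q x = \<zero>\<^bsub>QE\<^esub>" using ker[OF x] by simp
  qed
qed

end

section \<open>The graded Hopf algebra and the exact sequence\<close>

locale character_subgroup = central_hopf_sub H A
  for H :: "('k::field, 'a) hopf" (structure) and A +
  fixes \<Gamma> :: "('a \<Rightarrow> 'k) set"
  assumes \<Gamma>: "subgroup \<Gamma> (Alg_group HA)"
begin

abbreviation G where "G \<equiv> Alg_group HA"
abbreviation C where "C \<equiv> fibre_coalg H A"
abbreviation D where "D \<equiv> fin_dual H"
abbreviation KS where "KS \<equiv> subspace_sum D \<Gamma> C"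
abbreviation K where "K \<equiv> sub_hopf D KS"
abbreviation \<Gamma>fd where "\<Gamma>fd \<equiv> fd_part H A \<Gamma>"

lemma \<Gamma>_sub: "\<kappa> \<in> \<Gamma> \<Longrightarrow> \<kappa> \<in> algebra_maps HA"
  using subgroup.subset[OF \<Gamma>] by auto

lemma \<Gamma>_mult: "\<lbrakk>\<kappa> \<in> \<Gamma>; \<gamma> \<in> \<Gamma>\<rbrakk> \<Longrightarrow> conv HA \<kappa> \<gamma> \<in> \<Gamma>"
  using subgroup.m_closed[OF \<Gamma>] by simp

lemma one_HA: "zero_ext A (counit HA) = \<epsilon>A"
  by (rule ext) (simp add: zero_ext_def)

lemma \<Gamma>_one: "\<epsilon>A \<in> \<Gamma>"
  using subgroup.one_closed[OF \<Gamma>] by (simp add: one_HA)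

lemma \<Gamma>_inv: "\<kappa> \<in> \<Gamma> \<Longrightarrow> inv\<^bsub>G\<^esub> \<kappa> \<in> \<Gamma>"
  by (rule subgroup.m_inv_closed[OF \<Gamma>])

lemma inv_mult: "\<kappa> \<in> algebra_maps HA \<Longrightarrow> conv HA (inv\<^bsub>G\<^esub> \<kappa>) \<kappa> = \<epsilon>A"
  using group.l_inv[OF hopf_algebra.group_Alg_group[OF HA_hopf_algebra], of \<kappa>] by (simp add: one_HA)

section \<open>The sum of the fibres as a Hopf algebra\<close>

sublocale D: hopf_algebra D by (rule fin_dual_hopf_algebra)

sublocale Fam: function_family D \<Gamma> C
proof
  fix \<kappa> assume "\<kappa> \<in> \<Gamma>"
  then have \<kappa>: "\<kappa> \<in> algebra_maps HA" by (rule \<Gamma>_sub)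
  show "k_subspace D (C \<kappa>)"
    using fibre_coalgD(1)[OF _ \<kappa>] fibre_coalg_plus[OF \<kappa>] fibre_coalg_times[OF \<kappa>] fibre_coalg_zero[OF \<kappa>]
    by (auto simp: k_subspace_def)
qed (rule function_space_fin_dual)

lemma KS_fin_dual: "f \<in> KS \<Longrightarrow> f \<in> fin_dual_carrier H"
  using Fam.total_carrier by simp

lemma KS_linear: "f \<in> KS \<Longrightarrow> linear_form H f"
  by (rule fin_dualD(1)[OF KS_fin_dual])

text \<open>Closure under products is proved one argument at a time; here the second factor stays in
  a single fibre.\<close>

lemma KS_conv_fibre:
  assumes "f \<in> KS" "\<gamma> \<in> \<Gamma>" "g \<in> C \<gamma>" shows "conv H f g \<in> KS"
  using assms(1)
proof (induction rule: Fam.total_induct)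
  case zero
  have "conv H (\<lambda>x. 0) g = (\<lambda>x. 0)"
    using conv_times(1)[OF linear_form_zero fibre_coalgD(3)[OF assms(3) \<Gamma>_sub[OF assms(2)]], of 0] by simp
  then show ?case using Fam.total_zero by simp
next
  case (plus f h)
  then show ?case using Fam.total_plus fibre_coalgD(3)[OF assms(3) \<Gamma>_sub[OF assms(2)]] by (simp add: conv_plus KS_linear)
next
  case (incl \<kappa> f)
  then show ?case using Fam.total_incl[OF \<Gamma>_mult[OF incl(1) assms(2)]] fibre_coalg_conv assms(2,3) \<Gamma>_sub by blast
qed

lemma KS_conv:
  assumes "f \<in> KS" "g \<in> KS" shows "conv H f g \<in> KS"
  using assms(2)
proof (induction rule: Fam.total_induct)
  case zero
  have "conv H f (\<lambda>x. 0) = (\<lambda>x. 0)"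
    using conv_times(2)[OF KS_linear[OF assms(1)] linear_form_zero, of 0] by simp
  then show ?case using Fam.total_zero by simp
next
  case (plus g h)
  then show ?case using Fam.total_plus assms(1) by (simp add: conv_plus KS_linear)
next
  case (incl \<kappa> g)
  then show ?case using KS_conv_fibre[OF assms(1)] by blast
qed

text \<open>The map s is arbitrary so that the antipode and its inverse are covered
  together.\<close>

lemma zero_ext_pull_closed:
  assumes "f \<in> KS" and "\<And>\<kappa> f. \<lbrakk>\<kappa> \<in> \<Gamma>; f \<in> C \<kappa>\<rbrakk> \<Longrightarrow> zero_ext (carrier H) (\<lambda>x. f (s x)) \<in> KS"
  shows "zero_ext (carrier H) (\<lambda>x. f (s x)) \<in> KS"
  using assms(1)
proof (induction rule: Fam.total_induct)
  case zero
  have "zero_ext (carrier H) (\<lambda>x. 0) = ((\<lambda>x. 0) :: 'a \<Rightarrow> 'k)" by (auto simp: zero_ext_def)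
  then show ?case using Fam.total_zero by simp
next
  case (plus f g)
  have "zero_ext (carrier H) (\<lambda>x. f (s x) + g (s x)) =
    (\<lambda>x. zero_ext (carrier H) (\<lambda>x. f (s x)) x + zero_ext (carrier H) (\<lambda>x. g (s x)) x)"
    by (auto simp: zero_ext_def)
  then show ?case using Fam.total_plus plus by simp
qed (rule assms(2))

lemma KS_antipode: "f \<in> KS \<Longrightarrow> zero_ext (carrier H) (\<lambda>x. f (antipode H x)) \<in> KS"
  by (erule zero_ext_pull_closed) (rule Fam.total_incl[OF \<Gamma>_inv fibre_coalg_antipode(1)[OF \<Gamma>_sub]])

lemma KS_antipode_inv: "f \<in> KS \<Longrightarrow> zero_ext (carrier H) (\<lambda>x. f (antipode_inv x)) \<in> KS"
  by (erule zero_ext_pull_closed) (rule Fam.total_incl[OF \<Gamma>_inv fibre_coalg_antipode(2)[OF \<Gamma>_sub]])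

lemma KS_hopf_subalgebra: "hopf_subalgebra D KS"
  unfolding hopf_subalgebra_def
proof (intro conjI ballI)
  show "subring KS D"
  proof (rule D.subringI)
    show "KS \<subseteq> carrier D" using Fam.total_carrier by auto
    show "\<one>\<^bsub>D\<^esub> \<in> KS" using Fam.total_incl[OF \<Gamma>_one fibre_coalg_counit] by simp
    show "\<ominus>\<^bsub>D\<^esub> f \<in> KS" if "f \<in> KS" for f by (rule D.subspace_uminus[OF Fam.total_subspace that])
  qed (simp_all add: KS_conv Fam.total_plus)
  show "k_subspace D KS" by (rule Fam.total_subspace)
  show "antipode D f \<in> KS" if "f \<in> KS" for f using KS_antipode[OF that] by simp
  fix f assume "f \<in> KS"
  then show "comult D f \<in> tensor_map D D (\<lambda>y. y) (\<lambda>y. y) ` tensor_space (D\<lparr>carrier := KS\<rparr>) (D\<lparr>carrier := KS\<rparr>)"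
    unfolding tensor_space_sub_hopf
  proof (induction rule: Fam.total_induct)
    case zero
    have "comult D (\<lambda>x. 0) = (\<lambda>b. 0)"
      using comult_fin_dual_times[OF fin_dual_zero, of 0] by simp
    moreover have "tensor_map D D (\<lambda>y. y) (\<lambda>y. y) (\<lambda>b. 0) = (\<lambda>b. 0)" by (auto simp: tensor_map_def)
    ultimately show ?case using tensor_space_zero by (metis image_eqI)
  next
    case (plus f g)
    then obtain T T' where T: "T \<in> tensor_space K K" "comult D f = tensor_map D D (\<lambda>y. y) (\<lambda>y. y) T"
      "T' \<in> tensor_space K K" "comult D g = tensor_map D D (\<lambda>y. y) (\<lambda>y. y) T'" by auto
    have "comult D (\<lambda>x. f x + g x) = tensor_map D D (\<lambda>y. y) (\<lambda>y. y) (\<lambda>b. T b + T' b)"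
      using T plus by (auto simp: comult_fin_dual_plus KS_fin_dual tensor_map_def)
    then show ?case using tensor_space_plus[OF T(1,3)] by blast
  next
    case (incl \<kappa> f)
    show ?case
      by (rule fibre_coalg_comult[OF \<Gamma>_sub[OF incl(1)] incl(2)]) (use Fam.total_incl[OF incl(1)] KS_fin_dual in auto)
  qed
qed

sublocale KH: hopf_sub D KS
  by (intro hopf_sub.intro hopf_sub_axioms.intro D.hopf_algebra_axioms KS_hopf_subalgebra)

text \<open>Each f in the sum is the antipode of its pull-back along the inverse antipode, which
  again lies in the sum.\<close>

lemma K_hopf_algebra: "hopf_algebra K"
proof (rule KH.sub_hopf_algebra, rule subsetI)
  fix f assume f: "f \<in> KS"
  show "f \<in> antipode D ` KS"
    using antipode_fin_dual_inv[OF KS_fin_dual[OF f]] KS_antipode_inv[OF f] by (metis image_eqI)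
qed

lemma fibre_hopf_K: "fibre_hopf H A \<Gamma> = K"
  by (simp add: fibre_hopf_def)

lemma function_space_K: "function_space K"
  by (rule function_space_sub_hopf[OF function_space_fin_dual])

lemma comult_K_eval:
  "\<lbrakk>f \<in> KS; x \<in> carrier H; y \<in> carrier H\<rbrakk> \<Longrightarrow> comult K f (\<lambda>g h. g x * h y) = f (x \<otimes> y)"
  by (simp add: KH.comult_sub_apply bilinear_form_eval comult_fin_dual KS_fin_dual)

text \<open>Elements of the sum vanish off H, so the inherited coproduct is still characterised by
  the values f(x y).\<close>

lemma comult_K_eqI:
  assumes f: "f \<in> KS" and T: "T \<in> tensor_space K K"
    and "\<And>x y. \<lbrakk>x \<in> carrier H; y \<in> carrier H\<rbrakk> \<Longrightarrow> T (\<lambda>g h. g x * h y) = f (x \<otimes> y)"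
  shows "comult K f = T"
proof (rule tensor_eqI_pointwise[OF KH.k_algebra_sub function_space_K KH.k_algebra_sub function_space_K])
  show "comult K f \<in> tensor_space K K" by (rule KH.comult_sub(1)[OF f])
  show "g x = 0" if "g \<in> carrier K" "x \<notin> carrier H" for g x
    using that fin_dualD(2)[OF KS_fin_dual] by simp
  show "g x = 0" if "g \<in> carrier K" "x \<notin> carrier H" for g x
    using that fin_dualD(2)[OF KS_fin_dual] by simp
qed (use assms comult_K_eval in auto)

section \<open>Characters with a finite-dimensional module, and the grading\<close>

lemma fd_iff: "\<kappa> \<in> \<Gamma>fd \<longleftrightarrow> \<kappa> \<in> \<Gamma> \<and> (\<exists>f\<in>C \<kappa>. f \<one> = 1)"
proof -
  have "(\<exists>f\<in>C \<kappa>. f \<one> \<noteq> 0) \<longleftrightarrow> (\<exists>f\<in>C \<kappa>. f \<one> = 1)" if "\<kappa> \<in> \<Gamma>"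
  proof
    assume "\<exists>f\<in>C \<kappa>. f \<one> \<noteq> 0"
    then obtain f where f: "f \<in> C \<kappa>" "f \<one> \<noteq> 0" by blast
    have "(\<lambda>x. inverse (f \<one>) * f x) \<in> C \<kappa>" by (rule fibre_coalg_times[OF \<Gamma>_sub[OF that] f(1)])
    then show "\<exists>f\<in>C \<kappa>. f \<one> = 1" using f(2) by (intro bexI[of _ "\<lambda>x. inverse (f \<one>) * f x"]) auto
  next
    assume "\<exists>f\<in>C \<kappa>. f \<one> = 1"
    then obtain f where "f \<in> C \<kappa>" "f \<one> = 1" by blast
    then show "\<exists>f\<in>C \<kappa>. f \<one> \<noteq> 0" by (intro bexI[of _ f]) simp_all
  qed
  then show ?thesis using fd_module_iff[OF \<Gamma>_sub, of \<kappa>] unfolding fd_part_def mem_Collect_eq by argo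
qed

text \<open>Otherwise a normalised translate of f would put \<kappa> into \<open>\<Gamma>fd\<close>.
  Hence summing over \<Gamma> or over \<open>\<Gamma>fd\<close> gives the same space.\<close>

lemma fd_zero:
  assumes "\<kappa> \<in> \<Gamma>" "\<kappa> \<notin> \<Gamma>fd" "f \<in> C \<kappa>" shows "f = (\<lambda>x. 0)"
proof (rule ccontr)
  assume "f \<noteq> (\<lambda>x. 0)"
  then obtain g where "g \<in> C \<kappa>" "g \<one> = 1" by (rule fibre_coalg_unital[OF \<Gamma>_sub[OF assms(1)] assms(3)])
  then show False using assms(1,2) fd_iff by blast
qed

lemma conv_at_one: "\<lbrakk>linear_form H f; linear_form H g\<rbrakk> \<Longrightarrow> conv H f g \<one> = f \<one> * g \<one>"
  by (simp add: conv_apply comult_one_form bilinear_form_product)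

lemma fd_subgroup: "subgroup \<Gamma>fd G"
proof (rule group.subgroupI[OF hopf_algebra.group_Alg_group[OF HA_hopf_algebra]])
  show "\<Gamma>fd \<subseteq> carrier G" using fd_iff \<Gamma>_sub by auto
  have "\<epsilon>A \<in> \<Gamma>fd" unfolding fd_iff using \<Gamma>_one fibre_coalg_counit
    by (intro conjI bexI[of _ "zero_ext (carrier H) (counit H)"]) (simp_all add: counit_one)
  then show "\<Gamma>fd \<noteq> {}" by blast
  show "inv\<^bsub>G\<^esub> \<kappa> \<in> \<Gamma>fd" if \<kappa>: "\<kappa> \<in> \<Gamma>fd" for \<kappa>
  proof -
    obtain f where f: "\<kappa> \<in> \<Gamma>" "f \<in> C \<kappa>" "f \<one> = 1" using \<kappa> unfolding fd_iff by blast
    show ?thesis unfolding fd_iff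
      using \<Gamma>_inv[OF f(1)] fibre_coalg_antipode(1)[OF \<Gamma>_sub[OF f(1)] f(2)] f(3)
      by (intro conjI bexI[of _ "zero_ext (carrier H) (\<lambda>x. f (antipode H x))"]) (simp_all add: antipode_one)
  qed
  show "\<kappa> \<otimes>\<^bsub>G\<^esub> \<gamma> \<in> \<Gamma>fd" if \<kappa>: "\<kappa> \<in> \<Gamma>fd" and \<gamma>: "\<gamma> \<in> \<Gamma>fd" for \<kappa> \<gamma>
  proof -
    obtain f where f: "\<kappa> \<in> \<Gamma>" "f \<in> C \<kappa>" "f \<one> = 1" using \<kappa> unfolding fd_iff by blast
    obtain g where g: "\<gamma> \<in> \<Gamma>" "g \<in> C \<gamma>" "g \<one> = 1" using \<gamma> unfolding fd_iff by blast
    note kg = \<Gamma>_sub[OF f(1)] \<Gamma>_sub[OF g(1)]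
    have "conv H f g \<one> = 1"
      using conv_at_one[OF fibre_coalgD(3)[OF f(2) kg(1)] fibre_coalgD(3)[OF g(2) kg(2)]] f(3) g(3) by simp
    then show ?thesis unfolding fd_iff
      using \<Gamma>_mult[OF f(1) g(1)] fibre_coalg_conv[OF kg f(2) g(2)] by auto
  qed
qed

lemma \<Gamma>fd_sub: "\<kappa> \<in> \<Gamma>fd \<Longrightarrow> \<kappa> \<in> \<Gamma>" "\<kappa> \<in> \<Gamma>fd \<Longrightarrow> \<kappa> \<in> algebra_maps HA"
  using fd_iff \<Gamma>_sub by auto

lemma C_KS: "\<kappa> \<in> \<Gamma> \<Longrightarrow> C \<kappa> \<subseteq> KS"
  using Fam.total_incl by blast

sublocale FamK: function_family K \<Gamma>fd C
proof (intro function_family.intro function_family_axioms.intro KH.k_algebra_sub function_space_K)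
  fix \<kappa> assume "\<kappa> \<in> \<Gamma>fd"
  then have \<kappa>: "\<kappa> \<in> \<Gamma>" by (rule \<Gamma>fd_sub)
  show "k_subspace K (C \<kappa>)" using Fam.C_subspace[OF \<kappa>] C_KS[OF \<kappa>] by (auto simp: k_subspace_def)
qed

lemma KS_graded: "subspace_sum K \<Gamma>fd C = KS"
proof (intro equalityI subsetI)
  fix f assume "f \<in> subspace_sum K \<Gamma>fd C"
  then show "f \<in> KS" using FamK.total_carrier by simp
next
  fix f assume "f \<in> KS"
  then show "f \<in> subspace_sum K \<Gamma>fd C"
  proof (induction rule: Fam.total_induct)
    case zero
    then show ?case by (rule FamK.total_zero)
  next
    case (plus f g)
    then show ?case using FamK.total_plus by blast
  next
    case (incl \<kappa> f)
    then show ?case using fd_zero[OF incl(1) _ incl(2)] FamK.total_zero FamK.total_incl by (cases "\<kappa> \<in> \<Gamma>fd") auto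
  qed
qed

theorem K_faithfully_graded: "faithfully_graded (G\<lparr>carrier := \<Gamma>fd\<rparr>) K C"
  unfolding faithfully_graded_def
proof (intro conjI ballI)
  show "group (G\<lparr>carrier := \<Gamma>fd\<rparr>)"
    by (rule group.subgroup_imp_group[OF hopf_algebra.group_Alg_group[OF HA_hopf_algebra] fd_subgroup])
  show "k_algebra K" by (rule KH.k_algebra_sub)
  show "k_subspace K (C \<kappa>)" if "\<kappa> \<in> carrier (G\<lparr>carrier := \<Gamma>fd\<rparr>)" for \<kappa>
    using FamK.C_subspace that by simp
  show "carrier K = subspace_sum K (carrier (G\<lparr>carrier := \<Gamma>fd\<rparr>)) C" by (simp add: KS_graded)
  show "independent_subspaces K (carrier (G\<lparr>carrier := \<Gamma>fd\<rparr>)) C"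
    unfolding independent_subspaces_def
  proof (intro allI impI ballI)
    fix F f \<kappa> assume F: "finite F" "F \<subseteq> carrier (G\<lparr>carrier := \<Gamma>fd\<rparr>)" and f: "\<forall>\<kappa>\<in>F. f \<kappa> \<in> C \<kappa>"
      and 0: "finsum K f F = \<zero>\<^bsub>K\<^esub>" and \<kappa>: "\<kappa> \<in> F"
    have Fs: "F \<subseteq> \<Gamma>fd" using F by simp
    then have Fa: "F \<subseteq> algebra_maps HA" using \<Gamma>fd_sub by auto
    have "f i \<in> carrier K" if "i \<in> F" for i
      using f that C_KS[OF \<Gamma>fd_sub(1)] Fs by auto
    from finsum_pointwise[OF KH.k_algebra_sub function_space_K this F(1)]
    have "(\<lambda>x. \<Sum>i\<in>F. f i x) = (\<lambda>x. 0)" using 0 by simp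
    then have "(\<Sum>i\<in>F. f i x) = 0" for x by (rule fun_cong)
    then show "f \<kappa> = \<zero>\<^bsub>K\<^esub>" using fibre_coalg_independent[OF F(1) Fa _ _ \<kappa>, of f] f by simp
  qed
  show "f \<otimes>\<^bsub>K\<^esub> g \<in> C (\<kappa> \<otimes>\<^bsub>G\<lparr>carrier := \<Gamma>fd\<rparr>\<^esub> \<gamma>)"
    if "\<kappa> \<in> carrier (G\<lparr>carrier := \<Gamma>fd\<rparr>)" "\<gamma> \<in> carrier (G\<lparr>carrier := \<Gamma>fd\<rparr>)" "f \<in> C \<kappa>" "g \<in> C \<gamma>" for \<kappa> \<gamma> f g
    using that \<Gamma>fd_sub fibre_coalg_conv by simp
  show "C \<kappa> \<noteq> {\<zero>\<^bsub>K\<^esub>}" if "\<kappa> \<in> carrier (G\<lparr>carrier := \<Gamma>fd\<rparr>)" for \<kappa>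
  proof
    assume eq: "C \<kappa> = {\<zero>\<^bsub>K\<^esub>}"
    have "\<kappa> \<in> \<Gamma>fd" using that by simp
    then obtain f where "f \<in> C \<kappa>" "f \<one> = 1" unfolding fd_iff by blast
    then show False using eq by auto
  qed
qed

section \<open>The span of the characters as a Hopf algebra\<close>

sublocale HA: hopf_algebra HA by (rule HA_hopf_algebra)

abbreviation DA where "DA \<equiv> fin_dual HA"
abbreviation LS where "LS \<equiv> k_span DA \<Gamma>fd"
abbreviation L where "L \<equiv> sub_hopf DA LS"

sublocale DA: hopf_algebra DA by (rule HA.fin_dual_hopf_algebra)

sublocale FamL: function_family DA \<Gamma>fd "\<lambda>\<kappa>. range (\<lambda>c x. c * \<kappa> x)"
proof
  fix \<kappa> assume "\<kappa> \<in> \<Gamma>fd"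
  then have k: "\<kappa> \<in> fin_dual_carrier HA" using HA.algebra_maps_fin_dual \<Gamma>fd_sub by blast
  show "k_subspace DA (range (\<lambda>c x. c * \<kappa> x))"
    unfolding k_subspace_def
  proof (intro conjI ballI allI)
    show "range (\<lambda>c x. c * \<kappa> x) \<subseteq> carrier DA" using HA.fin_dual_times[OF k] by auto
    show "\<zero>\<^bsub>DA\<^esub> \<in> range (\<lambda>c x. c * \<kappa> x)" by (intro range_eqI[of _ _ 0]) simp
    show "f \<oplus>\<^bsub>DA\<^esub> g \<in> range (\<lambda>c x. c * \<kappa> x)" if "f \<in> range (\<lambda>c x. c * \<kappa> x)" "g \<in> range (\<lambda>c x. c * \<kappa> x)" for f g
    proof -
      obtain c d where "f = (\<lambda>x. c * \<kappa> x)" "g = (\<lambda>x. d * \<kappa> x)" using \<open>f \<in> _\<close> \<open>g \<in> _\<close> by blast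
      then show ?thesis by (intro range_eqI[of _ _ "c + d"]) (simp add: distrib_right)
    qed
    show "c \<odot>\<^bsub>DA\<^esub> f \<in> range (\<lambda>c x. c * \<kappa> x)" if "f \<in> range (\<lambda>c x. c * \<kappa> x)" for f c
    proof -
      obtain d where "f = (\<lambda>x. d * \<kappa> x)" using \<open>f \<in> _\<close> by blast
      then show ?thesis by (intro range_eqI[of _ _ "c * d"]) (simp add: mult.assoc)
    qed
  qed
qed (rule function_space_fin_dual)

text \<open>Seen as a sum of lines, the span acquires the closure properties and the induction
  principle for sums.\<close>

lemma LS_total: "LS = FamL.total"
proof (intro equalityI subsetI)
  fix f assume "f \<in> LS"
  then obtain c F where F: "finite F" "F \<subseteq> \<Gamma>fd" "f = finsum DA (\<lambda>\<kappa>. c \<kappa> \<odot>\<^bsub>DA\<^esub> \<kappa>) F" by (auto simp: k_span_def)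
  show "f \<in> FamL.total" unfolding subspace_sum_def
    by (intro CollectI exI[of _ "\<lambda>\<kappa>. c \<kappa> \<odot>\<^bsub>DA\<^esub> \<kappa>"] exI[of _ F]) (use F in auto)
next
  fix f assume "f \<in> FamL.total"
  then obtain g F where F: "finite F" "F \<subseteq> \<Gamma>fd" "\<forall>\<kappa>\<in>F. g \<kappa> \<in> range (\<lambda>c x. c * \<kappa> x)" "f = finsum DA g F"
    by (auto simp: subspace_sum_def)
  have "\<exists>c. \<forall>\<kappa>\<in>F. g \<kappa> = c \<kappa> \<odot>\<^bsub>DA\<^esub> \<kappa>"
    using F(3) by (intro bchoice) auto
  then obtain c where c: "\<And>\<kappa>. \<kappa> \<in> F \<Longrightarrow> g \<kappa> = c \<kappa> \<odot>\<^bsub>DA\<^esub> \<kappa>" by blast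
  have "g \<kappa> \<in> carrier DA" if "\<kappa> \<in> F" for \<kappa>
    using F(2,3) that k_subspaceD(1)[OF FamL.C_subspace, of \<kappa>] by blast
  then have "finsum DA g F = finsum DA (\<lambda>\<kappa>. c \<kappa> \<odot>\<^bsub>DA\<^esub> \<kappa>) F"
    using c by (intro DA.finsum_cong') auto
  then show "f \<in> LS" unfolding k_span_def
    by (intro CollectI exI[of _ c] exI[of _ F]) (use F in auto)
qed

lemma LS_char: "\<kappa> \<in> \<Gamma>fd \<Longrightarrow> (\<lambda>x. c * \<kappa> x) \<in> LS"
  unfolding LS_total by (rule FamL.total_incl) auto

lemma LS_char1: "\<kappa> \<in> \<Gamma>fd \<Longrightarrow> \<kappa> \<in> LS"
  using LS_char[of \<kappa> 1] by simp

lemma LS_zero: "(\<lambda>x. 0) \<in> LS" and LS_plus: "\<lbrakk>f \<in> LS; g \<in> LS\<rbrakk> \<Longrightarrow> (\<lambda>x. f x + g x) \<in> LS"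
  and LS_times: "f \<in> LS \<Longrightarrow> (\<lambda>x. c * f x) \<in> LS" and LS_fin_dual: "f \<in> LS \<Longrightarrow> f \<in> fin_dual_carrier HA"
  unfolding LS_total using FamL.total_zero FamL.total_plus FamL.total_times FamL.total_carrier by auto

lemma LS_induct [consumes 1, case_names zero plus char]:
  assumes "f \<in> LS" "P (\<lambda>x. 0)" and "\<And>f g. \<lbrakk>f \<in> LS; g \<in> LS; P f; P g\<rbrakk> \<Longrightarrow> P (\<lambda>x. f x + g x)"
    and "\<And>\<kappa> c. \<kappa> \<in> \<Gamma>fd \<Longrightarrow> P (\<lambda>x. c * \<kappa> x)"
  shows "P f"
  using assms(1) unfolding LS_total
proof (induction rule: FamL.total_induct)
  case (incl \<kappa> f)
  then show ?case using assms(4) by blast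
qed (use assms(2,3) LS_total in auto)

lemma char_fin_dual: "\<kappa> \<in> \<Gamma>fd \<Longrightarrow> \<kappa> \<in> fin_dual_carrier HA"
  using HA.algebra_maps_fin_dual \<Gamma>fd_sub by blast

lemma LS_conv_char:
  assumes "f \<in> LS" "\<gamma> \<in> \<Gamma>fd" shows "conv HA f \<gamma> \<in> LS"
  using assms(1)
proof (induction rule: LS_induct)
  note lin = fin_dualD(1)[OF LS_fin_dual] and g = fin_dualD(1)[OF char_fin_dual[OF assms(2)]]
  {
    case zero
    have "conv HA (\<lambda>x. 0) \<gamma> = (\<lambda>x. 0)" using HA.conv_times(1)[OF linear_form_zero g, of 0] by simp
    then show ?case using LS_zero by simp
  next
    case (plus f h)
    then show ?case using LS_plus by (simp add: HA.conv_plus lin g)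
  next
    case (char \<kappa> c)
    have "conv HA \<kappa> \<gamma> \<in> \<Gamma>fd" using subgroup.m_closed[OF fd_subgroup char assms(2)] by simp
    then show ?case using LS_char by (simp add: HA.conv_times(1)[OF fin_dualD(1)[OF char_fin_dual[OF char]] g])
  }
qed

lemma LS_conv:
  assumes "f \<in> LS" "g \<in> LS" shows "conv HA f g \<in> LS"
  using assms(2)
proof (induction rule: LS_induct)
  note lin = fin_dualD(1)[OF LS_fin_dual]
  {
    case zero
    have "conv HA f (\<lambda>x. 0) = (\<lambda>x. 0)" using HA.conv_times(2)[OF lin[OF assms(1)] linear_form_zero, of 0] by simp
    then show ?case using LS_zero by simp
  next
    case (plus g h)
    then show ?case using LS_plus assms(1) by (simp add: HA.conv_plus lin)
  next
    case (char \<kappa> c)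
    then show ?case using LS_times[OF LS_conv_char[OF assms(1) char]]
      by (simp add: HA.conv_times(2)[OF lin[OF assms(1)] fin_dualD(1)[OF char_fin_dual[OF char]]])
  }
qed

lemma char_antipode: "\<kappa> \<in> \<Gamma>fd \<Longrightarrow> zero_ext A (\<lambda>a. \<kappa> (antipode H a)) \<in> \<Gamma>fd"
  using subgroup.m_inv_closed[OF fd_subgroup] char_inv_sub(1)[OF \<Gamma>fd_sub(2)] by metis

lemma LS_antipode: "f \<in> LS \<Longrightarrow> zero_ext A (\<lambda>a. f (antipode H a)) \<in> LS"
proof (induction rule: LS_induct)
  case zero
  have "zero_ext A (\<lambda>a. 0) = ((\<lambda>x. 0) :: 'a \<Rightarrow> 'k)" by (auto simp: zero_ext_def)
  then show ?case using LS_zero by simp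
next
  case (plus f g)
  have "zero_ext A (\<lambda>a. f (antipode H a) + g (antipode H a)) =
    (\<lambda>x. zero_ext A (\<lambda>a. f (antipode H a)) x + zero_ext A (\<lambda>a. g (antipode H a)) x)" by (auto simp: zero_ext_def)
  then show ?case using plus LS_plus by simp
next
  case (char \<kappa> c)
  have "zero_ext A (\<lambda>a. c * \<kappa> (antipode H a)) = (\<lambda>x. c * zero_ext A (\<lambda>a. \<kappa> (antipode H a)) x)" by (auto simp: zero_ext_def)
  then show ?case using LS_char[OF char_antipode[OF char]] by simp
qed

lemma LS_subspace: "k_subspace DA LS"
  unfolding LS_total by (rule FamL.total_subspace)

lemma LS_hopf_subalgebra: "hopf_subalgebra DA LS"
  unfolding hopf_subalgebra_def
proof (intro conjI ballI)
  show "subring LS DA"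
  proof (rule DA.subringI)
    show "LS \<subseteq> carrier DA" using LS_fin_dual by auto
    show "\<one>\<^bsub>DA\<^esub> \<in> LS"
      using LS_char1 subgroup.one_closed[OF fd_subgroup] by simp
    show "\<ominus>\<^bsub>DA\<^esub> f \<in> LS" if "f \<in> LS" for f by (rule DA.subspace_uminus[OF LS_subspace that])
  qed (simp_all add: LS_conv LS_plus)
  show "k_subspace DA LS" by (rule LS_subspace)
  show "antipode DA f \<in> LS" if "f \<in> LS" for f using LS_antipode[OF that] by simp
  have incl: "linear_map L DA (\<lambda>y. y)" using LS_fin_dual by (auto simp: linear_map_def)
  fix f assume "f \<in> LS"
  then show "comult DA f \<in> tensor_map DA DA (\<lambda>y. y) (\<lambda>y. y) ` tensor_space (DA\<lparr>carrier := LS\<rparr>) (DA\<lparr>carrier := LS\<rparr>)"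
    unfolding tensor_space_sub_hopf
  proof (induction rule: LS_induct)
    case zero
    have "comult DA (\<lambda>x. 0) = (\<lambda>b. 0)"
      using HA.comult_fin_dual_times[OF HA.fin_dual_zero, of 0] by simp
    moreover have "tensor_map DA DA (\<lambda>y. y) (\<lambda>y. y) (\<lambda>b. 0) = (\<lambda>b. 0)" by (auto simp: tensor_map_def)
    ultimately show ?case using tensor_space_zero by (metis image_eqI)
  next
    case (plus f g)
    then obtain T T' where T: "T \<in> tensor_space L L" "comult DA f = tensor_map DA DA (\<lambda>y. y) (\<lambda>y. y) T"
      "T' \<in> tensor_space L L" "comult DA g = tensor_map DA DA (\<lambda>y. y) (\<lambda>y. y) T'" by auto
    have "comult DA (\<lambda>x. f x + g x) = tensor_map DA DA (\<lambda>y. y) (\<lambda>y. y) (\<lambda>b. T b + T' b)"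
      using T plus by (auto simp: HA.comult_fin_dual_plus LS_fin_dual tensor_map_def)
    then show ?case using tensor_space_plus[OF T(1,3)] by blast
  next
    case (char \<kappa> c)
    \<comment> \<open>Being multiplicative, a character is group-like; the scalar goes into the
      first leg.\<close>
    have "comult DA (\<lambda>x. c * \<kappa> x) = tensor_sum DA DA [(\<lambda>x. c * \<kappa> x, \<kappa>)]"
    proof (rule HA.comult_fin_dual_eqI)
      show "tensor_sum DA DA [(\<lambda>x. c * \<kappa> x, \<kappa>)] \<in> tensor_space DA DA"
        by (rule tensor_space_elementary) (simp_all add: HA.fin_dual_times char_fin_dual[OF char])
    qed (use algebra_map_sub(4)[OF \<Gamma>fd_sub(2)[OF char]] in \<open>simp add: tensor_sum_apply HA.bilinear_form_eval mult.assoc\<close>)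
    also have "\<dots> = tensor_map DA DA (\<lambda>y. y) (\<lambda>y. y) (tensor_sum L L [(\<lambda>x. c * \<kappa> x, \<kappa>)])"
      by (simp add: tensor_map_tensor_sum[OF incl incl])
    finally show ?case
      using tensor_space_elementary[of "\<lambda>x. c * \<kappa> x" L \<kappa> L] LS_char[OF char] LS_char1[OF char] by simp
  qed
qed

sublocale LH: hopf_sub DA LS
  by (intro hopf_sub.intro hopf_sub_axioms.intro DA.hopf_algebra_axioms LS_hopf_subalgebra)

text \<open>Precomposition with the antipode is an involution on functionals on A, because the
  antipode of A is one.\<close>

lemma L_hopf_algebra: "hopf_algebra L"
proof (rule LH.sub_hopf_algebra, rule subsetI)
  fix f assume f: "f \<in> LS"
  have "antipode DA (zero_ext A (\<lambda>a. f (antipode H a))) = f"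
    by (rule ext) (auto simp: zero_ext_def sub_antipode antipode_antipode fin_dualD(2)[OF LS_fin_dual[OF f]])
  then show "f \<in> antipode DA ` LS" using LS_antipode[OF f] by (metis image_eqI)
qed

lemma character_span_L: "character_span HA \<Gamma>fd = L"
  by (simp add: character_span_def)

lemma function_space_L: "function_space L"
  by (rule function_space_sub_hopf[OF function_space_fin_dual])

lemma comult_L_eqI:
  assumes f: "f \<in> LS" and T: "T \<in> tensor_space L L"
    and "\<And>x y. \<lbrakk>x \<in> A; y \<in> A\<rbrakk> \<Longrightarrow> T (\<lambda>g h. g x * h y) = f (x \<otimes> y)"
  shows "comult L f = T"
proof (rule tensor_eqI_pointwise[OF LH.k_algebra_sub function_space_L LH.k_algebra_sub function_space_L])
  show "comult L f \<in> tensor_space L L" by (rule LH.comult_sub(1)[OF f])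
  show "g x = 0" if "g \<in> carrier L" "x \<notin> A" for g x
    using that fin_dualD(2)[OF LS_fin_dual, of g x] by simp
  show "g x = 0" if "g \<in> carrier L" "x \<notin> A" for g x
    using that fin_dualD(2)[OF LS_fin_dual, of g x] by simp
  fix x y assume xy: "x \<in> A" "y \<in> A"
  have "comult L f (\<lambda>g h. g x * h y) = f (x \<otimes> y)"
    using xy HA.comult_fin_dual(2)[OF LS_fin_dual[OF f], of x y]
    by (simp add: LH.comult_sub_apply[OF f HA.bilinear_form_eval])
  then show "comult L f (\<lambda>g h. g x * h y) = T (\<lambda>g h. g x * h y)" using assms(3)[OF xy] by simp
qed (rule T)

section \<open>Restriction of functionals to A\<close>

lemma zero_ext_A [simp]: "a \<in> A \<Longrightarrow> zero_ext A f a = f a"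
  by (simp add: zero_ext_def)

lemma restrict_plus: "zero_ext A (\<lambda>x. f x + g x) = (\<lambda>x. zero_ext A f x + zero_ext A g x)"
  and restrict_times: "zero_ext A (\<lambda>x. c * f x) = (\<lambda>x. c * zero_ext A f x)"
  for f g :: "'a \<Rightarrow> 'k"
  by (auto simp: fun_eq_iff zero_ext_def)

lemma restrict_fibre:
  assumes "\<kappa> \<in> \<Gamma>" "f \<in> C \<kappa>" shows "zero_ext A f = (\<lambda>x. f \<one> * \<kappa> x)"
proof
  fix x
  show "zero_ext A f x = f \<one> * \<kappa> x"
    using fibre_coalg_restrict[OF assms(2) \<Gamma>_sub[OF assms(1)], of x] algebra_map_sub(2)[OF \<Gamma>_sub[OF assms(1)], of x]
    by (cases "x \<in> A") simp_all
qed

lemma restrict_closed: "f \<in> KS \<Longrightarrow> zero_ext A f \<in> LS"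
proof (induction rule: Fam.total_induct)
  case zero
  have "zero_ext A (\<lambda>a. 0) = ((\<lambda>x. 0) :: 'a \<Rightarrow> 'k)" by (auto simp: zero_ext_def)
  then show ?case using LS_zero by simp
next
  case (plus f g)
  then show ?case using LS_plus by (simp add: restrict_plus)
next
  case (incl \<kappa> f)
  show ?case
  proof (cases "\<kappa> \<in> \<Gamma>fd")
    case True
    then show ?thesis using restrict_fibre[OF incl] LS_char by simp
  next
    case False
    have "zero_ext A (\<lambda>a. 0) = ((\<lambda>x. 0) :: 'a \<Rightarrow> 'k)" by (auto simp: zero_ext_def)
    then show ?thesis using fd_zero[OF incl(1) False incl(2)] LS_zero by simp
  qed
qed

text \<open>The coproduct of an element of A is the same sum in A and in H, with legs in A, where
  restriction changes no values.\<close>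

lemma restrict_conv:
  assumes f: "linear_form H f" and g: "linear_form H g"
  shows "zero_ext A (conv H f g) = conv HA (zero_ext A f) (zero_ext A g)"
proof
  fix a
  show "zero_ext A (conv H f g) a = conv HA (zero_ext A f) (zero_ext A g) a"
  proof (cases "a \<in> A")
    case True
    have "comult HA a (\<lambda>u v. zero_ext A f u * zero_ext A g v) = comult HA a (\<lambda>u v. f u * g v)"
      by (rule tensor_cong[OF comult_sub(1)[OF True] k_algebra_sub k_algebra_sub]) simp
    also have "\<dots> = comult H a (\<lambda>u v. f u * g v)"
      by (rule comult_sub_apply[OF True bilinear_form_product[OF f g]])
    finally show ?thesis using True by (simp add: conv_apply sub_carrier) (simp add: conv_def)
  qed (simp add: conv_def)
qed

lemma restrict_linear: "linear_map K L (zero_ext A)"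
  by (simp add: linear_map_def restrict_closed restrict_plus restrict_times)

lemma restrict_hopf_hom: "hopf_hom K L (zero_ext A)"
  unfolding hopf_hom_def
proof (intro conjI ballI allI)
  show "zero_ext A \<in> Ring.ring_hom K L"
  proof (rule ring_hom_memI)
    have "zero_ext A (zero_ext (carrier H) (counit H)) = \<epsilon>A"
      by (rule ext) (simp add: zero_ext_def sub_carrier)
    then show "zero_ext A \<one>\<^bsub>K\<^esub> = \<one>\<^bsub>L\<^esub>" by (simp add: one_HA)
  qed (simp_all add: restrict_closed restrict_plus restrict_conv KS_linear)
  show "zero_ext A (c \<odot>\<^bsub>K\<^esub> f) = c \<odot>\<^bsub>L\<^esub> zero_ext A f" for c f by (simp add: restrict_times)
  fix f assume "f \<in> carrier K"
  then have f: "f \<in> KS" by simp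
  show "counit L (zero_ext A f) = counit K f" by (simp add: sub_one)
  show "comult L (zero_ext A f) = tensor_map L L (zero_ext A) (zero_ext A) (comult K f)"
  proof (rule comult_L_eqI[OF restrict_closed[OF f]])
    show "tensor_map L L (zero_ext A) (zero_ext A) (comult K f) \<in> tensor_space L L"
      by (rule tensor_map_in_space[OF restrict_linear restrict_linear KH.comult_sub(1)[OF f]])
    fix x y assume x: "x \<in> A" and y: "y \<in> A"
    have bil: "bilinear_form L L (\<lambda>g h. g x * h y)"
      by (rule LH.bilinear_form_restrict[OF HA.bilinear_form_eval])
    show "tensor_map L L (zero_ext A) (zero_ext A) (comult K f) (\<lambda>g h. g x * h y) = zero_ext A f (x \<otimes> y)"
      using x y by (simp add: tensor_map_apply[OF bil] comult_K_eval[OF f] sub_carrier sub_mult)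
  qed
qed

lemma restrict_surj: "zero_ext A ` carrier K = carrier L"
proof (intro equalityI subsetI)
  fix f assume "f \<in> zero_ext A ` carrier K"
  then show "f \<in> carrier L" using restrict_closed by auto
next
  fix f assume "f \<in> carrier L"
  then have "f \<in> LS" by simp
  then have "f \<in> zero_ext A ` KS"
  proof (induction rule: LS_induct)
    case zero
    have "((\<lambda>x. 0) :: 'a \<Rightarrow> 'k) = zero_ext A (\<lambda>x. 0)" by (auto simp: zero_ext_def)
    then show ?case using Fam.total_zero by (rule image_eqI)
  next
    case (plus f g)
    then obtain f' g' where "f' \<in> KS" "g' \<in> KS" "f = zero_ext A f'" "g = zero_ext A g'" by auto
    then show ?case
      using Fam.total_plus[of f' g'] by (intro image_eqI[of _ _ "\<lambda>x. f' x + g' x"]) (simp_all add: restrict_plus)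
  next
    case (char \<kappa> c)
    \<comment> \<open>An element of C(\<kappa>) with value 1 at \<one> restricts to \<kappa>
      itself.\<close>
    obtain g where g: "\<kappa> \<in> \<Gamma>" "g \<in> C \<kappa>" "g \<one> = 1" using char unfolding fd_iff by blast
    have "zero_ext A (\<lambda>x. c * g x) = (\<lambda>x. c * \<kappa> x)"
      using restrict_fibre[OF g(1,2)] g(3) by (simp add: restrict_times)
    moreover have "(\<lambda>x. c * g x) \<in> KS" by (rule Fam.total_times[OF Fam.total_incl[OF g(1,2)]])
    ultimately show ?case by (rule image_eqI[OF sym])
  qed
  then show "f \<in> zero_ext A ` carrier K" by simp
qed

section \<open>The transpose of the projection onto the fibre over \<epsilon>\<close>

sublocale E: hopf_epi H QE "\<lambda>x. IE +> x" by (rule hopf_epi_QE)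

lemma quot_transpose_E: "quot_transpose H IE = E.transpose"
  by (rule ext) (simp add: quot_transpose_def E.transpose_def)

text \<open>\<open>QE\<close> is a different record from the quotient algebra in
  \<open>fibre_coalg\<close>, so the description of the image by the vanishing condition is derived
  for it afresh.\<close>

lemma transpose_range: "E.transpose ` fin_dual_carrier QE = C \<epsilon>A"
proof -
  interpret I: ideal IE H by (rule ideal_IE)
  have "E.transpose ` fin_dual_carrier QE = {f \<in> fin_dual_carrier H. \<forall>x\<in>IE. f x = 0}"
    by (rule E.transpose_image[OF ideal_IE]) (simp add: quot_hopf_simps quot_alg_simps I.coset_eq_iff)
  also have "\<dots> = C \<epsilon>A"
    unfolding fibre_coalg_eq[OF counit_algebra_map_sub]
    using vanish_fibre_ideal_iff[OF fin_dualD(1) counit_form] by (intro Collect_cong conj_cong refl) blast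
  finally show ?thesis .
qed

lemma transpose_closed: "\<phi> \<in> fin_dual_carrier QE \<Longrightarrow> E.transpose \<phi> \<in> KS"
  using transpose_range C_KS[OF \<Gamma>_one] by blast

lemma transpose_linear: "linear_map (fin_dual QE) K E.transpose"
proof -
  have "E.transpose (\<lambda>y. \<phi> y + \<psi> y) x = E.transpose \<phi> x + E.transpose \<psi> x"
    "E.transpose (\<lambda>y. c * \<phi> y) x = c * E.transpose \<phi> x" for \<phi> \<psi> c x
    by (cases "x \<in> carrier H"; simp add: E.transpose_def)+
  then show ?thesis by (simp add: linear_map_def transpose_closed fun_eq_iff)
qed

lemma transpose_one: "E.transpose \<phi> \<one> = \<phi> \<one>\<^bsub>QE\<^esub>"
  using E.p_one by (simp add: E.transpose_def)

lemma transpose_hopf_hom: "hopf_hom (fin_dual QE) K E.transpose"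
  unfolding hopf_hom_def
proof (intro conjI ballI allI)
  note tl = linear_mapD[OF transpose_linear]
  interpret Q: hopf_algebra QE by (rule E.hopf_algebra_image)
  show "E.transpose \<in> Ring.ring_hom (fin_dual QE) K"
  proof (rule ring_hom_memI)
    show "E.transpose \<one>\<^bsub>fin_dual QE\<^esub> = \<one>\<^bsub>K\<^esub>"
    proof
      fix x
      show "E.transpose \<one>\<^bsub>fin_dual QE\<^esub> x = \<one>\<^bsub>K\<^esub> x"
        by (cases "x \<in> carrier H") (simp_all add: E.transpose_def E.p_closed E.p_counit)
    qed
    show "E.transpose (\<phi> \<otimes>\<^bsub>fin_dual QE\<^esub> \<psi>) = E.transpose \<phi> \<otimes>\<^bsub>K\<^esub> E.transpose \<psi>"
      if "\<phi> \<in> carrier (fin_dual QE)" "\<psi> \<in> carrier (fin_dual QE)" for \<phi> \<psi>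
      using that by (simp add: E.transpose_conv)
  qed (use tl in blast)+
  fix \<phi> assume \<phi>: "\<phi> \<in> carrier (fin_dual QE)"
  then have \<phi>': "\<phi> \<in> fin_dual_carrier QE" by simp
  show "E.transpose (c \<odot>\<^bsub>fin_dual QE\<^esub> \<phi>) = c \<odot>\<^bsub>K\<^esub> E.transpose \<phi>" for c using tl(3)[OF \<phi>] .
  show "counit K (E.transpose \<phi>) = counit (fin_dual QE) \<phi>" by (simp add: transpose_one)
  \<comment> \<open>Tested at (x, y), both sides become the value of \<phi> at the product of the
    classes of x and y, since the projection is multiplicative.\<close>
  show "comult K (E.transpose \<phi>) = tensor_map K K E.transpose E.transpose (comult (fin_dual QE) \<phi>)"
  proof (rule comult_K_eqI[OF transpose_closed[OF \<phi>']])
    show "tensor_map K K E.transpose E.transpose (comult (fin_dual QE) \<phi>) \<in> tensor_space K K"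
      by (rule tensor_map_in_space[OF transpose_linear transpose_linear Q.comult_fin_dual(1)[OF \<phi>']])
    fix x y assume x: "x \<in> carrier H" and y: "y \<in> carrier H"
    have bil: "bilinear_form K K (\<lambda>g h. g x * h y)"
      by (rule KH.bilinear_form_restrict[OF bilinear_form_eval])
    show "tensor_map K K E.transpose E.transpose (comult (fin_dual QE) \<phi>) (\<lambda>g h. g x * h y) = E.transpose \<phi> (x \<otimes> y)"
      using x y Q.comult_fin_dual(2)[OF \<phi>' E.p_closed[OF x] E.p_closed[OF y]]
      by (simp add: tensor_map_apply[OF bil] E.transpose_def E.p_mult)
  qed
qed

section \<open>Kernel and coinvariants of the restriction\<close>

lemma transpose_augmentation:
  "E.transpose ` augmentation_ideal (fin_dual QE) = {f \<in> C \<epsilon>A. f \<one> = 0}"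
proof -
  have "E.transpose ` augmentation_ideal (fin_dual QE) = E.transpose ` {\<phi> \<in> fin_dual_carrier QE. E.transpose \<phi> \<one> = 0}"
    by (simp add: augmentation_ideal_def transpose_one)
  also have "\<dots> = {f \<in> E.transpose ` fin_dual_carrier QE. f \<one> = 0}" by blast
  finally show ?thesis by (simp add: transpose_range)
qed

text \<open>The legs of h stay in C(\<kappa>), so S(h_2) f has degree \<kappa>^{-1} \<kappa> =
  \<epsilon>; it vanishes at \<one> because evaluation at \<one> is multiplicative and f(\<one>) =
  0.\<close>

lemma fibre_augmentation:
  assumes \<kappa>: "\<kappa> \<in> \<Gamma>" and f: "f \<in> C \<kappa>" and f1: "f \<one> = 0"
  shows "f \<in> KS \<cdot>\<^bsub>K\<^esub> {f \<in> C \<epsilon>A. f \<one> = 0}"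
proof -
  let ?M = "{f \<in> C \<epsilon>A. f \<one> = 0}"
  note \<kappa>' = \<Gamma>_sub[OF \<kappa>] and F = fibre_coalgD[OF f \<Gamma>_sub[OF \<kappa>]]
  have prod: "conv H u v \<in> KS \<cdot>\<^bsub>K\<^esub> ?M" if "u \<in> KS" "v \<in> ?M" for u v
    using ideal_prod.prod[of u KS v ?M K] that by simp
  have zero: "(\<lambda>x. 0) \<in> KS \<cdot>\<^bsub>K\<^esub> ?M"
    using prod[OF Fam.total_zero, of "\<lambda>x. 0"] fibre_coalg_zero[OF counit_algebra_map_sub]
      conv_times(1)[OF linear_form_zero linear_form_zero, of 0] by simp
  show ?thesis
  proof (cases "f = (\<lambda>x. 0)")
    case True
    then show ?thesis using zero by simp
  next
    case False
    then obtain h where h: "h \<in> C \<kappa>" "h \<one> = 1" by (rule fibre_coalg_unital[OF \<kappa>' f])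
    have h': "h \<in> carrier D" using fibre_coalgD(1)[OF h(1) \<kappa>'] by simp
    let ?S = "sub_hopf D (C \<kappa>)"
    have Cd: "C \<kappa> \<subseteq> fin_dual_carrier H" using fibre_coalgD(1)[OF _ \<kappa>'] by blast
    have incl: "linear_map ?S D (\<lambda>y. y)" using Cd by (auto simp: linear_map_def)
    \<comment> \<open>The legs are taken in C(\<kappa>) itself, not merely in the whole sum, so that
      the second legs have a definite degree.\<close>
    obtain T where T: "T \<in> tensor_space ?S ?S" "comult D h = tensor_map D D (\<lambda>y. y) (\<lambda>y. y) T"
      using fibre_coalg_comult[OF \<kappa>' h(1) order_refl Cd] by blast
    obtain hs where hs: "set hs \<subseteq> carrier ?S \<times> carrier ?S" "T = tensor_sum ?S ?S hs"
      by (rule tensor_spaceE[OF T(1)])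
    have hsC: "set hs \<subseteq> C \<kappa> \<times> C \<kappa>" using hs(1) by simp
    have eq: "comult D h = tensor_sum D D hs"
      using T(2) by (simp add: hs(2) tensor_map_tensor_sum[OF incl incl])
    have hsD: "set hs \<subseteq> carrier D \<times> carrier D" using hsC Cd by auto
    have aD: "antipode D v \<in> carrier D" if "v \<in> carrier D" for v using D.antipode_closed[OF that] .
    have fD: "f \<in> carrier D" using F(1) by simp
    \<comment> \<open>The counit of h is h(\<one>) = 1, so \<Sum> h_1 S(h_2) is the unit and
      multiplying f by it changes nothing.\<close>
    have "list_sum D (map (\<lambda>(u, v). u \<otimes>\<^bsub>D\<^esub> antipode D v) hs) = \<one>\<^bsub>D\<^esub>"
      using D.antipode_right[OF h' hsD eq] h(2) by simp
    then have "f = list_sum D (map (\<lambda>(u, v). u \<otimes>\<^bsub>D\<^esub> antipode D v) hs) \<otimes>\<^bsub>D\<^esub> f" using D.l_one[OF fD] by simp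
    also have "\<dots> = list_sum D (map (\<lambda>(u, v). u \<otimes>\<^bsub>D\<^esub> antipode D v \<otimes>\<^bsub>D\<^esub> f) hs)"
    proof (subst D.list_sum_mult_right[OF _ fD])
      show "set (map (\<lambda>(u, v). u \<otimes>\<^bsub>D\<^esub> antipode D v) hs) \<subseteq> carrier D"
        using hsD aD D.m_closed by (auto simp del: fin_dual_simps)
    qed (simp add: o_def case_prod_unfold del: fin_dual_simps)
    also have "map (\<lambda>(u, v). u \<otimes>\<^bsub>D\<^esub> antipode D v \<otimes>\<^bsub>D\<^esub> f) hs = map (\<lambda>(u, v). u \<otimes>\<^bsub>D\<^esub> (antipode D v \<otimes>\<^bsub>D\<^esub> f)) hs"
      using hsD aD fD D.m_assoc by (intro map_cong refl) (auto simp del: fin_dual_simps)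
    finally have fe: "f = list_sum D (map (\<lambda>(u, v). u \<otimes>\<^bsub>D\<^esub> (antipode D v \<otimes>\<^bsub>D\<^esub> f)) hs)" .
    \<comment> \<open>Generalised from hs to any list over C(\<kappa>), for the induction.\<close>
    have "list_sum D (map (\<lambda>(u, v). u \<otimes>\<^bsub>D\<^esub> (antipode D v \<otimes>\<^bsub>D\<^esub> f)) gs) \<in> KS \<cdot>\<^bsub>K\<^esub> ?M" if "set gs \<subseteq> C \<kappa> \<times> C \<kappa>" for gs
      using that
    proof (induction gs)
      case Nil
      then show ?case using zero by simp
    next
      case (Cons p gs)
      obtain u v where p: "p = (u, v)" "u \<in> C \<kappa>" "v \<in> C \<kappa>" using Cons.prems by auto
      let ?v = "antipode D v"
      have v: "?v \<in> C (inv\<^bsub>G\<^esub> \<kappa>)" using fibre_coalg_antipode(1)[OF \<kappa>' p(3)] by simp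
      have i: "inv\<^bsub>G\<^esub> \<kappa> \<in> algebra_maps HA" by (rule \<Gamma>_sub[OF \<Gamma>_inv[OF \<kappa>]])
      have "conv H ?v f \<in> C \<epsilon>A" using fibre_coalg_conv[OF i \<kappa>' v f] inv_mult[OF \<kappa>'] by simp
      moreover have "conv H ?v f \<one> = 0" using conv_at_one[OF fibre_coalgD(3)[OF v i] F(3)] f1 by simp
      ultimately have "conv H u (conv H ?v f) \<in> KS \<cdot>\<^bsub>K\<^esub> ?M" using p(2) C_KS[OF \<kappa>] by (intro prod) auto
      from ideal_prod.sum[OF this Cons.IH] show ?case using Cons.prems p by simp
    qed
    from this[OF hsC] show ?thesis using fe by simp
  qed
qed

text \<open>If f is the sum of components g_\<kappa> and restricts to zero, then \<Sum>
  g_\<kappa>(\<one>) \<kappa> = 0, and separating the characters gives g_\<kappa>(\<one>) = 0 for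
  each component; \<open>fibre_augmentation\<close> does the rest. Conversely restriction is
  multiplicative and kills the right-hand factors.\<close>

lemma restrict_kernel:
  "{f \<in> carrier K. zero_ext A f = \<zero>\<^bsub>L\<^esub>} = carrier K \<cdot>\<^bsub>K\<^esub> {f \<in> C \<epsilon>A. f \<one> = 0}"
proof (intro equalityI subsetI)
  let ?M = "{f \<in> C \<epsilon>A. f \<one> = 0}"
  fix f assume "f \<in> carrier K \<cdot>\<^bsub>K\<^esub> ?M"
  then have "f \<in> KS \<and> zero_ext A f = (\<lambda>x. 0)"
  proof (induction rule: ideal_prod.induct)
    case (prod i j)
    then have i: "i \<in> KS" and j: "j \<in> C \<epsilon>A" "j \<one> = 0" by auto
    have j': "j \<in> KS" using j(1) C_KS[OF \<Gamma>_one] by blast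
    have "zero_ext A j = (\<lambda>x. 0)" using restrict_fibre[OF \<Gamma>_one j(1)] j(2) by simp
    then have "zero_ext A (conv H i j) = conv HA (zero_ext A i) (\<lambda>x. 0)"
      using restrict_conv[OF KS_linear[OF i] KS_linear[OF j']] by simp
    also have "\<dots> = (\<lambda>x. 0)"
      using HA.conv_times(2)[OF fin_dualD(1)[OF LS_fin_dual[OF restrict_closed[OF i]]] linear_form_zero, of 0] by simp
    finally show ?case using KS_conv[OF i j'] by simp
  next
    case (sum s1 s2)
    then show ?case using Fam.total_plus by (simp add: restrict_plus)
  qed
  then show "f \<in> {f \<in> carrier K. zero_ext A f = \<zero>\<^bsub>L\<^esub>}" by simp
next
  let ?M = "{f \<in> C \<epsilon>A. f \<one> = 0}"
  fix f assume "f \<in> {f \<in> carrier K. zero_ext A f = \<zero>\<^bsub>L\<^esub>}"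
  then have f: "f \<in> KS" and f0: "zero_ext A f = (\<lambda>x. 0)" by auto
  obtain g F where F: "finite F" "F \<subseteq> \<Gamma>" "\<forall>\<kappa>\<in>F. g \<kappa> \<in> C \<kappa>" "f = (\<lambda>x. \<Sum>\<kappa>\<in>F. g \<kappa> x)"
    using f unfolding Fam.total_iff by blast
  have Fa: "F \<subseteq> algebra_maps HA" using F(2) \<Gamma>_sub by auto
  have g1: "g \<kappa> \<one> = 0" if \<kappa>: "\<kappa> \<in> F" for \<kappa>
  proof -
    obtain a where a: "a \<in> A" "\<kappa> a = 1" "\<forall>\<gamma>\<in>F - {\<kappa>}. \<gamma> a = 0"
      using separating_element[of "F - {\<kappa>}" \<kappa>] F(1) Fa \<kappa> by auto
    have "0 = f a" using fun_cong[OF f0, of a] a(1) by simp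
    also have "\<dots> = (\<Sum>\<gamma>\<in>F. g \<gamma> \<one> * \<gamma> a)"
      unfolding F(4) using F(3) Fa a(1) fibre_coalg_restrict by (intro sum.cong refl) blast
    also have "\<dots> = g \<kappa> \<one> * \<kappa> a + (\<Sum>\<gamma>\<in>F - {\<kappa>}. g \<gamma> \<one> * \<gamma> a)" by (rule sum.remove[OF F(1) \<kappa>])
    also have "(\<Sum>\<gamma>\<in>F - {\<kappa>}. g \<gamma> \<one> * \<gamma> a) = 0" by (rule sum.neutral) (use a(3) in simp)
    finally show ?thesis using a(2) by simp
  qed
  have "(\<lambda>x. \<Sum>\<kappa>\<in>F'. g \<kappa> x) \<in> KS \<cdot>\<^bsub>K\<^esub> ?M" if "F' \<subseteq> F" for F'
    using finite_subset[OF that F(1)] that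
  proof (induction F' rule: finite_induct)
    case empty
    have "(\<lambda>x. 0) \<in> KS \<cdot>\<^bsub>K\<^esub> ?M"
      by (rule fibre_augmentation[OF \<Gamma>_one fibre_coalg_zero[OF counit_algebra_map_sub]]) simp
    then show ?case by simp
  next
    case (insert \<kappa> F')
    then have \<kappa>: "\<kappa> \<in> F" by simp
    have "g \<kappa> \<in> KS \<cdot>\<^bsub>K\<^esub> ?M" by (rule fibre_augmentation) (use F \<kappa> g1 in auto)
    from ideal_prod.sum[OF this insert.IH] insert show ?case by simp
  qed
  then show "f \<in> carrier K \<cdot>\<^bsub>K\<^esub> ?M" using F(4) by simp
qed

text \<open>Tensors over two function spaces are determined at pairs (x, a). There the two sides of
  the coinvariance condition are f(x a) and \<epsilon>(a) f(x), which is the eigenvalue equation of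
  C(\<epsilon>).\<close>

lemma restrict_coinvariants: "coinvariants K L (zero_ext A) = C \<epsilon>A"
proof -
  have ev: "bilinear_form K L (\<lambda>g h. g x * h y)" for x y
    by (intro bilinear_form_product linear_form_eval function_space_K function_space_L)
  have id: "linear_map K K (\<lambda>y. y)" by (simp add: linear_map_def)
  have LHS: "tensor_map K L (\<lambda>y. y) (zero_ext A) (comult K f) (\<lambda>g h. g x * h a) = f (x \<otimes> a)"
    and RHS: "tensor_sum K L [(f, \<one>\<^bsub>L\<^esub>)] (\<lambda>g h. g x * h a) = counit H a * f x"
    if "f \<in> KS" "x \<in> carrier H" "a \<in> A" for f x a
    using that by (simp_all add: tensor_map_apply[OF ev] tensor_sum_apply[OF ev] comult_K_eval sub_carrier)
  have "tensor_map K L (\<lambda>y. y) (zero_ext A) (comult K f) = tensor_sum K L [(f, \<one>\<^bsub>L\<^esub>)] \<longleftrightarrow> f \<in> C \<epsilon>A"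
    if f: "f \<in> KS" for f
  proof
    assume eq: "tensor_map K L (\<lambda>y. y) (zero_ext A) (comult K f) = tensor_sum K L [(f, \<one>\<^bsub>L\<^esub>)]"
    show "f \<in> C \<epsilon>A"
    proof (rule fibre_coalgI[OF counit_algebra_map_sub KS_fin_dual[OF f]])
      fix x a assume "x \<in> carrier H" "a \<in> A"
      then show "f (x \<otimes> a) = \<epsilon>A a * f x" using LHS[OF f] RHS[OF f] eq by simp
    qed
  next
    assume fC: "f \<in> C \<epsilon>A"
    show "tensor_map K L (\<lambda>y. y) (zero_ext A) (comult K f) = tensor_sum K L [(f, \<one>\<^bsub>L\<^esub>)]"
    proof (rule tensor_eqI_pointwise[OF KH.k_algebra_sub function_space_K LH.k_algebra_sub function_space_L])
      show "tensor_map K L (\<lambda>y. y) (zero_ext A) (comult K f) \<in> tensor_space K L"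
        by (rule tensor_map_in_space[OF id restrict_linear KH.comult_sub(1)[OF f]])
      show "tensor_sum K L [(f, \<one>\<^bsub>L\<^esub>)] \<in> tensor_space K L"
        by (rule tensor_space_elementary) (use f LH.sub_one in simp_all)
      show "g x = 0" if "g \<in> carrier K" "x \<notin> carrier H" for g x
        using that fin_dualD(2)[OF KS_fin_dual] by simp
      show "g x = 0" if "g \<in> carrier L" "x \<notin> A" for g x
        using that fin_dualD(2)[OF LS_fin_dual, of g x] by simp
      fix x a assume xa: "x \<in> carrier H" "a \<in> A"
      then show "tensor_map K L (\<lambda>y. y) (zero_ext A) (comult K f) (\<lambda>g h. g x * h a) =
        tensor_sum K L [(f, \<one>\<^bsub>L\<^esub>)] (\<lambda>g h. g x * h a)"
        using LHS[OF f xa] RHS[OF f xa] fibre_coalgD(2)[OF fC counit_algebra_map_sub xa] by simp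
    qed
  qed
  then show ?thesis unfolding coinvariants_def using C_KS[OF \<Gamma>_one] by auto
qed

theorem exact_sequence: "exact_hopf_sequence (fin_dual QE) E.transpose K (zero_ext A) L"
  unfolding exact_hopf_sequence_def
proof (intro conjI)
  show "hopf_algebra (fin_dual QE)" by (rule hopf_algebra.fin_dual_hopf_algebra[OF E.hopf_algebra_image])
  show "inj_on E.transpose (carrier (fin_dual QE))" using E.transpose_inj by simp
  show "{f \<in> carrier K. zero_ext A f = \<zero>\<^bsub>L\<^esub>} = carrier K \<cdot>\<^bsub>K\<^esub> E.transpose ` augmentation_ideal (fin_dual QE)"
    unfolding transpose_augmentation by (rule restrict_kernel)
  show "E.transpose ` carrier (fin_dual QE) = coinvariants K L (zero_ext A)"
    using transpose_range restrict_coinvariants by simp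
qed (rule K_hopf_algebra L_hopf_algebra transpose_hopf_hom restrict_hopf_hom restrict_surj)+

end

theorem theorem3p6:
  fixes H :: "('k::{alg_closed_field, field_char_0}, 'a) hopf"
    and A :: "'a set"
    and \<Gamma> :: "('a \<Rightarrow> 'k) set"
  assumes "hopf_algebra H"
    and "noetherian H"
    and "central_hopf_subalgebra H A"
    and "subgroup \<Gamma> (Alg_group (sub_hopf H A))"
  shows "faithfully_graded ((Alg_group (sub_hopf H A))\<lparr>carrier := fd_part H A \<Gamma>\<rparr>)
           (fibre_hopf H A \<Gamma>) (fibre_coalg H A) \<and>
         exact_hopf_sequence
           (fin_dual (quot_hopf H (carrier H \<cdot>\<^bsub>H\<^esub> augmentation_ideal (sub_hopf H A))))
           (quot_transpose H (carrier H \<cdot>\<^bsub>H\<^esub> augmentation_ideal (sub_hopf H A)))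
           (fibre_hopf H A \<Gamma>)
           (zero_ext A)
           (character_span (sub_hopf H A) (fd_part H A \<Gamma>))"
proof -
  interpret character_subgroup H A \<Gamma>
    using assms
    by (intro character_subgroup.intro central_hopf_sub.intro hopf_sub.intro hopf_sub_axioms.intro
        central_hopf_sub_axioms.intro character_subgroup_axioms.intro) (auto simp: central_hopf_subalgebra_def)
  show ?thesis
    using K_faithfully_graded exact_sequence
    by (simp only: fibre_hopf_K character_span_L augmentation_fibre_ideal quot_transpose_E)
qed

end
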